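(* Let $\{X_i\}_{i=1}^n$ be a family of connected graphs, let $\{v_{pq}\}_{p\in V(X_i),\,q\in V(X_j)}$ be the generators of $\mathrm{QIso}(X_i,X_j)$ for $i,j\in[n]$, and let $[u_{ij}]_{i,j\in[n]}$ be the magic unitary (fundamental representation) of $\mathbb{S}_n^+$. Let $X=\bigsqcup_{i=1}^n X_i$ be the disjoint union. Then the quantum automorphism group $\mathrm{Qut}(X)$ is the quantum permutation group given by the $C^*$-algebra $$\Big(\widetilde{\mathcal{F}} *_{\mathbb{C}} C(\mathbb{S}_n^+)\Big)\Big/\Big\langle u_{ij}=1_{\mathrm{QIso}(X_i,X_j)} \;\Big|\; i,j\in[n]\Big\rangle,$$ where $\mathcal{F}$ is the free product of the $n^2$ $C^*$-algebras $\mathrm{QIso}(X_i,X_j)$, $i,j\in[n]$, and $\widetilde{\mathcal{F}}$ is its unitization, with fundamental representation given by the block matrix $[C_{ij}]_{i,j\in[n]}$, where $C_{ij}=[v_{pq}]_{p\in V(X_i),\,q\in V(X_j)}$.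
   Context: All graphs are finite and simple; connected graphs have nonempty vertex set. $[n]=\{1,\dots,n\}$. $A_X$ is the adjacency matrix of $X$. A magic unitary is a matrix $u=[u_{ij}]$ with entries in a unital $C^*$-algebra such that $u_{ij}^2=u_{ij}^*=u_{ij}$ for all $i,j$ and every row and every column sums to $1$. A quantum permutation group acting on a finite set $I$ is a pair $(C(\mathbb{G}),u)$, where $C(\mathbb{G})$ is a unital $C^*$-algebra generated by the entries of a magic unitary $u=[u_{ij}]_{i,j\in I}$ (the fundamental representation), such that $\Delta(u_{ij})=\sum_k u_{ik}\otimes u_{kj}$ defines a unital $*$-homomorphism making $(C(\mathbb{G}),\Delta)$ a compact quantum group. Two quantum permutation groups $(C(\mathbb{G}),u)$ and $(C(\mathbb{H}),v)$ acting on the same set are the same if $u_{ij}\mapsto v_{ij}$ defines a $*$-isomorphism $C(\mathbb{G})\to C(\mathbb{H})$. $C(\mathbb{S}_n^+)$ is the universal unital $C^*$-algebra generated by the entries of an $n\times n$ magic unitary. $\mathrm{Qut}(X)=(C(\mathrm{Qut}(X)),u)$, where $C(\mathrm{Qut}(X))$ is the universal unital $C^*$-algebra generated by $[u_{xx'}]_{x,x'\in V(X)}$ subject to: $u$ is a magic unitary and $A_Xu=uA_X$. For graphs $X,Y$, $\mathrm{QIso}(X,Y)$ is the universal unital $C^*$-algebra (possibly the zero algebra, in which $1=0$) generated by $[e_{xy}]_{x\in V(X),y\in V(Y)}$ subject to: $e_{xy}^2=e_{xy}^*=e_{xy}$; $\sum_{y}e_{xy}=1$ for all $x$; $\sum_x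 e_{xy}=1$ for all $y$; and $e_{xy}e_{x'y'}=0$ if $xx'\in E(X)$ and $yy'\notin E(Y)$ or vice versa. If $|V(X)|\ne|V(Y)|$ this algebra is zero. The free product of $C^*$-algebras is the coproduct in the category of not necessarily unital $C^*$-algebras (with $*$-homomorphisms), so the units $1_{\mathrm{QIso}(X_i,X_j)}$ of the factors are not identified with each other; $*_{\mathbb{C}}$ is the coproduct in the category of unital $C^*$-algebras (free product amalgamated over $\mathbb{C}$). The unitization of a $C^*$-algebra $\mathcal{A}$ is $\widetilde{\mathcal{A}}=(\mathcal{A}*\mathbb{C})/\langle 1a=a1=a \mid a\in\mathcal{A}\rangle$. The elements $v_{pq}$, $1_{\mathrm{QIso}(X_i,X_j)}$, $u_{ij}$ denote also their images in the free products and in the quotient. *)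

theory Defs
  imports
    "HOL-Analysis.Analysis"
    "HOL-Library.Poly_Mapping"
    "HOL-Algebra.FiniteProduct"
    "Graph_Theory.Graph_Theory"
begin

section \<open>C*-algebras\<close>

text \<open>
  The algebras are not required to have a unit, so the record has no field for one.  The unit of a
  unital algebra is determined by the multiplication (see \<open>unit_of\<close>).
\<close>

record 'a star_algebra = "'a partial_object" +
  zer :: 'a
  add :: "'a \<Rightarrow> 'a \<Rightarrow> 'a"
  scl :: "complex \<Rightarrow> 'a \<Rightarrow> 'a"
  mul :: "'a \<Rightarrow> 'a \<Rightarrow> 'a"
  adj :: "'a \<Rightarrow> 'a"
  nrm :: "'a \<Rightarrow> real"

definition additive_group :: "'a star_algebra \<Rightarrow> 'a monoid" where
  "additive_group A = \<lparr>carrier = carrier A, monoid.mult = add A, one = zer A\<rparr>"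

definition asum :: "'a star_algebra \<Rightarrow> ('i \<Rightarrow> 'a) \<Rightarrow> 'i set \<Rightarrow> 'a" where
  "asum A f I = finprod (additive_group A) f I"

definition sub :: "'a star_algebra \<Rightarrow> 'a \<Rightarrow> 'a \<Rightarrow> 'a" where
  "sub A x y = add A x (scl A (-1) y)"

definition conv_to :: "'a star_algebra \<Rightarrow> (nat \<Rightarrow> 'a) \<Rightarrow> 'a \<Rightarrow> bool" where
  "conv_to A s x \<longleftrightarrow> (\<lambda>n. nrm A (sub A (s n) x)) \<longlonglongrightarrow> 0"

definition cauchy :: "'a star_algebra \<Rightarrow> (nat \<Rightarrow> 'a) \<Rightarrow> bool" where
  "cauchy A s \<longleftrightarrow> (\<forall>n. s n \<in> carrier A) \<and>
     (\<forall>e>0. \<exists>N. \<forall>m\<ge>N. \<forall>n\<ge>N. nrm A (sub A (s m) (s n)) < e)"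

locale cstar_algebra =
  fixes A :: "'a star_algebra"
  assumes add_group: "comm_group (additive_group A)"
    and scl_closed: "x \<in> carrier A \<Longrightarrow> scl A c x \<in> carrier A"
    and scl_add_right: "x \<in> carrier A \<Longrightarrow> y \<in> carrier A \<Longrightarrow>
          scl A c (add A x y) = add A (scl A c x) (scl A c y)"
    and scl_add_left: "x \<in> carrier A \<Longrightarrow> scl A (c + d) x = add A (scl A c x) (scl A d x)"
    and scl_scl: "x \<in> carrier A \<Longrightarrow> scl A c (scl A d x) = scl A (c * d) x"
    and scl_one: "x \<in> carrier A \<Longrightarrow> scl A 1 x = x"
    and mul_closed: "x \<in> carrier A \<Longrightarrow> y \<in> carrier A \<Longrightarrow> mul A x y \<in> carrier A"
    and mul_assoc: "x \<in> carrier A \<Longrightarrow> y \<in> carrier A \<Longrightarrow> z \<in> carrier A \<Longrightarrow>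
          mul A (mul A x y) z = mul A x (mul A y z)"
    and mul_add_left: "x \<in> carrier A \<Longrightarrow> y \<in> carrier A \<Longrightarrow> z \<in> carrier A \<Longrightarrow>
          mul A (add A x y) z = add A (mul A x z) (mul A y z)"
    and mul_add_right: "x \<in> carrier A \<Longrightarrow> y \<in> carrier A \<Longrightarrow> z \<in> carrier A \<Longrightarrow>
          mul A x (add A y z) = add A (mul A x y) (mul A x z)"
    and mul_scl_left: "x \<in> carrier A \<Longrightarrow> y \<in> carrier A \<Longrightarrow>
          mul A (scl A c x) y = scl A c (mul A x y)"
    and mul_scl_right: "x \<in> carrier A \<Longrightarrow> y \<in> carrier A \<Longrightarrow>
          mul A x (scl A c y) = scl A c (mul A x y)"
    and adj_closed: "x \<in> carrier A \<Longrightarrow> adj A x \<in> carrier A"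
    and adj_adj: "x \<in> carrier A \<Longrightarrow> adj A (adj A x) = x"
    and adj_add: "x \<in> carrier A \<Longrightarrow> y \<in> carrier A \<Longrightarrow>
          adj A (add A x y) = add A (adj A x) (adj A y)"
    and adj_scl: "x \<in> carrier A \<Longrightarrow> adj A (scl A c x) = scl A (cnj c) (adj A x)"
    and adj_mul: "x \<in> carrier A \<Longrightarrow> y \<in> carrier A \<Longrightarrow>
          adj A (mul A x y) = mul A (adj A y) (adj A x)"
    and nrm_nonneg: "x \<in> carrier A \<Longrightarrow> 0 \<le> nrm A x"
    and nrm_eq_0: "x \<in> carrier A \<Longrightarrow> nrm A x = 0 \<longleftrightarrow> x = zer A"
    and nrm_add: "x \<in> carrier A \<Longrightarrow> y \<in> carrier A \<Longrightarrow> nrm A (add A x y) \<le> nrm A x + nrm A y"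
    and nrm_scl: "x \<in> carrier A \<Longrightarrow> nrm A (scl A c x) = cmod c * nrm A x"
    and nrm_mul: "x \<in> carrier A \<Longrightarrow> y \<in> carrier A \<Longrightarrow> nrm A (mul A x y) \<le> nrm A x * nrm A y"
    and nrm_cstar: "x \<in> carrier A \<Longrightarrow> nrm A (mul A (adj A x) x) = (nrm A x)\<^sup>2"
    and complete: "cauchy A s \<Longrightarrow> \<exists>x\<in>carrier A. conv_to A s x"

definition is_unit_of :: "'a star_algebra \<Rightarrow> 'a \<Rightarrow> bool" where
  "is_unit_of A e \<longleftrightarrow> e \<in> carrier A \<and> (\<forall>a\<in>carrier A. mul A e a = a \<and> mul A a e = a)"

definition unit_of :: "'a star_algebra \<Rightarrow> 'a" where
  "unit_of A = (THE e. is_unit_of A e)"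

definition unital_cstar :: "'a star_algebra \<Rightarrow> bool" where
  "unital_cstar A \<longleftrightarrow> cstar_algebra A \<and> (\<exists>e. is_unit_of A e)"

definition star_hom :: "'a star_algebra \<Rightarrow> 'b star_algebra \<Rightarrow> ('a \<Rightarrow> 'b) \<Rightarrow> bool" where
  "star_hom A B f \<longleftrightarrow> f \<in> carrier A \<rightarrow> carrier B \<and>
     (\<forall>x\<in>carrier A. \<forall>y\<in>carrier A. f (add A x y) = add B (f x) (f y)) \<and>
     (\<forall>c. \<forall>x\<in>carrier A. f (scl A c x) = scl B c (f x)) \<and>
     (\<forall>x\<in>carrier A. \<forall>y\<in>carrier A. f (mul A x y) = mul B (f x) (f y)) \<and>
     (\<forall>x\<in>carrier A. f (adj A x) = adj B (f x))"

definition unital_star_hom :: "'a star_algebra \<Rightarrow> 'b star_algebra \<Rightarrow> ('a \<Rightarrow> 'b) \<Rightarrow> bool" where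
  "unital_star_hom A B f \<longleftrightarrow> star_hom A B f \<and> f (unit_of A) = unit_of B"

definition star_iso :: "'a star_algebra \<Rightarrow> 'b star_algebra \<Rightarrow> ('a \<Rightarrow> 'b) \<Rightarrow> bool" where
  "star_iso A B f \<longleftrightarrow> star_hom A B f \<and> bij_betw f (carrier A) (carrier B)"

definition complex_cstar :: "complex star_algebra" where
  "complex_cstar = \<lparr>carrier = UNIV, zer = 0, add = (+), scl = (*), mul = (*), adj = cnj, nrm = cmod\<rparr>"

definition closed_subspace :: "'a star_algebra \<Rightarrow> 'a set \<Rightarrow> bool" where
  "closed_subspace A L \<longleftrightarrow> L \<subseteq> carrier A \<and> zer A \<in> L \<and>
     (\<forall>x\<in>L. \<forall>y\<in>L. add A x y \<in> L) \<and> (\<forall>c. \<forall>x\<in>L. scl A c x \<in> L) \<and>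
     (\<forall>s. \<forall>x\<in>carrier A. (\<forall>n. s n \<in> L) \<longrightarrow> conv_to A s x \<longrightarrow> x \<in> L)"

definition closed_span :: "'a star_algebra \<Rightarrow> 'a set \<Rightarrow> 'a set" where
  "closed_span A S = \<Inter>{L. closed_subspace A L \<and> S \<subseteq> L}"

definition closed_unital_star_subalgebra :: "'a star_algebra \<Rightarrow> 'a set \<Rightarrow> bool" where
  "closed_unital_star_subalgebra A L \<longleftrightarrow> closed_subspace A L \<and> unit_of A \<in> L \<and>
     (\<forall>x\<in>L. \<forall>y\<in>L. mul A x y \<in> L) \<and> (\<forall>x\<in>L. adj A x \<in> L)"

definition generates :: "'a star_algebra \<Rightarrow> 'a set \<Rightarrow> bool" where
  "generates A S \<longleftrightarrow> \<Inter>{L. closed_unital_star_subalgebra A L \<and> S \<subseteq> L} = carrier A"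

subsection \<open>Quotients by closed two-sided ideals\<close>

definition closed_ideal :: "'a star_algebra \<Rightarrow> 'a set \<Rightarrow> bool" where
  "closed_ideal A I \<longleftrightarrow> closed_subspace A I \<and>
     (\<forall>a\<in>carrier A. \<forall>x\<in>I. mul A a x \<in> I \<and> mul A x a \<in> I)"

definition ideal_gen :: "'a star_algebra \<Rightarrow> 'a set \<Rightarrow> 'a set" where
  "ideal_gen A S = \<Inter>{I. closed_ideal A I \<and> S \<subseteq> I}"

definition coset :: "'a star_algebra \<Rightarrow> 'a set \<Rightarrow> 'a \<Rightarrow> 'a set" where
  "coset A I x = add A x ` I"

definition quotient :: "'a star_algebra \<Rightarrow> 'a set \<Rightarrow> 'a set star_algebra" where
  "quotient A I = \<lparr>
     carrier = coset A I ` carrier A,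
     zer = coset A I (zer A),
     add = (\<lambda>U V. \<Union>x\<in>U. \<Union>y\<in>V. coset A I (add A x y)),
     scl = (\<lambda>c U. \<Union>x\<in>U. coset A I (scl A c x)),
     mul = (\<lambda>U V. \<Union>x\<in>U. \<Union>y\<in>V. coset A I (mul A x y)),
     adj = (\<lambda>U. \<Union>x\<in>U. coset A I (adj A x)),
     nrm = (\<lambda>U. Inf (nrm A ` U))\<rparr>"

subsection \<open>Separation and completion\<close>

text \<open>
  Let \<open>M\<close> be a *-algebra whose \<open>nrm\<close> is only a seminorm.  Its completion consists of
  the Cauchy sequences modulo the null sequences, so elements of seminorm zero become zero.
\<close>

definition cls :: "'a star_algebra \<Rightarrow> (nat \<Rightarrow> 'a) \<Rightarrow> (nat \<Rightarrow> 'a) set" where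
  "cls M s = {t. cauchy M t \<and> (\<lambda>n. nrm M (sub M (s n) (t n))) \<longlonglongrightarrow> 0}"

definition completion :: "'a star_algebra \<Rightarrow> (nat \<Rightarrow> 'a) set star_algebra" where
  "completion M = \<lparr>
     carrier = cls M ` {s. cauchy M s},
     zer = cls M (\<lambda>_. zer M),
     add = (\<lambda>U V. \<Union>s\<in>U. \<Union>t\<in>V. cls M (\<lambda>n. add M (s n) (t n))),
     scl = (\<lambda>c U. \<Union>s\<in>U. cls M (\<lambda>n. scl M c (s n))),
     mul = (\<lambda>U V. \<Union>s\<in>U. \<Union>t\<in>V. cls M (\<lambda>n. mul M (s n) (t n))),
     adj = (\<lambda>U. \<Union>s\<in>U. cls M (\<lambda>n. adj M (s n))),
     nrm = (\<lambda>U. THE r. \<forall>s\<in>U. (\<lambda>n. nrm M (s n)) \<longlonglongrightarrow> r)\<rparr>"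

section \<open>Universal C*-algebras\<close>

subsection \<open>Free *-algebras\<close>

text \<open>The letter \<open>(g, False)\<close> stands for the generator \<open>g\<close> and \<open>(g, True)\<close> for its adjoint.\<close>

datatype 'g star_word = Star_Word (letters: "('g \<times> bool) list")

instantiation star_word :: (type) monoid_add
begin

definition zero_star_word :: "'a star_word" where
  "zero_star_word = Star_Word []"

definition plus_star_word :: "'a star_word \<Rightarrow> 'a star_word \<Rightarrow> 'a star_word" where
  "plus_star_word v w = Star_Word (letters v @ letters w)"

instance
  by standard (auto simp: zero_star_word_def plus_star_word_def)

end

text \<open>
  With words forming an (additively written) monoid under concatenation, \<open>'g free_alg\<close> is the
  monoid algebra, that is, the algebra of noncommutative polynomials, with the ring operations of
  the library.
\<close>

type_synonym 'g free_alg = "'g star_word \<Rightarrow>\<^sub>0 complex"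

definition cscale :: "complex \<Rightarrow> ('k \<Rightarrow>\<^sub>0 complex) \<Rightarrow> ('k \<Rightarrow>\<^sub>0 complex)" where
  "cscale c f = Poly_Mapping.map (\<lambda>z. c * z) f"

definition star_word_adj :: "'g star_word \<Rightarrow> 'g star_word" where
  "star_word_adj w = Star_Word (rev (map (\<lambda>(g, b). (g, \<not> b)) (letters w)))"

definition free_star :: "'g free_alg \<Rightarrow> 'g free_alg" where
  "free_star f = Poly_Mapping.map cnj (Poly_Mapping.map_key star_word_adj f)"

definition gen :: "'g \<Rightarrow> 'g free_alg" where
  "gen g = Poly_Mapping.single (Star_Word [(g, False)]) 1"

definition free_unital :: "'g set \<Rightarrow> 'g free_alg star_algebra" where
  "free_unital G = \<lparr>
     carrier = {f. \<forall>w\<in>Poly_Mapping.keys f. fst ` set (letters w) \<subseteq> G},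
     zer = 0, add = (+), scl = cscale, mul = (*), adj = free_star, nrm = (\<lambda>_. 0)\<rparr>"

definition free_nonunital :: "'g set \<Rightarrow> 'g free_alg star_algebra" where
  "free_nonunital G = (free_unital G)
     \<lparr>carrier := {f \<in> carrier (free_unital G). 0 \<notin> Poly_Mapping.keys f}\<rparr>"

subsection \<open>The enveloping C*-algebra of a *-algebra with relations\<close>

definition cstar_seminorm :: "'a star_algebra \<Rightarrow> ('a \<Rightarrow> real) \<Rightarrow> bool" where
  "cstar_seminorm P p \<longleftrightarrow>
     (\<forall>x\<in>carrier P. 0 \<le> p x \<and> p (mul P (adj P x) x) = (p x)\<^sup>2 \<and>
        (\<forall>c. p (scl P c x) = cmod c * p x) \<and>
        (\<forall>y\<in>carrier P. p (add P x y) \<le> p x + p y \<and> p (mul P x y) \<le> p x * p y))"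

text \<open>
  The C*-seminorms on a *-algebra \<open>P\<close> are exactly the seminorms \<open>x \<mapsto> \<parallel>\<phi> x\<parallel>\<close> given
  by *-homomorphisms \<open>\<phi>\<close> from \<open>P\<close> to C*-algebras, and \<open>\<phi>\<close> satisfies the relations \<open>R\<close>
  (each \<open>r \<in> R\<close> is sent to \<open>0\<close>) iff its seminorm vanishes on \<open>R\<close>.  Completing with respect to the
  largest of them therefore gives the universal C*-algebra satisfying \<open>R\<close>; the largest seminorm is
  finite in all the instances below.  For \<open>P = free_unital G\<close> it is the universal unital C*-algebra
  generated by \<open>G\<close> subject to \<open>R\<close> (zero if only the zero seminorm satisfies \<open>R\<close>), and for
  \<open>P = free_nonunital G\<close> the universal not necessarily unital one.
\<close>

definition max_seminormed :: "'a star_algebra \<Rightarrow> 'a set \<Rightarrow> 'a star_algebra" where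
  "max_seminormed P R =
     P\<lparr>nrm := (\<lambda>x. SUP p \<in> {p. cstar_seminorm P p \<and> (\<forall>r\<in>R. p r = 0)}. p x)\<rparr>"

definition univ_cstar :: "'a star_algebra \<Rightarrow> 'a set \<Rightarrow> (nat \<Rightarrow> 'a) set star_algebra" where
  "univ_cstar P R = completion (max_seminormed P R)"

definition univ_gen :: "'g free_alg star_algebra \<Rightarrow> 'g free_alg set \<Rightarrow> 'g \<Rightarrow>
    (nat \<Rightarrow> 'g free_alg) set" where
  "univ_gen P R g = cls (max_seminormed P R) (\<lambda>_. gen g)"

type_synonym 'g univ = "(nat \<Rightarrow> 'g free_alg) set"

subsection \<open>Free products and unitization\<close>

text \<open>The relations expressing that \<open>a \<mapsto> gen (\<iota> a)\<close> is a *-homomorphism on \<open>A\<close>.\<close>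

definition hom_rels :: "'a star_algebra \<Rightarrow> ('a \<Rightarrow> 'g) \<Rightarrow> 'g free_alg set" where
  "hom_rels A \<iota> =
     {gen (\<iota> (add A a b)) - (gen (\<iota> a) + gen (\<iota> b)) |a b. a \<in> carrier A \<and> b \<in> carrier A} \<union>
     {gen (\<iota> (scl A c a)) - cscale c (gen (\<iota> a)) |c a. a \<in> carrier A} \<union>
     {gen (\<iota> (mul A a b)) - gen (\<iota> a) * gen (\<iota> b) |a b. a \<in> carrier A \<and> b \<in> carrier A} \<union>
     {gen (\<iota> (adj A a)) - free_star (gen (\<iota> a)) |a. a \<in> carrier A}"

text \<open>
  Coproduct of a family in the category of not necessarily unital C*-algebras: the universal
  C*-algebra generated by *-homomorphic images of the factors.
\<close>

definition free_prod_gens :: "'k set \<Rightarrow> ('k \<Rightarrow> 'a star_algebra) \<Rightarrow> ('k \<times> 'a) free_alg star_algebra"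
  where "free_prod_gens K A = free_nonunital (SIGMA k:K. carrier (A k))"

definition free_prod_rels :: "'k set \<Rightarrow> ('k \<Rightarrow> 'a star_algebra) \<Rightarrow> ('k \<times> 'a) free_alg set" where
  "free_prod_rels K A = (\<Union>k\<in>K. hom_rels (A k) (Pair k))"

definition free_prod :: "'k set \<Rightarrow> ('k \<Rightarrow> 'a star_algebra) \<Rightarrow> ('k \<times> 'a) univ star_algebra" where
  "free_prod K A = univ_cstar (free_prod_gens K A) (free_prod_rels K A)"

definition free_prod_incl :: "'k set \<Rightarrow> ('k \<Rightarrow> 'a star_algebra) \<Rightarrow> 'k \<Rightarrow> 'a \<Rightarrow> ('k \<times> 'a) univ" where
  "free_prod_incl K A k a = univ_gen (free_prod_gens K A) (free_prod_rels K A) (k, a)"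

definition free_prod2_gens :: "'a star_algebra \<Rightarrow> 'b star_algebra \<Rightarrow> ('a + 'b) free_alg star_algebra"
  where "free_prod2_gens A B = free_nonunital (carrier A <+> carrier B)"

definition free_prod2_rels :: "'a star_algebra \<Rightarrow> 'b star_algebra \<Rightarrow> ('a + 'b) free_alg set" where
  "free_prod2_rels A B = hom_rels A Inl \<union> hom_rels B Inr"

definition free_prod2 :: "'a star_algebra \<Rightarrow> 'b star_algebra \<Rightarrow> ('a + 'b) univ star_algebra" where
  "free_prod2 A B = univ_cstar (free_prod2_gens A B) (free_prod2_rels A B)"

definition free_prod2_incl :: "'a star_algebra \<Rightarrow> 'b star_algebra \<Rightarrow> 'a + 'b \<Rightarrow> ('a + 'b) univ" where
  "free_prod2_incl A B = univ_gen (free_prod2_gens A B) (free_prod2_rels A B)"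

text \<open>Coproduct of two algebras in the category of unital C*-algebras.\<close>

definition unital_free_prod_gens ::
  "'a star_algebra \<Rightarrow> 'b star_algebra \<Rightarrow> ('a + 'b) free_alg star_algebra" where
  "unital_free_prod_gens A B = free_unital (carrier A <+> carrier B)"

definition unital_free_prod_rels ::
  "'a star_algebra \<Rightarrow> 'b star_algebra \<Rightarrow> ('a + 'b) free_alg set" where
  "unital_free_prod_rels A B = hom_rels A Inl \<union> hom_rels B Inr \<union>
     {gen (Inl (unit_of A)) - 1, gen (Inr (unit_of B)) - 1}"

definition unital_free_prod ::
  "'a star_algebra \<Rightarrow> 'b star_algebra \<Rightarrow> ('a + 'b) univ star_algebra" where
  "unital_free_prod A B = univ_cstar (unital_free_prod_gens A B) (unital_free_prod_rels A B)"

definition unital_free_prod_incl ::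
  "'a star_algebra \<Rightarrow> 'b star_algebra \<Rightarrow> 'a + 'b \<Rightarrow> ('a + 'b) univ" where
  "unital_free_prod_incl A B = univ_gen (unital_free_prod_gens A B) (unital_free_prod_rels A B)"

text \<open>The unitization of \<open>A\<close> as the quotient of \<open>A * \<complex>\<close> by the ideal \<open>\<langle>1a = a1 = a | a \<in> A\<rangle>\<close>.\<close>

definition unitization_ideal :: "'a star_algebra \<Rightarrow> ('a + complex) univ set" where
  "unitization_ideal A =
     (let P = free_prod2 A complex_cstar; \<iota> = free_prod2_incl A complex_cstar in
      ideal_gen P
        ({sub P (mul P (\<iota> (Inr 1)) (\<iota> (Inl a))) (\<iota> (Inl a)) |a. a \<in> carrier A} \<union>
         {sub P (mul P (\<iota> (Inl a)) (\<iota> (Inr 1))) (\<iota> (Inl a)) |a. a \<in> carrier A}))"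

definition unitization :: "'a star_algebra \<Rightarrow> ('a + complex) univ set star_algebra" where
  "unitization A = quotient (free_prod2 A complex_cstar) (unitization_ideal A)"

definition unitization_incl :: "'a star_algebra \<Rightarrow> 'a \<Rightarrow> ('a + complex) univ set" where
  "unitization_incl A a = coset (free_prod2 A complex_cstar) (unitization_ideal A)
     (free_prod2_incl A complex_cstar (Inl a))"

section \<open>Spatial tensor powers\<close>

definition ell2 :: "'i set \<Rightarrow> ('i \<Rightarrow> complex) set" where
  "ell2 S = {\<xi>. (\<forall>i. i \<notin> S \<longrightarrow> \<xi> i = 0) \<and> (\<lambda>i. (cmod (\<xi> i))\<^sup>2) summable_on UNIV}"

definition ell2_norm :: "('i \<Rightarrow> complex) \<Rightarrow> real" where
  "ell2_norm \<xi> = sqrt (\<Sum>\<^sub>\<infinity>i. (cmod (\<xi> i))\<^sup>2)"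

definition ell2_inner :: "('i \<Rightarrow> complex) \<Rightarrow> ('i \<Rightarrow> complex) \<Rightarrow> complex" where
  "ell2_inner \<xi> \<eta> = (\<Sum>\<^sub>\<infinity>i. cnj (\<xi> i) * \<eta> i)"

type_synonym ell2_op = "(nat \<Rightarrow> complex) \<Rightarrow> (nat \<Rightarrow> complex)"

definition bounded_op :: "ell2_op \<Rightarrow> bool" where
  "bounded_op T \<longleftrightarrow> T \<in> ell2 UNIV \<rightarrow> ell2 UNIV \<and>
     (\<forall>\<xi>\<in>ell2 UNIV. \<forall>\<eta>\<in>ell2 UNIV. T (\<lambda>i. \<xi> i + \<eta> i) = (\<lambda>i. T \<xi> i + T \<eta> i)) \<and>
     (\<forall>c. \<forall>\<xi>\<in>ell2 UNIV. T (\<lambda>i. c * \<xi> i) = (\<lambda>i. c * T \<xi> i)) \<and>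
     (\<exists>K. \<forall>\<xi>\<in>ell2 UNIV. ell2_norm (T \<xi>) \<le> K * ell2_norm \<xi>)"

text \<open>*-representations (not necessarily nondegenerate) of \<open>A\<close> by bounded operators on \<open>\<ell>\<^sup>2(\<nat>)\<close>.\<close>

definition star_rep :: "'a star_algebra \<Rightarrow> ('a \<Rightarrow> ell2_op) \<Rightarrow> bool" where
  "star_rep A \<pi> \<longleftrightarrow> (\<forall>a\<in>carrier A. bounded_op (\<pi> a)) \<and>
     (\<forall>\<xi>\<in>ell2 UNIV. \<forall>a\<in>carrier A.
        (\<forall>b\<in>carrier A. \<pi> (add A a b) \<xi> = (\<lambda>i. \<pi> a \<xi> i + \<pi> b \<xi> i) \<and>
                        \<pi> (mul A a b) \<xi> = \<pi> a (\<pi> b \<xi>)) \<and>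
        (\<forall>c. \<pi> (scl A c a) \<xi> = (\<lambda>i. c * \<pi> a \<xi> i)) \<and>
        (\<forall>\<eta>\<in>ell2 UNIV. ell2_inner \<xi> (\<pi> a \<eta>) = ell2_inner (\<pi> (adj A a) \<xi>) \<eta>))"

text \<open>
  \<open>tens_op [T\<^sub>1, \<dots>, T\<^sub>k]\<close> is \<open>T\<^sub>1 \<otimes> \<dots> \<otimes> T\<^sub>k\<close> acting on \<open>\<ell>\<^sup>2(\<nat>\<^sup>k) = \<ell>\<^sup>2(\<nat>) \<otimes> \<dots> \<otimes> \<ell>\<^sup>2(\<nat>)\<close>, where
  \<open>\<nat>\<^sup>k\<close> is the set of lists of length \<open>k\<close>: each \<open>T\<^sub>i\<close> is applied in the \<open>i\<close>-th coordinate.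
\<close>

primrec tens_op :: "ell2_op list \<Rightarrow> (nat list \<Rightarrow> complex) \<Rightarrow> nat list \<Rightarrow> complex" where
  "tens_op [] = (\<lambda>\<xi>. \<xi>)"
| "tens_op (T # Ts) = (\<lambda>\<xi> l. case l of [] \<Rightarrow> 0
     | m # l' \<Rightarrow> T (\<lambda>m'. tens_op Ts (\<lambda>r. \<xi> (m' # r)) l') m)"

text \<open>
  Elements of the algebraic tensor power \<open>A \<odot> \<dots> \<odot> A\<close> (\<open>k\<close> factors) are written as formal linear
  combinations of the lists \<open>[a\<^sub>1, \<dots>, a\<^sub>k]\<close>, which stand for \<open>a\<^sub>1 \<otimes> \<dots> \<otimes> a\<^sub>k\<close>.  The multilinearity relations
  have spatial seminorm zero, so they hold in the completion.
\<close>

definition formal_mul :: "'a star_algebra \<Rightarrow> ('a list \<Rightarrow>\<^sub>0 complex) \<Rightarrow> ('a list \<Rightarrow>\<^sub>0 complex) \<Rightarrow>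
    ('a list \<Rightarrow>\<^sub>0 complex)" where
  "formal_mul A f g = (\<Sum>v\<in>Poly_Mapping.keys f. \<Sum>w\<in>Poly_Mapping.keys g.
     Poly_Mapping.single (map2 (mul A) v w) (Poly_Mapping.lookup f v * Poly_Mapping.lookup g w))"

definition formal_adj :: "'a star_algebra \<Rightarrow> ('a list \<Rightarrow>\<^sub>0 complex) \<Rightarrow> ('a list \<Rightarrow>\<^sub>0 complex)" where
  "formal_adj A f = (\<Sum>w\<in>Poly_Mapping.keys f.
     Poly_Mapping.single (map (adj A) w) (cnj (Poly_Mapping.lookup f w)))"

text \<open>
  The spatial (minimal) norm is the supremum of the operator norms of \<open>\<pi>\<^sub>1 \<otimes> \<dots> \<otimes> \<pi>\<^sub>k\<close> over
  representations of \<open>A\<close>.  Representations on the separable space \<open>\<ell>\<^sup>2(\<nat>)\<close> suffice for separable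
  \<open>A\<close>, which have a faithful one; below, \<open>A\<close> is always generated by finitely many elements.
\<close>

definition spatial_norm :: "'a star_algebra \<Rightarrow> nat \<Rightarrow> ('a list \<Rightarrow>\<^sub>0 complex) \<Rightarrow> real" where
  "spatial_norm A k f = Sup {ell2_norm (\<lambda>l. \<Sum>w\<in>Poly_Mapping.keys f.
       Poly_Mapping.lookup f w * tens_op (map2 (\<lambda>\<pi> a. \<pi> a) \<pi>s w) \<xi> l) |\<pi>s \<xi>.
     length \<pi>s = k \<and> (\<forall>\<pi>\<in>set \<pi>s. star_rep A \<pi>) \<and>
     \<xi> \<in> ell2 {l. length l = k} \<and> ell2_norm \<xi> \<le> 1}"

definition formal_tensor_power :: "'a star_algebra \<Rightarrow> nat \<Rightarrow> ('a list \<Rightarrow>\<^sub>0 complex) star_algebra" where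
  "formal_tensor_power A k = \<lparr>
     carrier = {f. \<forall>w\<in>Poly_Mapping.keys f. length w = k \<and> set w \<subseteq> carrier A},
     zer = 0, add = (+), scl = cscale, mul = formal_mul A, adj = formal_adj A,
     nrm = spatial_norm A k\<rparr>"

definition tensor_power :: "'a star_algebra \<Rightarrow> nat \<Rightarrow> (nat \<Rightarrow> 'a list \<Rightarrow>\<^sub>0 complex) set star_algebra"
  where "tensor_power A k = completion (formal_tensor_power A k)"

definition tens :: "'a star_algebra \<Rightarrow> 'a list \<Rightarrow> (nat \<Rightarrow> 'a list \<Rightarrow>\<^sub>0 complex) set" where
  "tens A w = cls (formal_tensor_power A (length w)) (\<lambda>_. Poly_Mapping.single w 1)"

section \<open>Quantum permutation groups\<close>

text \<open>
  In the coassociativity condition \<open>\<iota>\<^sub>1\<^sub>2 x = x \<otimes> 1\<close>, \<open>\<iota>\<^sub>2\<^sub>3 x = 1 \<otimes> x\<close>, and hence \<open>T = \<Delta> \<otimes> id\<close> and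
  \<open>S = id \<otimes> \<Delta>\<close>.  These maps are determined by their values on elementary tensors.
\<close>

definition coassociative ::
  "'a star_algebra \<Rightarrow> ('a \<Rightarrow> (nat \<Rightarrow> 'a list \<Rightarrow>\<^sub>0 complex) set) \<Rightarrow> bool" where
  "coassociative A \<Delta> \<longleftrightarrow> (\<exists>\<iota>\<^sub>1\<^sub>2 \<iota>\<^sub>2\<^sub>3 T S.
     unital_star_hom (tensor_power A 2) (tensor_power A 3) \<iota>\<^sub>1\<^sub>2 \<and>
     unital_star_hom (tensor_power A 2) (tensor_power A 3) \<iota>\<^sub>2\<^sub>3 \<and>
     unital_star_hom (tensor_power A 2) (tensor_power A 3) T \<and>
     unital_star_hom (tensor_power A 2) (tensor_power A 3) S \<and>
     (\<forall>a\<in>carrier A. \<forall>b\<in>carrier A.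
        \<iota>\<^sub>1\<^sub>2 (tens A [a, b]) = tens A [a, b, unit_of A] \<and>
        \<iota>\<^sub>2\<^sub>3 (tens A [a, b]) = tens A [unit_of A, a, b] \<and>
        T (tens A [a, b]) = mul (tensor_power A 3) (\<iota>\<^sub>1\<^sub>2 (\<Delta> a)) (tens A [unit_of A, unit_of A, b]) \<and>
        S (tens A [a, b]) = mul (tensor_power A 3) (tens A [a, unit_of A, unit_of A]) (\<iota>\<^sub>2\<^sub>3 (\<Delta> b))) \<and>
     (\<forall>a\<in>carrier A. T (\<Delta> a) = S (\<Delta> a)))"

definition compact_quantum_group ::
  "'a star_algebra \<Rightarrow> ('a \<Rightarrow> (nat \<Rightarrow> 'a list \<Rightarrow>\<^sub>0 complex) set) \<Rightarrow> bool" where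
  "compact_quantum_group A \<Delta> \<longleftrightarrow>
     unital_cstar A \<and> unital_star_hom A (tensor_power A 2) \<Delta> \<and> coassociative A \<Delta> \<and>
     closed_span (tensor_power A 2)
       {mul (tensor_power A 2) (\<Delta> a) (tens A [unit_of A, b]) |a b. a \<in> carrier A \<and> b \<in> carrier A}
       = carrier (tensor_power A 2) \<and>
     closed_span (tensor_power A 2)
       {mul (tensor_power A 2) (\<Delta> a) (tens A [b, unit_of A]) |a b. a \<in> carrier A \<and> b \<in> carrier A}
       = carrier (tensor_power A 2)"

definition magic_unitary :: "'i set \<Rightarrow> 'a star_algebra \<Rightarrow> ('i \<Rightarrow> 'i \<Rightarrow> 'a) \<Rightarrow> bool" where
  "magic_unitary I A u \<longleftrightarrow>
     (\<forall>i\<in>I. \<forall>j\<in>I. u i j \<in> carrier A \<and> mul A (u i j) (u i j) = u i j \<and> adj A (u i j) = u i j) \<and>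
     (\<forall>i\<in>I. asum A (\<lambda>j. u i j) I = unit_of A) \<and>
     (\<forall>j\<in>I. asum A (\<lambda>i. u i j) I = unit_of A)"

definition quantum_permutation_group :: "'i set \<Rightarrow> 'a star_algebra \<Rightarrow> ('i \<Rightarrow> 'i \<Rightarrow> 'a) \<Rightarrow> bool" where
  "quantum_permutation_group I A u \<longleftrightarrow>
     finite I \<and> unital_cstar A \<and> magic_unitary I A u \<and> generates A {u i j |i j. i \<in> I \<and> j \<in> I} \<and>
     (\<exists>\<Delta>. compact_quantum_group A \<Delta> \<and>
        (\<forall>i\<in>I. \<forall>j\<in>I. \<Delta> (u i j) = asum (tensor_power A 2) (\<lambda>k. tens A [u i k, u k j]) I))"

definition same_quantum_permutation_group ::
  "'i set \<Rightarrow> 'a star_algebra \<Rightarrow> ('i \<Rightarrow> 'i \<Rightarrow> 'a) \<Rightarrow> 'b star_algebra \<Rightarrow> ('i \<Rightarrow> 'i \<Rightarrow> 'b) \<Rightarrow> bool" where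
  "same_quantum_permutation_group I A u B v \<longleftrightarrow>
     (\<exists>\<phi>. star_iso A B \<phi> \<and> (\<forall>i\<in>I. \<forall>j\<in>I. \<phi> (u i j) = v i j))"

text \<open>Relations for a matrix of projections, indexed by \<open>I \<times> J\<close>, whose rows and columns sum to \<open>1\<close>.\<close>

definition magic_rels :: "'i set \<Rightarrow> 'j set \<Rightarrow> ('i \<times> 'j) free_alg set" where
  "magic_rels I J =
     {gen (i, j) * gen (i, j) - gen (i, j) |i j. i \<in> I \<and> j \<in> J} \<union>
     {free_star (gen (i, j)) - gen (i, j) |i j. i \<in> I \<and> j \<in> J} \<union>
     {(\<Sum>j\<in>J. gen (i, j)) - 1 |i. i \<in> I} \<union>
     {(\<Sum>i\<in>I. gen (i, j)) - 1 |j. j \<in> J}"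

definition Sn_plus :: "nat \<Rightarrow> (nat \<times> nat) univ star_algebra" where
  "Sn_plus n = univ_cstar (free_unital ({1..n} \<times> {1..n})) (magic_rels {1..n} {1..n})"

definition Sn_plus_gen :: "nat \<Rightarrow> nat \<Rightarrow> nat \<Rightarrow> (nat \<times> nat) univ" where
  "Sn_plus_gen n i j = univ_gen (free_unital ({1..n} \<times> {1..n})) (magic_rels {1..n} {1..n}) (i, j)"

section \<open>Quantum automorphisms and quantum isomorphisms of graphs\<close>

text \<open>
  A finite simple graph is a \<open>pair_graph\<close>: finite, loopless, and with each edge
  \<open>xy\<close> represented by the two arcs \<open>(x, y)\<close> and \<open>(y, x)\<close>.
\<close>

definition adjacency :: "'v pair_pre_digraph \<Rightarrow> 'v \<Rightarrow> 'v \<Rightarrow> complex" where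
  "adjacency X x y = (if (x, y) \<in> parcs X then 1 else 0)"

definition disjoint_union :: "nat \<Rightarrow> (nat \<Rightarrow> 'v pair_pre_digraph) \<Rightarrow> (nat \<times> 'v) pair_pre_digraph" where
  "disjoint_union n X = \<lparr>
     pverts = (SIGMA i:{1..n}. pverts (X i)),
     parcs = {((i, x), (i, y)) |i x y. i \<in> {1..n} \<and> (x, y) \<in> parcs (X i)}\<rparr>"

definition Qut_rels :: "'v pair_pre_digraph \<Rightarrow> ('v \<times> 'v) free_alg set" where
  "Qut_rels X = magic_rels (pverts X) (pverts X) \<union>
     {(\<Sum>z\<in>pverts X. cscale (adjacency X x z) (gen (z, y))) -
      (\<Sum>z\<in>pverts X. cscale (adjacency X z y) (gen (x, z))) |x y. x \<in> pverts X \<and> y \<in> pverts X}"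

definition Qut :: "'v pair_pre_digraph \<Rightarrow> ('v \<times> 'v) univ star_algebra" where
  "Qut X = univ_cstar (free_unital (pverts X \<times> pverts X)) (Qut_rels X)"

definition Qut_gen :: "'v pair_pre_digraph \<Rightarrow> 'v \<Rightarrow> 'v \<Rightarrow> ('v \<times> 'v) univ" where
  "Qut_gen X x y = univ_gen (free_unital (pverts X \<times> pverts X)) (Qut_rels X) (x, y)"

definition QIso_rels :: "'v pair_pre_digraph \<Rightarrow> 'w pair_pre_digraph \<Rightarrow> ('v \<times> 'w) free_alg set" where
  "QIso_rels X Y = magic_rels (pverts X) (pverts Y) \<union>
     {gen (x, y) * gen (x', y') |x x' y y'.
        x \<in> pverts X \<and> x' \<in> pverts X \<and> y \<in> pverts Y \<and> y' \<in> pverts Y \<and>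
        ((x, x') \<in> parcs X \<and> (y, y') \<notin> parcs Y \<or> (x, x') \<notin> parcs X \<and> (y, y') \<in> parcs Y)}"

definition QIso :: "'v pair_pre_digraph \<Rightarrow> 'w pair_pre_digraph \<Rightarrow> ('v \<times> 'w) univ star_algebra" where
  "QIso X Y = univ_cstar (free_unital (pverts X \<times> pverts Y)) (QIso_rels X Y)"

definition QIso_gen :: "'v pair_pre_digraph \<Rightarrow> 'w pair_pre_digraph \<Rightarrow> 'v \<Rightarrow> 'w \<Rightarrow> ('v \<times> 'w) univ" where
  "QIso_gen X Y x y = univ_gen (free_unital (pverts X \<times> pverts Y)) (QIso_rels X Y) (x, y)"

section \<open>The algebra built from the connected components\<close>

text \<open>The free product \<open>\<F>\<close> of the algebras \<open>QIso(X\<^sub>i, X\<^sub>j)\<close> for \<open>i, j \<in> [n]\<close>.\<close>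

definition QIso_family ::
  "(nat \<Rightarrow> 'v pair_pre_digraph) \<Rightarrow> nat \<times> nat \<Rightarrow> ('v \<times> 'v) univ star_algebra" where
  "QIso_family X = (\<lambda>(i, j). QIso (X i) (X j))"

definition QIso_free_prod ::
  "nat \<Rightarrow> (nat \<Rightarrow> 'v pair_pre_digraph) \<Rightarrow> ((nat \<times> nat) \<times> ('v \<times> 'v) univ) univ star_algebra" where
  "QIso_free_prod n X = free_prod ({1..n} \<times> {1..n}) (QIso_family X)"

definition QIso_free_prod_incl ::
  "nat \<Rightarrow> (nat \<Rightarrow> 'v pair_pre_digraph) \<Rightarrow> nat \<Rightarrow> nat \<Rightarrow> ('v \<times> 'v) univ \<Rightarrow>
    ((nat \<times> nat) \<times> ('v \<times> 'v) univ) univ" where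
  "QIso_free_prod_incl n X i j = free_prod_incl ({1..n} \<times> {1..n}) (QIso_family X) (i, j)"

type_synonym 'v amalgam_type =
  "((((nat \<times> nat) \<times> ('v \<times> 'v) univ) univ + complex) univ set + (nat \<times> nat) univ) univ"

definition amalgam :: "nat \<Rightarrow> (nat \<Rightarrow> 'v pair_pre_digraph) \<Rightarrow> 'v amalgam_type star_algebra" where
  "amalgam n X = unital_free_prod (unitization (QIso_free_prod n X)) (Sn_plus n)"

text \<open>The images of elements of \<open>QIso(X\<^sub>i, X\<^sub>j)\<close> and of \<open>u\<^sub>i\<^sub>j\<close> in \<open>amalgam n X\<close>.\<close>

definition amalgam_QIso ::
  "nat \<Rightarrow> (nat \<Rightarrow> 'v pair_pre_digraph) \<Rightarrow> nat \<Rightarrow> nat \<Rightarrow> ('v \<times> 'v) univ \<Rightarrow> 'v amalgam_type" where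
  "amalgam_QIso n X i j a =
     unital_free_prod_incl (unitization (QIso_free_prod n X)) (Sn_plus n)
       (Inl (unitization_incl (QIso_free_prod n X) (QIso_free_prod_incl n X i j a)))"

definition amalgam_Sn ::
  "nat \<Rightarrow> (nat \<Rightarrow> 'v pair_pre_digraph) \<Rightarrow> nat \<Rightarrow> nat \<Rightarrow> 'v amalgam_type" where
  "amalgam_Sn n X i j =
     unital_free_prod_incl (unitization (QIso_free_prod n X)) (Sn_plus n) (Inr (Sn_plus_gen n i j))"

definition component_ideal :: "nat \<Rightarrow> (nat \<Rightarrow> 'v pair_pre_digraph) \<Rightarrow> 'v amalgam_type set" where
  "component_ideal n X = ideal_gen (amalgam n X)
     {sub (amalgam n X) (amalgam_Sn n X i j) (amalgam_QIso n X i j (unit_of (QIso (X i) (X j)))) |i j.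
        i \<in> {1..n} \<and> j \<in> {1..n}}"

definition component_algebra ::
  "nat \<Rightarrow> (nat \<Rightarrow> 'v pair_pre_digraph) \<Rightarrow> 'v amalgam_type set star_algebra" where
  "component_algebra n X = quotient (amalgam n X) (component_ideal n X)"

definition component_matrix ::
  "nat \<Rightarrow> (nat \<Rightarrow> 'v pair_pre_digraph) \<Rightarrow> nat \<times> 'v \<Rightarrow> nat \<times> 'v \<Rightarrow> 'v amalgam_type set" where
  "component_matrix n X = (\<lambda>(i, p) (j, q).
     coset (amalgam n X) (component_ideal n X) (amalgam_QIso n X i j (QIso_gen (X i) (X j) p q)))"

end

theory Submission
  imports Defs
begin

text \<open>
 Let \<open>w\<close> be the magic unitary of \<open>Qut(X)\<close>.  Entries of \<open>w\<close> at an adjacent and a nonadjacent pair of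
 vertices are orthogonal, so for adjacent \<open>p, p'\<close> in \<open>X\<^sub>i\<close> the block row sums
 \<open>\<Sum>\<^sub>q w (p, q)\<close> and \<open>\<Sum>\<^sub>q w (p', q)\<close> over \<open>V(X\<^sub>j)\<close> agree.  By connectedness they depend only on \<open>i, j\<close>, and they
 equal the block column sums.  These sums form an \<open>n \<times> n\<close> magic unitary, and the \<open>(i, j)\<close> block
 satisfies the relations of \<open>QIso(X\<^sub>i, X\<^sub>j)\<close> in the corner that the \<open>(i, j)\<close> sum cuts out.  The universal
 properties give inverse homomorphisms between \<open>Qut(X)\<close> and the algebra of the components.
 Orthogonality of projections summing to \<open>1\<close> and contractivity of *-homomorphisms are obtained
 without spectral theory, from square roots \<open>1 - k\<close> of \<open>1 - v\<close> found by iteration.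
\<close>

text \<open>Every algebra in the statement is an explicit set of classes of sequences or cosets, so
  most of the work is to show that these are C*-algebras with the expected universal properties.
  Maps out of a universal algebra need no separate norm estimate, since the pulled back norm is one
  of the seminorms under the supremum. Quotients need approximate units, both for stability of the
  ideal under the adjoint and for the C*-identity. The free product has to be nonunital because the
  unit of QIso(X_i, X_j) goes to a block sum, a projection of Qut(X) that is in general not 1. The
  quantum group structure is a separate task. The matrix with entries sum_k v_xk \<otimes> v_ky is
  again a magic unitary commuting with the adjacency matrix, so the universal property of Qut(X)
  yields the comultiplication. The delicate point is the maps from the tensor square to the tensor
  cube in coassociativity: they come from the fact that the spatial norm dominates representations
  in which one factor is itself a tensor product and therefore acts on l2(N x N) instead of
  l2(N).\<close>

abbreviation elem :: "'a => ('a, 'm) partial_object_scheme => bool" (infix "\<in>:" 50) where "x \<in>: A \<equiv> x \<in> carrier A"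

section \<open>Calculus in *-algebras with a C*-seminorm: finite sums, limits, closed
  subspaces\<close>

section \<open>Seminormed *-algebras\<close>

text \<open>A \<open>cstar_algebra\<close> without definiteness of the norm and without completeness.\<close>

locale pre_cstar =
 fixes A :: "'a star_algebra"
 assumes add_group: "comm_group (additive_group A)"
  and scl_closed [simp]: "x \<in>: A ==> scl A c x \<in>: A"
  and scl_add_right: "x \<in>: A ==> y \<in>: A ==>
     scl A c (add A x y) = add A (scl A c x) (scl A c y)"
  and scl_add_left: "x \<in>: A ==> scl A (c + d) x = add A (scl A c x) (scl A d x)"
  and scl_scl: "x \<in>: A ==> scl A c (scl A d x) = scl A (c * d) x"
  and scl_one [simp]: "x \<in>: A ==> scl A 1 x = x"
  and mul_closed [simp]: "x \<in>: A ==> y \<in>: A ==> mul A x y \<in>: A"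
  and mul_assoc: "x \<in>: A ==> y \<in>: A ==> z \<in>: A ==>
     mul A (mul A x y) z = mul A x (mul A y z)"
  and mul_add_left: "x \<in>: A ==> y \<in>: A ==> z \<in>: A ==>
     mul A (add A x y) z = add A (mul A x z) (mul A y z)"
  and mul_add_right: "x \<in>: A ==> y \<in>: A ==> z \<in>: A ==>
     mul A x (add A y z) = add A (mul A x y) (mul A x z)"
  and mul_scl_left: "x \<in>: A ==> y \<in>: A ==>
     mul A (scl A c x) y = scl A c (mul A x y)"
  and mul_scl_right: "x \<in>: A ==> y \<in>: A ==>
     mul A x (scl A c y) = scl A c (mul A x y)"
  and adj_closed [simp]: "x \<in>: A ==> adj A x \<in>: A"
  and adj_adj [simp]: "x \<in>: A ==> adj A (adj A x) = x"
  and adj_add: "x \<in>: A ==> y \<in>: A ==>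
     adj A (add A x y) = add A (adj A x) (adj A y)"
  and adj_scl: "x \<in>: A ==> adj A (scl A c x) = scl A (cnj c) (adj A x)"
  and adj_mul: "x \<in>: A ==> y \<in>: A ==>
     adj A (mul A x y) = mul A (adj A y) (adj A x)"
  and nrm_nonneg [simp]: "x \<in>: A ==> 0 <= nrm A x"
  and nrm_add: "x \<in>: A ==> y \<in>: A ==> nrm A (add A x y) <= nrm A x + nrm A y"
  and nrm_scl: "x \<in>: A ==> nrm A (scl A c x) = cmod c * nrm A x"
  and nrm_mul: "x \<in>: A ==> y \<in>: A ==> nrm A (mul A x y) <= nrm A x * nrm A y"
  and nrm_cstar: "x \<in>: A ==> nrm A (mul A (adj A x) x) = (nrm A x)\<^sup>2"

sublocale cstar_algebra \<subseteq> pre?: pre_cstar A by (intro pre_cstar.intro)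
  (simp_all add: add_group scl_closed scl_add_right scl_add_left scl_scl scl_one mul_closed
   mul_assoc mul_add_left mul_add_right mul_scl_left mul_scl_right adj_closed adj_adj adj_add
   adj_scl adj_mul nrm_nonneg nrm_add nrm_scl nrm_mul nrm_cstar)

lemma additive_group_simps [simp]:
 "carrier (additive_group A) = carrier A"
 "x \<otimes>\<^bsub>additive_group A\<^esub> y = add A x y"
 "\<one>\<^bsub>additive_group A\<^esub> = zer A" by (simp_all add: additive_group_def)

context pre_cstar
begin

lemma add_closed [simp]: "x \<in>: A ==> y \<in>: A ==> add A x y \<in>: A"
 and zer_closed [simp]: "zer A \<in>: A"
 and add_assoc: "x \<in>: A ==> y \<in>: A ==> z \<in>: A ==>
    add A (add A x y) z = add A x (add A y z)"
 and add_commute: "x \<in>: A ==> y \<in>: A ==> add A x y = add A y x"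
 and add_left_commute: "x \<in>: A ==> y \<in>: A ==> z \<in>: A ==>
    add A x (add A y z) = add A y (add A x z)"
 and add_zer_right [simp]: "x \<in>: A ==> add A x (zer A) = x"
 and add_zer_left [simp]: "x \<in>: A ==> add A (zer A) x = x"
 and add_right_imp_zer: "x \<in>: A ==> y \<in>: A ==> add A x y = x ==> y = zer A"
proof -
 interpret G: comm_group "additive_group A" by (rule add_group)
 show "x \<in>: A ==> y \<in>: A ==> add A x y \<in>: A"
  "zer A \<in>: A"
  "x \<in>: A ==> y \<in>: A ==> z \<in>: A ==>
    add A (add A x y) z = add A x (add A y z)"
  "x \<in>: A ==> y \<in>: A ==> add A x y = add A y x"
  "x \<in>: A ==> y \<in>: A ==> z \<in>: A ==>
    add A x (add A y z) = add A y (add A x z)"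
  "x \<in>: A ==> add A x (zer A) = x"
  "x \<in>: A ==> add A (zer A) x = x"
  by (fact G.m_closed[unfolded additive_group_simps] G.one_closed[unfolded additive_group_simps]
   G.m_assoc[unfolded additive_group_simps] G.m_comm[unfolded additive_group_simps]
   G.m_lcomm[unfolded additive_group_simps] G.r_one[unfolded additive_group_simps]
   G.l_one[unfolded additive_group_simps])+
 show "x \<in>: A ==> y \<in>: A ==> add A x y = x ==> y = zer A" using G.l_cancel_one[of x y] by simp
qed

lemmas add_ac = add_assoc add_commute add_left_commute

lemma scl_zero [simp]: "x \<in>: A ==> scl A 0 x = zer A"
 using scl_add_left[of x 0 0] by (intro add_right_imp_zer[of "scl A 0 x"]) auto

lemma scl_zer [simp]: "scl A c (zer A) = zer A" using scl_scl[of "zer A" c 0] by simp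

lemma add_neg [simp]: "x \<in>: A ==> add A x (scl A (-1) x) = zer A" using scl_add_left[of x 1 "-1"] by simp

lemma sub_closed [simp]: "x \<in>: A ==> y \<in>: A ==> sub A x y \<in>: A" by (simp add: sub_def)

lemma sub_self [simp]: "x \<in>: A ==> sub A x x = zer A" by (simp add: sub_def)

lemma sub_zer [simp]: "x \<in>: A ==> sub A x (zer A) = x" by (simp add: sub_def)

lemma add_sub_sub: "x \<in>: A ==> y \<in>: A ==> z \<in>: A ==>
  add A (sub A x y) (sub A y z) = sub A x z"
proof -
 assume [simp]: "x \<in>: A" "y \<in>: A" "z \<in>: A"
 have "add A (sub A x y) (sub A y z) =
   add A x (add A (add A y (scl A (-1) y)) (scl A (-1) z))" unfolding sub_def by (simp add: add_ac del: add_neg)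
 then show ?thesis by (simp add: sub_def)
qed

lemma sub_add_cancel [simp]: "x \<in>: A ==> y \<in>: A ==> add A (sub A x y) y = x"
 using add_sub_sub[of x y "zer A"] by simp

lemma add_sub_cancel [simp]: "x \<in>: A ==> y \<in>: A ==> add A y (sub A x y) = x"
 using add_commute[of y "sub A x y"] by simp

lemma add_sub_cancel_right [simp]: "x \<in>: A ==> y \<in>: A ==> sub A (add A x y) y = x"
 by (simp add: sub_def add_assoc)

lemma add_sub_cancel_left [simp]: "x \<in>: A ==> y \<in>: A ==> sub A (add A y x) y = x" by (simp add: add_commute)

lemma sub_eq_zer_iff: "x \<in>: A ==> y \<in>: A ==> sub A x y = zer A \<longleftrightarrow> x = y"
 by (metis add_zer_left sub_add_cancel sub_self)

lemma add_left_cancel: "x \<in>: A ==> y \<in>: A ==> z \<in>: A ==>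
  add A x y = add A x z \<longleftrightarrow> y = z" by (metis add_sub_cancel_left)

lemma sub_eq_iff: "x \<in>: A ==> y \<in>: A ==> z \<in>: A ==>
  sub A x y = z \<longleftrightarrow> x = add A z y" by (metis add_sub_cancel_right sub_add_cancel)

lemma scl_sub: "x \<in>: A ==> y \<in>: A ==>
  scl A c (sub A x y) = sub A (scl A c x) (scl A c y)" by (simp add: sub_def scl_add_right scl_scl)

lemma neg_sub: "x \<in>: A ==> y \<in>: A ==> scl A (-1) (sub A x y) = sub A y x"
 by (simp add: sub_def scl_add_right scl_scl add_commute)

lemma sub_add_add: "a \<in>: A ==> b \<in>: A ==> c \<in>: A ==> d \<in>: A ==>
  sub A (add A a b) (add A c d) = add A (sub A a c) (sub A b d)" by (simp add: sub_def scl_add_right add_ac)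

lemma sub_sub_sub: "a \<in>: A ==> b \<in>: A ==> c \<in>: A ==> d \<in>: A ==>
  sub A (sub A a b) (sub A c d) = sub A (sub A a c) (sub A b d)" by (simp add: sub_def scl_add_right scl_scl add_ac)

lemma mul_zer_right [simp]: "x \<in>: A ==> mul A x (zer A) = zer A" using mul_scl_right[of x "zer A" 0] by simp

lemma mul_zer_left [simp]: "x \<in>: A ==> mul A (zer A) x = zer A" using mul_scl_left[of "zer A" x 0] by simp

lemma mul_sub_right: "x \<in>: A ==> y \<in>: A ==> z \<in>: A ==>
  mul A x (sub A y z) = sub A (mul A x y) (mul A x z)" by (simp add: sub_def mul_add_right mul_scl_right)

lemma mul_sub_left: "x \<in>: A ==> y \<in>: A ==> z \<in>: A ==>
  mul A (sub A x y) z = sub A (mul A x z) (mul A y z)" by (simp add: sub_def mul_add_left mul_scl_left)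

lemma sub_mul_mul: "a \<in>: A ==> b \<in>: A ==> c \<in>: A ==> d \<in>: A ==>
  sub A (mul A a b) (mul A c d) = add A (mul A a (sub A b d)) (mul A (sub A a c) d)"
 by (simp add: mul_sub_right mul_sub_left add_sub_sub)

lemma adj_zer [simp]: "adj A (zer A) = zer A" using adj_scl[of "zer A" 0] by simp

lemma adj_sub: "x \<in>: A ==> y \<in>: A ==> adj A (sub A x y) = sub A (adj A x) (adj A y)"
 by (simp add: sub_def adj_add adj_scl)

lemma nrm_zer [simp]: "nrm A (zer A) = 0" using nrm_scl[of "zer A" 0] by simp

lemma nrm_sub_commute: "x \<in>: A ==> y \<in>: A ==> nrm A (sub A x y) = nrm A (sub A y x)"
 using nrm_scl[of "sub A y x" "-1"] by (simp add: neg_sub)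

lemma nrm_sub_le: "x \<in>: A ==> y \<in>: A ==> nrm A (sub A x y) <= nrm A x + nrm A y"
 using nrm_add[of x "scl A (-1) y"] by (simp add: sub_def nrm_scl)

lemma nrm_sub_triangle: "x \<in>: A ==> y \<in>: A ==> z \<in>: A ==>
  nrm A (sub A x z) <= nrm A (sub A x y) + nrm A (sub A y z)"
 using nrm_add[of "sub A x y" "sub A y z"] by (simp add: add_sub_sub)

lemma nrm_diff_le: "x \<in>: A ==> y \<in>: A ==> \<bar>nrm A x - nrm A y\<bar> <= nrm A (sub A x y)"
 using nrm_add[of "sub A x y" y] nrm_add[of "sub A y x" x] nrm_sub_commute[of x y] by simp

text \<open>The C*-identity bounds ||x||^2 by ||x^*|| ||x||, and cancelling ||x|| gives one
  inequality; the same for x^* gives the other. The case ||x|| = 0, where nothing can be cancelled,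
  is separate.\<close>

lemma nrm_adj [simp]: "x \<in>: A ==> nrm A (adj A x) = nrm A x"
proof -
 have le: "nrm A x <= nrm A (adj A x)" if "x \<in>: A" for x
 proof (cases "nrm A x = 0")
  case False
  then have "nrm A x > 0" using that nrm_nonneg[of x] by linarith
  moreover have "nrm A x * nrm A x <= nrm A (adj A x) * nrm A x"
   using nrm_mul[of "adj A x" x] nrm_cstar[of x] that by (simp add: power2_eq_square)
  ultimately show ?thesis by simp
 qed (use that in simp)
 show "nrm A (adj A x) = nrm A x" if "x \<in>: A" using le[of x] le[of "adj A x"] that by simp
qed

lemma nrm_cstar_sa: "x \<in>: A ==> adj A x = x ==> nrm A (mul A x x) = (nrm A x)\<^sup>2" using nrm_cstar[of x] by simp

text \<open>The C*-identity reads ||p||^2 = ||p||, so the norm is 0 or 1.\<close>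

lemma nrm_projection: "x \<in>: A ==> adj A x = x ==> mul A x x = x ==> nrm A x <= 1"
 using nrm_cstar_sa[of x] by (auto simp: power2_eq_square)

subsection \<open>Finite sums\<close>

lemma asum_empty [simp]: "asum A f {} = zer A"
 and asum_infinite [simp]: "infinite I ==> asum A f I = zer A"
 and asum_closed [simp]: "(!!i. i \<in> I ==> f i \<in>: A) ==> asum A f I \<in>: A"
 and asum_insert: "finite I ==> j \<notin> I ==> (!!i. i \<in> I ==> f i \<in>: A) ==> f j \<in>: A ==>
    asum A f (insert j I) = add A (f j) (asum A f I)"
 and asum_cong: "I = J ==> (!!i. i \<in> J ==> g i \<in>: A) ==> (!!i. i \<in> J ==> f i = g i) ==>
    asum A f I = asum A g J"
proof -
 interpret G: comm_group "additive_group A" by (rule add_group)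
 show "asum A f {} = zer A" "infinite I ==> asum A f I = zer A" by (simp_all add: asum_def)
 show "asum A f I \<in>: A" if "!!i. i \<in> I ==> f i \<in>: A"
  using G.finprod_closed[of f I] that by (auto simp: asum_def)
 show "asum A f (insert j I) = add A (f j) (asum A f I)" if "finite I" "j \<notin> I"
   "!!i. i \<in> I ==> f i \<in>: A" "f j \<in>: A" using G.finprod_insert[of I j f] that by (auto simp: asum_def)
 show "asum A f I = asum A g J" if "I = J" "!!i. i \<in> J ==> g i \<in>: A" "!!i. i \<in> J ==> f i = g i"
  using G.finprod_cong'[of I J g f] that by (auto simp: asum_def)
qed

lemma asum_add: "(!!i. i \<in> I ==> f i \<in>: A) ==> (!!i. i \<in> I ==> g i \<in>: A) ==>
  asum A (%i. add A (f i) (g i)) I = add A (asum A f I) (asum A g I)"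
 by (induction I rule: infinite_finite_induct) (auto simp: asum_insert add_ac)

lemma asum_zer [simp]: "asum A (%i. zer A) I = zer A"
 by (induction I rule: infinite_finite_induct) (auto simp: asum_insert)

lemma asum_neutral: "(!!i. i \<in> I ==> f i = zer A) ==> asum A f I = zer A"
 using asum_cong[of I I "%_. zer A" f] by simp

lemma asum_scl: "(!!i. i \<in> I ==> f i \<in>: A) ==>
  asum A (%i. scl A c (f i)) I = scl A c (asum A f I)"
 by (induction I rule: infinite_finite_induct) (auto simp: asum_insert scl_add_right)

lemma asum_mul_left: "(!!i. i \<in> I ==> f i \<in>: A) ==> a \<in>: A ==>
  mul A a (asum A f I) = asum A (%i. mul A a (f i)) I"
 by (induction I rule: infinite_finite_induct) (auto simp: asum_insert mul_add_right)

lemma asum_mul_right: "(!!i. i \<in> I ==> f i \<in>: A) ==> a \<in>: A ==>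
  mul A (asum A f I) a = asum A (%i. mul A (f i) a) I"
 by (induction I rule: infinite_finite_induct) (auto simp: asum_insert mul_add_left)

lemma asum_adj: "(!!i. i \<in> I ==> f i \<in>: A) ==>
  adj A (asum A f I) = asum A (%i. adj A (f i)) I"
 by (induction I rule: infinite_finite_induct) (auto simp: asum_insert adj_add)

lemma asum_union_disjoint: "finite I ==> finite J ==> I \<inter> J = {} ==>
  (!!i. i \<in> I \<union> J ==> f i \<in>: A) ==> asum A f (I \<union> J) = add A (asum A f I) (asum A f J)"
proof (induction I rule: finite_induct)
 case (insert x F)
 have "asum A f (insert x (F \<union> J)) = add A (f x) (asum A f (F \<union> J))"
  by (rule asum_insert) (use insert in auto)
 then show ?case using insert by (simp add: asum_insert add_assoc)
qed simp

lemma asum_single: "finite I ==> j \<in> I ==> f j \<in>: A ==> (!!i. i \<in> I ==> i ~= j ==> f i = zer A) ==>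
  asum A f I = f j" using asum_insert[of "I - {j}" j f] asum_neutral[of "I - {j}" f] by (simp add: insert_absorb)

lemma asum_swap: "finite I ==> finite J ==> (!!i j. i \<in> I ==> j \<in> J ==> f i j \<in>: A) ==>
  asum A (%i. asum A (f i) J) I = asum A (%j. asum A (%i. f i j) I) J"
proof (induction I rule: finite_induct)
 case (insert x F)
 have "asum A (%j. asum A (%i. f i j) (insert x F)) J
   = asum A (%j. add A (f x j) (asum A (%i. f i j) F)) J" by (rule asum_cong) (use insert in "auto simp: asum_insert")
 then show ?case using insert by (auto simp: asum_insert asum_add)
qed simp

lemma asum_reindex: "inj_on h I ==> (!!i. i \<in> I ==> f (h i) \<in>: A) ==>
  asum A f (h ` I) = asum A (%i. f (h i)) I"
proof (induction I rule: infinite_finite_induct)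
 case (infinite I)
 then show ?case by (simp add: finite_image_iff)
next
 case (insert x F)
 have "asum A f (insert (h x) (h ` F)) = add A (f (h x)) (asum A f (h ` F))"
  by (rule asum_insert) (use insert in "auto simp: inj_on_def")
 then show ?case using insert by (auto simp: asum_insert)
qed simp

lemma asum_Sigma: "finite I ==> (!!i. i \<in> I ==> finite (J i)) ==>
  (!!i j. i \<in> I ==> j \<in> J i ==> f (i, j) \<in>: A) ==>
  asum A f (SIGMA i:I. J i) = asum A (%i. asum A (%j. f (i, j)) (J i)) I"
proof (induction I rule: finite_induct)
 case (insert x F)
 have eq: "(SIGMA i:insert x F. J i) = Pair x ` J x \<union> (SIGMA i:F. J i)" by auto
 have "asum A f (SIGMA i:insert x F. J i) = add A (asum A f (Pair x ` J x)) (asum A f (SIGMA i:F. J i))"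
  unfolding eq by (rule asum_union_disjoint) (use insert in "auto intro!: finite_SigmaI")
 moreover have "asum A f (Pair x ` J x) = asum A (%j. f (x, j)) (J x)"
  by (rule asum_reindex) (use insert in "auto simp: inj_on_def")
 ultimately show ?case using insert by (auto simp: asum_insert)
qed simp

lemma asum_mono_neutral: "finite J ==> I <= J ==> (!!i. i \<in> I ==> f i \<in>: A) ==>
  (!!i. i \<in> J - I ==> f i = zer A) ==> asum A f J = asum A f I"
proof -
 assume a: "finite J" "I <= J" "!!i. i \<in> I ==> f i \<in>: A" "!!i. i \<in> J - I ==> f i = zer A"
 have "asum A f (I \<union> (J - I)) = add A (asum A f I) (asum A f (J - I))"
 proof (rule asum_union_disjoint)
  show "f i \<in>: A" if "i \<in> I \<union> (J - I)" for i using that a(3,4)[of i] by (cases "i \<in> I") auto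
 qed (use a in "auto intro: finite_subset")
 then show ?thesis using a asum_neutral[of "J - I" f] by (simp add: Un_absorb1)
qed

lemma asum_const: "finite I ==> x \<in>: A ==> asum A (%_. x) I = scl A (of_nat (card I)) x"
 by (induction I rule: finite_induct) (auto simp: asum_insert scl_add_left)

lemma nrm_asum_le: "(!!i. i \<in> I ==> f i \<in>: A) ==> nrm A (asum A f I) <= (\<Sum>i\<in>I. nrm A (f i))"
proof (induction I rule: infinite_finite_induct)
 case (insert x F)
 then show ?case using nrm_add[of "f x" "asum A f F"] by (auto simp: asum_insert)
qed auto

subsection \<open>Limits\<close>

lemma conv_to_const [simp]: "x \<in>: A ==> conv_to A (%_. x) x" by (simp add: conv_to_def)

lemma conv_to_sandwich:
 assumes "!!n. nrm A (sub A (s n) x) <= b n" "b \<longlonglongrightarrow> 0" "!!n. s n \<in>: A" "x \<in>: A"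
 shows "conv_to A s x" unfolding conv_to_def by (rule tendsto_sandwich[of "%_. 0" _ _ b]) (use assms in auto)

lemma conv_to_add:
 assumes "conv_to A s x" "conv_to A t y" "!!n. s n \<in>: A" "!!n. t n \<in>: A"
  "x \<in>: A" "y \<in>: A"
 shows "conv_to A (%n. add A (s n) (t n)) (add A x y)"
proof (rule conv_to_sandwich[where b = "%n. nrm A (sub A (s n) x) + nrm A (sub A (t n) y)"])
 show "(%n. nrm A (sub A (s n) x) + nrm A (sub A (t n) y)) \<longlonglongrightarrow> 0"
  using tendsto_add[of _ 0 _ _ 0] assms(1,2) by (simp add: conv_to_def)
qed (use assms in "auto simp: sub_add_add intro: nrm_add")

lemma conv_to_scl:
 assumes "conv_to A s x" "!!n. s n \<in>: A" "x \<in>: A"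
 shows "conv_to A (%n. scl A c (s n)) (scl A c x)"
 using tendsto_mult_left[of "%n. nrm A (sub A (s n) x)" 0 _ "cmod c"] assms
 by (simp add: conv_to_def scl_sub[symmetric] nrm_scl)

lemma conv_to_adj:
 assumes "conv_to A s x" "!!n. s n \<in>: A" "x \<in>: A"
 shows "conv_to A (%n. adj A (s n)) (adj A x)" using assms by (simp add: conv_to_def adj_sub[symmetric])

lemma conv_to_sub:
 assumes "conv_to A s x" "conv_to A t y" "!!n. s n \<in>: A" "!!n. t n \<in>: A"
  "x \<in>: A" "y \<in>: A"
 shows "conv_to A (%n. sub A (s n) (t n)) (sub A x y)"
 unfolding sub_def by (intro conv_to_add conv_to_scl) (use assms in auto)

lemma conv_to_nrm:
 assumes "conv_to A s x" "!!n. s n \<in>: A" "x \<in>: A"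
 shows "(%n. nrm A (s n)) \<longlonglongrightarrow> nrm A x"
proof (rule LIM_zero_cancel, rule Lim_null_comparison)
 show "\<forall>\<^sub>F n in sequentially. norm (nrm A (s n) - nrm A x) <= nrm A (sub A (s n) x)"
  using assms nrm_diff_le by auto
qed (use assms in "simp add: conv_to_def")

lemma nrm_mul_sub_le:
 assumes "a \<in>: A" "b \<in>: A" "c \<in>: A" "d \<in>: A"
 shows "nrm A (sub A (mul A a b) (mul A c d)) <= nrm A a * nrm A (sub A b d) + nrm A (sub A a c) * nrm A d"
 using nrm_add[of "mul A a (sub A b d)" "mul A (sub A a c) d"] nrm_mul[of a "sub A b d"]
  nrm_mul[of "sub A a c" d] assms by (simp add: sub_mul_mul)

lemma conv_to_mul:
 assumes "conv_to A s x" "conv_to A t y" "!!n. s n \<in>: A" "!!n. t n \<in>: A"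
  "x \<in>: A" "y \<in>: A"
 shows "conv_to A (%n. mul A (s n) (t n)) (mul A x y)"
proof (rule conv_to_sandwich)
 show "nrm A (sub A (mul A (s n) (t n)) (mul A x y))
   <= nrm A (s n) * nrm A (sub A (t n) y) + nrm A (sub A (s n) x) * nrm A y" for n
  by (rule nrm_mul_sub_le) (use assms in auto)
 have "(%n. nrm A (s n) * nrm A (sub A (t n) y) + nrm A (sub A (s n) x) * nrm A y)
   \<longlonglongrightarrow> nrm A x * 0 + 0 * nrm A y"
  by (intro tendsto_intros conv_to_nrm) (use assms in "auto simp: conv_to_def")
 then show "(%n. nrm A (s n) * nrm A (sub A (t n) y) + nrm A (sub A (s n) x) * nrm A y) \<longlonglongrightarrow> 0"
  by simp
qed (use assms in auto)

lemma cauchyD: "cauchy A s ==> s n \<in>: A" by (simp add: cauchy_def)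

lemma cauchy_nrm: "cauchy A s ==> Cauchy (%n. nrm A (s n))" unfolding Cauchy_def cauchy_def dist_real_def
 by (blast intro: le_less_trans[OF nrm_diff_le])

lemma cauchy_nrm_bound: "cauchy A s ==> \<exists>K>0. \<forall>n. nrm A (s n) <= K"
 using Cauchy_Bseq[OF cauchy_nrm[of s]] unfolding Bseq_def real_norm_def by (meson abs_le_D1)

lemma closed_subspaceD:
 assumes "closed_subspace A L"
 shows "L <= carrier A" "x \<in> L ==> x \<in>: A" "zer A \<in> L"
  "x \<in> L ==> y \<in> L ==> add A x y \<in> L" "x \<in> L ==> scl A c x \<in> L"
  "x \<in> L ==> y \<in> L ==> sub A x y \<in> L"
  "(!!n. s n \<in> L) ==> x \<in>: A ==> conv_to A s x ==> x \<in> L"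
 using assms unfolding closed_subspace_def sub_def by blast+

lemma closed_subspace_asum:
 "closed_subspace A L ==> (!!i. i \<in> I ==> f i \<in> L) ==> asum A f I \<in> L"
proof (induction I rule: infinite_finite_induct)
 case (insert x F)
 then have "asum A f (insert x F) = add A (f x) (asum A f F)"
  by (intro asum_insert) (use closed_subspaceD(2)[of L] insert in auto)
 then show ?case using insert closed_subspaceD(4)[of L] by auto
qed (auto dest: closed_subspaceD(3))

lemma unit_unique: "is_unit_of A e ==> is_unit_of A e' ==> e = e'" unfolding is_unit_of_def by metis

lemma unit_ofI: "is_unit_of A e ==> unit_of A = e"
 unfolding unit_of_def by (rule the_equality) (auto intro: unit_unique)

lemma is_unit_adj: "is_unit_of A e ==> adj A e = e"
proof -
 assume "is_unit_of A e"
 then have e: "e \<in>: A" "!!a. a \<in>: A ==> mul A e a = a" by (auto simp: is_unit_of_def)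
 have "adj A (mul A e (adj A e)) = mul A e (adj A e)" using e(1) by (simp add: adj_mul)
 then show ?thesis using e by simp
qed

end

text \<open>The algebraic axioms do not mention the norm, so any C*-seminorm can take its place.
  Facts proved for the norm of a \<open>pre_cstar\<close> thus become facts about arbitrary
  C*-seminorms on the same algebra.\<close>

lemma pre_cstar_renorm: "pre_cstar A ==> cstar_seminorm A p ==> pre_cstar (A\<lparr>nrm := p\<rparr>)"
 unfolding pre_cstar_def cstar_seminorm_def additive_group_def by simp

lemma pre_cstar_seminorm: "pre_cstar A ==> cstar_seminorm A (nrm A)" unfolding pre_cstar_def cstar_seminorm_def by simp

context cstar_algebra
begin

lemma nrm_eq_0D: "x \<in>: A ==> nrm A x <= 0 ==> x = zer A" by (meson antisym nrm_eq_0 nrm_nonneg)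

lemma conv_to_unique:
 assumes "conv_to A s x" "conv_to A s y" "!!n. s n \<in>: A" "x \<in>: A" "y \<in>: A"
 shows "x = y"
proof -
 have "conv_to A (%n. sub A (s n) (s n)) (sub A x y)" by (rule conv_to_sub) (use assms in auto)
 then have "(%n. nrm A (sub A (s n) (s n))) \<longlonglongrightarrow> nrm A (sub A x y)"
  by (rule conv_to_nrm) (use assms in auto)
 then have "nrm A (sub A x y) = 0" using assms by (simp add: LIMSEQ_const_iff)
 then show ?thesis using assms nrm_eq_0 sub_eq_zer_iff by simp
qed

lemma cauchy_limit:
 assumes "cauchy A s" obtains x where "x \<in>: A" "conv_to A s x" using complete assms by blast

end

lemma star_homD:
 assumes "star_hom A B f"
 shows "x \<in>: A ==> f x \<in>: B"
  "x \<in>: A ==> y \<in>: A ==> f (add A x y) = add B (f x) (f y)"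
  "x \<in>: A ==> f (scl A c x) = scl B c (f x)"
  "x \<in>: A ==> y \<in>: A ==> f (mul A x y) = mul B (f x) (f y)"
  "x \<in>: A ==> f (adj A x) = adj B (f x)" using assms unfolding star_hom_def by auto

lemma star_homI:
 assumes "!!x. x \<in>: A ==> f x \<in>: B"
  "!!x y. x \<in>: A ==> y \<in>: A ==> f (add A x y) = add B (f x) (f y)"
  "!!x c. x \<in>: A ==> f (scl A c x) = scl B c (f x)"
  "!!x y. x \<in>: A ==> y \<in>: A ==> f (mul A x y) = mul B (f x) (f y)"
  "!!x. x \<in>: A ==> f (adj A x) = adj B (f x)"
 shows "star_hom A B f" using assms unfolding star_hom_def by auto

lemma star_hom_comp: "star_hom A B f ==> star_hom B C g ==> star_hom A C (%x. g (f x))"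
 by (rule star_homI) (simp_all add: star_homD)

lemma star_hom_zer:
 assumes "star_hom A B f" "pre_cstar A" "pre_cstar B" shows "f (zer A) = zer B"
proof -
 interpret A: pre_cstar A by fact
 interpret B: pre_cstar B by fact
 have "f (scl A 0 (zer A)) = scl B 0 (f (zer A))" by (rule star_homD[OF assms(1)]) simp
 then show ?thesis using star_homD(1)[OF assms(1), of "zer A"] by simp
qed

lemma star_hom_sub:
 assumes "star_hom A B f" "pre_cstar A" "x \<in>: A" "y \<in>: A"
 shows "f (sub A x y) = sub B (f x) (f y)"
proof -
 interpret A: pre_cstar A by fact
 show ?thesis using assms by (simp add: sub_def star_homD[OF assms(1)])
qed

lemma star_hom_asum:
 assumes "star_hom A B f" "pre_cstar A" "pre_cstar B" "!!i. i \<in> I ==> g i \<in>: A"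
 shows "f (asum A g I) = asum B (%i. f (g i)) I"
proof -
 interpret A: pre_cstar A by fact
 interpret B: pre_cstar B by fact
 show ?thesis using assms(4)
 proof (induction I rule: infinite_finite_induct)
  case (insert x F)
  then show ?case by (simp add: A.asum_insert B.asum_insert star_homD[OF assms(1)])
 qed (simp_all add: star_hom_zer[OF assms(1-3)])
qed

text \<open>The pulled back norm links homomorphisms with seminorms: it will be bounded by the norm
  of a complete source, and by the maximal seminorm of a universal algebra once the relations are
  satisfied.\<close>

lemma star_hom_seminorm:
 assumes "star_hom A B f" "pre_cstar A" "pre_cstar B"
 shows "cstar_seminorm A (%x. nrm B (f x))"
proof -
 interpret A: pre_cstar A by fact
 interpret B: pre_cstar B by fact
 show ?thesis unfolding cstar_seminorm_def
  by (auto simp: star_homD[OF assms(1)] B.nrm_cstar B.nrm_scl B.nrm_add B.nrm_mul)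
qed

section \<open>Convolution algebras of semigroups with involution, and linear extension to
  them\<close>

section \<open>Semigroup algebras\<close>

abbreviation keys where "keys \<equiv> Poly_Mapping.keys"
abbreviation lookup where "lookup \<equiv> Poly_Mapping.lookup"
abbreviation single where "single \<equiv> Poly_Mapping.single"

lemma lookup_cscale [simp]: "lookup (cscale c f) w = c * lookup f w"
 by (auto simp: cscale_def Poly_Mapping.map.rep_eq when_def)

lemma keys_cscale: "keys (cscale c f) <= keys f" by (auto simp: in_keys_iff)

lemma cscale_single [simp]: "cscale c (single w a) = single w (c * a)"
 by (rule poly_mapping_eqI) (simp add: lookup_single when_def)

lemma cscale_add: "cscale c (f + g) = cscale c f + cscale c g"
 and cscale_add_left: "cscale (c + d) f = cscale c f + cscale d f"
 and cscale_cscale: "cscale c (cscale d f) = cscale (c * d) f"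
 and cscale_one [simp]: "cscale 1 f = f"
 and cscale_zero [simp]: "cscale c 0 = 0"
 and cscale_minus_one: "cscale (-1) f = - f" by (rule poly_mapping_eqI; simp add: lookup_add algebra_simps)+

lemma poly_mapping_sum_single:
 fixes f :: "'k \<Rightarrow>\<^sub>0 complex"
 shows "f = (\<Sum>w\<in>keys f. single w (lookup f w))"
proof (rule poly_mapping_eqI)
 fix k
 have "lookup (\<Sum>w\<in>keys f. single w (lookup f w)) k = (\<Sum>w\<in>keys f. if w = k then lookup f w else 0)"
  by (simp add: lookup_sum lookup_single when_def)
 then show "lookup f k = lookup (\<Sum>w\<in>keys f. single w (lookup f w)) k" by (simp add: in_keys_iff)
qed

text \<open>The supports stay inside \<open>W\<close> in every case, so closure of \<open>W\<close>
  under the semigroup operations is available during the induction.\<close>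

lemma poly_mapping_sg_induct [consumes 1, case_names zero single add]:
 fixes f :: "'k \<Rightarrow>\<^sub>0 complex"
 assumes "keys f <= W" "P 0" "!!w a. w \<in> W ==> P (single w a)"
  "!!f g. keys f <= W ==> keys g <= W ==> P f ==> P g ==> P (f + g)"
 shows "P f"
proof -
 have "keys (\<Sum>w\<in>S. single w (lookup f w)) <= W & P (\<Sum>w\<in>S. single w (lookup f w))"
  if "finite S" "S <= W" for S using that
 proof (induction S rule: finite_induct)
  case (insert x F)
  have "keys (single x (lookup f x)) <= W" using insert by auto
  moreover have "keys (single x (lookup f x) + (\<Sum>w\<in>F. single w (lookup f w))) <= W"
   using insert keys_add[of "single x (lookup f x)" "\<Sum>w\<in>F. single w (lookup f w)"]
    \<open>keys (single x (lookup f x)) <= W\<close> by auto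
  ultimately show ?case using insert assms by simp
 qed (use assms in auto)
 from this[of "keys f"] show ?thesis using assms(1) poly_mapping_sum_single[of f] by auto
qed

text \<open>Convolution for an arbitrary binary operation. Concatenation of words gives the free
  algebra and entrywise multiplication of lists gives the formal tensor powers, so one construction
  serves both.\<close>

definition sg_mul :: "('k => 'k => 'k) => ('k \<Rightarrow>\<^sub>0 complex) => ('k \<Rightarrow>\<^sub>0 complex) => ('k \<Rightarrow>\<^sub>0 complex)" where
 "sg_mul m f g = (\<Sum>v\<in>keys f. \<Sum>w\<in>keys g. single (m v w) (lookup f v * lookup g w))"

definition sg_adj :: "('k => 'k) => ('k \<Rightarrow>\<^sub>0 complex) => ('k \<Rightarrow>\<^sub>0 complex)" where
 "sg_adj st f = (\<Sum>w\<in>keys f. single (st w) (cnj (lookup f w)))"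

text \<open>The zero seminorm is a placeholder: it satisfies the axioms of \<open>pre_cstar\<close>,
  and \<open>pre_cstar_renorm\<close> replaces it where a genuine seminorm is known.\<close>

definition sg_alg :: "'k set => ('k => 'k => 'k) => ('k => 'k) => ('k \<Rightarrow>\<^sub>0 complex) star_algebra" where
 "sg_alg W m st = \<lparr>carrier = {f. keys f <= W}, zer = 0, add = (+), scl = cscale, mul = sg_mul m,
  adj = sg_adj st, nrm = (%_. 0)\<rparr>"

text \<open>Coefficients can cancel, so the support of a sum may be smaller than the union of the
  supports. Summing over larger finite sets makes bilinearity visible.\<close>

lemma sg_mul_superset: "finite S ==> finite T ==> keys f <= S ==> keys g <= T ==>
  sg_mul m f g = (\<Sum>v\<in>S. \<Sum>w\<in>T. single (m v w) (lookup f v * lookup g w))"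
proof -
 assume a: "finite S" "finite T" "keys f <= S" "keys g <= T"
 have "sg_mul m f g = (\<Sum>v\<in>keys f. \<Sum>w\<in>T. single (m v w) (lookup f v * lookup g w))"
  unfolding sg_mul_def by (intro sum.cong sum.mono_neutral_left) (use a in "auto simp: in_keys_iff")
 also have "... = (\<Sum>v\<in>S. \<Sum>w\<in>T. single (m v w) (lookup f v * lookup g w))"
  by (intro sum.mono_neutral_left) (use a in "auto simp: in_keys_iff")
 finally show ?thesis .
qed

lemma sg_adj_superset: "finite S ==> keys f <= S ==>
  sg_adj st f = (\<Sum>w\<in>S. single (st w) (cnj (lookup f w)))"
 unfolding sg_adj_def by (intro sum.mono_neutral_left) (auto simp: in_keys_iff)

lemma sg_mul_add_left: "sg_mul m (f + g) h = sg_mul m f h + sg_mul m g h"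
 and sg_mul_add_right: "sg_mul m h (f + g) = sg_mul m h f + sg_mul m h g"
 and sg_adj_add: "sg_adj st (f + g) = sg_adj st f + sg_adj st g"
proof -
 let ?S = "keys f \<union> keys g"
 have S: "keys (f + g) <= ?S" by (rule keys_add)
 show "sg_mul m (f + g) h = sg_mul m f h + sg_mul m g h"
  using S by (simp add: sg_mul_superset[of ?S "keys h"] lookup_add ring_distribs single_add sum.distrib)
 show "sg_mul m h (f + g) = sg_mul m h f + sg_mul m h g"
  using S by (simp add: sg_mul_superset[of "keys h" ?S] lookup_add ring_distribs single_add sum.distrib)
 show "sg_adj st (f + g) = sg_adj st f + sg_adj st g"
  using S by (simp add: sg_adj_superset[of ?S] lookup_add single_add sum.distrib)
qed

lemma sg_mul_zero [simp]: "sg_mul m 0 f = 0" "sg_mul m f 0 = 0"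
 and sg_adj_zero [simp]: "sg_adj st 0 = 0" by (simp_all add: sg_mul_def sg_adj_def)

lemma sg_mul_single [simp]: "sg_mul m (single v a) (single w b) = single (m v w) (a * b)"
 and sg_adj_single [simp]: "sg_adj st (single w a) = single (st w) (cnj a)" by (simp_all add: sg_mul_def sg_adj_def)

lemma keys_add_subset: "keys f <= W ==> keys g <= W ==> keys (f + g) <= W" using keys_add[of f g] by blast

lemma sum_keys_subset: "(!!i. i \<in> I ==> keys (f i) <= W) ==> keys (sum f I) <= W"
 by (induction I rule: infinite_finite_induct) (simp_all add: keys_add_subset)

text \<open>The laws are demanded on \<open>W\<close> only, because for lists over an algebra they
  are known only for entries in its carrier.\<close>

locale star_semigroup =
 fixes W :: "'k set" and m :: "'k => 'k => 'k" and st :: "'k => 'k"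
 assumes m_closed: "v \<in> W ==> w \<in> W ==> m v w \<in> W"
  and m_assoc: "v \<in> W ==> w \<in> W ==> x \<in> W ==> m (m v w) x = m v (m w x)"
  and st_closed: "v \<in> W ==> st v \<in> W"
  and st_st: "v \<in> W ==> st (st v) = v"
  and st_m: "v \<in> W ==> w \<in> W ==> st (m v w) = m (st w) (st v)"
begin

lemma sg_mul_closed: "keys f <= W ==> keys g <= W ==> keys (sg_mul m f g) <= W"
 unfolding sg_mul_def by (intro sum_keys_subset) (auto intro: m_closed)

lemma sg_adj_closed: "keys f <= W ==> keys (sg_adj st f) <= W"
 unfolding sg_adj_def by (intro sum_keys_subset) (auto intro: st_closed)

lemma sg_mul_assoc:
 assumes "keys f <= W" "keys g <= W" "keys h <= W"
 shows "sg_mul m (sg_mul m f g) h = sg_mul m f (sg_mul m g h)" using assms(1)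
proof (induction f rule: poly_mapping_sg_induct)
 case (single v a)
 show ?case using assms(2)
 proof (induction g rule: poly_mapping_sg_induct)
  case (single w b)
  show ?case using assms(3) by (induction h rule: poly_mapping_sg_induct)
    (use single \<open>v \<in> W\<close> in \<open>simp_all add: sg_mul_add_right m_assoc mult.assoc\<close>)
 qed (simp_all add: sg_mul_add_left sg_mul_add_right)
qed (simp_all add: sg_mul_add_left)

lemma sg_adj_adj: "keys f <= W ==> sg_adj st (sg_adj st f) = f"
 by (induction f rule: poly_mapping_sg_induct) (simp_all add: sg_adj_add st_st)

lemma sg_adj_mul:
 assumes "keys f <= W" "keys g <= W"
 shows "sg_adj st (sg_mul m f g) = sg_mul m (sg_adj st g) (sg_adj st f)" using assms(1)
proof (induction f rule: poly_mapping_sg_induct)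
 case (single v a)
 show ?case using assms(2) by (induction g rule: poly_mapping_sg_induct)
   (use single in "simp_all add: sg_mul_add_right sg_mul_add_left sg_adj_add st_m mult.commute")
qed (simp_all add: sg_mul_add_left sg_mul_add_right sg_adj_add)

lemma sg_mul_cscale_left: "keys f <= W ==> keys g <= W ==> sg_mul m (cscale c f) g = cscale c (sg_mul m f g)"
proof (induction f rule: poly_mapping_sg_induct)
 case (single v a)
 show ?case using single(2)
  by (induction g rule: poly_mapping_sg_induct) (simp_all add: sg_mul_add_right cscale_add mult.assoc)
qed (simp_all add: cscale_add sg_mul_add_left)

lemma sg_mul_cscale_right: "keys f <= W ==> keys g <= W ==> sg_mul m f (cscale c g) = cscale c (sg_mul m f g)"
proof (induction f rule: poly_mapping_sg_induct)
 case (single v a)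
 show ?case using single(2) by (induction g rule: poly_mapping_sg_induct)
   (simp_all add: sg_mul_add_right cscale_add mult.left_commute)
qed (simp_all add: cscale_add sg_mul_add_left)

lemma sg_adj_cscale: "keys f <= W ==> sg_adj st (cscale c f) = cscale (cnj c) (sg_adj st f)"
 by (induction f rule: poly_mapping_sg_induct) (simp_all add: sg_adj_add cscale_add)

lemma pre_cstar_sg_alg: "pre_cstar (sg_alg W m st)"
proof (rule pre_cstar.intro)
 have neg: "keys (- f) <= W" if "keys f <= W" for f :: "'k \<Rightarrow>\<^sub>0 complex"
  using that by (auto simp: in_keys_iff)
 show "comm_group (additive_group (sg_alg W m st))"
 proof (rule comm_groupI)
  fix x assume "x \<in>: (additive_group (sg_alg W m st))"
  then show "\<exists>y\<in>carrier (additive_group (sg_alg W m st)).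
    y \<otimes>\<^bsub>additive_group (sg_alg W m st)\<^esub> x = \<one>\<^bsub>additive_group (sg_alg W m st)\<^esub>"
   using neg by (intro bexI[of _ "- x"]) (auto simp: sg_alg_def)
 qed (simp_all add: sg_alg_def keys_add_subset ac_simps)
qed (simp_all add: sg_alg_def cscale_add cscale_add_left cscale_cscale sg_mul_add_left sg_mul_add_right
  sg_mul_assoc sg_mul_cscale_left sg_mul_cscale_right sg_adj_adj sg_adj_add sg_adj_cscale sg_adj_mul
  order_trans[OF keys_cscale] sg_mul_closed sg_adj_closed)

end

subsection \<open>Linear extension\<close>

definition lin :: "'b star_algebra => ('k => 'b) => ('k \<Rightarrow>\<^sub>0 complex) => 'b" where
 "lin B phi f = asum B (%w. scl B (lookup f w) (phi w)) (keys f)"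

context pre_cstar
begin

context
 fixes W :: "'k set" and phi :: "'k => 'a"
 assumes phi: "!!w. w \<in> W ==> phi w \<in>: A"
begin

lemma lin_superset:
 assumes "finite S" "keys f <= S" "S <= W"
 shows "lin A phi f = asum A (%w. scl A (lookup f w) (phi w)) S" unfolding lin_def
 by (rule asum_mono_neutral[symmetric])
  (use assms phi in "auto simp: in_keys_iff subset_iff")

lemma lin_closed: "keys f <= W ==> lin A phi f \<in>: A" unfolding lin_def by (rule asum_closed) (use phi in auto)

lemma lin_add:
 assumes "keys f <= W" "keys g <= W"
 shows "lin A phi (f + g) = add A (lin A phi f) (lin A phi g)"
proof -
 have "lin A phi h = asum A (%w. scl A (lookup h w) (phi w)) (keys f \<union> keys g)"
  if "keys h <= keys f \<union> keys g" for h by (rule lin_superset) (use that assms in auto)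
 then have "lin A phi (f + g) = asum A (%w. scl A (lookup (f + g) w) (phi w)) (keys f \<union> keys g)"
  "lin A phi f = asum A (%w. scl A (lookup f w) (phi w)) (keys f \<union> keys g)"
  "lin A phi g = asum A (%w. scl A (lookup g w) (phi w)) (keys f \<union> keys g)" using keys_add[of f g] by auto
 moreover have "asum A (%w. scl A (lookup (f + g) w) (phi w)) (keys f \<union> keys g) =
   asum A (%w. add A (scl A (lookup f w) (phi w)) (scl A (lookup g w) (phi w))) (keys f \<union> keys g)"
  by (rule asum_cong) (use phi assms in "auto simp: lookup_add intro: scl_add_left")
 moreover have "... = add A (asum A (%w. scl A (lookup f w) (phi w)) (keys f \<union> keys g))
   (asum A (%w. scl A (lookup g w) (phi w)) (keys f \<union> keys g))" by (rule asum_add) (use phi assms in auto)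
 ultimately show ?thesis by simp
qed

lemma lin_single [simp]: "w \<in> W ==> lin A phi (single w c) = scl A c (phi w)"
 using phi asum_insert[of "{}" w "%v. scl A (lookup (single w c) v) (phi v)"] by (cases "c = 0") (auto simp: lin_def)

lemma lin_zero [simp]: "lin A phi 0 = zer A" by (simp add: lin_def)

lemma lin_cscale: "keys f <= W ==> lin A phi (cscale c f) = scl A c (lin A phi f)"
proof (induction f rule: poly_mapping_sg_induct)
 case (add f g)
 have "keys (cscale c f) <= W" "keys (cscale c g) <= W" using add(1,2) by (simp_all add: order_trans[OF keys_cscale])
 then show ?case using add by (simp add: cscale_add lin_add scl_add_right lin_closed)
qed (simp_all add: scl_scl phi)

lemma star_hom_lin:
 assumes "star_semigroup W m st"
  "!!v w. v \<in> W ==> w \<in> W ==> phi (m v w) = mul A (phi v) (phi w)"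
  "!!w. w \<in> W ==> phi (st w) = adj A (phi w)"
 shows "star_hom (sg_alg W m st) A (lin A phi)"
proof -
 interpret S: star_semigroup W m st by fact
 have mul: "lin A phi (sg_mul m f g) = mul A (lin A phi f) (lin A phi g)"
  if "keys f <= W" "keys g <= W" for f g using that(1)
 proof (induction f rule: poly_mapping_sg_induct)
  case zero
  then show ?case using that by (simp add: lin_closed)
 next
  case (single v a)
  show ?case using that(2)
  proof (induction g rule: poly_mapping_sg_induct)
   case zero
   show ?case using single by (simp add: phi)
  next
   case (single w b)
   with \<open>v \<in> W\<close> show ?case
    by (simp add: assms S.m_closed phi mul_scl_left mul_scl_right scl_scl mult.commute)
  next
   case (add f g)
   then show ?case using \<open>v \<in> W\<close> S.sg_mul_closed[of "single v a"]
    by (simp add: sg_mul_add_right lin_add mul_add_right phi lin_closed)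
  qed
 next
  case (add f f')
  then show ?case using that(2) by (simp add: sg_mul_add_left lin_add mul_add_left lin_closed S.sg_mul_closed)
 qed
 have adj: "lin A phi (sg_adj st f) = adj A (lin A phi f)" if "keys f <= W" for f using that
 proof (induction f rule: poly_mapping_sg_induct)
  case (add f g)
  then show ?case by (simp add: sg_adj_add lin_add adj_add lin_closed S.sg_adj_closed)
 qed (simp_all add: S.st_closed assms phi adj_scl)
 show ?thesis by (rule star_homI) (auto simp: sg_alg_def lin_closed lin_add lin_cscale mul adj)
qed

end

end

lemma star_hom_sg_alg_eq:
 assumes "star_hom (sg_alg W m st) B f" "star_hom (sg_alg W m st) B g"
  "star_semigroup W m st" "pre_cstar B" "!!w. w \<in> W ==> f (single w 1) = g (single w 1)"
  "keys x <= W"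
 shows "f x = g x" using assms(6)
proof (induction x rule: poly_mapping_sg_induct)
 case zero
 have P: "pre_cstar (sg_alg W m st)" by (rule star_semigroup.pre_cstar_sg_alg) fact
 show ?case using star_hom_zer[OF assms(1) P assms(4)] star_hom_zer[OF assms(2) P assms(4)] by (simp add: sg_alg_def)
next
 case (single w a)
 then show ?case using star_homD(3)[OF assms(1), of "single w 1" a] star_homD(3)[OF assms(2), of "single w 1" a]
   assms(5)[of w] by (simp add: sg_alg_def)
next
 case (add x y)
 then show ?case using star_homD(2)[OF assms(1), of x y] star_homD(2)[OF assms(2), of x y] by (simp add: sg_alg_def)
qed

section \<open>Noncommutative polynomials, their evaluation, and suprema of C*-seminorms\<close>

section \<open>Free *-algebras\<close>

definition words :: "'g set => 'g star_word set" where
 "words G = {w. fst ` set (letters w) <= G}"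

lemma letters_plus [simp]: "letters (v + w) = letters v @ letters w"
 and letters_zero [simp]: "letters 0 = []" by (simp_all add: plus_star_word_def zero_star_word_def)

lemma star_word_eqI: "letters v = letters w ==> v = w" by (cases v, cases w) simp

lemma letters_star_word_adj: "letters (star_word_adj w) = rev (map (%(g, b). (g, \<not> b)) (letters w))"
 by (simp add: star_word_adj_def)

lemma star_word_adj_adj [simp]: "star_word_adj (star_word_adj w) = w"
 by (rule star_word_eqI) (simp add: letters_star_word_adj rev_map comp_def case_prod_unfold)

lemma star_word_adj_plus: "star_word_adj (v + w) = star_word_adj w + star_word_adj v"
 by (rule star_word_eqI) (simp add: letters_star_word_adj)

lemma star_word_adj_zero [simp]: "star_word_adj 0 = 0" by (rule star_word_eqI) (simp add: letters_star_word_adj)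

lemma inj_star_word_adj: "inj star_word_adj" by (metis injI star_word_adj_adj)

lemma Star_Word_in_words: "Star_Word ls \<in> words G \<longleftrightarrow> fst ` set ls <= G" by (simp add: words_def)

lemma star_word_adj_words: "w \<in> words G ==> star_word_adj w \<in> words G"
 by (auto simp: words_def letters_star_word_adj)

lemma star_semigroup_words: "star_semigroup (words G) (+) star_word_adj"
 by unfold_locales (auto simp: words_def star_word_adj_plus add.assoc letters_star_word_adj)

text \<open>Leaving out the empty word removes the unit; the semigroup algebra of the remaining
  words is the nonunital free algebra.\<close>

lemma star_semigroup_nonempty_words: "star_semigroup (words G - {0}) (+) star_word_adj"
proof unfold_locales
 fix v w :: "'a star_word" assume a: "v \<in> words G - {0}"
 then have "letters v ~= []" using star_word_eqI[of v 0] by auto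
 then show "v + w \<in> words G - {0}" if "w \<in> words G - {0}"
  using that a by (auto simp: words_def dest: arg_cong[of _ _ letters])
 show "star_word_adj v \<in> words G - {0}"
  using a star_word_adj_words[of v G] star_word_adj_adj[of v] by (auto simp del: star_word_adj_adj)
qed (auto simp: star_word_adj_plus add.assoc)

text \<open>Both products are bilinear and agree on monomials. The equation carries the results on
  semigroup algebras over to the library product of the statement.\<close>

lemma times_eq_sg_mul: "(*) = (sg_mul (+) :: 'g free_alg => _)"
proof (intro ext)
 fix f g :: "'g free_alg"
 have "keys f <= UNIV" "keys g <= UNIV" by auto
 then show "f * g = sg_mul (+) f g"
 proof (induction f rule: poly_mapping_sg_induct)
  case (single v a)
  show ?case using single(2) by (induction g rule: poly_mapping_sg_induct)
    (simp_all add: mult_single sg_mul_add_right distrib_left)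
 qed (simp_all add: sg_mul_add_left distrib_right)
qed

lemma lookup_free_star: "lookup (free_star f) w = cnj (lookup f (star_word_adj w))"
 by (simp add: free_star_def Poly_Mapping.map.rep_eq map_key.rep_eq inj_star_word_adj when_def)

lemma free_star_eq_sg_adj: "free_star = sg_adj star_word_adj"
proof
 fix f :: "'a free_alg"
 have add: "free_star (f + g) = free_star f + free_star g" for f g :: "'a free_alg"
  by (rule poly_mapping_eqI) (simp add: lookup_free_star lookup_add)
 have sing: "free_star (single w a) = single (star_word_adj w) (cnj a)" for w :: "'a star_word" and a
  by (rule poly_mapping_eqI)
   (auto simp: lookup_free_star lookup_single when_def)
 have "keys f <= UNIV" by auto
 then show "free_star f = sg_adj star_word_adj f"
 proof (induction f rule: poly_mapping_sg_induct)
  case zero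
  show ?case by (rule poly_mapping_eqI) (simp add: lookup_free_star)
 qed (simp_all add: add sing sg_adj_add)
qed

lemma free_unital_eq: "free_unital G = sg_alg (words G) (+) star_word_adj"
 by (auto simp: free_unital_def sg_alg_def times_eq_sg_mul free_star_eq_sg_adj words_def)

lemma free_nonunital_eq: "free_nonunital G = sg_alg (words G - {0}) (+) star_word_adj"
 by (auto simp: free_nonunital_def free_unital_def sg_alg_def times_eq_sg_mul free_star_eq_sg_adj words_def)

lemma pre_cstar_free_unital: "pre_cstar (free_unital G)"
 unfolding free_unital_eq by (rule star_semigroup.pre_cstar_sg_alg[OF star_semigroup_words])

lemma pre_cstar_free_nonunital: "pre_cstar (free_nonunital G)"
 unfolding free_nonunital_eq by (rule star_semigroup.pre_cstar_sg_alg[OF star_semigroup_nonempty_words])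

lemma free_unital_simps [simp]:
 "zer (free_unital G) = 0" "add (free_unital G) = (+)" "scl (free_unital G) = cscale"
 "mul (free_unital G) = (*)" "adj (free_unital G) = free_star" by (simp_all add: free_unital_def)

lemma free_nonunital_simps [simp]:
 "zer (free_nonunital G) = 0" "add (free_nonunital G) = (+)" "scl (free_nonunital G) = cscale"
 "mul (free_nonunital G) = (*)" "adj (free_nonunital G) = free_star" by (simp_all add: free_nonunital_def)

lemma carrier_free_nonunital: "carrier (free_nonunital G) <= carrier (free_unital G)" by (auto simp: free_nonunital_def)

lemma sub_free_unital [simp]: "sub (free_unital G) x y = x - y" by (simp add: sub_def cscale_minus_one)

lemma sub_free_nonunital [simp]: "sub (free_nonunital G) x y = x - y" by (simp add: sub_def cscale_minus_one)

lemma gen_in_free_unital [simp]: "g \<in> G ==> gen g \<in>: free_unital G" by (simp add: gen_def free_unital_def)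

lemma gen_in_free_nonunital [simp]: "g \<in> G ==> gen g \<in>: free_nonunital G"
 by (auto simp: gen_def free_nonunital_def free_unital_def dest: arg_cong[of _ _ letters])

lemma one_in_free_unital [simp]: "1 \<in>: free_unital G" by (simp add: free_unital_def)

subsection \<open>Evaluation of noncommutative polynomials\<close>

definition letter_val :: "'b star_algebra => ('g => 'b) => 'g \<times> bool => 'b" where
 "letter_val B f l = (if snd l then adj B (f (fst l)) else f (fst l))"

text \<open>The fold starts at the unit of \<open>B\<close>, which is the value of the empty word.
  For this reason the targets of evaluation are unital even when the free algebra is not.\<close>

definition word_val :: "'b star_algebra => ('g => 'b) => 'g star_word => 'b" where
 "word_val B f w = foldr (%l. mul B (letter_val B f l)) (letters w) (unit_of B)"

definition ev :: "'b star_algebra => ('g => 'b) => 'g free_alg => 'b" where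
 "ev B f = lin B (word_val B f)"

locale unital_pre_cstar = pre_cstar +
 assumes unit: "is_unit_of A (unit_of A)"
begin

lemma unit_closed [simp]: "unit_of A \<in>: A"
 and unit_left [simp]: "x \<in>: A ==> mul A (unit_of A) x = x"
 and unit_right [simp]: "x \<in>: A ==> mul A x (unit_of A) = x"
 and unit_adj [simp]: "adj A (unit_of A) = unit_of A" using unit is_unit_adj[OF unit] unfolding is_unit_of_def by auto

context
 fixes G :: "'g set" and f :: "'g => 'a"
 assumes f: "!!g. g \<in> G ==> f g \<in>: A"
begin

lemma letter_val_closed: "fst l \<in> G ==> letter_val A f l \<in>: A" by (simp add: letter_val_def f)

lemma foldr_letters_closed: "fst ` set ls <= G ==> x \<in>: A ==>
  foldr (%l. mul A (letter_val A f l)) ls x \<in>: A" by (induction ls) (auto simp: letter_val_closed)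

text \<open>Moving the starting value of the fold out as a right factor turns concatenation of words
  into multiplication of values.\<close>

lemma foldr_letters: "fst ` set ls <= G ==> x \<in>: A ==>
  foldr (%l. mul A (letter_val A f l)) ls x
   = mul A (foldr (%l. mul A (letter_val A f l)) ls (unit_of A)) x"
 by (induction ls) (auto simp: letter_val_closed foldr_letters_closed mul_assoc)

lemma word_val_closed: "w \<in> words G ==> word_val A f w \<in>: A"
 unfolding word_val_def by (rule foldr_letters_closed) (auto simp: words_def)

lemma word_val_plus: "v \<in> words G ==> w \<in> words G ==>
  word_val A f (v + w) = mul A (word_val A f v) (word_val A f w)"
 using foldr_letters[of "letters v" "word_val A f w"] word_val_closed[of w] by (simp add: word_val_def words_def)

lemma foldr_letters_adj: "fst ` set ls <= G ==>
  foldr (%l. mul A (letter_val A f l)) (rev (map (%(g, b). (g, \<not> b)) ls)) (unit_of A)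
   = adj A (foldr (%l. mul A (letter_val A f l)) ls (unit_of A))"
proof (induction ls)
 case (Cons l ls)
 have l: "letter_val A f (case l of (g, b) => (g, \<not> b)) = adj A (letter_val A f l)"
  using Cons.prems by (cases l) (auto simp: letter_val_def f)
 have "fst ` set (rev (map (%(g, b). (g, \<not> b)) ls)) <= G" using Cons.prems by force
 then have "foldr (%l. mul A (letter_val A f l)) (rev (map (%(g, b). (g, \<not> b)) ls)) (adj A (letter_val A f l))
   = mul A (adj A (foldr (%l. mul A (letter_val A f l)) ls (unit_of A))) (adj A (letter_val A f l))"
  using Cons by (subst foldr_letters) (auto simp: letter_val_closed)
 then show ?case using Cons.prems by (simp add: l adj_mul letter_val_closed foldr_letters_closed)
qed simp

lemma word_val_adj: "w \<in> words G ==> word_val A f (star_word_adj w) = adj A (word_val A f w)"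
 unfolding word_val_def letters_star_word_adj by (rule foldr_letters_adj) (simp add: words_def)

lemma star_hom_ev: "star_hom (free_unital G) A (ev A f)" unfolding ev_def free_unital_eq
 by (rule star_hom_lin[OF _ star_semigroup_words]) (auto simp: word_val_closed word_val_plus word_val_adj)

lemma ev_gen [simp]: "g \<in> G ==> ev A f (gen g) = f g" unfolding ev_def gen_def
 by (subst lin_single[where W = "words G"], erule word_val_closed)
  (auto simp: words_def word_val_def letter_val_def f)

lemma ev_one [simp]: "ev A f 1 = unit_of A" unfolding ev_def single_one[symmetric]
 by (subst lin_single[where W = "words G"], erule word_val_closed) (auto simp: words_def word_val_def)

end

end

lemma cstar_algebra_pre: "cstar_algebra A ==> pre_cstar A"
proof -
 assume "cstar_algebra A"
 then interpret cstar_algebra A .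
 show ?thesis by unfold_locales
qed

lemma unital_cstarD: "unital_cstar A ==> cstar_algebra A" by (simp add: unital_cstar_def)

lemma unital_cstar_pre: "unital_cstar A ==> unital_pre_cstar A" unfolding unital_cstar_def
 by (metis cstar_algebra_pre pre_cstar.unit_ofI unital_pre_cstar.intro unital_pre_cstar_axioms.intro)

subsection \<open>Suprema of C*-seminorms\<close>

text \<open>Inequalities pass to the supremum directly. The C*-identity needs in addition that each
  p x is the square root of p (x^* x) and so at most the square root of the supremum there;
  homogeneity combines the inequality for c with the one for 1/c.\<close>

lemma cstar_seminorm_Sup:
 assumes "S ~= {}" "!!p. p \<in> S ==> cstar_seminorm P p" "pre_cstar P"
  and bdd: "!!x. x \<in>: P ==> bdd_above ((%p. p x) ` S)"
 shows "cstar_seminorm P (%x. SUP p\<in>S. p x)"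
proof -
 interpret P: pre_cstar P by fact
 let ?s = "%x. SUP p\<in>S. p x"
 have le: "p x <= ?s x" if "p \<in> S" "x \<in>: P" for p x using cSUP_upper[OF that(1) bdd[OF that(2)]] .
 have least: "?s x <= b" if "!!p. p \<in> S ==> p x <= b" for x b using assms(1) that by (intro cSUP_least) auto
 note sem = assms(2)[unfolded cstar_seminorm_def, rule_format]
 obtain p0 where p0: "p0 \<in> S" using assms(1) by blast
 have nonneg: "0 <= ?s x" if "x \<in>: P" for x using le[OF p0 that] sem[OF p0 that] by linarith
 have sq: "?s (mul P (adj P x) x) = (?s x)\<^sup>2" if x: "x \<in>: P" for x
 proof (rule antisym)
  show "?s (mul P (adj P x) x) <= (?s x)\<^sup>2" by (rule least) (use sem x le power_mono in metis)
  have "?s x <= sqrt (?s (mul P (adj P x) x))" by (rule least) (metis le sem x P.mul_closed P.adj_closed real_le_rsqrt)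
  then show "(?s x)\<^sup>2 <= ?s (mul P (adj P x) x)" using nonneg[of "mul P (adj P x) x"] nonneg[OF x] x
   by (metis P.adj_closed P.mul_closed power_mono real_sqrt_pow2)
 qed
 have scl_le: "?s (scl P c x) <= cmod c * ?s x" if "x \<in>: P" for c x
  by (rule least) (use sem that le mult_left_mono norm_ge_zero in metis)
 have scl: "?s (scl P c x) = cmod c * ?s x" if x: "x \<in>: P" for c x
 proof (cases "c = 0")
  case True
  then show ?thesis using scl_le[OF x, of c] nonneg[of "scl P c x"] x by simp
 next
  case False
  have "?s x <= cmod (1 / c) * ?s (scl P c x)" using scl_le[of "scl P c x" "1 / c"] x False by (simp add: P.scl_scl)
  then have "cmod c * ?s x <= cmod c * (cmod (1 / c) * ?s (scl P c x))" by (rule mult_left_mono) simp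
  then have "cmod c * ?s x <= ?s (scl P c x)" using False by (simp add: norm_divide)
  then show ?thesis using scl_le[OF x, of c] by simp
 qed
 have add: "?s (add P x y) <= ?s x + ?s y" if "x \<in>: P" "y \<in>: P" for x y
 proof (rule least)
  fix p assume "p \<in> S"
  then have "p (add P x y) <= p x + p y" using sem that by blast
  then show "p (add P x y) <= ?s x + ?s y" using le[OF \<open>p \<in> S\<close> that(1)] le[OF \<open>p \<in> S\<close> that(2)] by linarith
 qed
 have mul: "?s (mul P x y) <= ?s x * ?s y" if "x \<in>: P" "y \<in>: P" for x y
 proof (rule least)
  fix p assume "p \<in> S"
  then have "p (mul P x y) <= p x * p y" using sem that by blast
  also have "... <= ?s x * ?s y" by (intro mult_mono le nonneg) (use sem \<open>p \<in> S\<close> that in auto)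
  finally show "p (mul P x y) <= ?s x * ?s y" .
 qed
 show ?thesis unfolding cstar_seminorm_def using nonneg sq scl add mul by blast
qed

lemma cstar_seminorm_facts:
 assumes "pre_cstar P" "cstar_seminorm P p"
 shows "p (zer P) = 0"
  "x \<in>: P ==> 0 <= p x"
  "x \<in>: P ==> y \<in>: P ==> p (add P x y) <= p x + p y"
  "x \<in>: P ==> y \<in>: P ==> p (mul P x y) <= p x * p y"
  "x \<in>: P ==> p (scl P c x) = cmod c * p x"
  "x \<in>: P ==> p (adj P x) = p x"
  "x \<in>: P ==> p (mul P (adj P x) x) = (p x)\<^sup>2"
 using pre_cstar.nrm_zer[OF pre_cstar_renorm[OF assms]] pre_cstar.nrm_nonneg[OF pre_cstar_renorm[OF assms], of x]
  pre_cstar.nrm_add[OF pre_cstar_renorm[OF assms], of x y] pre_cstar.nrm_mul[OF pre_cstar_renorm[OF assms], of x y]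
  pre_cstar.nrm_scl[OF pre_cstar_renorm[OF assms], of x c] pre_cstar.nrm_adj[OF pre_cstar_renorm[OF assms], of x]
  pre_cstar.nrm_cstar[OF pre_cstar_renorm[OF assms], of x] by simp_all

section \<open>Norm estimates from square roots; *-homomorphisms are contractive\<close>

section \<open>Square roots and automatic contractivity\<close>

context pre_cstar
begin

lemma cauchy_if_summable:
 assumes s: "!!n. s n \<in>: A" and "summable b" "!!n. nrm A (sub A (s (Suc n)) (s n)) <= b n"
 shows "cauchy A s"
proof -
 have le: "nrm A (sub A (s (m + k)) (s m)) <= sum b {m..<m + k}" for m k
 proof (induction k)
  case (Suc k)
  then show ?case using nrm_sub_triangle[of "s (Suc (m + k))" "s (m + k)" "s m"] s assms(3)[of "m + k"] by simp
 qed (use s in simp)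
 show ?thesis unfolding cauchy_def
 proof (intro conjI allI impI)
  fix e :: real assume "e > 0"
  then obtain N where N: "!!m n. m \<ge> N ==> norm (sum b {m..<n}) < e"
   using assms(2) unfolding summable_Cauchy by blast
  have 1: "nrm A (sub A (s n) (s m)) < e" if "m \<ge> N" "m <= n" for m n
   using le[of m "n - m"] N[OF that(1), of n] that by simp
  have "nrm A (sub A (s m) (s n)) < e" if "m \<ge> N" "n \<ge> N" for m n
   using 1[of m n] 1[of n m] that nrm_sub_commute[of "s m" "s n"] s by (cases "m <= n") auto
  then show "\<exists>N. \<forall>m\<ge>N. \<forall>n\<ge>N. nrm A (sub A (s m) (s n)) < e" by blast
 qed (rule s)
qed

lemma add_scl_cancel: "x \<in>: A ==> c + d = 0 ==> add A (scl A c x) (scl A d x) = zer A" by (simp flip: scl_add_left)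

text \<open>A form of Pythagoras: z^* y is self-adjoint and c is imaginary, so the mixed terms
  cancel, and - c * c is the square of the modulus of c.\<close>

lemma adj_mul_imaginary:
 assumes [simp]: "z \<in>: A" "y \<in>: A" and zy: "mul A (adj A z) y = mul A (adj A y) z" and c: "cnj c = - c"
 shows "mul A (adj A (add A z (scl A c y))) (add A z (scl A c y))
  = add A (mul A (adj A z) z) (scl A (- (c * c)) (mul A (adj A y) y))"
proof -
 let ?q = "mul A (adj A y) z"
 have "mul A (adj A (add A z (scl A c y))) (add A z (scl A c y))
  = add A (mul A (adj A z) z) (add A (add A (scl A c ?q) (scl A (- c) ?q)) (scl A (- (c * c)) (mul A (adj A y) y)))"
  by (simp add: adj_add adj_scl mul_add_left mul_add_right mul_scl_left mul_scl_right scl_scl c zy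
    scl_add_right add_ac del: add_neg)
 also have "add A (scl A c ?q) (scl A (- c) ?q) = zer A" by (rule add_scl_cancel) auto
 finally show ?thesis by simp
qed

text \<open>Up to a factor i, z and c y are half the sum and half the difference of the two elements
  that are assumed to be bounded.\<close>

lemma nrm_imaginary_parts:
 assumes z: "z \<in>: A" and y: "y \<in>: A" and "nrm A (add A z (scl A \<i> (scl A c y))) <= b"
  "nrm A (add A z (scl A (-\<i>) (scl A c y))) <= b"
 shows "nrm A z <= b" "cmod c * nrm A y <= b"
proof -
 let ?u = "add A z (scl A \<i> (scl A c y))" and ?v = "add A z (scl A (-\<i>) (scl A c y))"
 have "add A ?u ?v = add A (add A z z) (add A (scl A (\<i> * c) y) (scl A (- \<i> * c) y))"
  using z y by (simp add: scl_scl add_ac)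
 also have "... = add A z z" using add_scl_cancel[of y "\<i> * c" "- \<i> * c"] z y by simp
 finally have "add A ?u ?v = scl A 2 z" using scl_add_left[of z 1 1] z by simp
 then have "2 * nrm A z <= nrm A ?u + nrm A ?v" using nrm_add[of ?u ?v] z y nrm_scl[of z 2] by simp
 then show "nrm A z <= b" using assms by linarith
 have "sub A ?u ?v = add A (add A (scl A 1 z) (scl A (-1) z)) (scl A (2 * (\<i> * c)) y)"
  using z y scl_add_left[of y "\<i> * c" "\<i> * c"] by (simp add: sub_def scl_scl scl_add_right add_ac del: add_neg)
 also have "... = scl A (2 * (\<i> * c)) y" using z y by simp
 finally have "2 * (cmod c * nrm A y) <= nrm A ?u + nrm A ?v"
  using nrm_sub_le[of ?u ?v] z y by (simp add: nrm_scl norm_mult)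
 then show "cmod c * nrm A y <= b" using assms by linarith
qed

end

context cstar_algebra
begin

text \<open>\<open>1 - k\<close> is the square root of \<open>1 - v\<close>; the iteration avoids the binomial series.\<close>

lemma sqrt_one_minus:
 assumes v: "v \<in>: A" "nrm A v < 1"
 obtains k where "k \<in>: A" "add A k k = add A v (mul A k k)"
  "!!Q. Q (zer A) ==> (!!x. x \<in>: A ==> Q x ==> Q (scl A (1/2) (add A v (mul A x x)))) ==>
   (!!s x. (!!n. s n \<in>: A) ==> (!!n. Q (s n)) ==> x \<in>: A ==> conv_to A s x ==> Q x) ==> Q k"
proof -
 \<comment> \<open>A fixed point k of \<open>F\<close> satisfies 2 k = v + k^2, that is, (1 - k)^2 =
   1 - v. With t = ||v|| < 1, \<open>F\<close> maps the ball of radius t into itself and contracts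
   distances there by the factor t.\<close>
 define F where "F = (%x. scl A (1/2) (add A v (mul A x x)))"
 define s where "s = (%n. (F ^^ n) (zer A))"
 define t where "t = nrm A v"
 have t: "0 <= t" "t < 1" using v by (auto simp: t_def)
 have F: "F x \<in>: A" if "x \<in>: A" for x using that v by (simp add: F_def)
 have s: "s n \<in>: A" for n by (induction n) (simp_all add: s_def F)
 have sSuc: "s (Suc n) = F (s n)" for n by (simp add: s_def)
 have bound: "nrm A (s n) <= t" for n
 proof (induction n)
  case 0
  then show ?case using t by (simp add: s_def)
 next
  case (Suc n)
  have "nrm A (add A v (mul A (s n) (s n))) <= t + nrm A (s n) * nrm A (s n)"
   using nrm_add[of v "mul A (s n) (s n)"] nrm_mul[of "s n" "s n"] s v by (simp add: t_def)
  also have "nrm A (s n) * nrm A (s n) <= t * 1" using Suc t s by (intro mult_mono) auto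
  finally show ?case using s v by (simp add: sSuc F_def nrm_scl)
 qed
 have step: "nrm A (sub A (F x) (F y)) <= t * nrm A (sub A x y)"
  if "x \<in>: A" "y \<in>: A" "nrm A x <= t" "nrm A y <= t" for x y
 proof -
  have eq: "sub A (F x) (F y) = scl A (1/2) (sub A (mul A x x) (mul A y y))"
   using that v by (simp add: F_def sub_add_add flip: scl_sub)
  have "nrm A (sub A (mul A x x) (mul A y y)) <= nrm A x * nrm A (sub A x y) + nrm A (sub A x y) * nrm A y"
   by (rule nrm_mul_sub_le) (use that in auto)
  also have "... <= t * nrm A (sub A x y) + nrm A (sub A x y) * t"
   by (intro add_mono mult_right_mono mult_left_mono) (use that in auto)
  finally show ?thesis using that by (simp add: eq nrm_scl)
 qed
 have "cauchy A s"
 proof (rule cauchy_if_summable)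
  show "nrm A (sub A (s (Suc n)) (s n)) <= t ^ n" for n
  proof (induction n)
   case 0
   show ?case using bound[of 1] t s by (simp add: s_def F)
  next
   case (Suc n)
   have "nrm A (sub A (s (Suc (Suc n))) (s (Suc n))) <= t * nrm A (sub A (s (Suc n)) (s n))"
    unfolding sSuc[of "Suc n"] sSuc[of n] using step[of "F (s n)" "s n"] s[of n] F[of "s n"] bound sSuc by metis
   also have "... <= t * t ^ n" using Suc t by (intro mult_left_mono) auto
   finally show ?case by simp
  qed
 qed (use s t in "auto intro: summable_geometric")
 then obtain k where k: "k \<in>: A" "conv_to A s k" by (rule cauchy_limit)
 have "conv_to A (%n. s (Suc n)) k" using k(2) LIMSEQ_Suc unfolding conv_to_def by blast
 moreover have "conv_to A (%n. s (Suc n)) (F k)"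
  unfolding sSuc F_def by (intro conv_to_scl conv_to_add conv_to_mul conv_to_const) (use s k v in auto)
 ultimately have Fk: "F k = k" using s F k conv_to_unique by blast
 show ?thesis
 proof (rule that[OF k(1)])
  have "add A k k = scl A 2 k" using scl_add_left[of k 1 1] k by simp
  also have "... = scl A 2 (F k)" by (simp add: Fk)
  also have "... = add A v (mul A k k)" using k v by (simp add: F_def scl_scl)
  finally show "add A k k = add A v (mul A k k)" .
  \<comment> \<open>Any closed property that holds at 0 and survives one iteration passes to the
    limit. The property is left open because self-adjointness, commutation and absorption are all
    needed later.\<close>
  fix Q assume Q: "Q (zer A)" "!!x. x \<in>: A ==> Q x ==> Q (scl A (1/2) (add A v (mul A x x)))"
   "!!s x. (!!n. s n \<in>: A) ==> (!!n. Q (s n)) ==> x \<in>: A ==> conv_to A s x ==> Q x"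
  have "Q (s n)" for n
  proof (induction n)
   case 0
   show ?case using Q(1) by (simp add: s_def)
  next
   case (Suc n)
   then show ?case using Q(2)[OF s[of n]] by (simp add: sSuc F_def)
  qed
  then show "Q k" using Q(3)[of s k] s k by blast
 qed
qed

text \<open>Each property of k is inherited from v by one iteration step and is preserved under
  limits, so the induction principle of \<open>sqrt_one_minus\<close> applies to it.\<close>

lemma sqrt_one_minus_sa:
 assumes v: "v \<in>: A" "nrm A v < 1" "adj A v = v"
 obtains k where "k \<in>: A" "add A k k = add A v (mul A k k)" "adj A k = k"
  "!!b. b \<in>: A ==> mul A v b = mul A b v ==> mul A k b = mul A b k"
  "!!p. p \<in>: A ==> mul A p v = v ==> mul A p k = k"
proof (rule sqrt_one_minus[OF v(1,2)])
 fix k assume k: "k \<in>: A" "add A k k = add A v (mul A k k)"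
  and Q: "!!Q. Q (zer A) ==> (!!x. x \<in>: A ==> Q x ==> Q (scl A (1/2) (add A v (mul A x x)))) ==>
   (!!s x. (!!n. s n \<in>: A) ==> (!!n. Q (s n)) ==> x \<in>: A ==> conv_to A s x ==> Q x) ==> Q k"
 show ?thesis
 proof (rule that[OF k])
  show "adj A k = k"
  proof (rule Q[of "%x. adj A x = x"])
   fix s x assume s: "!!n. s n \<in>: A" "!!n. adj A (s n) = s n" "x \<in>: A" "conv_to A s x"
   then have "conv_to A s (adj A x)" using conv_to_adj[of s x] by simp
   then show "adj A x = x" using s conv_to_unique[of s "adj A x" x] by simp
  qed (use v in "simp_all add: adj_scl adj_add adj_mul")
  fix b assume b: "b \<in>: A"
  show "mul A k b = mul A b k" if vb: "mul A v b = mul A b v"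
  proof (rule Q[of "%x. mul A x b = mul A b x"])
   fix x assume x: "x \<in>: A" "mul A x b = mul A b x"
   have "mul A (mul A x x) b = mul A b (mul A x x)"
    using x b mul_assoc[of x x b] mul_assoc[of x b x] mul_assoc[of b x x] by simp
   then show "mul A (scl A (1/2) (add A v (mul A x x))) b = mul A b (scl A (1/2) (add A v (mul A x x)))"
    using x b v vb by (simp add: mul_scl_left mul_scl_right mul_add_left mul_add_right)
  next
   fix s x assume s: "!!n. s n \<in>: A" "!!n. mul A (s n) b = mul A b (s n)" "x \<in>: A" "conv_to A s x"
   have "conv_to A (%n. mul A (s n) b) (mul A x b)" by (intro conv_to_mul conv_to_const) (use s b in auto)
   moreover have "conv_to A (%n. mul A b (s n)) (mul A b x)" by (intro conv_to_mul conv_to_const) (use s b in auto)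
   ultimately show "mul A x b = mul A b x"
    using conv_to_unique[of "%n. mul A b (s n)" "mul A x b" "mul A b x"] s b by simp
  qed (use b in simp)
  show "mul A b k = k" if bv: "mul A b v = v"
  proof (rule Q[of "%x. mul A b x = x"])
   fix x assume x: "x \<in>: A" "mul A b x = x"
   have "mul A b (mul A x x) = mul A x x" using x b mul_assoc[of b x x] by simp
   then show "mul A b (scl A (1/2) (add A v (mul A x x))) = scl A (1/2) (add A v (mul A x x))"
    using x b v bv by (simp add: mul_scl_right mul_add_right)
  next
   fix s x assume s: "!!n. s n \<in>: A" "!!n. mul A b (s n) = s n" "x \<in>: A" "conv_to A s x"
   have "conv_to A (%n. mul A b (s n)) (mul A b x)" by (intro conv_to_mul conv_to_const) (use s b in auto)
   then show "mul A b x = x" using conv_to_unique[of s "mul A b x" x] s b by simp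
  qed (use b in simp)
 qed
qed

text \<open>
 With \<open>1 - k\<close> the square root of \<open>1 - h\<^sup>2\<close>, the elements \<open>h \<plusminus> \<i> (1 - k)\<close> of the unitization are
 unitary, so multiplication by them preserves every C*-seminorm.
\<close>

lemma seminorm_unitary_parts:
 assumes h: "h \<in>: A" "adj A h = h" "nrm A h < 1"
 obtains k where "k \<in>: A"
  "!!x. x \<in>: A ==> sub A (sub A x (mul A k x)) (mul A k (sub A x (mul A k x))) = sub A x (mul A (mul A h h) x)"
  "!!p x. cstar_seminorm A p ==> x \<in>: A ==> p (mul A h x) <= p x & p (sub A x (mul A k x)) <= p x"
proof -
 let ?v = "mul A h h"
 have v: "?v \<in>: A" "adj A ?v = ?v" "nrm A ?v < 1"
  using h by (auto simp: adj_mul nrm_cstar_sa power_strict_mono[of "nrm A h" 1 2, simplified] abs_square_less_1)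
 obtain k where k: "k \<in>: A" "add A k k = add A ?v (mul A k k)" "adj A k = k"
  and comm: "!!b. b \<in>: A ==> mul A ?v b = mul A b ?v ==> mul A k b = mul A b k"
  using sqrt_one_minus_sa[OF v(1,3,2)] by metis
 have kh: "mul A k h = mul A h k" by (rule comm) (use h in "simp_all add: mul_assoc")
 \<comment> \<open>In the absence of a unit, (1 - k)^2 = 1 - v is expressed by letting both sides
   act on x from the left.\<close>
 have sq: "sub A (sub A x (mul A k x)) (mul A k (sub A x (mul A k x))) = sub A x (mul A ?v x)"
  if [simp]: "x \<in>: A" for x
 proof -
  let ?a = "mul A k x" and ?b = "mul A (mul A k k) x" and ?c = "mul A ?v x"
  have [simp]: "?a \<in>: A" "?b \<in>: A" "?c \<in>: A" using h k by auto
  have "add A ?a ?a = add A ?c ?b" using k(2) h k by (metis mul_add_left that v(1) mul_closed)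
  moreover have "sub A (sub A x ?a) (mul A k (sub A x ?a)) = sub A (add A x ?b) (add A ?a ?a)"
   using k by (simp add: mul_sub_right mul_assoc) (simp add: sub_def scl_add_right scl_scl add_ac mul_assoc[symmetric] k)
  ultimately have "sub A (sub A x ?a) (mul A k (sub A x ?a)) = sub A (add A x ?b) (add A ?c ?b)" by simp
  also have "... = sub A x ?c" by (simp add: sub_add_add)
  finally show ?thesis .
 qed
 have main: "p (mul A h x) <= p x & p (sub A x (mul A k x)) <= p x"
  if p: "cstar_seminorm A p" and x [simp]: "x \<in>: A" for p x
 proof -
  interpret P: pre_cstar "A\<lparr>nrm := p\<rparr>" by (rule pre_cstar_renorm) (use p pre.pre_cstar_axioms in auto)
  let ?z = "mul A h x" and ?y = "sub A x (mul A k x)"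
  have [simp]: "?z \<in>: A" "?y \<in>: A" using h k by auto
  have zz: "mul A (adj A ?z) ?z = mul A (adj A x) (mul A ?v x)" using h by (simp add: adj_mul mul_assoc)
  have yy: "mul A (adj A ?y) ?y = mul A (adj A x) (sub A x (mul A ?v x))"
  proof -
   have "adj A ?y = sub A (adj A x) (mul A (adj A x) k)" using k by (simp add: adj_sub adj_mul)
   then have "mul A (adj A ?y) ?y = sub A (mul A (adj A x) ?y) (mul A (mul A (adj A x) k) ?y)"
    using mul_sub_left[of "adj A x" "mul A (adj A x) k" ?y] k by simp
   also have "mul A (mul A (adj A x) k) ?y = mul A (adj A x) (mul A k ?y)" by (rule mul_assoc) (use k in auto)
   also have "sub A (mul A (adj A x) ?y) ... = mul A (adj A x) (sub A ?y (mul A k ?y))"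
    by (rule mul_sub_right[symmetric]) (use k in auto)
   finally show ?thesis by (simp only: sq[OF x])
  qed
  have sum: "add A (mul A (adj A ?z) ?z) (mul A (adj A ?y) ?y) = mul A (adj A x) x"
   unfolding zz yy using h by (simp flip: mul_add_right)
  have zy: "mul A (adj A ?z) ?y = mul A (adj A ?y) ?z"
   using h k kh by (simp add: adj_mul adj_sub mul_sub_left mul_sub_right mul_assoc)
    (metis kh mul_assoc x)
  have u: "p (add A ?z (scl A c ?y)) = p x" if "cnj c = - c" "c * c = -1" for c
  proof -
   have "(p (add A ?z (scl A c ?y)))\<^sup>2 = p (mul A (adj A (add A ?z (scl A c ?y))) (add A ?z (scl A c ?y)))"
    using P.nrm_cstar[of "add A ?z (scl A c ?y)"] by simp
   also have "... = p (mul A (adj A x) x)" using adj_mul_imaginary[of ?z ?y c] zy that sum by simp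
   also have "... = (p x)\<^sup>2" using P.nrm_cstar[of x] by simp
   finally show ?thesis using P.nrm_nonneg[of x] P.nrm_nonneg[of "add A ?z (scl A c ?y)"] by simp
  qed
  show ?thesis using P.nrm_imaginary_parts[of ?z ?y 1 "p x"] u[of \<i>] u[of "-\<i>"] by simp
 qed
 show ?thesis by (rule that[OF k(1) sq main])
qed

text \<open>Suppose ||a|| < 1 and put h = a^* a. Multiplication by h does not increase p, so p(h)^2
  = p(h h) <= p(h). Hence p(h) <= 1, and p(a)^2 = p(h) <= 1. The general case follows by scaling
  with ||a|| + e, which is positive even for a = 0.\<close>

lemma seminorm_le_nrm:
 assumes p: "cstar_seminorm A p" and a: "a \<in>: A"
 shows "p a <= nrm A a"
proof -
 interpret P: pre_cstar "A\<lparr>nrm := p\<rparr>" by (rule pre_cstar_renorm) (use p pre.pre_cstar_axioms in auto)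
 have unit: "p a <= 1" if a: "a \<in>: A" "nrm A a < 1" for a
 proof -
  let ?h = "mul A (adj A a) a"
  have h: "?h \<in>: A" "adj A ?h = ?h" "nrm A ?h < 1" using a by (auto simp: adj_mul nrm_cstar abs_square_less_1)
  have "p (mul A ?h ?h) <= p ?h" using seminorm_unitary_parts[OF h] p h(1) by metis
  moreover have "p (mul A ?h ?h) = (p ?h)\<^sup>2" using P.nrm_cstar_sa[of ?h] h by simp
  ultimately have "p ?h * p ?h <= p ?h * 1" by (simp add: power2_eq_square)
  then have "p ?h <= 1" using P.nrm_nonneg[of ?h] h(1) by (cases "p ?h = 0") (auto simp: mult_le_cancel_left)
  moreover have "p ?h = (p a)\<^sup>2" using P.nrm_cstar[of a] a by simp
  ultimately show ?thesis by (simp add: abs_square_le_1)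
 qed
 show ?thesis
 proof (rule field_le_epsilon)
  fix e :: real assume e: "e > 0"
  define r where "r = nrm A a + e"
  have r: "r > 0" using e a by (simp add: r_def add_nonneg_pos)
  have "nrm A (scl A (1 / r) a) = nrm A a / r" using a r by (simp add: nrm_scl norm_divide)
  also have "... < 1" using r e by (simp add: r_def)
  finally have "nrm A (scl A (1 / r) a) < 1" .
  then have "p (scl A (1 / r) a) <= 1" using a by (intro unit) auto
  then have "p a / r <= 1" using P.nrm_scl[of a "1 / r"] a r by (simp add: norm_divide)
  then show "p a <= nrm A a + e" using r by (simp add: r_def)
 qed
qed

text \<open>Since (1 - h^2) x = (1 - k) (1 - k) x, the map is a composite of two
  contractions.\<close>

lemma nrm_sub_square_mul_le:
 assumes "h \<in>: A" "adj A h = h" "nrm A h < 1" "x \<in>: A"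
 shows "nrm A (sub A x (mul A (mul A h h) x)) <= nrm A x"
proof -
 have sem: "cstar_seminorm A (nrm A)" by (rule pre_cstar_seminorm) (rule pre.pre_cstar_axioms)
 obtain k where k: "k \<in>: A"
  "!!x. x \<in>: A ==> sub A (sub A x (mul A k x)) (mul A k (sub A x (mul A k x))) = sub A x (mul A (mul A h h) x)"
  "!!x. x \<in>: A ==> nrm A (sub A x (mul A k x)) <= nrm A x" using seminorm_unitary_parts[OF assms(1-3)] sem by metis
 have "nrm A (sub A (sub A x (mul A k x)) (mul A k (sub A x (mul A k x)))) <= nrm A (sub A x (mul A k x))"
  by (rule k(3)) (use k(1) assms in simp)
 also have "... <= nrm A x" by (rule k(3)) fact
 finally show ?thesis by (simp only: k(2)[OF assms(4)])
qed

end

lemma star_hom_contractive: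
 assumes "star_hom A B f" "cstar_algebra A" "pre_cstar B" "x \<in>: A"
 shows "nrm B (f x) <= nrm A x"
 using cstar_algebra.seminorm_le_nrm[OF assms(2) star_hom_seminorm[OF assms(1) cstar_algebra_pre[OF assms(2)] assms(3)] assms(4)] .

lemma star_hom_conv_to:
 assumes f: "star_hom A B f" and A: "cstar_algebra A" and B: "pre_cstar B"
  and s: "conv_to A s x" "!!n. s n \<in>: A" "x \<in>: A"
 shows "conv_to B (%n. f (s n)) (f x)"
proof -
 interpret A: cstar_algebra A by fact
 interpret B: pre_cstar B by fact
 show ?thesis
 proof (rule B.conv_to_sandwich)
  show "nrm B (sub B (f (s n)) (f x)) <= nrm A (sub A (s n) x)" for n
   using star_hom_contractive[OF f A B, of "sub A (s n) x"] s by (simp add: star_hom_sub[OF f A.pre.pre_cstar_axioms])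
 qed (use s in "auto simp: star_homD[OF f] conv_to_def")
qed

section \<open>Orthogonality of finitely many projections with sum 1\<close>

section \<open>Projections summing to the unit\<close>

context cstar_algebra
begin

text \<open>The unit of a corner is an extreme point of its unit ball, here for self-adjoint
  perturbations. Averaging (p + b)^2 and (p - b)^2 gives ||p + b^2|| <= 1. For 0 < r < 1 the element
  p - r (p + b^2) has a square root q in the corner, and q +- i sqrt(r) b have norm at most sqrt(1 -
  r). Therefore r ||b||^2 <= 1 - r for all such r, which forces b = 0.\<close>

lemma corner_unit_extreme:
 assumes p: "p \<in>: A" "adj A p = p" "mul A p p = p"
  and b: "b \<in>: A" "adj A b = b" "mul A p b = b" "mul A b p = b"
  and le: "nrm A (add A p b) <= 1" "nrm A (sub A p b) <= 1"
 shows "b = zer A"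
proof -
 let ?c = "add A p (mul A b b)"
 have [simp]: "p \<in>: A" "b \<in>: A" by fact+
 have sq: "nrm A (mul A x x) <= 1" if "x \<in>: A" "nrm A x <= 1" for x
  using nrm_mul[of x x] that mult_le_one[of "nrm A x" "nrm A x"] by simp
 have "add A (mul A (add A p b) (add A p b)) (mul A (sub A p b) (sub A p b)) =
   add A (add A p p) (add A (add A (mul A b b) (mul A b b))
    (add A (add A b b) (scl A (-1) (add A b b))))"
  using p b by (simp add: sub_def mul_add_left mul_add_right mul_scl_left mul_scl_right scl_scl
    scl_add_right add_ac del: add_neg)
 also have "... = add A ?c ?c" using p b by (simp add: add_ac)
 finally have "add A (mul A (add A p b) (add A p b)) (mul A (sub A p b) (sub A p b)) = scl A 2 ?c"
  using scl_add_left[of ?c 1 1] by simp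
 then have "2 * nrm A ?c <= 1 + 1" using nrm_add[of "mul A (add A p b) (add A p b)" "mul A (sub A p b) (sub A p b)"]
   sq[of "add A p b"] sq[of "sub A p b"] le nrm_scl[of ?c 2] by simp
 then have c: "nrm A ?c <= 1" by simp
 have main: "r * (nrm A b)\<^sup>2 <= 1 - r" if r: "0 < r" "r < 1" for r :: real
 proof -
  \<comment> \<open>The factor r brings the norm strictly below 1, as the square root
    requires.\<close>
  let ?v = "scl A r ?c"
  have v: "?v \<in>: A" "adj A ?v = ?v" "mul A p ?v = ?v" "mul A ?v b = mul A b ?v"
   using p b by (simp_all add: adj_scl adj_add adj_mul mul_scl_right mul_scl_left mul_add_right
     mul_add_left mul_assoc[symmetric])
  have "nrm A ?v < 1" using c r by (simp add: nrm_scl mult_le_one order_le_less_trans[of _ r])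
  then obtain k where k: "k \<in>: A" "add A k k = add A ?v (mul A k k)" "adj A k = k"
   "mul A k b = mul A b k" "mul A p k = k" using sqrt_one_minus_sa[OF v(1) _ v(2)] v(3,4) p(1) b(1) by metis
  have kp: "mul A k p = k" using adj_mul[of p k] k p by simp
  \<comment> \<open>In the corner of p this is the square root of p - v. The two contributions of
    b^2 cancel, leaving q^2 + r b^2 = (1 - r) p.\<close>
  let ?q = "sub A p k" and ?s = "complex_of_real (sqrt r)"
  have q: "?q \<in>: A" "adj A ?q = ?q" using p k by (simp_all add: adj_sub)
  have "mul A ?q ?q = sub A (add A p (mul A k k)) (add A k k)"
   using p k(1,3-5) kp by (simp add: mul_sub_left mul_sub_right) (simp add: sub_def scl_add_right scl_scl add_ac)
  also have "... = sub A (add A p (mul A k k)) (add A ?v (mul A k k))" using k by simp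
  also have "... = sub A p ?v" using p k v by (simp add: sub_add_add)
  finally have qq: "mul A ?q ?q = sub A p ?v" .
  have pv: "add A (sub A p ?v) (scl A r (mul A b b)) = scl A (1 - r) p"
  proof -
   have "add A (sub A p ?v) (scl A r (mul A b b)) =
     add A (add A (scl A 1 p) (scl A (- r) p)) (add A (scl A (- r) (mul A b b)) (scl A r (mul A b b)))"
    by (simp add: sub_def scl_add_right scl_scl add_ac)
   also have "... = scl A (1 - r) p" using add_scl_cancel[of "mul A b b" "- r" r] scl_add_left[of p 1 "- r"] by simp
   finally show ?thesis .
  qed
  have w: "nrm A (add A ?q (scl A c (scl A ?s b))) <= sqrt (1 - r)" if c: "cnj c = - c" "c * c = -1" for c
  proof -
   let ?w = "add A ?q (scl A c (scl A ?s b))"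
   have "mul A (adj A ?w) ?w = add A (mul A (adj A ?q) ?q)
     (scl A (- (c * c)) (mul A (adj A (scl A ?s b)) (scl A ?s b)))" by (rule adj_mul_imaginary)
     (use q b k c in "simp_all add: adj_scl adj_sub p mul_scl_left mul_scl_right mul_sub_left mul_sub_right scl_sub")
   also have "... = scl A (1 - r) p"
    using q b r pv qq c by (simp add: adj_scl mul_scl_left mul_scl_right scl_scl flip: of_real_mult)
   finally have "(nrm A ?w)\<^sup>2 = nrm A (scl A (1 - r) p)" using nrm_cstar[of ?w] q(1) by simp
   also have "... = (1 - r) * nrm A p" using norm_of_real[of "1 - r", where 'a = complex] r by (simp add: nrm_scl)
   also have "... <= 1 - r" using r nrm_projection[OF p] by (simp add: mult_left_le)
   finally show ?thesis using q(1) by (simp add: real_le_rsqrt)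
  qed
  have "cmod ?s * nrm A b <= sqrt (1 - r)"
   by (rule nrm_imaginary_parts[OF q(1) b(1)]) (use w[of \<i>] w[of "-\<i>"] in auto)
  then have "(sqrt r * nrm A b)\<^sup>2 <= (sqrt (1 - r))\<^sup>2" using r by (intro power_mono) auto
  then show ?thesis using r by (simp add: power_mult_distrib)
 qed
 have "(nrm A b)\<^sup>2 = 0"
 proof (rule ccontr)
  assume "(nrm A b)\<^sup>2 ~= 0"
  then have pos: "0 < (nrm A b)\<^sup>2" by (simp add: order_less_le)
  define beta where "beta = (nrm A b)\<^sup>2"
  \<comment> \<open>The inequality \<open>main\<close> says r (1 + beta) <= 1. This r is still below
    1 but makes the left side 1 + beta/2.\<close>
  define r where "r = (1 + beta/2) / (1 + beta)"
  have "beta > 0" using pos by (simp add: beta_def)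
  then have r: "0 < r" "r < 1" by (auto simp: r_def field_simps)
  have "r * beta <= 1 - r" using main[OF r] by (simp add: beta_def)
  moreover have "r * (1 + beta) = 1 + beta/2" using \<open>beta > 0\<close> by (simp add: r_def)
  ultimately show False using \<open>beta > 0\<close> by (simp add: algebra_simps)
 qed
 then show ?thesis using b nrm_eq_0 by simp
qed

text \<open>Compress everything by P = p_i: the elements a_j = P p_j P sum to P, and a_i = P, so the
  others sum to 0. Each P - a_l has norm at most 1; adding these over the N indices l other than i
  and j gives ||N P + a_j|| <= N. Hence a small multiple b of a_j satisfies ||P + b|| <= 1 and ||P -
  b|| <= 1, so b = 0 by extremality. Finally a_j is the square (p_j P)^* (p_j P), and the
  C*-identity finishes the proof.\<close>

lemma projections_orthogonal:
 assumes e: "is_unit_of A e" and J: "finite J" "asum A p J = e"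
  and p: "!!j. j \<in> J ==> p j \<in>: A" "!!j. j \<in> J ==> adj A (p j) = p j"
   "!!j. j \<in> J ==> mul A (p j) (p j) = p j"
  and ij: "i \<in> J" "j \<in> J" "i ~= j"
 shows "mul A (p j) (p i) = zer A"
proof -
 have e1: "e \<in>: A" "adj A e = e" "!!x. x \<in>: A ==> mul A e x = x" "!!x. x \<in>: A ==> mul A x e = x"
  using e is_unit_adj unfolding is_unit_of_def by auto
 let ?P = "p i"
 have P [simp]: "?P \<in>: A" "adj A ?P = ?P" "mul A ?P ?P = ?P" using p ij by auto
 define a where "a = (%j. mul A ?P (mul A (p j) ?P))"
 have a: "a j \<in>: A" if "j \<in> J" for j using that p by (simp add: a_def)
 have aa: "adj A (a j) = a j" "mul A ?P (a j) = a j" "mul A (a j) ?P = a j" if "j \<in> J" for j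
  using that p by (simp_all add: a_def adj_mul mul_assoc) (simp add: mul_assoc[symmetric])
 have PP: "mul A (p l) (mul A (p l) x) = mul A (p l) x" if "l \<in> J" "x \<in>: A" for l x
  using that p by (simp add: mul_assoc[symmetric])
 have pa: "nrm A (sub A ?P (a l)) <= 1" if l: "l \<in> J" for l
 proof -
  let ?f = "sub A e (p l)"
  have f: "?f \<in>: A" "nrm A ?f <= 1" by (simp_all add: e1 l p nrm_projection adj_sub mul_sub_left mul_sub_right)
  have "sub A ?P (a l) = mul A ?P (mul A ?f ?P)" using l p e1 by (simp add: a_def mul_sub_left mul_sub_right)
  moreover have "nrm A (mul A ?P (mul A ?f ?P)) <= nrm A ?P * (nrm A ?f * nrm A ?P)"
   using nrm_mul[of ?P "mul A ?f ?P"] nrm_mul[of ?f ?P] f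
    mult_left_mono[of "nrm A (mul A ?f ?P)" "nrm A ?f * nrm A ?P" "nrm A ?P"] by simp
  moreover have "nrm A ?P * (nrm A ?f * nrm A ?P) <= 1" using f nrm_projection[OF P] by (intro mult_le_one) auto
  ultimately show ?thesis by simp
 qed
 have total: "asum A a J = ?P"
 proof -
  have "asum A a J = mul A ?P (mul A (asum A p J) ?P)"
   unfolding a_def using p by (simp add: asum_mul_left asum_mul_right)
  then show ?thesis using e1 J by simp
 qed
 define K where "K = J - {i, j}"
 have K: "finite K" "K <= J" "j \<notin> K" "i \<notin> insert j K" "insert i (insert j K) = J"
  using ij J by (auto simp: K_def)
 have "asum A a J = add A (a i) (add A (a j) (asum A a K))"
  using asum_insert[of "insert j K" i a] asum_insert[of K j a] K ij a by (auto simp: subset_iff)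
 moreover have "a i = ?P" by (simp add: a_def)
 ultimately have "add A (a j) (asum A a K) = zer A" using total a ij K by (intro add_right_imp_zer[of ?P]) auto
 then have aK: "asum A a K = scl A (-1) (a j)" using add_left_cancel[of "a j" "asum A a K" "scl A (-1) (a j)"] a K ij
  by (auto simp: subset_iff)
 define N where "N = card K"
 have "asum A (%l. sub A ?P (a l)) K = sub A (scl A (of_nat N) ?P) (asum A a K)" unfolding sub_def using a K
  by (subst asum_add) (auto simp: asum_scl asum_const N_def)
 also have "... = add A (scl A (of_nat N) ?P) (a j)" unfolding aK using a ij by (simp add: sub_def scl_scl)
 finally have "nrm A (add A (scl A (of_nat N) ?P) (a j)) <= (\<Sum>l\<in>K. nrm A (sub A ?P (a l)))"
  using nrm_asum_le[of K "%l. sub A ?P (a l)"] a K by auto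
 also have "... <= of_nat N * 1" unfolding N_def using pa K by (intro sum_bounded_above) auto
 finally have le1: "nrm A (add A (scl A (of_nat N) ?P) (a j)) <= N" by simp
 \<comment> \<open>With this scaling P + b = t (P + (N P + a_j)) and P - b = t ((P - a_j) + N P),
   and both brackets have norm at most N + 1.\<close>
 define t :: real where "t = 1 / (N + 1)"
 define b where "b = scl A t (a j)"
 have b: "b \<in>: A" "adj A b = b" "mul A ?P b = b" "mul A b ?P = b"
  using a[OF ij(2)] aa[OF ij(2)] by (simp_all add: b_def adj_scl mul_scl_left mul_scl_right)
 have tN: "complex_of_real t * (of_nat N + 1) = 1" and t0: "t > 0" "t * (N + 1) = 1"
 proof -
  show t0: "t > 0" "t * (N + 1) = 1" by (simp_all add: t_def add_nonneg_pos)
  have "complex_of_real (t * (N + 1)) = 1" by (simp only: t0 of_real_1)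
  then show "complex_of_real t * (of_nat N + 1) = 1" by (simp add: add.commute)
 qed
 have "add A ?P b = scl A t (add A ?P (add A (scl A (of_nat N) ?P) (a j)))"
  using a[OF ij(2)] tN scl_add_left[of ?P 1 "of_nat N"] scl_scl[of ?P t "1 + of_nat N"]
  by (simp add: b_def scl_add_right add_assoc[symmetric] add.commute flip: scl_add_left)
 then have "nrm A (add A ?P b) <= t * (1 + N)"
  using nrm_add[of ?P "add A (scl A (of_nat N) ?P) (a j)"] le1 nrm_projection[OF P] a[OF ij(2)] t0(1)
  by (auto simp: nrm_scl intro!: mult_left_mono)
 then have b1: "nrm A (add A ?P b) <= 1" using t0 by (simp add: add.commute)
 have "sub A ?P b = scl A t (add A (sub A ?P (a j)) (scl A (of_nat N) ?P))"
 proof -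
  have "scl A t (add A (sub A ?P (a j)) (scl A (of_nat N) ?P)) =
    sub A (scl A t (add A ?P (scl A (of_nat N) ?P))) b"
   using a[OF ij(2)] by (simp add: b_def sub_def scl_add_right scl_scl add_ac)
  moreover have "scl A t (add A ?P (scl A (of_nat N) ?P)) = ?P"
   using tN scl_add_left[of ?P 1 "of_nat N"] scl_scl[of ?P t "1 + of_nat N"] by (simp add: add.commute)
  ultimately show ?thesis by simp
 qed
 then have "nrm A (sub A ?P b) <= t * (1 + N)"
  using nrm_add[of "sub A ?P (a j)" "scl A (of_nat N) ?P"] pa[OF ij(2)] nrm_projection[OF P] a[OF ij(2)] t0(1)
   mult_left_mono[OF nrm_projection[OF P], of N] by (auto simp: nrm_scl intro!: mult_left_mono)
 then have b2: "nrm A (sub A ?P b) <= 1" using t0 by (simp add: add.commute)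
 have "b = zer A" by (rule corner_unit_extreme[OF P b b1 b2])
 then have "scl A (1 / t) b = zer A" by simp
 then have "a j = zer A" using a[OF ij(2)] t0 by (simp add: b_def scl_scl)
 then have "mul A (adj A (mul A (p j) ?P)) (mul A (p j) ?P) = zer A"
  using ij p by (simp add: a_def adj_mul mul_assoc PP)
 then have "nrm A (mul A (p j) ?P) = 0" using nrm_cstar[of "mul A (p j) ?P"] ij p by simp
 then show ?thesis using nrm_eq_0 ij p by simp
qed

end

section \<open>Completion of a seminormed *-algebra and extension of contractive
  homomorphisms\<close>

section \<open>Completion\<close>

text \<open>For contractive \<open>f\<close> into a C*-algebra all representatives of a class have
  images with the same limit, and \<open>THE\<close> names that limit.\<close>

definition completion_lift :: "'b star_algebra => ('a => 'b) => (nat => 'a) set => 'b" where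
 "completion_lift B f U = (THE y. y \<in>: B & (\<forall>s\<in>U. conv_to B (%n. f (s n)) y))"

context pre_cstar
begin

definition nulld :: "(nat => 'a) => (nat => 'a) => bool" where
 "nulld s t \<longleftrightarrow> (%n. nrm A (sub A (s n) (t n))) \<longlonglongrightarrow> 0"

lemma nulldI:
 assumes "!!n. s n \<in>: A" "!!n. t n \<in>: A"
  "!!n. nrm A (sub A (s n) (t n)) <= b n" "b \<longlonglongrightarrow> 0"
 shows "nulld s t" unfolding nulld_def by (rule tendsto_sandwich[of "%_. 0" _ _ b]) (use assms in auto)

lemma nulld_refl: "(!!n. s n \<in>: A) ==> nulld s s" by (simp add: nulld_def)

lemma nulld_sym: "(!!n. s n \<in>: A) ==> (!!n. t n \<in>: A) ==> nulld s t ==> nulld t s"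
 unfolding nulld_def by (subst nrm_sub_commute) auto

lemma nulld_trans:
 assumes "!!n. s n \<in>: A" "!!n. t n \<in>: A" "!!n. r n \<in>: A" "nulld s t" "nulld t r"
 shows "nulld s r"
proof (rule nulldI[where b = "%n. nrm A (sub A (s n) (t n)) + nrm A (sub A (t n) (r n))"])
 show "(%n. nrm A (sub A (s n) (t n)) + nrm A (sub A (t n) (r n))) \<longlonglongrightarrow> 0"
  using tendsto_add[of _ 0 _ _ 0] assms(4,5) by (simp add: nulld_def)
qed (use assms nrm_sub_triangle in auto)

lemma cls_eq_Collect: "cls A s = {t. cauchy A t & nulld s t}" by (simp add: cls_def nulld_def)

lemma cls_eqI:
 assumes "cauchy A s" "cauchy A t" "nulld s t"
 shows "cls A s = cls A t" unfolding cls_eq_Collect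
 using assms nulld_trans[of s t] nulld_trans[of t s] nulld_sym[of s t] cauchyD by blast

lemma nulld_self: "cauchy A s ==> nulld s s" by (rule nulld_refl) (rule cauchyD)

lemma cls_cauchy: "t \<in> cls A s ==> cauchy A t" by (simp add: cls_eq_Collect)

lemma cls_self: "cauchy A s ==> s \<in> cls A s" by (simp add: cls_eq_Collect nulld_refl cauchyD)

lemma cauchyI:
 assumes "!!n. s n \<in>: A" "!!e. e > 0 ==> \<exists>N. \<forall>m\<ge>N. \<forall>n\<ge>N. nrm A (sub A (s m) (s n)) < e"
 shows "cauchy A s" using assms by (simp add: cauchy_def)

lemma cauchyD2: "cauchy A s ==> e > 0 ==> \<exists>N. \<forall>m\<ge>N. \<forall>n\<ge>N. nrm A (sub A (s m) (s n)) < e"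
 by (simp add: cauchy_def)

lemma cauchy_const [simp]: "x \<in>: A ==> cauchy A (%_. x)" by (simp add: cauchy_def)

lemma cauchy_dominated:
 assumes s: "cauchy A s" and t: "cauchy A t" and "K > 0"
  and "!!n. r n \<in>: A"
  "!!m n. nrm A (sub A (r m) (r n)) <= K * nrm A (sub A (s m) (s n)) + K * nrm A (sub A (t m) (t n))"
 shows "cauchy A r"
proof (rule cauchyI)
 fix e :: real assume "e > 0"
 then have e: "e / (2 * K) > 0" using \<open>K > 0\<close> by simp
 obtain M N where MN: "!!m n. m \<ge> M ==> n \<ge> M ==> nrm A (sub A (s m) (s n)) < e / (2 * K)"
  "!!m n. m \<ge> N ==> n \<ge> N ==> nrm A (sub A (t m) (t n)) < e / (2 * K)"
  using cauchyD2[OF s e] cauchyD2[OF t e] by metis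
 have "nrm A (sub A (r m) (r n)) < e" if "m \<ge> max M N" "n \<ge> max M N" for m n
 proof -
  have *: "m \<ge> M" "n \<ge> M" "m \<ge> N" "n \<ge> N" using that by simp_all
  note mult_strict_left_mono[OF MN(1)[OF *(1,2)] \<open>K > 0\<close>]
   mult_strict_left_mono[OF MN(2)[OF *(3,4)] \<open>K > 0\<close>]
  moreover have "K * (e / (2 * K)) = e / 2" using \<open>K > 0\<close> by simp
  ultimately show ?thesis using assms(5)[of m n] by linarith
 qed
 then show "\<exists>N. \<forall>m\<ge>N. \<forall>n\<ge>N. nrm A (sub A (r m) (r n)) < e" by blast
qed (use assms in auto)

lemma cauchy_add: "cauchy A s ==> cauchy A t ==> cauchy A (%n. add A (s n) (t n))"
 by (rule cauchy_dominated[of s t 1]) (auto simp: cauchyD sub_add_add intro: nrm_add)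

lemma cauchy_scl: "cauchy A s ==> cauchy A (%n. scl A c (s n))" by (rule cauchy_dominated[of s s "cmod c + 1"])
  (auto simp: cauchyD nrm_scl algebra_simps add_pos_nonneg simp flip: scl_sub)

lemma cauchy_adj: "cauchy A s ==> cauchy A (%n. adj A (s n))"
 by (rule cauchy_dominated[of s s 1]) (auto simp: cauchyD simp flip: adj_sub)

lemma cauchy_mul:
 assumes "cauchy A s" "cauchy A t" shows "cauchy A (%n. mul A (s n) (t n))"
proof -
 obtain K L where K: "K > 0" "!!n. nrm A (s n) <= K" and L: "L > 0" "!!n. nrm A (t n) <= L"
  using cauchy_nrm_bound assms by metis
 show ?thesis
 proof (rule cauchy_dominated[OF assms, of "max K L"])
  fix m n
  have "nrm A (sub A (mul A (s m) (t m)) (mul A (s n) (t n)))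
    <= nrm A (s m) * nrm A (sub A (t m) (t n)) + nrm A (sub A (s m) (s n)) * nrm A (t n)"
   by (rule nrm_mul_sub_le) (use assms cauchyD in auto)
  also have "... <= max K L * nrm A (sub A (t m) (t n)) + nrm A (sub A (s m) (s n)) * max K L"
   using K(2)[of m] L(2)[of n] assms cauchyD by (intro add_mono mult_right_mono mult_left_mono) auto
  finally show "nrm A (sub A (mul A (s m) (t m)) (mul A (s n) (t n)))
    <= max K L * nrm A (sub A (s m) (s n)) + max K L * nrm A (sub A (t m) (t n))" by (simp add: algebra_simps)
 qed (use assms K cauchyD in auto)
qed

lemma nulld_add:
 assumes c: "cauchy A s" "cauchy A s'" "cauchy A t" "cauchy A t'" and "nulld s s'" "nulld t t'"
 shows "nulld (%n. add A (s n) (t n)) (%n. add A (s' n) (t' n))"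
proof (rule nulldI[where b = "%n. nrm A (sub A (s n) (s' n)) + nrm A (sub A (t n) (t' n))"])
 show "(%n. nrm A (sub A (s n) (s' n)) + nrm A (sub A (t n) (t' n))) \<longlonglongrightarrow> 0"
  using tendsto_add[of _ 0 _ _ 0] assms(5,6) by (simp add: nulld_def)
qed (auto simp: c[THEN cauchyD] sub_add_add intro: nrm_add)

lemma nulld_scl:
 assumes c: "cauchy A s" "cauchy A s'" and "nulld s s'"
 shows "nulld (%n. scl A c (s n)) (%n. scl A c (s' n))"
 using tendsto_mult_left[of "%n. nrm A (sub A (s n) (s' n))" 0 _ "cmod c"] assms(3) c[THEN cauchyD]
 by (simp add: nulld_def nrm_scl flip: scl_sub)

lemma nulld_adj:
 assumes c: "cauchy A s" "cauchy A s'" and "nulld s s'"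
 shows "nulld (%n. adj A (s n)) (%n. adj A (s' n))"
 using assms(3) c[THEN cauchyD] by (simp add: nulld_def flip: adj_sub)

lemma nulld_mul:
 assumes c: "cauchy A s" "cauchy A s'" "cauchy A t" "cauchy A t'" and "nulld s s'" "nulld t t'"
 shows "nulld (%n. mul A (s n) (t n)) (%n. mul A (s' n) (t' n))"
proof -
 obtain K L where K: "K > 0" "!!n. nrm A (s n) <= K" and L: "L > 0" "!!n. nrm A (t' n) <= L"
  using cauchy_nrm_bound c by metis
 note cc = c[THEN cauchyD]
 show ?thesis
 proof (rule nulldI[where b = "%n. K * nrm A (sub A (t n) (t' n)) + nrm A (sub A (s n) (s' n)) * L"])
  fix n
  have "nrm A (sub A (mul A (s n) (t n)) (mul A (s' n) (t' n)))
    <= nrm A (s n) * nrm A (sub A (t n) (t' n)) + nrm A (sub A (s n) (s' n)) * nrm A (t' n)"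
   by (rule nrm_mul_sub_le) (use cc in auto)
  also have "... <= K * nrm A (sub A (t n) (t' n)) + nrm A (sub A (s n) (s' n)) * L"
   using K L cc by (intro add_mono mult_right_mono mult_left_mono) auto
  finally show "nrm A (sub A (mul A (s n) (t n)) (mul A (s' n) (t' n))) <= ..." .
 next
  have "(%n. K * nrm A (sub A (t n) (t' n)) + nrm A (sub A (s n) (s' n)) * L) \<longlonglongrightarrow> K * 0 + 0 * L"
   by (intro tendsto_intros) (use assms(5,6) in "simp_all add: nulld_def")
  then show "(%n. K * nrm A (sub A (t n) (t' n)) + nrm A (sub A (s n) (s' n)) * L) \<longlonglongrightarrow> 0" by simp
 qed (use cc in auto)
qed

abbreviation "C \<equiv> completion A"

lemma carrier_C: "carrier C = cls A ` {s. cauchy A s}"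
 and zer_C: "zer C = cls A (%_. zer A)" by (simp_all add: completion_def)

text \<open>The operations of \<open>completion\<close> are unions over all representatives.
  Independence of the representative collapses such a union to one class.\<close>

lemma UN_cls:
 assumes "cauchy A s" "!!s'. cauchy A s' ==> nulld s s' ==> F s' = F s"
 shows "(\<Union>s'\<in>cls A s. F s') = F s"
proof -
 have "F s' = F s" if "s' \<in> cls A s" for s' using that assms(2) by (simp add: cls_eq_Collect)
 then have "(\<Union>s'\<in>cls A s. F s') = (\<Union>s'\<in>cls A s. F s)" by (intro SUP_cong refl)
 moreover have "cls A s ~= {}" using cls_self[OF assms(1)] by blast
 ultimately show ?thesis by simp
qed

lemma add_C: "cauchy A s ==> cauchy A t ==> add C (cls A s) (cls A t) = cls A (%n. add A (s n) (t n))"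
proof -
 assume c: "cauchy A s" "cauchy A t"
 have "(\<Union>t'\<in>cls A t. cls A (%n. add A (s' n) (t' n))) = cls A (%n. add A (s' n) (t n))"
  if "cauchy A s'" for s' by (rule UN_cls[OF c(2), of "%t'. cls A (%n. add A (s' n) (t' n))"])
   (rule cls_eqI[symmetric]; use that c in "simp add: cauchy_add nulld_add nulld_self")
 then have "add C (cls A s) (cls A t) = (\<Union>s'\<in>cls A s. cls A (%n. add A (s' n) (t n)))"
  unfolding completion_def star_algebra.simps by (intro SUP_cong refl) (auto dest: cls_cauchy)
 also have "... = cls A (%n. add A (s n) (t n))" by (rule UN_cls[OF c(1), of "%s'. cls A (%n. add A (s' n) (t n))"])
   (rule cls_eqI[symmetric]; use c in "simp add: cauchy_add nulld_add nulld_self")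
 finally show ?thesis .
qed

lemma mul_C: "cauchy A s ==> cauchy A t ==> mul C (cls A s) (cls A t) = cls A (%n. mul A (s n) (t n))"
proof -
 assume c: "cauchy A s" "cauchy A t"
 have "(\<Union>t'\<in>cls A t. cls A (%n. mul A (s' n) (t' n))) = cls A (%n. mul A (s' n) (t n))"
  if "cauchy A s'" for s' by (rule UN_cls[OF c(2), of "%t'. cls A (%n. mul A (s' n) (t' n))"])
   (rule cls_eqI[symmetric]; use that c in "simp add: cauchy_mul nulld_mul nulld_self")
 then have "mul C (cls A s) (cls A t) = (\<Union>s'\<in>cls A s. cls A (%n. mul A (s' n) (t n)))"
  unfolding completion_def star_algebra.simps by (intro SUP_cong refl) (auto dest: cls_cauchy)
 also have "... = cls A (%n. mul A (s n) (t n))" by (rule UN_cls[OF c(1), of "%s'. cls A (%n. mul A (s' n) (t n))"])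
   (rule cls_eqI[symmetric]; use c in "simp add: cauchy_mul nulld_mul nulld_self")
 finally show ?thesis .
qed

lemma scl_C: "cauchy A s ==> scl C c (cls A s) = cls A (%n. scl A c (s n))"
proof -
 assume c: "cauchy A s"
 have "scl C c (cls A s) = (\<Union>s'\<in>cls A s. cls A (%n. scl A c (s' n)))" by (simp add: completion_def)
 also have "... = cls A (%n. scl A c (s n))" by (rule UN_cls[OF c, of "%s'. cls A (%n. scl A c (s' n))"])
   (rule cls_eqI[symmetric]; use c in "simp add: cauchy_scl nulld_scl")
 finally show ?thesis .
qed

lemma adj_C: "cauchy A s ==> adj C (cls A s) = cls A (%n. adj A (s n))"
proof -
 assume c: "cauchy A s"
 have "adj C (cls A s) = (\<Union>s'\<in>cls A s. cls A (%n. adj A (s' n)))" by (simp add: completion_def)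
 also have "... = cls A (%n. adj A (s n))" by (rule UN_cls[OF c, of "%s'. cls A (%n. adj A (s' n))"])
   (rule cls_eqI[symmetric]; use c in "simp add: cauchy_adj nulld_adj")
 finally show ?thesis .
qed

lemma sub_C: "cauchy A s ==> cauchy A t ==> sub C (cls A s) (cls A t) = cls A (%n. sub A (s n) (t n))"
 by (simp add: sub_def scl_C add_C cauchy_scl)

lemma cauchy_sub: "cauchy A s ==> cauchy A t ==> cauchy A (%n. sub A (s n) (t n))"
 unfolding sub_def by (intro cauchy_add cauchy_scl)

lemma nrm_C: "cauchy A s ==> (%n. nrm A (s n)) \<longlonglongrightarrow> nrm C (cls A s)"
proof -
 assume c: "cauchy A s"
 obtain r where r: "(%n. nrm A (s n)) \<longlonglongrightarrow> r"
  using cauchy_nrm[OF c] real_Cauchy_convergent convergent_def by blast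
 have all: "(%n. nrm A (t n)) \<longlonglongrightarrow> r" if t: "t \<in> cls A s" for t
 proof -
  have t': "cauchy A t" "nulld s t" using t by (auto simp: cls_eq_Collect)
  have "(%n. nrm A (s n) - nrm A (t n)) \<longlonglongrightarrow> 0"
  proof (rule Lim_null_comparison)
   show "\<forall>\<^sub>F n in sequentially. norm (nrm A (s n) - nrm A (t n)) <= nrm A (sub A (s n) (t n))"
    using nrm_diff_le c t' by (simp add: cauchyD)
  qed (use t' in \<open>simp add: nulld_def\<close>)
  from tendsto_diff[OF r this] show ?thesis by simp
 qed
 have "nrm C (cls A s) = r" unfolding completion_def star_algebra.simps
 proof (rule the_equality)
  fix r' assume "\<forall>s\<in>cls A s. (%n. nrm A (s n)) \<longlonglongrightarrow> r'"
  then show "r' = r" using cls_self[OF c] r LIMSEQ_unique by blast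
 qed (use all in blast)
 then show ?thesis using r by simp
qed

lemma C_cases:
 assumes "x \<in>: C" obtains s where "cauchy A s" "x = cls A s" using assms by (auto simp: carrier_C)

lemma cls_in_C [simp]: "cauchy A s ==> cls A s \<in>: C" by (simp add: carrier_C)

lemmas C_simps = add_C mul_C scl_C adj_C zer_C cauchy_add cauchy_mul cauchy_scl cauchy_adj cauchy_const

lemma pre_cstar_C: "pre_cstar C"
proof (rule pre_cstar.intro)
 show "comm_group (additive_group C)"
 proof (rule comm_groupI)
  fix x assume "x \<in>: additive_group C"
  then obtain s where s: "cauchy A s" "x = cls A s" by (auto elim: C_cases)
  then show "\<exists>y\<in>carrier (additive_group C). y \<otimes>\<^bsub>additive_group C\<^esub> x = \<one>\<^bsub>additive_group C\<^esub>"
   by (intro bexI[of _ "cls A (%n. scl A (-1) (s n))"])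
    (simp_all add: C_simps cauchyD add_commute[of "scl A (- 1) (s n)" for n])
 qed (auto elim!: C_cases simp: C_simps cauchyD add_ac)
next
 fix x y assume xy: "x \<in>: C" "y \<in>: C"
 obtain s t where st: "cauchy A s" "x = cls A s" "cauchy A t" "y = cls A t" using xy by (auto elim!: C_cases)
 show "nrm C (add C x y) <= nrm C x + nrm C y"
 proof -
  have "nrm C (cls A (%n. add A (s n) (t n))) <= nrm C (cls A s) + nrm C (cls A t)"
   by (rule LIMSEQ_le[OF nrm_C[OF cauchy_add[OF st(1,3)]] tendsto_add[OF nrm_C[OF st(1)] nrm_C[OF st(3)]]])
    (use st in "auto simp: cauchyD nrm_add")
  then show ?thesis using st by (simp add: C_simps)
 qed
 show "nrm C (mul C x y) <= nrm C x * nrm C y"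
 proof -
  have "nrm C (cls A (%n. mul A (s n) (t n))) <= nrm C (cls A s) * nrm C (cls A t)"
   by (rule LIMSEQ_le[OF nrm_C[OF cauchy_mul[OF st(1,3)]] tendsto_mult[OF nrm_C[OF st(1)] nrm_C[OF st(3)]]])
    (use st in "auto simp: cauchyD nrm_mul")
  then show ?thesis using st by (simp add: C_simps)
 qed
next
 fix x c assume "x \<in>: C"
 then obtain s where s: "cauchy A s" "x = cls A s" by (auto elim: C_cases)
 show "0 <= nrm C x" using s by (intro LIMSEQ_le_const[OF nrm_C[OF s(1), folded s(2)]]) (auto simp: cauchyD)
 have "(%n. cmod c * nrm A (s n)) \<longlonglongrightarrow> cmod c * nrm C x"
  using s nrm_C[OF s(1)] by (intro tendsto_intros) auto
 then show "nrm C (scl C c x) = cmod c * nrm C x" using nrm_C[OF cauchy_scl[OF s(1)], of c] s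
  by (intro LIMSEQ_unique[of "%n. cmod c * nrm A (s n)"]) (auto simp: C_simps cauchyD nrm_scl)
 have "(%n. (nrm A (s n))\<^sup>2) \<longlonglongrightarrow> (nrm C x)\<^sup>2"
  using s nrm_C[OF s(1)] by (intro tendsto_intros) auto
 then show "nrm C (mul C (adj C x) x) = (nrm C x)\<^sup>2" using nrm_C[OF cauchy_mul[OF cauchy_adj[OF s(1)] s(1)]] s
  by (intro LIMSEQ_unique[of "%n. (nrm A (s n))\<^sup>2"]) (auto simp: C_simps cauchyD nrm_cstar)
qed (auto elim!: C_cases simp: C_simps cauchyD scl_add_right scl_add_left scl_scl mul_assoc
  mul_add_left mul_add_right mul_scl_left mul_scl_right adj_add adj_scl adj_mul)

definition emb :: "'a => (nat => 'a) set" where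
 "emb x = cls A (%_. x)"

lemma star_hom_emb: "star_hom A C emb" by (rule star_homI) (simp_all add: emb_def C_simps)

lemma nrm_emb [simp]: "x \<in>: A ==> nrm C (emb x) = nrm A x"
 using nrm_C[of "%_. x"] by (simp add: emb_def LIMSEQ_const_iff)

lemma emb_closed [simp]: "x \<in>: A ==> emb x \<in>: C" by (simp add: emb_def)

lemma conv_to_cls:
 assumes s: "cauchy A s" shows "conv_to C (%n. emb (s n)) (cls A s)" unfolding conv_to_def
proof (rule LIMSEQ_I)
 fix e :: real assume "e > 0"
 then obtain N where N: "!!m n. m \<ge> N ==> n \<ge> N ==> nrm A (sub A (s m) (s n)) < e / 2"
  using cauchyD2[OF s, of "e / 2"] by auto
 interpret C: pre_cstar C by (rule pre_cstar_C)
 have "nrm C (sub C (emb (s n)) (cls A s)) < e" if "n \<ge> N" for n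
 proof -
  have c: "cauchy A (%m. sub A (s n) (s m))" using s by (intro cauchy_sub) (auto simp: cauchyD)
  have "nrm C (cls A (%m. sub A (s n) (s m))) <= e / 2"
   by (rule LIMSEQ_le_const2[OF nrm_C[OF c]]) (use N that less_imp_le in blast)
  then show ?thesis using s \<open>e > 0\<close> by (simp add: emb_def sub_C cauchyD)
 qed
 then show "\<exists>N. \<forall>n\<ge>N. norm (nrm C (sub C (emb (s n)) (cls A s)) - 0) < e"
  using s by (intro exI[of _ N]) (auto simp: cauchyD)
qed

lemma emb_dense:
 assumes "x \<in>: C" "e > 0"
 obtains y where "y \<in>: A" "nrm C (sub C x (emb y)) < e"
proof -
 interpret C: pre_cstar C by (rule pre_cstar_C)
 obtain s where s: "cauchy A s" "x = cls A s" using assms by (auto elim: C_cases)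
 obtain n where "norm (nrm C (sub C (emb (s n)) x) - 0) < e"
  using LIMSEQ_D[OF conv_to_cls[OF s(1), unfolded conv_to_def] assms(2)] unfolding s(2) by blast
 then have "nrm C (sub C (emb (s n)) x) < e" by simp
 then show ?thesis using that[of "s n"] s C.nrm_sub_commute[of x "emb (s n)"] by (simp add: cauchyD)
qed

text \<open>For completeness, replace the n-th term of a Cauchy sequence of classes by the image of
  a single element y n at distance less than 1/(n+1). The sequence y is Cauchy because the embedding
  is isometric, and its class is the limit.\<close>

lemma cstar_algebra_C: "cstar_algebra C"
proof -
 interpret C: pre_cstar C by (rule pre_cstar_C)
 have eq_0: "nrm C x = 0 \<longleftrightarrow> x = zer C" if "x \<in>: C" for x
 proof
  assume 0: "nrm C x = 0"
  obtain s where s: "cauchy A s" "x = cls A s" using \<open>x \<in>: C\<close> by (auto elim: C_cases)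
  then have "nulld s (%_. zer A)" using nrm_C[OF s(1)] 0 by (simp add: nulld_def cauchyD)
  then show "x = zer C" using s by (simp add: zer_C cls_eqI)
 qed simp
 have complete: "\<exists>x\<in>carrier C. conv_to C X x" if X: "cauchy C X" for X
 proof -
  have "\<exists>y. y \<in>: A & nrm C (sub C (X n) (emb y)) < 1 / Suc n" for n
   using emb_dense[of "X n" "1 / Suc n"] C.cauchyD[OF X] by (metis of_nat_0_less_iff zero_less_Suc zero_less_divide_1_iff)
  then obtain y where y: "!!n. y n \<in>: A" "!!n. nrm C (sub C (X n) (emb (y n))) < 1 / Suc n" by metis
  have Xc [simp]: "X n \<in>: C" for n by (rule C.cauchyD[OF X])
  have "cauchy A y"
  proof (rule cauchyI)
   fix e :: real assume "e > 0"
   then have "e / 3 > 0" by simp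
   obtain N where N: "!!m n. m \<ge> N ==> n \<ge> N ==> nrm C (sub C (X m) (X n)) < e / 3"
    using C.cauchyD2[OF X \<open>e / 3 > 0\<close>] by blast
   obtain M where M: "1 / Suc M < e / 3" using nat_approx_posE[OF \<open>e / 3 > 0\<close>] .
   have "nrm A (sub A (y m) (y n)) < e" if mn: "m \<ge> max M N" "n \<ge> max M N" for m n
   proof -
    have small: "nrm C (sub C (X k) (emb (y k))) < e / 3" if "k \<ge> max M N" for k
    proof -
     have "1 / real (Suc k) <= 1 / Suc M" using that by (intro divide_left_mono) auto
     then show ?thesis using y(2)[of k] M by linarith
    qed
    have "nrm A (sub A (y m) (y n)) = nrm C (sub C (emb (y m)) (emb (y n)))"
     using star_hom_sub[OF star_hom_emb pre_cstar_axioms, of "y m" "y n"] y by (simp flip: nrm_emb)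
    also have "... <= nrm C (sub C (emb (y m)) (X m)) + (nrm C (sub C (X m) (X n)) + nrm C (sub C (X n) (emb (y n))))"
     using C.nrm_sub_triangle[of "emb (y m)" "X m" "emb (y n)"]
      C.nrm_sub_triangle[of "X m" "X n" "emb (y n)"] y by simp
    also have "... < e / 3 + (e / 3 + e / 3)"
     using small[OF mn(1)] small[OF mn(2)] N[of m n] mn C.nrm_sub_commute[of "emb (y m)" "X m"] y by simp
    finally show ?thesis by simp
   qed
   then show "\<exists>N. \<forall>m\<ge>N. \<forall>n\<ge>N. nrm A (sub A (y m) (y n)) < e" by blast
  qed (rule y)
  moreover have "conv_to C X (cls A y)"
  proof (rule C.conv_to_sandwich[where b = "%n. 1 / Suc n + nrm C (sub C (emb (y n)) (cls A y))"])
   show "nrm C (sub C (X n) (cls A y)) <= 1 / Suc n + nrm C (sub C (emb (y n)) (cls A y))" for n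
    using C.nrm_sub_triangle[of "X n" "emb (y n)" "cls A y"] y \<open>cauchy A y\<close> less_imp_le[OF y(2)[of n]]
    by simp
   have "(%n. 1 / Suc n + nrm C (sub C (emb (y n)) (cls A y))) \<longlonglongrightarrow> 0 + 0"
    by (intro tendsto_add LIMSEQ_Suc[OF lim_1_over_n]) (use conv_to_cls[OF \<open>cauchy A y\<close>] in "simp add: conv_to_def")
   then show "(%n. 1 / Suc n + nrm C (sub C (emb (y n)) (cls A y))) \<longlonglongrightarrow> 0" by simp
  qed (use \<open>cauchy A y\<close> in auto)
  ultimately show ?thesis by auto
 qed
 show ?thesis by (rule cstar_algebra.intro)
   (simp_all add: C.add_group C.scl_add_right C.scl_add_left C.scl_scl C.mul_assoc C.mul_add_left
    C.mul_add_right C.mul_scl_left C.mul_scl_right C.adj_add C.adj_scl C.adj_mul C.nrm_add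
    C.nrm_scl C.nrm_mul C.nrm_cstar eq_0 complete)
qed

context
 fixes B :: "'b star_algebra" and f :: "'a => 'b"
 assumes B: "cstar_algebra B" and f: "star_hom A B f"
  and le: "!!x. x \<in>: A ==> nrm B (f x) <= nrm A x"
begin

interpretation B: cstar_algebra B by (rule B)

lemma nrm_hom_sub_le: "x \<in>: A ==> y \<in>: A ==> nrm B (sub B (f x) (f y)) <= nrm A (sub A x y)"
 using le[of "sub A x y"] by (simp add: star_hom_sub[OF f pre_cstar_axioms])

lemma cauchy_hom:
 assumes s: "cauchy A s" shows "cauchy B (%n. f (s n))" unfolding cauchy_def
proof (intro conjI allI impI)
 fix e :: real assume "e > 0"
 then obtain N where N: "!!m n. m \<ge> N ==> n \<ge> N ==> nrm A (sub A (s m) (s n)) < e" using cauchyD2[OF s] by blast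
 have "nrm B (sub B (f (s m)) (f (s n))) < e" if "m \<ge> N" "n \<ge> N" for m n
  using nrm_hom_sub_le[of "s m" "s n"] N[OF that] by (simp add: cauchyD[OF s])
 then show "\<exists>N. \<forall>m\<ge>N. \<forall>n\<ge>N. nrm B (sub B (f (s m)) (f (s n))) < e" by blast
qed (simp add: star_homD[OF f] cauchyD[OF s])

lemma completion_lift_cls:
 assumes s: "cauchy A s"
 shows "completion_lift B f (cls A s) \<in>: B" "conv_to B (%n. f (s n)) (completion_lift B f (cls A s))"
proof -
 have fs [simp]: "f (s n) \<in>: B" for n by (simp add: star_homD[OF f] cauchyD[OF s])
 obtain y where y: "y \<in>: B" "conv_to B (%n. f (s n)) y" using B.cauchy_limit[OF cauchy_hom[OF s]] by blast
 have all: "conv_to B (%n. f (t n)) y" if "t \<in> cls A s" for t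
 proof -
  have t: "cauchy A t" "nulld s t" using that by (auto simp: cls_eq_Collect)
  have ft [simp]: "f (t n) \<in>: B" for n by (simp add: star_homD[OF f] cauchyD[OF t(1)])
  show ?thesis
  proof (rule B.conv_to_sandwich[where b = "%n. nrm A (sub A (s n) (t n)) + nrm B (sub B (f (s n)) y)"])
   show "nrm B (sub B (f (t n)) y) <= nrm A (sub A (s n) (t n)) + nrm B (sub B (f (s n)) y)" for n
    using B.nrm_sub_triangle[of "f (t n)" "f (s n)" y] y nrm_hom_sub_le[of "s n" "t n"]
     B.nrm_sub_commute[of "f (t n)" "f (s n)"] cauchyD[OF s] cauchyD[OF t(1)] by simp
   have "(%n. nrm A (sub A (s n) (t n)) + nrm B (sub B (f (s n)) y)) \<longlonglongrightarrow> 0 + 0"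
    by (intro tendsto_add) (use t y in "simp_all add: nulld_def conv_to_def")
   then show "(%n. nrm A (sub A (s n) (t n)) + nrm B (sub B (f (s n)) y)) \<longlonglongrightarrow> 0" by simp
  qed (use y in auto)
 qed
 have "completion_lift B f (cls A s) = y" unfolding completion_lift_def
 proof (rule the_equality)
  show "y \<in>: B & (\<forall>s\<in>cls A s. conv_to B (%n. f (s n)) y)" using y all by blast
  fix z assume "z \<in>: B & (\<forall>s\<in>cls A s. conv_to B (%n. f (s n)) z)"
  then show "z = y" using y cls_self[OF s] by (intro B.conv_to_unique[of "%n. f (s n)" z y]) auto
 qed
 then show "completion_lift B f (cls A s) \<in>: B"
  "conv_to B (%n. f (s n)) (completion_lift B f (cls A s))" using y by simp_all
qed

lemma completion_lift_eqI:
 assumes "cauchy A s" "conv_to B (%n. f (s n)) y" "y \<in>: B"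
 shows "completion_lift B f (cls A s) = y" by (rule B.conv_to_unique[OF completion_lift_cls(2)[OF assms(1)] assms(2)])
  (use assms completion_lift_cls in "auto simp: star_homD[OF f] cauchyD")

lemma completion_lift_emb [simp]: "x \<in>: A ==> completion_lift B f (emb x) = f x"
 unfolding emb_def by (rule completion_lift_eqI) (auto simp: star_homD[OF f])

lemma star_hom_completion_lift: "star_hom C B (completion_lift B f)"
proof (rule star_homI)
 note fD = star_homD[OF f]
 note l = completion_lift_cls
 fix x y c assume "x \<in>: C"
 then obtain s where s: "cauchy A s" "x = cls A s" by (auto elim: C_cases)
 note sc = cauchyD[OF s(1)]
 show "completion_lift B f x \<in>: B" using l s by simp
 have "conv_to B (%n. scl B c (f (s n))) (scl B c (completion_lift B f x))"
  by (intro B.conv_to_scl) (use l s fD sc in auto)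
 then show "completion_lift B f (scl C c x) = scl B c (completion_lift B f x)"
  using s l sc by (simp add: scl_C) (intro completion_lift_eqI, simp_all add: cauchy_scl fD)
 have "conv_to B (%n. adj B (f (s n))) (adj B (completion_lift B f x))" by (intro B.conv_to_adj) (use l s fD sc in auto)
 then show "completion_lift B f (adj C x) = adj B (completion_lift B f x)"
  using s l sc by (simp add: adj_C) (intro completion_lift_eqI, simp_all add: cauchy_adj fD)
 assume "y \<in>: C"
 then obtain t where t: "cauchy A t" "y = cls A t" by (auto elim: C_cases)
 note tc = cauchyD[OF t(1)]
 have "conv_to B (%n. add B (f (s n)) (f (t n))) (add B (completion_lift B f x) (completion_lift B f y))"
  by (intro B.conv_to_add) (use l s t fD sc tc in auto)
 then show "completion_lift B f (add C x y) = add B (completion_lift B f x) (completion_lift B f y)"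
  using s t l sc tc by (simp add: add_C) (intro completion_lift_eqI, simp_all add: cauchy_add fD)
 have "conv_to B (%n. mul B (f (s n)) (f (t n))) (mul B (completion_lift B f x) (completion_lift B f y))"
  by (intro B.conv_to_mul) (use l s t fD sc tc in auto)
 then show "completion_lift B f (mul C x y) = mul B (completion_lift B f x) (completion_lift B f y)"
  using s t l sc tc by (simp add: mul_C) (intro completion_lift_eqI, simp_all add: cauchy_mul fD)
qed

end

lemma star_hom_C_eq:
 assumes f: "star_hom C B f" and g: "star_hom C B g" and B: "cstar_algebra B"
  and eq: "!!x. x \<in>: A ==> f (emb x) = g (emb x)" and x: "x \<in>: C"
 shows "f x = g x"
proof -
 interpret B: cstar_algebra B by fact
 obtain s where s: "cauchy A s" "x = cls A s" using x by (auto elim: C_cases)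
 have c: "conv_to C (%n. emb (s n)) x" using conv_to_cls[OF s(1)] s by simp
 have "conv_to B (%n. f (emb (s n))) (f x)" "conv_to B (%n. g (emb (s n))) (g x)"
  using star_hom_conv_to[OF f cstar_algebra_C B.pre.pre_cstar_axioms c]
   star_hom_conv_to[OF g cstar_algebra_C B.pre.pre_cstar_axioms c] s x by (simp_all add: cauchyD)
 then show ?thesis using s x eq
  by (intro B.conv_to_unique[of "%n. f (emb (s n))"]) (simp_all add: cauchyD star_homD[OF f] star_homD[OF g])
qed

lemma is_unit_emb:
 assumes e: "is_unit_of A e" shows "is_unit_of C (emb e)" using e unfolding is_unit_of_def
 by (auto elim!: C_cases simp: emb_def C_simps cauchyD)

end

section \<open>Approximate units in closed ideals, and quotient C*-algebras\<close>

section \<open>Quotients by closed ideals\<close>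

context pre_cstar
begin

lemma closed_idealD:
 assumes "closed_ideal A I"
 shows "closed_subspace A I" "I <= carrier A" "x \<in> I ==> x \<in>: A" "zer A \<in> I"
  "x \<in> I ==> y \<in> I ==> add A x y \<in> I" "x \<in> I ==> scl A c x \<in> I"
  "x \<in> I ==> y \<in> I ==> sub A x y \<in> I"
  "a \<in>: A ==> x \<in> I ==> mul A a x \<in> I"
  "a \<in>: A ==> x \<in> I ==> mul A x a \<in> I"
proof -
 have S: "closed_subspace A I" and J: "\<forall>a\<in>carrier A. \<forall>x\<in>I. mul A a x \<in> I & mul A x a \<in> I"
  using assms by (simp_all add: closed_ideal_def)
 show "closed_subspace A I" by (rule S)
 show "I <= carrier A" "x \<in> I ==> x \<in>: A" "zer A \<in> I"
  "x \<in> I ==> y \<in> I ==> add A x y \<in> I" "x \<in> I ==> scl A c x \<in> I"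
  "x \<in> I ==> y \<in> I ==> sub A x y \<in> I" by (fact closed_subspaceD(1-6)[OF S])+
 show "a \<in>: A ==> x \<in> I ==> mul A a x \<in> I" "a \<in>: A ==> x \<in> I ==> mul A x a \<in> I"
  using J by simp_all
qed

lemma sub_sub_cancel: "x \<in>: A ==> y \<in>: A ==> sub A x (sub A x y) = y" by (simp add: sub_eq_iff)

lemma closed_ideal_ideal_gen:
 assumes "S <= carrier A" shows "closed_ideal A (ideal_gen A S)"
proof -
 have "closed_ideal A (carrier A)" by (auto simp: closed_ideal_def closed_subspace_def)
 then have sub: "ideal_gen A S <= carrier A" using assms by (auto simp: ideal_gen_def)
 have mem: "x \<in> ideal_gen A S \<longleftrightarrow> (\<forall>I. closed_ideal A I --> S <= I --> x \<in> I)" for x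
  by (auto simp: ideal_gen_def)
 show ?thesis unfolding closed_ideal_def closed_subspace_def
 proof (intro conjI ballI allI impI sub)
  fix s x assume s: "\<forall>n. s n \<in> ideal_gen A S" "x \<in>: A" "conv_to A s x"
  show "x \<in> ideal_gen A S" unfolding mem
  proof (intro allI impI)
   fix I assume I: "closed_ideal A I" "S <= I"
   show "x \<in> I" by (rule closed_subspaceD(7)[OF closed_idealD(1)[OF I(1)], of s]) (use s I mem in auto)
  qed
 qed (auto simp: mem closed_idealD)
qed

lemma ideal_gen_subset: "S <= ideal_gen A S" unfolding ideal_gen_def by blast

lemma ideal_gen_least: "closed_ideal A I ==> S <= I ==> ideal_gen A S <= I" unfolding ideal_gen_def by blast

end

context cstar_algebra
begin

text \<open>
 For \<open>\<parallel>y\<parallel> < 1\<close> the unit is approximated by \<open>e = 1 - (1/N) \<Sum>\<^sub>j (1 - y\<^sup>2)\<^sup>j\<close>: then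
 \<open>y\<^sup>2 (1 - e) = (1 - (1 - y\<^sup>2)\<^sup>N) / N\<close>, and \<open>1 - e\<close> is a contraction.  Below \<open>f N = 1 - (1 - y\<^sup>2)\<^sup>N\<close>
 and \<open>g N = N e\<close>.
\<close>

lemma approximate_unit_sa:
 assumes I: "closed_ideal A I" and y: "y \<in> I" "adj A y = y" "nrm A y < 1" and N: "N > 0"
 obtains e where "e \<in> I" "adj A e = e" "!!b. b \<in>: A ==> nrm A (sub A b (mul A e b)) <= nrm A b"
  "(nrm A (sub A y (mul A y e)))\<^sup>2 <= 2 / real N"
proof -
 note ID = closed_idealD[OF I]
 define v where "v = mul A y y"
 have yc [simp]: "y \<in>: A" using ID y by blast
 have vI: "v \<in> I" using ID y by (simp add: v_def)
 have v [simp]: "v \<in>: A" "adj A v = v" using y by (simp_all add: v_def adj_mul)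
 \<comment> \<open>The recursion is 1 - f (n+1) = (1 - v) (1 - f n), multiplied out so that no unit
   occurs and every f n stays in the ideal.\<close>
 define f where "f = rec_nat (zer A) (%_ x. add A x (sub A v (mul A v x)))"
 define g where "g = rec_nat (zer A) (%n x. add A x (f n))"
 have f_simps: "f 0 = zer A" "f (Suc n) = add A (f n) (sub A v (mul A v (f n)))" for n by (simp_all add: f_def)
 have g_simps: "g 0 = zer A" "g (Suc n) = add A (g n) (f n)" for n by (simp_all add: g_def)
 have fI: "f n \<in> I" for n by (induction n) (use ID vI v in "simp_all add: f_simps")
 have gI: "g n \<in> I" for n by (induction n) (use ID fI in "simp_all add: g_simps")
 have fc [simp]: "f n \<in>: A" and gc [simp]: "g n \<in>: A" for n using ID fI gI by auto
 have fv: "mul A (f n) v = mul A v (f n)" for n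
  by (induction n) (simp_all add: f_simps mul_add_left mul_add_right mul_sub_left mul_sub_right mul_assoc)
 have fadj: "adj A (f n) = f n" for n by (induction n) (simp_all add: f_simps adj_add adj_sub adj_mul fv)
 have gadj: "adj A (g n) = g n" for n by (induction n) (simp_all add: g_simps adj_add fadj)
 have fle: "nrm A (sub A b (mul A (f n) b)) <= nrm A b" if [simp]: "b \<in>: A" for b n
 proof (induction n)
  case (Suc n)
  let ?c = "sub A b (mul A (f n) b)"
  have "sub A b (mul A (f (Suc n)) b) = sub A ?c (mul A v ?c)"
   by (simp add: f_simps mul_add_left mul_sub_left mul_sub_right mul_assoc)
    (simp add: sub_def scl_add_right scl_scl add_ac)
  also have "nrm A ... <= nrm A ?c" unfolding v_def by (rule nrm_sub_square_mul_le) (use y in auto)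
  finally show ?case using Suc by simp
 qed (simp add: f_simps)
 have gle: "nrm A (sub A (scl A (of_nat n) b) (mul A (g n) b)) <= n * nrm A b" if [simp]: "b \<in>: A" for b n
 proof (induction n)
  case (Suc n)
  have "sub A (scl A (of_nat (Suc n)) b) (mul A (g (Suc n)) b) =
    add A (sub A (scl A (of_nat n) b) (mul A (g n) b)) (sub A b (mul A (f n) b))" using scl_add_left[of b "of_nat n" 1]
   by (simp add: g_simps mul_add_left add.commute flip: sub_add_add)
  then show ?case
   using nrm_add[of "sub A (scl A (of_nat n) b) (mul A (g n) b)" "sub A b (mul A (f n) b)"] Suc fle[of b n]
   by (simp add: algebra_simps)
 qed (simp add: g_simps)
 have telescope: "sub A (scl A (of_nat n) v) (mul A v (g n)) = f n" for n
 proof (induction n)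
  case (Suc n)
  have "sub A (scl A (of_nat (Suc n)) v) (mul A v (g (Suc n))) =
    add A (sub A (scl A (of_nat n) v) (mul A v (g n))) (sub A v (mul A v (f n)))" using scl_add_left[of v "of_nat n" 1]
   by (simp add: g_simps mul_add_right add.commute flip: sub_add_add)
  then show ?case using Suc by (simp add: f_simps)
 qed (simp add: g_simps f_simps)
 \<comment> \<open>Since 1 - f is a contraction, ||f||^2 = ||f f|| <= ||f|| + ||f - f f|| <= 2
   ||f||.\<close>
 have fN: "nrm A (f N) <= 2"
 proof -
  have "mul A (f N) (f N) = sub A (f N) (sub A (f N) (mul A (f N) (f N)))" by (simp add: sub_sub_cancel)
  then have "nrm A (mul A (f N) (f N)) <= nrm A (f N) + nrm A (sub A (f N) (mul A (f N) (f N)))"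
   using nrm_sub_le[of "f N" "sub A (f N) (mul A (f N) (f N))"] by simp
  then have "nrm A (f N) * nrm A (f N) <= 2 * nrm A (f N)"
   using fle[of "f N" N] nrm_cstar_sa[of "f N"] fadj by (simp add: power2_eq_square)
  then show ?thesis by (cases "nrm A (f N) = 0") (auto simp: mult_le_cancel_right)
 qed
 define e where "e = scl A (1 / of_nat N) (g N)"
 have Nc: "complex_of_nat N ~= 0" using N by simp
 have e [simp]: "e \<in>: A" "adj A e = e" by (simp_all add: e_def adj_scl gadj)
 have eI: "e \<in> I" using ID gI by (simp add: e_def)
 have eb: "sub A b (mul A e b) = scl A (1 / of_nat N) (sub A (scl A (of_nat N) b) (mul A (g N) b))"
  if "b \<in>: A" for b using that Nc by (simp add: e_def scl_sub scl_scl mul_scl_left)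
 have ele: "nrm A (sub A b (mul A e b)) <= nrm A b" if "b \<in>: A" for b
  using gle[OF that, of N] N that by (simp add: eb nrm_scl norm_divide field_simps)
 have "sub A v (mul A v e) = scl A (1 / of_nat N) (f N)"
  unfolding telescope[symmetric, of N] using Nc by (simp add: e_def scl_sub scl_scl mul_scl_right)
 then have ve: "nrm A (sub A v (mul A v e)) <= 2 / N" using fN N by (simp add: nrm_scl norm_divide divide_right_mono)
 have "(nrm A (sub A y (mul A y e)))\<^sup>2 = nrm A (mul A (adj A (sub A y (mul A y e))) (sub A y (mul A y e)))"
  by (rule nrm_cstar[symmetric]) simp
 also have "mul A (adj A (sub A y (mul A y e))) (sub A y (mul A y e)) = sub A (sub A v (mul A v e)) (mul A e (sub A v (mul A v e)))"
  using y by (simp add: adj_sub adj_mul mul_sub_left mul_sub_right mul_assoc v_def) (rule sub_sub_sub; simp)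
 also have "nrm A ... <= nrm A (sub A v (mul A v e))" by (rule ele) simp
 finally have "(nrm A (sub A y (mul A y e)))\<^sup>2 <= 2 / N" using ve by simp
 from that[OF eI e(2) ele this] show ?thesis .
qed

text \<open>The self-adjoint case applies to a multiple of y^* y, and ||y - y e||^2 <= ||y^* y - y^*
  y e|| transfers the estimate to y. Only y^* y has to lie in the ideal, which is what allows y to
  be the adjoint of an element of the ideal.\<close>

lemma approximate_unit:
 assumes I: "closed_ideal A I" and y: "y \<in>: A" "mul A (adj A y) y \<in> I" and eps: "\<epsilon> > 0"
 obtains e where "e \<in> I" "adj A e = e" "!!b. b \<in>: A ==> nrm A (sub A b (mul A e b)) <= nrm A b"
  "nrm A (sub A y (mul A y e)) <= \<epsilon>"
proof -
 note ID = closed_idealD[OF I]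
 let ?Y = "mul A (adj A y) y"
 define c where "c = nrm A ?Y + 1"
 have c: "c > 0" "nrm A ?Y < c" using y by (simp_all add: c_def add_nonneg_pos)
 define z where "z = scl A (1 / c) ?Y"
 have z: "z \<in> I" "adj A z = z" "nrm A z < 1" "z \<in>: A"
  using ID y c by (simp_all add: z_def adj_scl adj_mul nrm_scl norm_divide)
 have Yz: "?Y = scl A c z" using y c by (simp add: z_def scl_scl)
 \<comment> \<open>A square root is taken twice, once for y^* y - y^* y e and once for y - y e;
   hence the fourth power of the tolerance. The factor c^2 comes from normalizing y^* y.\<close>
 define N where "N = nat \<lceil>2 * c\<^sup>2 / \<epsilon> ^ 4\<rceil> + 1"
 have N: "N > 0" "2 * c\<^sup>2 / \<epsilon> ^ 4 <= N" unfolding N_def by linarith+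
 show ?thesis
 proof (rule approximate_unit_sa[OF I z(1-3) N(1)])
  fix e assume e: "e \<in> I" "adj A e = e" "!!b. b \<in>: A ==> nrm A (sub A b (mul A e b)) <= nrm A b"
   "(nrm A (sub A z (mul A z e)))\<^sup>2 <= 2 / real N"
  have ec [simp]: "e \<in>: A" using ID e by blast
  have "(nrm A (sub A ?Y (mul A ?Y e)))\<^sup>2 = c\<^sup>2 * (nrm A (sub A z (mul A z e)))\<^sup>2"
   unfolding Yz using z c by (simp add: mul_scl_left nrm_scl power_mult_distrib flip: scl_sub)
  also have "... <= c\<^sup>2 * (2 / N)" using e(4) by (intro mult_left_mono) auto
  also have "... <= \<epsilon> ^ 4" using N eps by (simp add: field_simps)
  also have "... = (\<epsilon>\<^sup>2)\<^sup>2" by simp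
  finally have Ye: "nrm A (sub A ?Y (mul A ?Y e)) <= \<epsilon>\<^sup>2" by (rule power2_le_imp_le) simp
  have "(nrm A (sub A y (mul A y e)))\<^sup>2 = nrm A (mul A (adj A (sub A y (mul A y e))) (sub A y (mul A y e)))"
   by (rule nrm_cstar[symmetric]) (use y in simp)
  also have "mul A (adj A (sub A y (mul A y e))) (sub A y (mul A y e)) = sub A (sub A ?Y (mul A ?Y e)) (mul A e (sub A ?Y (mul A ?Y e)))"
   using y e by (simp add: adj_sub adj_mul mul_sub_left mul_sub_right mul_assoc) (rule sub_sub_sub; simp)
  also have "nrm A ... <= nrm A (sub A ?Y (mul A ?Y e))" by (rule e(3)) (use y in simp)
  finally have "(nrm A (sub A y (mul A y e)))\<^sup>2 <= \<epsilon>\<^sup>2" using Ye by simp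
  then have "nrm A (sub A y (mul A y e)) <= \<epsilon>" by (rule power2_le_imp_le) (use eps in simp)
  from that[OF e(1-3) this] show ?thesis .
 qed
qed

text \<open>As x x^* lies in the ideal, there are elements e of the ideal with x^* e arbitrarily
  close to x^*, and each x^* e is in the ideal.\<close>

lemma closed_ideal_adj:
 assumes I: "closed_ideal A I" and x: "x \<in> I"
 shows "adj A x \<in> I"
proof -
 note ID = closed_idealD[OF I]
 have xc [simp]: "x \<in>: A" using ID x by blast
 have "\<exists>e. e \<in> I & nrm A (sub A (adj A x) (mul A (adj A x) e)) <= 1 / Suc n" for n
 proof (rule approximate_unit[OF I, of "adj A x" "1 / Suc n"])
  show "mul A (adj A (adj A x)) (adj A x) \<in> I" using ID(9)[of "adj A x" x] x by simp
  fix e assume "e \<in> I" "nrm A (sub A (adj A x) (mul A (adj A x) e)) <= 1 / Suc n"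
  then show ?thesis by (intro exI[of _ e] conjI)
 qed simp_all
 then have "\<forall>n. \<exists>e. e \<in> I & nrm A (sub A (adj A x) (mul A (adj A x) e)) <= 1 / Suc n" by (rule allI)
 from choice[OF this] obtain e where e: "!!n. e n \<in> I"
  "!!n. nrm A (sub A (adj A x) (mul A (adj A x) (e n))) <= 1 / Suc n" by blast
 have ec: "e n \<in>: A" for n by (rule ID(3)[OF e(1)])
 have "conv_to A (%n. mul A (adj A x) (e n)) (adj A x)"
 proof (rule conv_to_sandwich[where b = "%n. 1 / Suc n"])
  show "nrm A (sub A (mul A (adj A x) (e n)) (adj A x)) <= 1 / Suc n" for n
   using e(2)[of n] nrm_sub_commute[of "adj A x" "mul A (adj A x) (e n)"] ec by simp
 qed (use ec LIMSEQ_Suc[OF lim_1_over_n] in auto)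
 then show ?thesis using closed_subspaceD(7)[OF ID(1), of "%n. mul A (adj A x) (e n)" "adj A x"] ID(8) e(1) by simp
qed

text \<open>This is the hard half of the C*-identity in the quotient. With e almost a right unit for
  y, take z = - x e. Then ||x - x e||^2 <= ||x^* x (1 - e)||, which is at most ||(x^* x + y) (1 -
  e)|| + ||y - y e||.\<close>

lemma closed_ideal_quotient_cstar:
 assumes I: "closed_ideal A I" and x: "x \<in>: A" and y: "y \<in> I" and eps: "\<epsilon> > 0"
 shows "\<exists>z\<in>I. (nrm A (add A x z))\<^sup>2 <= nrm A (add A (mul A (adj A x) x) y) + \<epsilon>"
proof -
 note ID = closed_idealD[OF I]
 have yc [simp]: "y \<in>: A" using ID y by blast
 have "mul A (adj A y) y \<in> I" using ID y by simp
 then show ?thesis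
 proof (rule approximate_unit[OF I yc _ eps])
  fix e assume e: "e \<in> I" "adj A e = e" "!!b. b \<in>: A ==> nrm A (sub A b (mul A e b)) <= nrm A b"
   "nrm A (sub A y (mul A y e)) <= \<epsilon>"
  have ec [simp]: "e \<in>: A" using ID e by blast
  have right: "nrm A (sub A b (mul A b e)) <= nrm A b" if "b \<in>: A" for b
  proof -
   have "sub A b (mul A b e) = adj A (sub A (adj A b) (mul A e (adj A b)))" using that e by (simp add: adj_sub adj_mul)
   then show ?thesis using e(3)[of "adj A b"] that by simp
  qed
  let ?X = "mul A (adj A x) x"
  let ?t = "sub A ?X (mul A ?X e)"
  have "(nrm A (sub A x (mul A x e)))\<^sup>2 = nrm A (mul A (adj A (sub A x (mul A x e))) (sub A x (mul A x e)))"
   by (rule nrm_cstar[symmetric]) (use x in simp)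
  also have "mul A (adj A (sub A x (mul A x e))) (sub A x (mul A x e)) = sub A ?t (mul A e ?t)"
   using x e by (simp add: adj_sub adj_mul mul_sub_left mul_sub_right mul_assoc) (rule sub_sub_sub; simp)
  also have "nrm A ... <= nrm A ?t" by (rule e(3)) (use x in simp)
  also have "?t = sub A (sub A (add A ?X y) (mul A (add A ?X y) e)) (sub A y (mul A y e))"
   using x by (simp add: mul_add_left sub_sub_sub)
  also have "nrm A ... <= nrm A (add A ?X y) + \<epsilon>"
   using nrm_sub_le[of "sub A (add A ?X y) (mul A (add A ?X y) e)" "sub A y (mul A y e)"]
    right[of "add A ?X y"] e(4) x by simp
  finally have "(nrm A (add A x (scl A (-1) (mul A x e))))\<^sup>2 <= nrm A (add A ?X y) + \<epsilon>"
   by (simp add: sub_def)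
  then show ?thesis using ID(6,8) e(1) x by blast
 qed
qed

end

locale cstar_ideal = cstar_algebra +
 fixes I assumes I: "closed_ideal A I"
begin

lemmas ID = closed_idealD[OF I]

abbreviation "Q \<equiv> quotient A I"
abbreviation "cs \<equiv> coset A I"

lemma mem_coset_iff: "x \<in>: A ==> y \<in> cs x \<longleftrightarrow> y \<in>: A & sub A y x \<in> I"
proof -
 assume x: "x \<in>: A"
 have "y \<in> add A x ` I" if "y \<in>: A" "sub A y x \<in> I" by (rule image_eqI[OF _ that(2)]) (use that x in simp)
 then show ?thesis unfolding coset_def using ID(3) x by auto
qed

lemma sub_commute_I: "x \<in>: A ==> y \<in>: A ==> sub A x y \<in> I \<longleftrightarrow> sub A y x \<in> I"
 using ID(6)[of "sub A x y" "-1"] ID(6)[of "sub A y x" "-1"] by (auto simp: neg_sub)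

lemma sub_trans_I: "x \<in>: A ==> y \<in>: A ==> z \<in>: A ==>
  sub A x y \<in> I ==> sub A y z \<in> I ==> sub A x z \<in> I"
 using ID(5)[of "sub A x y" "sub A y z"] by (simp add: add_sub_sub)

lemma coset_self: "x \<in>: A ==> x \<in> cs x" by (simp add: mem_coset_iff ID(4))

lemma coset_eqI: "x \<in>: A ==> y \<in>: A ==> sub A x y \<in> I ==> cs x = cs y"
proof -
 assume x: "x \<in>: A" and y: "y \<in>: A" and xy: "sub A x y \<in> I"
 have "z \<in> cs x \<longleftrightarrow> z \<in> cs y" for z
  using x y xy sub_commute_I[of x y] sub_trans_I[of z x y] sub_trans_I[of z y x] by (auto simp: mem_coset_iff)
 then show ?thesis by blast
qed

lemma coset_eq_iff: "x \<in>: A ==> y \<in>: A ==> cs x = cs y \<longleftrightarrow> sub A x y \<in> I"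
 using coset_eqI coset_self[of x] mem_coset_iff[of y x] by auto

lemma UN_coset:
 assumes "x \<in>: A" "!!x'. x' \<in>: A ==> sub A x' x \<in> I ==> F x' = F x"
 shows "(\<Union>x'\<in>cs x. F x') = F x"
proof -
 have "(\<Union>x'\<in>cs x. F x') = (\<Union>x'\<in>cs x. F x)"
  by (intro SUP_cong refl assms(2)) (use assms(1) in "auto simp: mem_coset_iff")
 then show ?thesis using coset_self[OF assms(1)] by auto
qed

lemma carrier_Q: "carrier Q = cs ` carrier A"
 and zer_Q: "zer Q = cs (zer A)" by (simp_all add: quotient_def)

lemma coset_in_Q [simp]: "x \<in>: A ==> cs x \<in>: Q" by (simp add: carrier_Q)

lemma add_Q: "x \<in>: A ==> y \<in>: A ==> add Q (cs x) (cs y) = cs (add A x y)"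
proof -
 assume xy: "x \<in>: A" "y \<in>: A"
 have "add Q (cs x) (cs y) = (\<Union>x'\<in>cs x. \<Union>y'\<in>cs y. cs (add A x' y'))" by (simp add: quotient_def)
 also have "... = (\<Union>y'\<in>cs y. cs (add A x y'))" by (rule UN_coset, fact, intro SUP_cong refl coset_eqI)
   (use xy ID(4,5) in "auto simp: mem_coset_iff sub_add_add")
 also have "... = cs (add A x y)" by (rule UN_coset, fact, intro coset_eqI) (use xy in "auto simp: sub_add_add ID(3)")
 finally show ?thesis .
qed

lemma mul_Q: "x \<in>: A ==> y \<in>: A ==> mul Q (cs x) (cs y) = cs (mul A x y)"
proof -
 assume xy: "x \<in>: A" "y \<in>: A"
 have "mul Q (cs x) (cs y) = (\<Union>x'\<in>cs x. \<Union>y'\<in>cs y. cs (mul A x' y'))" by (simp add: quotient_def)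
 also have "... = (\<Union>y'\<in>cs y. cs (mul A x y'))" by (rule UN_coset, fact, intro SUP_cong refl coset_eqI)
   (use xy in "auto simp: mem_coset_iff ID(9) simp flip: mul_sub_left")
 also have "... = cs (mul A x y)"
  by (rule UN_coset, fact, intro coset_eqI) (use xy in "auto simp: ID(8) simp flip: mul_sub_right")
 finally show ?thesis .
qed

lemma scl_Q: "x \<in>: A ==> scl Q c (cs x) = cs (scl A c x)"
proof -
 assume x: "x \<in>: A"
 have "scl Q c (cs x) = (\<Union>x'\<in>cs x. cs (scl A c x'))" by (simp add: quotient_def)
 also have "... = cs (scl A c x)"
  by (rule UN_coset, fact, intro coset_eqI) (use x in "auto simp: ID(6) simp flip: scl_sub")
 finally show ?thesis .
qed

lemma adj_Q: "x \<in>: A ==> adj Q (cs x) = cs (adj A x)"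
proof -
 assume x: "x \<in>: A"
 have "adj Q (cs x) = (\<Union>x'\<in>cs x. cs (adj A x'))" by (simp add: quotient_def)
 also have "... = cs (adj A x)" by (rule UN_coset, fact, intro coset_eqI)
   (use x in "auto simp: closed_ideal_adj[OF I] simp flip: adj_sub")
 finally show ?thesis .
qed

lemma sub_Q: "x \<in>: A ==> y \<in>: A ==> sub Q (cs x) (cs y) = cs (sub A x y)" by (simp add: sub_def scl_Q add_Q)

lemma nrm_Q_le: "x \<in>: A ==> nrm Q (cs x) <= nrm A x" unfolding quotient_def star_algebra.simps
 by (rule cInf_lower) (auto simp: coset_self mem_coset_iff intro!: bdd_belowI[of _ 0])

lemma Q_rep:
 assumes "U \<in>: Q" "e > 0"
 obtains x where "x \<in>: A" "U = cs x" "nrm A x < nrm Q U + e"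
proof -
 obtain x0 where x0: "x0 \<in>: A" "U = cs x0" using assms by (auto simp: carrier_Q)
 have "\<exists>r\<in>nrm A ` U. r < nrm Q U + e" unfolding quotient_def star_algebra.simps
  by (rule cInf_lessD[of "nrm A ` U" "Inf (nrm A ` U) + e", simplified Bex_def[symmetric]])
   (use x0 coset_self assms in auto)
 then obtain x where x: "x \<in> U" "nrm A x < nrm Q U + e" by auto
 then have "x \<in>: A" "sub A x x0 \<in> I" using x0 by (auto simp: mem_coset_iff)
 then show ?thesis using that[of x] x x0 coset_eqI[of x x0] by auto
qed

lemma Q_cases: assumes "U \<in>: Q" obtains x where "x \<in>: A" "U = cs x" using assms by (auto simp: carrier_Q)

lemmas Q_simps = add_Q mul_Q scl_Q adj_Q zer_Q

lemma nrm_Q_nonneg: "U \<in>: Q ==> 0 <= nrm Q U"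
 by (rule field_le_epsilon) (metis Q_rep le_less nrm_nonneg order_le_less_trans)

lemma nrm_Q_add: "U \<in>: Q ==> V \<in>: Q ==> nrm Q (add Q U V) <= nrm Q U + nrm Q V"
proof (rule field_le_epsilon)
 fix e :: real assume UV: "U \<in>: Q" "V \<in>: Q" and "e > 0"
 then have "e / 2 > 0" by simp
 obtain x where x: "x \<in>: A" "U = cs x" "nrm A x < nrm Q U + e / 2" by (rule Q_rep[OF UV(1) \<open>e / 2 > 0\<close>])
 obtain y where y: "y \<in>: A" "V = cs y" "nrm A y < nrm Q V + e / 2" by (rule Q_rep[OF UV(2) \<open>e / 2 > 0\<close>])
 have "nrm Q (add Q U V) <= nrm A (add A x y)" using x y nrm_Q_le[of "add A x y"] by (simp add: add_Q)
 then show "nrm Q (add Q U V) <= nrm Q U + nrm Q V + e" using nrm_add[of x y] x y by simp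
qed

lemma nrm_Q_mul: "U \<in>: Q ==> V \<in>: Q ==> nrm Q (mul Q U V) <= nrm Q U * nrm Q V"
proof -
 assume UV: "U \<in>: Q" "V \<in>: Q"
 have le: "nrm Q (mul Q U V) <= (nrm Q U + e) * (nrm Q V + e)" if e: "e > 0" for e
 proof -
  obtain x where x: "x \<in>: A" "U = cs x" "nrm A x < nrm Q U + e" by (rule Q_rep[OF UV(1) e])
  obtain y where y: "y \<in>: A" "V = cs y" "nrm A y < nrm Q V + e" by (rule Q_rep[OF UV(2) e])
  have "nrm Q (mul Q U V) <= nrm A (mul A x y)" using x y nrm_Q_le[of "mul A x y"] by (simp add: mul_Q)
  also have "... <= nrm A x * nrm A y" using x y by (intro nrm_mul)
  also have "... <= (nrm Q U + e) * (nrm Q V + e)" using x y nrm_Q_nonneg[OF UV(1)] e by (intro mult_mono) auto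
  finally show ?thesis .
 qed
 have "(%n. (nrm Q U + 1 / Suc n) * (nrm Q V + 1 / Suc n)) \<longlonglongrightarrow> (nrm Q U + 0) * (nrm Q V + 0)"
  by (intro tendsto_intros LIMSEQ_Suc[OF lim_1_over_n])
 then show ?thesis using LIMSEQ_le_const[of _ "(nrm Q U + 0) * (nrm Q V + 0)" "nrm Q (mul Q U V)"] le by force
qed

lemma nrm_Q_scl_le: "U \<in>: Q ==> nrm Q (scl Q c U) <= cmod c * nrm Q U"
proof -
 assume U: "U \<in>: Q"
 have le: "nrm Q (scl Q c U) <= cmod c * (nrm Q U + e)" if e: "e > 0" for e
 proof -
  obtain x where x: "x \<in>: A" "U = cs x" "nrm A x < nrm Q U + e" by (rule Q_rep[OF U e])
  have "nrm Q (scl Q c U) <= cmod c * nrm A x" using x nrm_Q_le[of "scl A c x"] by (simp add: scl_Q nrm_scl)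
  also have "... <= cmod c * (nrm Q U + e)" using x by (intro mult_left_mono) auto
  finally show ?thesis .
 qed
 have "(%n. cmod c * (nrm Q U + 1 / Suc n)) \<longlonglongrightarrow> cmod c * (nrm Q U + 0)"
  by (intro tendsto_intros LIMSEQ_Suc[OF lim_1_over_n])
 then show ?thesis using LIMSEQ_le_const[of _ "cmod c * (nrm Q U + 0)" "nrm Q (scl Q c U)"] le by force
qed

lemma nrm_Q_adj_le: "U \<in>: Q ==> nrm Q (adj Q U) <= nrm Q U"
proof (rule field_le_epsilon)
 fix e :: real assume U: "U \<in>: Q" and e: "e > 0"
 obtain x where x: "x \<in>: A" "U = cs x" "nrm A x < nrm Q U + e" by (rule Q_rep[OF U e])
 then show "nrm Q (adj Q U) <= nrm Q U + e" using nrm_Q_le[of "adj A x"] by (simp add: adj_Q)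
qed

lemma nrm_Q_cstar: "U \<in>: Q ==> nrm Q (mul Q (adj Q U) U) = (nrm Q U)\<^sup>2"
proof (rule antisym)
 assume U: "U \<in>: Q"
 obtain x where x: "x \<in>: A" "U = cs x" using U by (rule Q_cases)
 have "nrm Q (mul Q (adj Q U) U) <= nrm Q (adj Q U) * nrm Q U" by (rule nrm_Q_mul) (use U x in "auto simp: adj_Q")
 also have "... <= nrm Q U * nrm Q U" using U nrm_Q_adj_le nrm_Q_nonneg by (intro mult_right_mono)
 finally show "nrm Q (mul Q (adj Q U) U) <= (nrm Q U)\<^sup>2" by (simp add: power2_eq_square)
 show "(nrm Q U)\<^sup>2 <= nrm Q (mul Q (adj Q U) U)"
 proof (rule field_le_epsilon)
  fix e :: real assume "e > 0"
  then have e: "e / 2 > 0" by simp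
  have XQ: "mul Q (adj Q U) U = cs (mul A (adj A x) x)" using x by (simp add: Q_simps)
  then have "mul Q (adj Q U) U \<in>: Q" using x by simp
  then obtain w where w: "w \<in>: A" "mul Q (adj Q U) U = cs w" "nrm A w < nrm Q (mul Q (adj Q U) U) + e / 2"
   using Q_rep[OF _ e] by metis
  \<comment> \<open>w is an almost optimal representative of U^* U and differs from x^* x by an
    element of the ideal, so the corrected element x + z represents U and has norm controlled by
    w.\<close>
  let ?y = "sub A w (mul A (adj A x) x)"
  have "?y \<in> I" using w x XQ coset_eq_iff[of w "mul A (adj A x) x"] by simp
  then obtain z where z: "z \<in> I" "(nrm A (add A x z))\<^sup>2 <= nrm A (add A (mul A (adj A x) x) ?y) + e / 2"
   using closed_ideal_quotient_cstar[OF I x(1) _ e] by blast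
  have "cs (add A x z) = U" using x z ID(3) coset_eqI[of "add A x z" x] by simp
  then have "nrm Q U <= nrm A (add A x z)" using nrm_Q_le[of "add A x z"] x z ID(3) by auto
  then have "(nrm Q U)\<^sup>2 <= (nrm A (add A x z))\<^sup>2" using nrm_Q_nonneg[OF U] by (intro power_mono)
  also have "... <= nrm A w + e / 2" using z w x by simp
  finally show "(nrm Q U)\<^sup>2 <= nrm Q (mul Q (adj Q U) U) + e" using w by simp
 qed
qed

lemma pre_cstar_Q: "pre_cstar Q"
proof (rule pre_cstar.intro)
 show "comm_group (additive_group Q)"
 proof (rule comm_groupI)
  fix U assume "U \<in>: additive_group Q"
  then obtain x where x: "x \<in>: A" "U = cs x" by (auto elim: Q_cases)
  then show "\<exists>V\<in>carrier (additive_group Q). V \<otimes>\<^bsub>additive_group Q\<^esub> U = \<one>\<^bsub>additive_group Q\<^esub>"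
   by (intro bexI[of _ "cs (scl A (-1) x)"]) (simp_all add: Q_simps add_commute[of "scl A (-1) x"])
 qed (auto elim!: Q_cases simp: Q_simps add_ac)
next
 fix U c assume U: "U \<in>: Q"
 then obtain x where x: "x \<in>: A" "U = cs x" by (rule Q_cases)
 show "nrm Q (scl Q c U) = cmod c * nrm Q U"
 proof (cases "c = 0")
  case True
  then show ?thesis using nrm_Q_scl_le[OF U, of c] nrm_Q_nonneg[of "scl Q c U"] x by (simp add: scl_Q)
 next
  case False
  then have "nrm Q U <= cmod (1 / c) * nrm Q (scl Q c U)"
   using nrm_Q_scl_le[of "scl Q c U" "1 / c"] x by (simp add: scl_Q scl_scl)
  then have "cmod c * nrm Q U <= nrm Q (scl Q c U)" using False by (simp add: norm_divide field_simps)
  then show ?thesis using nrm_Q_scl_le[OF U, of c] by simp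
 qed
qed (auto elim!: Q_cases simp: Q_simps nrm_Q_nonneg nrm_Q_add nrm_Q_mul nrm_Q_cstar scl_add_right
  scl_add_left scl_scl mul_assoc mul_add_left mul_add_right mul_scl_left mul_scl_right adj_add adj_scl adj_mul)

lemma star_hom_coset: "star_hom A Q cs" by (rule star_homI) (simp_all add: Q_simps)

lemma nrm_Q_eq_0:
 assumes "U \<in>: Q" "nrm Q U = 0" shows "U = zer Q"
proof -
 obtain x where x: "x \<in>: A" "U = cs x" using assms(1) by (rule Q_cases)
 have "\<exists>y. y \<in>: A & U = cs y & nrm A y < 1 / Suc n" for n
 proof -
  have "1 / real (Suc n) > 0" by simp
  then show ?thesis using assms(2) by (rule_tac Q_rep[OF assms(1), of "1 / Suc n"]) auto
 qed
 then obtain y where y: "!!n. y n \<in>: A" "!!n. U = cs (y n)" "!!n. nrm A (y n) < 1 / Suc n" by metis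
 have "conv_to A (%n. sub A x (y n)) (sub A x (zer A))"
 proof (intro conv_to_sub conv_to_const)
  show "conv_to A y (zer A)" by (rule conv_to_sandwich[where b = "%n. 1 / Suc n"])
    (use y less_imp_le[OF y(3)] LIMSEQ_Suc[OF lim_1_over_n] in auto)
 qed (use x y in auto)
 moreover have "sub A x (y n) \<in> I" for n using x y coset_eq_iff[of x "y n"] by simp
 ultimately have "x \<in> I" using closed_subspaceD(7)[OF ID(1), of "%n. sub A x (y n)" x] x by simp
 then show ?thesis using x coset_eqI[of x "zer A"] by (simp add: zer_Q)
qed

text \<open>Pass to a subsequence with steps below 2^-n, lift the steps to elements d n of norm
  below 2 * 2^-n, and sum them in \<open>A\<close>. The coset of the sum is a limit of the
  subsequence and hence of the Cauchy sequence.\<close>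

lemma complete_Q:
 assumes X: "cauchy Q X" shows "\<exists>U\<in>carrier Q. conv_to Q X U"
proof -
 interpret Q: pre_cstar Q by (rule pre_cstar_Q)
 have Xc [simp]: "X n \<in>: Q" for n by (rule Q.cauchyD[OF X])
 have "\<exists>k\<ge>n. \<forall>i\<ge>k. \<forall>j\<ge>k. nrm Q (sub Q (X i) (X j)) < (1/2) ^ n" for n
 proof -
  obtain N where "\<forall>i\<ge>N. \<forall>j\<ge>N. nrm Q (sub Q (X i) (X j)) < (1/2) ^ n"
   using Q.cauchyD2[OF X, of "(1/2) ^ n"] by auto
  then show ?thesis by (intro exI[of _ "max n N"]) auto
 qed
 then obtain k0 where k0: "!!n. k0 n \<ge> n"
  "!!n i j. i \<ge> k0 n ==> j \<ge> k0 n ==> nrm Q (sub Q (X i) (X j)) < (1/2) ^ n" by metis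
 \<comment> \<open>Taking the maximum makes the chosen indices increasing, so that consecutive terms
   of the subsequence both lie beyond \<open>k0 n\<close>.\<close>
 define k where "k = (%n. Max (k0 ` {..n}))"
 have k: "k n \<ge> k0 n" "k (Suc n) \<ge> k n" for n by (auto simp: k_def intro!: Max_ge Max_mono)
 have kn: "k n \<ge> n" for n using k(1)[of n] k0(1)[of n] by linarith
 define V where "V = (%n. X (k n))"
 have V [simp]: "V n \<in>: Q" for n by (simp add: V_def)
 have "nrm Q (sub Q (V (Suc n)) (V n)) < (1/2) ^ n" for n unfolding V_def by (rule k0(2)) (use k[of n] in linarith)+
 moreover have "\<exists>d. d \<in>: A & sub Q (V (Suc n)) (V n) = cs d &
   nrm A d < nrm Q (sub Q (V (Suc n)) (V n)) + (1/2) ^ n" for n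
  by (rule Q_rep[of "sub Q (V (Suc n)) (V n)" "(1/2) ^ n"]) auto
 ultimately have "\<exists>d. d \<in>: A & sub Q (V (Suc n)) (V n) = cs d & nrm A d < 2 * (1/2) ^ n" for n
  by (smt (verit))
 then obtain d where d: "!!n. d n \<in>: A" "!!n. sub Q (V (Suc n)) (V n) = cs (d n)"
  "!!n. nrm A (d n) < 2 * (1/2) ^ n" by metis
 obtain x0 where x0: "x0 \<in>: A" "V 0 = cs x0" using Q_cases[OF V[of 0]] by blast
 define x where "x = rec_nat x0 (%n x. add A x (d n))"
 have x_simps: "x 0 = x0" "x (Suc n) = add A (x n) (d n)" for n by (simp_all add: x_def)
 have xc [simp]: "x n \<in>: A" for n by (induction n) (simp_all add: x_simps x0 d)
 have xV: "cs (x n) = V n" for n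
 proof (induction n)
  case (Suc n)
  have "cs (x (Suc n)) = add Q (V n) (sub Q (V (Suc n)) (V n))" using d Suc by (simp add: x_simps flip: add_Q)
  then show ?case by simp
 qed (simp add: x_simps x0)
 have "cauchy A x"
 proof (rule cauchy_if_summable[where b = "%n. 2 * (1/2) ^ n"])
  show "nrm A (sub A (x (Suc n)) (x n)) <= 2 * (1/2) ^ n" for n using d(1,3)[of n] by (simp add: x_simps)
 qed (auto intro!: summable_mult summable_geometric)
 then obtain y where y: "y \<in>: A" "conv_to A x y" by (rule cauchy_limit)
 have "conv_to Q X (cs y)" unfolding conv_to_def
 proof (rule LIMSEQ_I)
  fix e :: real assume "e > 0"
  then have e: "e / 2 > 0" by simp
  obtain N where N: "!!i j. i \<ge> N ==> j \<ge> N ==> nrm Q (sub Q (X i) (X j)) < e / 2"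
   using Q.cauchyD2[OF X e] by blast
  obtain M where M: "!!n. n \<ge> M ==> norm (nrm A (sub A (x n) y) - 0) < e / 2"
   using LIMSEQ_D[OF y(2)[unfolded conv_to_def] e] by blast
  have "nrm Q (sub Q (X n) (cs y)) < e" if n: "n \<ge> max M N" for n
  proof -
   have "nrm Q (sub Q (V n) (cs y)) <= nrm A (sub A (x n) y)"
    using nrm_Q_le[of "sub A (x n) y"] y by (simp add: sub_Q flip: xV)
   moreover have "nrm A (sub A (x n) y) < e / 2" using M[of n] n by simp
   moreover have "nrm Q (sub Q (X n) (V n)) < e / 2" unfolding V_def by (rule N) (use n kn[of n] in linarith)+
   moreover have "nrm Q (sub Q (X n) (cs y)) <= nrm Q (sub Q (X n) (V n)) + nrm Q (sub Q (V n) (cs y))"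
    by (rule Q.nrm_sub_triangle) (use y in auto)
   ultimately show ?thesis by linarith
  qed
  then show "\<exists>N. \<forall>n\<ge>N. norm (nrm Q (sub Q (X n) (cs y)) - 0) < e"
   using y by (intro exI[of _ "max M N"]) auto
 qed
 then show ?thesis using y by auto
qed

lemma cstar_algebra_Q: "cstar_algebra Q"
proof -
 interpret Q: pre_cstar Q by (rule pre_cstar_Q)
 have eq_0: "nrm Q U = 0 \<longleftrightarrow> U = zer Q" if "U \<in>: Q" for U using nrm_Q_eq_0[OF that] by auto
 show ?thesis by (rule cstar_algebra.intro)
   (simp_all add: Q.add_group Q.scl_add_right Q.scl_add_left Q.scl_scl Q.mul_assoc Q.mul_add_left
    Q.mul_add_right Q.mul_scl_left Q.mul_scl_right Q.adj_add Q.adj_scl Q.adj_mul Q.nrm_add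
    Q.nrm_scl Q.nrm_mul Q.nrm_cstar eq_0 complete_Q)
qed

lemma is_unit_coset: "is_unit_of A e ==> is_unit_of Q (cs e)"
 unfolding is_unit_of_def by (auto elim!: Q_cases simp: Q_simps)

end

definition quotient_lift :: "('a => 'b) => 'a set => 'b" where
 "quotient_lift f U = f (SOME x. x \<in> U)"

lemma (in cstar_ideal) star_hom_quotient_lift:
 assumes f: "star_hom A B f" and B: "pre_cstar B" and ker: "!!x. x \<in> I ==> f x = zer B"
 shows "star_hom Q B (quotient_lift f)" "x \<in>: A ==> quotient_lift f (cs x) = f x"
proof -
 interpret B: pre_cstar B by fact
 have eq: "quotient_lift f (cs x) = f x" if x: "x \<in>: A" for x
 proof -
  have "(SOME y. y \<in> cs x) \<in> cs x" by (rule someI[of _ x]) (rule coset_self[OF x])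
  then obtain y where y: "y = (SOME y. y \<in> cs x)" "y \<in>: A" "sub A y x \<in> I"
   using x by (auto simp: mem_coset_iff)
  have "sub B (f y) (f x) = zer B" using star_hom_sub[OF f pre.pre_cstar_axioms y(2) x] ker[OF y(3)] by simp
  then show ?thesis using y x by (simp add: quotient_lift_def B.sub_eq_zer_iff star_homD[OF f])
 qed
 then show "x \<in>: A ==> quotient_lift f (cs x) = f x" .
 show "star_hom Q B (quotient_lift f)" by (rule star_homI) (auto elim!: Q_cases simp: Q_simps eq star_homD[OF f])
qed

lemma star_hom_kernel_ideal:
 assumes f: "star_hom A B f" and A: "cstar_algebra A" and B: "cstar_algebra B"
 shows "closed_ideal A {x \<in> carrier A. f x = zer B}"
proof -
 interpret A: cstar_algebra A by fact
 interpret B: cstar_algebra B by fact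
 have "f x = zer B" if "!!n. s n \<in>: A & f (s n) = zer B" "x \<in>: A" "conv_to A s x" for s x
  using star_hom_conv_to[OF f A B.pre.pre_cstar_axioms that(3)] that star_homD(1)[OF f]
  by (intro B.conv_to_unique[of "%n. f (s n)"]) auto
 moreover have "f (zer A) = zer B" by (rule star_hom_zer[OF f A.pre.pre_cstar_axioms B.pre.pre_cstar_axioms])
 ultimately show ?thesis unfolding closed_ideal_def closed_subspace_def by (auto simp: star_homD[OF f])
qed

lemma star_hom_ideal_gen_lift:
 assumes f: "star_hom A B f" and A: "cstar_algebra A" and B: "cstar_algebra B"
  and S: "S <= carrier A" "!!x. x \<in> S ==> f x = zer B"
 shows "star_hom (quotient A (ideal_gen A S)) B (quotient_lift f)"
  "x \<in>: A ==> quotient_lift f (coset A (ideal_gen A S) x) = f x"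
proof -
 interpret A: cstar_algebra A by fact
 interpret B: cstar_algebra B by fact
 interpret cstar_ideal A "ideal_gen A S" by unfold_locales (rule A.closed_ideal_ideal_gen[OF S(1)])
 have "ideal_gen A S <= {x \<in> carrier A. f x = zer B}"
  by (rule A.ideal_gen_least[OF star_hom_kernel_ideal[OF f A B]]) (use S in auto)
 then show "star_hom (quotient A (ideal_gen A S)) B (quotient_lift f)"
  "x \<in>: A ==> quotient_lift f (coset A (ideal_gen A S) x) = f x"
  using star_hom_quotient_lift[OF f B.pre.pre_cstar_axioms] by auto
qed

section \<open>The Hilbert space of square-summable families as a Banach space\<close>

section \<open>The Hilbert space of square-summable families\<close>

text \<open>As a type of its own the space can carry the class of Banach spaces, and operators on it
  can be bounded linear functions of the library.\<close>

typedef 'i l2 = "ell2 UNIV :: ('i => complex) set" morphisms l2_app Abs_l2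
 by (rule exI[of _ "%_. 0"]) (simp add: ell2_def)

lemma ell2_UNIV_iff: "xi \<in> ell2 UNIV \<longleftrightarrow> (%i. (cmod (xi i))\<^sup>2) summable_on UNIV"
 by (simp add: ell2_def)

lemma l2_app_summable: "(%i. (cmod (l2_app x i))\<^sup>2) summable_on UNIV"
 using l2_app[of x] by (simp add: ell2_UNIV_iff)

lemma l2_eqI: "(!!i. l2_app x i = l2_app y i) ==> x = y" by (metis ext l2_app_inject)

lemma ell2_add: 
 assumes "xi \<in> ell2 UNIV" "\<eta> \<in> ell2 UNIV" shows "(%i. xi i + \<eta> i) \<in> ell2 UNIV"
proof -
 have "(cmod (xi i + \<eta> i))\<^sup>2 <= 2 * (cmod (xi i))\<^sup>2 + 2 * (cmod (\<eta> i))\<^sup>2" for i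
 proof -
  have "(cmod (xi i + \<eta> i))\<^sup>2 <= (cmod (xi i) + cmod (\<eta> i))\<^sup>2"
   by (intro power_mono norm_triangle_ineq) simp
  then show ?thesis using sum_squares_bound[of "cmod (xi i)" "cmod (\<eta> i)"] by (simp add: power2_sum)
 qed
 moreover have "(%i. 2 * (cmod (xi i))\<^sup>2 + 2 * (cmod (\<eta> i))\<^sup>2) summable_on UNIV"
  using assms by (intro summable_on_add summable_on_cmult_right) (auto simp: ell2_UNIV_iff)
 ultimately show ?thesis unfolding ell2_UNIV_iff
  using Infinite_Sum.abs_summable_on_comparison_test'[of "%i. 2 * (cmod (xi i))\<^sup>2 + 2 * (cmod (\<eta> i))\<^sup>2" UNIV "%i. (cmod (xi i + \<eta> i))\<^sup>2"]
  by simp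
qed

lemma ell2_scale: "xi \<in> ell2 UNIV ==> (%i. c * xi i) \<in> ell2 UNIV"
 by (simp add: ell2_UNIV_iff norm_mult power_mult_distrib summable_on_cmult_right)

text \<open>The inner product is the real part of the complex one. Complex scalars act through
  \<open>scaleC\<close>, and complex linearity of operators is imposed separately.\<close>

instantiation l2 :: (type) real_inner
begin

definition "0 = Abs_l2 (%_. 0)"
definition "x + y = Abs_l2 (%i. l2_app x i + l2_app y i)"
definition "- x = Abs_l2 (%i. - l2_app x i)"
definition "x - y = (x :: 'a l2) + - y"
definition "scaleR r x = Abs_l2 (%i. complex_of_real r * l2_app x i)"
definition "inner x y = (\<Sum>\<^sub>\<infinity>i. inner (l2_app x i) (l2_app y i))"
definition "norm x = sqrt (inner x (x :: 'a l2))"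
definition "sgn x = inverse (norm x) *\<^sub>R (x :: 'a l2)"
definition "dist x y = norm (x - y :: 'a l2)"
definition "(uniformity :: ('a l2 \<times> 'a l2) filter) = (INF e\<in>{0<..}. principal {(x, y). dist x y < e})"
definition "open (U :: 'a l2 set) \<longleftrightarrow> (\<forall>x\<in>U. \<forall>\<^sub>F (x', y) in uniformity. x' = x --> y \<in> U)"

lemma l2_app_zero [simp]: "l2_app 0 i = 0" unfolding zero_l2_def by (subst Abs_l2_inverse) (simp_all add: ell2_UNIV_iff)

lemma l2_app_add [simp]: "l2_app (x + y) i = l2_app x i + l2_app y i"
 unfolding plus_l2_def by (subst Abs_l2_inverse) (simp_all add: ell2_add l2_app)

lemma l2_app_uminus [simp]: "l2_app (- x) i = - l2_app x i"
 unfolding uminus_l2_def by (subst Abs_l2_inverse) (simp_all add: ell2_scale[of _ "-1", simplified] l2_app)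

lemma l2_app_minus [simp]: "l2_app (x - y) i = l2_app x i - l2_app y i" by (simp add: minus_l2_def)

lemma l2_app_scaleR [simp]: "l2_app (r *\<^sub>R x) i = complex_of_real r * l2_app x i"
 unfolding scaleR_l2_def by (subst Abs_l2_inverse) (simp_all add: ell2_scale l2_app)

lemma inner_l2_summable: "(%i. inner (l2_app x i) (l2_app y i)) summable_on UNIV"
proof (rule Infinite_Sum.abs_summable_summable, rule Infinite_Sum.abs_summable_on_comparison_test')
 show "(%i. (cmod (l2_app x i))\<^sup>2 + (cmod (l2_app y i))\<^sup>2) summable_on UNIV"
  by (intro summable_on_add l2_app_summable)
 show "norm (inner (l2_app x i) (l2_app y i)) <= (cmod (l2_app x i))\<^sup>2 + (cmod (l2_app y i))\<^sup>2" for i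
  using Cauchy_Schwarz_ineq2[of "l2_app x i" "l2_app y i"]
   sum_squares_bound[of "cmod (l2_app x i)" "cmod (l2_app y i)"] by (simp add: real_norm_def)
qed

instance
proof
 fix x y z :: "'a l2" and a b :: real
 show "x + y + z = x + (y + z)" "x + y = y + x" "0 + x = x" "- x + x = 0" "x - y = x + - y"
  "a *\<^sub>R (x + y) = a *\<^sub>R x + a *\<^sub>R y" "(a + b) *\<^sub>R x = a *\<^sub>R x + b *\<^sub>R x" "a *\<^sub>R b *\<^sub>R x = (a * b) *\<^sub>R x"
  "1 *\<^sub>R x = x" by (rule l2_eqI; simp add: algebra_simps)+
 show "sgn x = inverse (norm x) *\<^sub>R x" by (rule sgn_l2_def)
 show "dist x y = norm (x - y)" by (rule dist_l2_def)
 show "(uniformity :: ('a l2 \<times> 'a l2) filter) = (INF e\<in>{0<..}. principal {(x, y). dist x y < e})"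
  by (rule uniformity_l2_def)
 show "open U \<longleftrightarrow> (\<forall>x\<in>U. \<forall>\<^sub>F (x', y) in uniformity. x' = x --> y \<in> U)" for U :: "'a l2 set"
  by (rule open_l2_def)
 show "norm x = sqrt (inner x x)" by (rule norm_l2_def)
 show "inner x y = inner y x" by (simp add: inner_l2_def inner_commute)
 show "inner (x + y) z = inner x z + inner y z"
  unfolding inner_l2_def by (simp add: inner_add_left infsum_add inner_l2_summable)
 show "inner (a *\<^sub>R x) y = a * inner x y" unfolding inner_l2_def
  by (simp add: infsum_cmult_right inner_l2_summable flip: scaleR_conv_of_real)
 show "0 <= inner x x" unfolding inner_l2_def by (rule infsum_nonneg) simp
 show "inner x x = 0 \<longleftrightarrow> x = 0"
 proof
  assume "inner x x = 0"
  then have "inner (l2_app x i) (l2_app x i) = 0" for i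
   using nonneg_infsum_le_0D[of "%i. inner (l2_app x i) (l2_app x i)" UNIV i] inner_l2_summable[of x x]
   by (simp add: inner_l2_def)
  then show "x = 0" by (intro l2_eqI) simp
 qed (simp add: inner_l2_def)
qed

end

lemma norm_l2_sq: "(norm x)\<^sup>2 = (\<Sum>\<^sub>\<infinity>i. (cmod (l2_app x i))\<^sup>2)"
 by (simp add: norm_eq_sqrt_inner inner_l2_def power2_norm_eq_inner infsum_nonneg)

lemma norm_l2_eq: "norm x = ell2_norm (l2_app x)" unfolding ell2_norm_def norm_l2_sq[symmetric] by simp

lemma finite_sum_le_norm_l2: "finite F ==> (\<Sum>i\<in>F. (cmod (l2_app x i))\<^sup>2) <= (norm x)\<^sup>2"
 unfolding norm_l2_sq by (rule finite_sum_le_infsum) (auto simp: l2_app_summable)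

lemma cmod_l2_app_le: "cmod (l2_app x i) <= norm x"
 using finite_sum_le_norm_l2[of "{i}" x] by (simp add: power2_le_iff_abs_le)

lemma ell2I_bound:
 assumes "!!F. finite F ==> (\<Sum>i\<in>F. (cmod (xi i))\<^sup>2) <= b"
 shows "xi \<in> ell2 UNIV" "(\<Sum>\<^sub>\<infinity>i. (cmod (xi i))\<^sup>2) <= b"
proof -
 show "xi \<in> ell2 UNIV" unfolding ell2_UNIV_iff
  by (rule nonneg_bdd_above_summable_on) (auto intro!: bdd_aboveI2 assms)
 then show "(\<Sum>\<^sub>\<infinity>i. (cmod (xi i))\<^sup>2) <= b"
  by (intro infsum_le_finite_sums assms) (auto simp: ell2_UNIV_iff)
qed

text \<open>A Cauchy sequence converges in each coordinate. Bounds on finite partial sums survive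
  this limit, so they show both that the coordinatewise limit is square-summable and that the
  convergence is in norm.\<close>

instance l2 :: (type) complete_space
proof
 fix X :: "nat => 'a l2" assume X: "Cauchy X"
 have "Cauchy (%n. l2_app (X n) i)" for i
 proof (rule CauchyI)
  fix e :: real assume "e > 0"
  then obtain M where M: "!!m n. m \<ge> M ==> n \<ge> M ==> norm (X m - X n) < e" using CauchyD[OF X] by blast
  then show "\<exists>M. \<forall>m\<ge>M. \<forall>n\<ge>M. norm (l2_app (X m) i - l2_app (X n) i) < e"
   using cmod_l2_app_le le_less_trans by (metis l2_app_minus)
 qed
 then have "\<exists>l. (%n. l2_app (X n) i) \<longlonglongrightarrow> l" for i
  using Cauchy_convergent_iff convergent_def by blast
 then obtain L where L: "!!i. (%n. l2_app (X n) i) \<longlonglongrightarrow> L i" by metis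
 have close: "(\<Sum>i\<in>F. (cmod (l2_app (X n) i - L i))\<^sup>2) <= e\<^sup>2"
  if M: "!!m. m \<ge> M ==> norm (X n - X m) <= e" and F: "finite F" for n M F and e :: real
 proof -
  have "(\<Sum>i\<in>F. (cmod (l2_app (X n - X m) i))\<^sup>2) <= e\<^sup>2" if "m \<ge> M" for m
   using finite_sum_le_norm_l2[OF F, of "X n - X m"] power_mono[OF M[OF that], of 2] by simp
  moreover have "(%m. \<Sum>i\<in>F. (cmod (l2_app (X n - X m) i))\<^sup>2) \<longlonglongrightarrow> (\<Sum>i\<in>F. (cmod (l2_app (X n) i - L i))\<^sup>2)"
   unfolding l2_app_minus by (intro tendsto_intros L)
  ultimately show ?thesis by (intro LIMSEQ_le_const2) auto
 qed
 have conv: "\<exists>M. \<forall>n\<ge>M. (%i. l2_app (X n) i - L i) \<in> ell2 UNIV & (\<Sum>\<^sub>\<infinity>i. (cmod (l2_app (X n) i - L i))\<^sup>2) <= e\<^sup>2"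
  if "e > 0" for e :: real
 proof -
  obtain M where M: "!!m n. m \<ge> M ==> n \<ge> M ==> norm (X m - X n) < e"
   using CauchyD[OF X \<open>e > 0\<close>] by blast
  have "(\<Sum>i\<in>F. (cmod (l2_app (X n) i - L i))\<^sup>2) <= e\<^sup>2" if "n \<ge> M" "finite F" for n F
   by (rule close[of M]) (use M[OF that(1)] that less_imp_le in auto)
  then have "(%i. l2_app (X n) i - L i) \<in> ell2 UNIV & (\<Sum>\<^sub>\<infinity>i. (cmod (l2_app (X n) i - L i))\<^sup>2) <= e\<^sup>2"
   if "n \<ge> M" for n using ell2I_bound[of "%i. l2_app (X n) i - L i" "e\<^sup>2"] that by simp
  then show ?thesis by blast
 qed
 obtain M where "(%i. l2_app (X M) i - L i) \<in> ell2 UNIV" using conv[of 1] by auto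
 then have "(%i. l2_app (X M) i + (-1) * (l2_app (X M) i - L i)) \<in> ell2 UNIV" by (intro ell2_add ell2_scale l2_app)
 then have L2: "L \<in> ell2 UNIV" by simp
 have "X \<longlonglongrightarrow> Abs_l2 L"
 proof (rule LIMSEQ_I)
  fix e :: real assume "e > 0"
  then have "e / 2 > 0" by simp
  then obtain M where "\<forall>n\<ge>M. (%i. l2_app (X n) i - L i) \<in> ell2 UNIV &
    (\<Sum>\<^sub>\<infinity>i. (cmod (l2_app (X n) i - L i))\<^sup>2) <= (e / 2)\<^sup>2" using conv by metis
  then have M: "!!n. n \<ge> M ==> (\<Sum>\<^sub>\<infinity>i. (cmod (l2_app (X n) i - L i))\<^sup>2) <= (e / 2)\<^sup>2"
   by simp
  have "norm (X n - Abs_l2 L) < e" if "n \<ge> M" for n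
  proof -
   have "(norm (X n - Abs_l2 L))\<^sup>2 <= (e / 2)\<^sup>2"
    unfolding norm_l2_sq using M[OF that] by (simp add: Abs_l2_inverse[OF L2])
   then have "norm (X n - Abs_l2 L) <= e / 2" by (rule power2_le_imp_le) (use \<open>e > 0\<close> in simp)
   then show ?thesis using \<open>e > 0\<close> by simp
  qed
  then show "\<exists>M. \<forall>n\<ge>M. norm (X n - Abs_l2 L) < e" by blast
 qed
 then show "convergent X" by (auto simp: convergent_def)
qed

instance l2 :: (type) banach ..

definition scaleC :: "complex => 'i l2 => 'i l2" where
 "scaleC c x = Abs_l2 (%i. c * l2_app x i)"

lemma l2_app_scaleC [simp]: "l2_app (scaleC c x) i = c * l2_app x i"
 unfolding scaleC_def by (subst Abs_l2_inverse) (simp_all add: ell2_scale l2_app)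

lemma norm_scaleC: "norm (scaleC c x) = cmod c * norm x"
proof -
 have "(norm (scaleC c x))\<^sup>2 = (cmod c * norm x)\<^sup>2"
  by (simp add: norm_l2_sq norm_mult power_mult_distrib infsum_cmult_right l2_app_summable)
 then show ?thesis by simp
qed

lemma bounded_linear_scaleC: "bounded_linear (scaleC c)" by (rule bounded_linear_intro[where K = "cmod c"])
  (auto intro!: l2_eqI simp: algebra_simps norm_scaleC)

lemma inner_scaleC: "inner (scaleC c x) y = inner x (scaleC (cnj c) y)"
 unfolding inner_l2_def by (intro infsum_cong) (simp add: inner_complex_def algebra_simps)

definition delta :: "'i => 'i l2" where
 "delta i = Abs_l2 (%j. if j = i then 1 else 0)"

lemma ell2_finite_support: "finite {i. xi i ~= 0} ==> xi \<in> ell2 UNIV"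
proof -
 assume fin: "finite {i. xi i ~= 0}"
 have "(%i. (cmod (xi i))\<^sup>2) summable_on {i. xi i ~= 0}" using fin by simp
 then show ?thesis unfolding ell2_UNIV_iff by (subst summable_on_cong_neutral[of "{i. xi i ~= 0}" UNIV]) auto
qed

lemma l2_app_delta: "l2_app (delta i) j = (if j = i then 1 else 0)"
 unfolding delta_def by (subst Abs_l2_inverse) (auto intro: ell2_finite_support)

text \<open>The real inner product sees only real parts, so two test vectors are needed to recover
  one complex coordinate.\<close>

lemma inner_delta: "inner (delta i) x = Re (l2_app x i)" "inner (scaleC \<i> (delta i)) x = Im (l2_app x i)"
proof -
 have one: "(\<Sum>\<^sub>\<infinity>j. inner ((if j = i then c else 0) :: complex) (l2_app x j)) = inner c (l2_app x i)" for c
 proof -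
  have "(\<Sum>\<^sub>\<infinity>j. inner ((if j = i then c else 0) :: complex) (l2_app x j))
    = (\<Sum>\<^sub>\<infinity>j\<in>{i}. inner ((if j = i then c else 0) :: complex) (l2_app x j))"
   by (rule infsum_cong_neutral) auto
  then show ?thesis by simp
 qed
 show "inner (delta i) x = Re (l2_app x i)"
  unfolding inner_l2_def l2_app_delta by (simp only: one) (simp add: inner_complex_def)
 have "c * (if j = i then 1 else 0) = (if j = i then c else 0)" for c :: complex and j by simp
 then show "inner (scaleC \<i> (delta i)) x = Im (l2_app x i)"
  unfolding inner_l2_def l2_app_delta l2_app_scaleC by (simp only: one) (simp add: inner_complex_def)
qed

section \<open>The C*-algebra of adjointable operators on l2 and their matrix entries\<close>

section \<open>The C*-algebra of bounded operators\<close>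

type_synonym 'i l2_op = "'i l2 \<Rightarrow>\<^sub>L 'i l2"

definition clinear_op :: "'i l2_op => bool" where
 "clinear_op T \<longleftrightarrow> (\<forall>c x. blinfun_apply T (scaleC c x) = scaleC c (blinfun_apply T x))"

text \<open>
 For complex linear operators, adjointness with respect to the real part of the inner product is
 the usual one.
\<close>

definition adjoint_ops :: "'i l2_op => 'i l2_op => bool" where
 "adjoint_ops T S \<longleftrightarrow> (\<forall>x y. inner (blinfun_apply T x) y = inner x (blinfun_apply S y))"

definition mult_op :: "complex => 'i l2_op" where
 "mult_op c = Blinfun (scaleC c)"

text \<open>Every bounded complex linear operator on a Hilbert space has an adjoint, so this is
  B(l2). Asking for the adjoint in the carrier replaces an appeal to the Riesz representation
  theorem.\<close>

definition l2_ops :: "'i l2_op star_algebra" where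
 "l2_ops = \<lparr>carrier = {T. clinear_op T & (\<exists>S. adjoint_ops T S)}, zer = 0, add = (+),
  scl = (%c T. mult_op c o\<^sub>L T), mul = (o\<^sub>L), adj = (%T. THE S. adjoint_ops T S), nrm = norm\<rparr>"

lemma mult_op_apply [simp]: "blinfun_apply (mult_op c) x = scaleC c x"
 by (simp add: mult_op_def bounded_linear_Blinfun_apply bounded_linear_scaleC)

lemma adjoint_ops_unique: "adjoint_ops T S ==> adjoint_ops T S' ==> S = S'"
 unfolding adjoint_ops_def by (intro blinfun_eqI) (metis vector_eq_ldot)

lemma adjoint_ops_sym: "adjoint_ops T S ==> adjoint_ops S T" unfolding adjoint_ops_def by (metis inner_commute)

lemma adjoint_ops_clinear:
 assumes "clinear_op T" "adjoint_ops T S" shows "clinear_op S" unfolding clinear_op_def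
proof (intro allI)
 fix c y
 have "inner x (blinfun_apply S (scaleC c y)) = inner x (scaleC c (blinfun_apply S y))" for x
  using assms inner_scaleC[of "cnj c" x] inner_scaleC[of "cnj c" "blinfun_apply T x" y]
  unfolding adjoint_ops_def clinear_op_def by (metis complex_cnj_cnj)
 then show "blinfun_apply S (scaleC c y) = scaleC c (blinfun_apply S y)" by (metis vector_eq_ldot)
qed

lemma l2_ops_simps [simp]:
 "zer l2_ops = 0" "add l2_ops = (+)" "scl l2_ops c T = mult_op c o\<^sub>L T" "mul l2_ops = (o\<^sub>L)" "nrm l2_ops = norm"
 by (simp_all add: l2_ops_def)

lemma l2_opsI: "clinear_op T ==> adjoint_ops T S ==> T \<in>: l2_ops" by (auto simp: l2_ops_def)

lemma adj_l2_ops_eq: "adjoint_ops T S ==> adj l2_ops T = S"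
 unfolding l2_ops_def star_algebra.simps by (rule the_equality) (auto dest: adjoint_ops_unique)

lemma l2_opsD:
 assumes "T \<in>: l2_ops"
 shows "clinear_op T" "adjoint_ops T (adj l2_ops T)" using assms adj_l2_ops_eq[of T] by (auto simp: l2_ops_def)

lemma clinear_opD: "clinear_op T ==> blinfun_apply T (scaleC c x) = scaleC c (blinfun_apply T x)"
 by (simp add: clinear_op_def)

lemma adjoint_opsD: "adjoint_ops T S ==> inner (blinfun_apply T x) y = inner x (blinfun_apply S y)"
 by (simp add: adjoint_ops_def)

lemma norm_adjoint_le:
 assumes "adjoint_ops T S" shows "norm S <= norm T"
proof (rule norm_blinfun_bound)
 fix y
 have "norm (S y) * norm (S y) = inner (T (S y)) y"
  using adjoint_opsD[OF assms, of "S y" y] by (simp add: power2_norm_eq_inner flip: power2_eq_square)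
 also have "... <= norm (T (S y)) * norm y" by (rule norm_cauchy_schwarz)
 also have "... <= (norm T * norm (S y)) * norm y" by (intro mult_right_mono norm_blinfun) simp
 finally have "norm (S y) * norm (S y) <= (norm T * norm y) * norm (S y)" by (simp add: mult_ac)
 then show "norm (S y) <= norm T * norm y" by (cases "norm (S y) = 0") (auto simp: mult_le_cancel_right)
qed simp

lemma norm_mult_op_le: "norm (mult_op c) <= cmod c" by (rule norm_blinfun_bound) (auto simp: norm_scaleC)

lemma adjoint_ops_add: "adjoint_ops T S ==> adjoint_ops T' S' ==> adjoint_ops (T + T') (S + S')"
 by (simp add: adjoint_ops_def blinfun.add_left inner_add_left inner_add_right)

lemma adjoint_ops_compose: "adjoint_ops T S ==> adjoint_ops T' S' ==> adjoint_ops (T o\<^sub>L T') (S' o\<^sub>L S)"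
 by (simp add: adjoint_ops_def)

lemma adjoint_ops_mult: "adjoint_ops (mult_op c) (mult_op (cnj c))" by (simp add: adjoint_ops_def inner_scaleC)

lemma scaleC_add: "scaleC c (x + y) = scaleC c x + scaleC c y"
 and scaleC_add_left: "scaleC (c + d) x = scaleC c x + scaleC d x"
 and scaleC_scaleC: "scaleC c (scaleC d x) = scaleC (c * d) x"
 and scaleC_one [simp]: "scaleC 1 x = x"
 and scaleC_minus_one: "scaleC (-1) x = - x" by (rule l2_eqI; simp add: algebra_simps)+

lemma pre_cstar_l2_ops: "pre_cstar (l2_ops :: 'i l2_op star_algebra)"
proof (rule pre_cstar.intro)
 have neg: "- T \<in>: l2_ops" if "T \<in>: l2_ops" for T :: "'i l2_op"
 proof (rule l2_opsI)
  show "clinear_op (- T)" using l2_opsD(1)[OF that] by (auto simp: clinear_op_def blinfun.minus_left intro!: l2_eqI)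
  show "adjoint_ops (- T) (- adj l2_ops T)" using l2_opsD(2)[OF that] by (simp add: adjoint_ops_def blinfun.minus_left)
 qed
 have zero: "0 \<in>: (l2_ops :: 'i l2_op star_algebra)"
  by (rule l2_opsI[where S = 0]) (auto simp: clinear_op_def adjoint_ops_def intro!: l2_eqI)
 have add: "T + T' \<in>: l2_ops" if "T \<in>: l2_ops" "T' \<in>: l2_ops" for T T' :: "'i l2_op"
  by (rule l2_opsI, use that[THEN l2_opsD(1)] in "simp add: clinear_op_def blinfun.add_left scaleC_add")
   (rule adjoint_ops_add[OF that[THEN l2_opsD(2)]])
 show "comm_group (additive_group (l2_ops :: 'i l2_op star_algebra))"
 proof (rule comm_groupI)
  fix T assume "T \<in>: (additive_group (l2_ops :: 'i l2_op star_algebra))"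
  then show "\<exists>S\<in>carrier (additive_group l2_ops). S \<otimes>\<^bsub>additive_group l2_ops\<^esub> T = \<one>\<^bsub>additive_group l2_ops\<^esub>"
   by (intro bexI[of _ "- T"]) (simp_all add: neg)
 qed (simp_all add: zero add ac_simps)
 have adjc: "adj l2_ops T \<in>: l2_ops" if "T \<in>: l2_ops" for T :: "'i l2_op"
  using l2_opsD[OF that] adjoint_ops_clinear adjoint_ops_sym by (intro l2_opsI)
 fix T S R :: "'i l2_op" and c d
 assume T: "T \<in>: l2_ops"
 note TD = l2_opsD[OF T]
 have sclA: "adjoint_ops (mult_op c o\<^sub>L T) (adj l2_ops T o\<^sub>L mult_op (cnj c))"
  by (rule adjoint_ops_compose[OF adjoint_ops_mult TD(2)])
 show "scl l2_ops c T \<in>: l2_ops" by (rule l2_opsI[OF _ sclA[simplified l2_ops_simps(3)[symmetric]]])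
   (use TD(1) in "simp add: clinear_op_def scaleC_scaleC mult.commute")
 show "scl l2_ops (c + d) T = add l2_ops (scl l2_ops c T) (scl l2_ops d T)"
  "scl l2_ops c (scl l2_ops d T) = scl l2_ops (c * d) T" "scl l2_ops 1 T = T"
  by (auto intro!: blinfun_eqI simp: blinfun.add_left scaleC_add_left scaleC_scaleC)
 show "adj l2_ops T \<in>: l2_ops" by (rule adjc[OF T])
 show "adj l2_ops (adj l2_ops T) = T" by (rule adj_l2_ops_eq) (rule adjoint_ops_sym[OF TD(2)])
 show "adj l2_ops (scl l2_ops c T) = scl l2_ops (cnj c) (adj l2_ops T)"
  using adj_l2_ops_eq[OF sclA] l2_opsD(1)[OF adjc[OF T]] by (auto intro!: blinfun_eqI simp: clinear_op_def)
 show "0 <= nrm l2_ops T" by simp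
 have scl_le: "norm (mult_op c o\<^sub>L T) <= cmod c * norm T" for c and T :: "'i l2_op"
  by (rule order_trans[OF norm_blinfun_compose]) (simp add: mult_right_mono norm_mult_op_le)
 show "nrm l2_ops (scl l2_ops c T) = cmod c * nrm l2_ops T"
 proof (cases "c = 0")
  case True
  then show ?thesis using scl_le[of c T] by simp
 next
  case False
  have "mult_op (1 / c) o\<^sub>L (mult_op c o\<^sub>L T) = T"
   using False by (auto intro!: blinfun_eqI simp: scaleC_scaleC)
  then have "norm T <= cmod (1 / c) * norm (mult_op c o\<^sub>L T)"
   using scl_le[of "1 / c" "mult_op c o\<^sub>L T"] by simp
  then have "cmod c * norm T <= norm (mult_op c o\<^sub>L T)" using False by (simp add: norm_divide field_simps)
  then show ?thesis using scl_le[of c T] by simp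
 qed
 show "nrm l2_ops (mul l2_ops (adj l2_ops T) T) = (nrm l2_ops T)\<^sup>2"
 proof (rule antisym)
  let ?S = "adj l2_ops T"
  have "norm (?S o\<^sub>L T) <= norm ?S * norm T" by (rule norm_blinfun_compose)
  also have "... <= norm T * norm T" by (intro mult_right_mono norm_adjoint_le TD(2)) simp
  finally show "nrm l2_ops (mul l2_ops ?S T) <= (nrm l2_ops T)\<^sup>2" by (simp add: power2_eq_square)
  have "norm T <= sqrt (norm (?S o\<^sub>L T))"
  proof (rule norm_blinfun_bound)
   fix x
   have "(norm (T x))\<^sup>2 = inner x (?S (T x))"
    using adjoint_opsD[OF TD(2), of x "T x"] by (simp add: power2_norm_eq_inner)
   also have "... <= norm x * norm ((?S o\<^sub>L T) x)" using norm_cauchy_schwarz[of x "?S (T x)"] by simp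
   also have "... <= norm x * (norm (?S o\<^sub>L T) * norm x)" by (intro mult_left_mono norm_blinfun) simp
   also have "... = (sqrt (norm (?S o\<^sub>L T)) * norm x)\<^sup>2" by (simp add: power2_eq_square)
   finally show "norm (T x) <= sqrt (norm (?S o\<^sub>L T)) * norm x" by (rule power2_le_imp_le) simp
  qed simp
  then have "(norm T)\<^sup>2 <= (sqrt (norm (?S o\<^sub>L T)))\<^sup>2" by (intro power_mono) auto
  then show "(nrm l2_ops T)\<^sup>2 <= nrm l2_ops (mul l2_ops ?S T)" by simp
 qed
 assume S: "S \<in>: l2_ops"
 note SD = l2_opsD[OF S]
 show "scl l2_ops c (add l2_ops T S) = add l2_ops (scl l2_ops c T) (scl l2_ops c S)"
  by (auto intro!: blinfun_eqI simp: blinfun.add_left scaleC_add)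
 show "mul l2_ops T S \<in>: l2_ops"
  using l2_opsI[OF _ adjoint_ops_compose[OF TD(2) SD(2)]] TD(1) SD(1) by (simp add: clinear_op_def)
 show "mul l2_ops (scl l2_ops c T) S = scl l2_ops c (mul l2_ops T S)" by (auto intro!: blinfun_eqI)
 show "mul l2_ops T (scl l2_ops c S) = scl l2_ops c (mul l2_ops T S)"
  using TD(1) by (auto intro!: blinfun_eqI simp: clinear_op_def)
 show "adj l2_ops (add l2_ops T S) = add l2_ops (adj l2_ops T) (adj l2_ops S)"
  using adj_l2_ops_eq[OF adjoint_ops_add[OF TD(2) SD(2)]] by simp
 show "adj l2_ops (mul l2_ops T S) = mul l2_ops (adj l2_ops S) (adj l2_ops T)"
  using adj_l2_ops_eq[OF adjoint_ops_compose[OF TD(2) SD(2)]] by simp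
 show "nrm l2_ops (add l2_ops T S) <= nrm l2_ops T + nrm l2_ops S" by (simp add: norm_triangle_ineq)
 show "nrm l2_ops (mul l2_ops T S) <= nrm l2_ops T * nrm l2_ops S" by (simp add: norm_blinfun_compose)
 assume R: "R \<in>: l2_ops"
 show "mul l2_ops (mul l2_ops T S) R = mul l2_ops T (mul l2_ops S R)"
  "mul l2_ops (add l2_ops T S) R = add l2_ops (mul l2_ops T R) (mul l2_ops S R)"
  "mul l2_ops T (add l2_ops S R) = add l2_ops (mul l2_ops T S) (mul l2_ops T R)"
  by (auto intro!: blinfun_eqI simp: blinfun.add_left blinfun.add_right)
qed

lemma sub_l2_ops [simp]: "sub l2_ops T S = T - S"
 by (auto intro!: blinfun_eqI simp: sub_def blinfun.add_left blinfun.diff_left blinfun.minus_left scaleC_minus_one)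

lemma cstar_algebra_l2_ops: "cstar_algebra (l2_ops :: 'i l2_op star_algebra)"
proof -
 interpret L: pre_cstar "l2_ops :: 'i l2_op star_algebra" by (rule pre_cstar_l2_ops)
 have complete: "\<exists>T\<in>carrier l2_ops. conv_to l2_ops X T" if X: "cauchy l2_ops X" for X :: "nat => 'i l2_op"
 proof -
  have Xc: "X n \<in>: l2_ops" for n by (rule L.cauchyD[OF X])
  have C: "Cauchy X" using L.cauchyD2[OF X] by (intro CauchyI) simp
  then obtain T where T: "X \<longlonglongrightarrow> T" using Cauchy_convergent_iff convergent_def by blast
  \<comment> \<open>The norm limit T also needs an adjoint. Taking adjoints is isometric, so the
    adjoints converge as well, and their limit is adjoint to T.\<close>
  have "Cauchy (%n. adj l2_ops (X n))"
  proof (rule CauchyI)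
   fix e :: real assume "e > 0"
   then obtain M where M: "\<forall>m\<ge>M. \<forall>n\<ge>M. norm (X m - X n) < e" using CauchyD[OF C] by blast
   have "norm (adj l2_ops (X m) - adj l2_ops (X n)) = norm (X m - X n)" for m n
    using L.nrm_adj[of "sub l2_ops (X m) (X n)"] L.adj_sub[OF Xc[of m] Xc[of n]]
     L.sub_closed[OF Xc[of m] Xc[of n]] by simp
   then show "\<exists>M. \<forall>m\<ge>M. \<forall>n\<ge>M. norm (adj l2_ops (X m) - adj l2_ops (X n)) < e" using M by auto
  qed
  then obtain S where S: "(%n. adj l2_ops (X n)) \<longlonglongrightarrow> S" using Cauchy_convergent_iff convergent_def by blast
  have Tx: "(%n. blinfun_apply (X n) x) \<longlonglongrightarrow> blinfun_apply T x" for x by (intro tendsto_intros T)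
  have Sx: "(%n. blinfun_apply (adj l2_ops (X n)) x) \<longlonglongrightarrow> blinfun_apply S x" for x
   by (intro tendsto_intros S)
  have "adjoint_ops T S" unfolding adjoint_ops_def
  proof (intro allI)
   fix x y
   have "(%n. inner (X n x) y) \<longlonglongrightarrow> inner (T x) y" by (intro tendsto_intros Tx)
   moreover have "(%n. inner (X n x) y) \<longlonglongrightarrow> inner x (S y)"
    unfolding adjoint_opsD[OF l2_opsD(2)[OF Xc]] by (intro tendsto_intros Sx)
   ultimately show "inner (T x) y = inner x (S y)" by (rule LIMSEQ_unique)
  qed
  moreover have "clinear_op T" unfolding clinear_op_def
  proof (intro allI)
   fix c x
   have "(%n. X n (scaleC c x)) \<longlonglongrightarrow> scaleC c (T x)" unfolding clinear_opD[OF l2_opsD(1)[OF Xc]]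
    by (rule bounded_linear.tendsto[OF bounded_linear_scaleC Tx])
   then show "T (scaleC c x) = scaleC c (T x)" using Tx LIMSEQ_unique by blast
  qed
  ultimately have "T \<in>: l2_ops" by (intro l2_opsI)
  moreover have "conv_to l2_ops X T" using tendsto_norm_zero[OF LIM_zero[OF T]] by (simp add: conv_to_def)
  ultimately show ?thesis by blast
 qed
 show ?thesis by (rule cstar_algebra.intro)
   (insert complete, simp_all add: L.add_group L.scl_closed L.scl_add_right L.scl_add_left L.scl_scl L.mul_closed
    L.mul_assoc L.mul_add_left L.mul_add_right L.mul_scl_left L.mul_scl_right L.adj_closed L.adj_add
    L.adj_scl L.adj_mul L.nrm_add L.nrm_scl L.nrm_mul L.nrm_cstar del: l2_ops_simps(2-),
   simp)
qed

subsection \<open>Matrix entries\<close>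

definition entry :: "'i l2_op => 'i => 'i => complex" where
 "entry T i j = l2_app (blinfun_apply T (delta j)) i"

text \<open>Equal entries give equal values at the basis vectors, first for T and S and then for
  their adjoints. A coordinate of T x is read off from inner products of x with values of the
  adjoint at multiples of a basis vector, so T x = S x without a density argument.\<close>

lemma l2_op_eqI:
 assumes T: "T \<in>: l2_ops" and S: "S \<in>: l2_ops" and eq: "!!i j. entry T i j = entry S i j"
 shows "T = S"
proof -
 let ?T = "adj l2_ops T" and ?S = "adj l2_ops S"
 note TD = l2_opsD[OF T] and SD = l2_opsD[OF S]
 have TS: "T (delta j) = S (delta j)" for j by (rule l2_eqI) (use eq in "simp add: entry_def")
 have "?T (delta i) = ?S (delta i)" for i
 proof (rule l2_eqI, rule complex_eqI)
  fix j
  show "Re (l2_app (?T (delta i)) j) = Re (l2_app (?S (delta i)) j)"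
   by (simp add: TS flip: inner_delta adjoint_opsD[OF TD(2)] adjoint_opsD[OF SD(2)])
  show "Im (l2_app (?T (delta i)) j) = Im (l2_app (?S (delta i)) j)"
   by (simp add: TS clinear_opD[OF TD(1)] clinear_opD[OF SD(1)]
     flip: inner_delta adjoint_opsD[OF TD(2)] adjoint_opsD[OF SD(2)])
 qed
 moreover have "clinear_op ?T" "clinear_op ?S" using adjoint_ops_clinear TD SD by blast+
 ultimately have *: "inner (?T (delta i)) x = inner (?S (delta i)) x"
  "inner (?T (scaleC \<i> (delta i))) x = inner (?S (scaleC \<i> (delta i))) x" for i x by (simp_all add: clinear_opD)
 show ?thesis
 proof (intro blinfun_eqI l2_eqI complex_eqI)
  fix x i
  show "Re (l2_app (T x) i) = Re (l2_app (S x) i)"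
   using *(1) by (simp add: adjoint_opsD[OF adjoint_ops_sym[OF TD(2)]] adjoint_opsD[OF adjoint_ops_sym[OF SD(2)]]
     flip: inner_delta)
  show "Im (l2_app (T x) i) = Im (l2_app (S x) i)"
   using *(2) by (simp add: adjoint_opsD[OF adjoint_ops_sym[OF TD(2)]] adjoint_opsD[OF adjoint_ops_sym[OF SD(2)]]
     flip: inner_delta)
 qed
qed

section \<open>Tensor products of operators as products of two commuting amplifications\<close>

section \<open>Tensor products of operators\<close>

lemma scaleR_eq_scaleC: "r *\<^sub>R x = scaleC (complex_of_real r) x" by (rule l2_eqI) simp

lemma Blinfun_op:
 fixes F :: "'i l2 => 'i l2"
 assumes "!!x y. F (x + y) = F x + F y" "!!c x. F (scaleC c x) = scaleC c (F x)"
  "!!x. norm (F x) <= K * norm x"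
 shows "blinfun_apply (Blinfun F) = F" "clinear_op (Blinfun F)"
proof -
 have "bounded_linear F"
  by (rule bounded_linear_intro[where K = K]) (use assms in "auto simp: scaleR_eq_scaleC mult.commute")
 then show "blinfun_apply (Blinfun F) = F" by (rule bounded_linear_Blinfun_apply)
 then show "clinear_op (Blinfun F)" using assms(2) by (simp add: clinear_op_def)
qed

subsection \<open>Reindexing\<close>

definition reindex_l2 :: "('a => 'b) => 'b l2 => 'a l2" where
 "reindex_l2 beta x = Abs_l2 (%i. l2_app x (beta i))"

definition conj_op :: "('a => 'b) => 'a l2_op => 'b l2_op" where
 "conj_op beta T = Blinfun (%x. reindex_l2 (inv_into UNIV beta) (blinfun_apply T (reindex_l2 beta x)))"

context
 fixes beta :: "'a => 'b" assumes beta: "bij beta"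
begin

lemma l2_app_reindex [simp]: "l2_app (reindex_l2 beta x) i = l2_app x (beta i)"
proof -
 have "(%i. (cmod (l2_app x (beta i)))\<^sup>2) summable_on UNIV"
  using summable_on_reindex_bij_betw[of beta UNIV UNIV "%i. (cmod (l2_app x i))\<^sup>2"] beta l2_app_summable[of x] by simp
 then show ?thesis unfolding reindex_l2_def by (subst Abs_l2_inverse) (auto simp: ell2_UNIV_iff)
qed

lemma inner_reindex [simp]: "inner (reindex_l2 beta x) (reindex_l2 beta y) = inner x y"
 using infsum_reindex_bij_betw[of beta UNIV UNIV "%i. inner (l2_app x i) (l2_app y i)"] beta by (simp add: inner_l2_def)

lemma norm_reindex [simp]: "norm (reindex_l2 beta x) = norm x" by (simp add: norm_eq_sqrt_inner)

lemma reindex_linear: "reindex_l2 beta (x + y) = reindex_l2 beta x + reindex_l2 beta y"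
 "reindex_l2 beta (scaleC c x) = scaleC c (reindex_l2 beta x)" by (rule l2_eqI; simp)+

end

context
 fixes beta :: "'a => 'b" assumes beta: "bij beta"
begin

lemma bij_inv: "bij (inv_into UNIV beta)" using beta by (rule bij_imp_bij_inv)

lemma reindex_inverse [simp]: "reindex_l2 beta (reindex_l2 (inv_into UNIV beta) x) = x" "reindex_l2 (inv_into UNIV beta) (reindex_l2 beta y) = y"
 using beta bij_inv by (auto intro!: l2_eqI simp: bij_is_inj bij_is_surj surj_f_inv_f)

lemma inner_reindex_adjoint: "inner (reindex_l2 (inv_into UNIV beta) x) y = inner x (reindex_l2 beta y)"
 using inner_reindex[OF beta, of "reindex_l2 (inv_into UNIV beta) x" y] by simp

lemma conj_op_apply_clinear:
 assumes "T \<in>: l2_ops"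
 shows "blinfun_apply (conj_op beta T) x = reindex_l2 (inv_into UNIV beta) (blinfun_apply T (reindex_l2 beta x))"
  and "clinear_op (conj_op beta T)"
proof -
 let ?F = "%x. reindex_l2 (inv_into UNIV beta) (blinfun_apply T (reindex_l2 beta x))"
 have add: "?F (x + y) = ?F x + ?F y" for x y
  by (simp add: reindex_linear[OF beta] reindex_linear[OF bij_inv] blinfun.add_right)
 have scl: "?F (scaleC c x) = scaleC c (?F x)" for c x
  by (simp add: reindex_linear[OF beta] reindex_linear[OF bij_inv] clinear_opD[OF l2_opsD(1)[OF assms]])
 have bd: "norm (?F x) <= norm T * norm x" for x
  using norm_blinfun[of T "reindex_l2 beta x"] by (simp add: norm_reindex[OF beta] norm_reindex[OF bij_inv])
 show "blinfun_apply (conj_op beta T) x = ?F x" "clinear_op (conj_op beta T)"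
  unfolding conj_op_def using Blinfun_op[of ?F, OF add scl bd] by simp_all
qed

lemmas conj_op_apply = conj_op_apply_clinear(1) and conj_op_clinear = conj_op_apply_clinear(2)

lemma adjoint_conj_op: "T \<in>: l2_ops ==> adjoint_ops (conj_op beta T) (conj_op beta (adj l2_ops T))"
proof -
 assume T: "T \<in>: l2_ops"
 interpret L: pre_cstar "l2_ops :: 'a l2_op star_algebra" by (rule pre_cstar_l2_ops)
 show ?thesis unfolding adjoint_ops_def
 proof (intro allI)
  fix x y
  have "inner (conj_op beta T x) y = inner (T (reindex_l2 beta x)) (reindex_l2 beta y)"
   by (simp add: conj_op_apply[OF T] inner_reindex_adjoint)
  also have "... = inner (reindex_l2 beta x) (adj l2_ops T (reindex_l2 beta y))"
   by (rule adjoint_opsD[OF l2_opsD(2)[OF T]])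
  also have "... = inner x (conj_op beta (adj l2_ops T) y)"
   using T inner_reindex_adjoint[of "adj l2_ops T (reindex_l2 beta y)" x] by (simp add: conj_op_apply inner_commute)
  finally show "inner (conj_op beta T x) y = inner x (conj_op beta (adj l2_ops T) y)" .
 qed
qed

lemma star_hom_conj_op: "star_hom l2_ops l2_ops (conj_op beta)"
proof (rule star_homI)
 interpret L: pre_cstar "l2_ops :: 'a l2_op star_algebra" by (rule pre_cstar_l2_ops)
 fix T S :: "'a l2_op" and c assume T: "T \<in>: l2_ops"
 note lin = reindex_linear[OF beta] reindex_linear[OF bij_inv]
 show "conj_op beta T \<in>: l2_ops" by (rule l2_opsI[OF conj_op_clinear[OF T] adjoint_conj_op[OF T]])
 show "conj_op beta (scl l2_ops c T) = scl l2_ops c (conj_op beta T)"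
  using conj_op_apply[OF L.scl_closed[OF T, of c]] by (intro blinfun_eqI) (simp add: conj_op_apply[OF T] lin)
 show "conj_op beta (adj l2_ops T) = adj l2_ops (conj_op beta T)"
  by (rule adj_l2_ops_eq[OF adjoint_conj_op[OF T], symmetric])
 assume S: "S \<in>: l2_ops"
 show "conj_op beta (add l2_ops T S) = add l2_ops (conj_op beta T) (conj_op beta S)"
  using conj_op_apply[OF L.add_closed[OF T S]]
  by (intro blinfun_eqI) (simp add: conj_op_apply[OF T] conj_op_apply[OF S] lin blinfun.add_left)
 show "conj_op beta (mul l2_ops T S) = mul l2_ops (conj_op beta T) (conj_op beta S)"
  using conj_op_apply[OF L.mul_closed[OF T S]]
  by (intro blinfun_eqI) (simp add: conj_op_apply[OF T] conj_op_apply[OF S])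
qed

lemma entry_conj_op: "T \<in>: l2_ops ==> entry (conj_op beta T) i j = entry T (inv_into UNIV beta i) (inv_into UNIV beta j)"
proof -
 assume T: "T \<in>: l2_ops"
 have "reindex_l2 beta (delta j) = delta (inv_into UNIV beta j)"
  using beta by (intro l2_eqI) (auto simp: l2_app_delta l2_app_reindex[OF beta] bij_inv_eq_iff bij_is_inj)
 then show ?thesis by (simp add: entry_def conj_op_apply[OF T] l2_app_reindex[OF bij_inv])
qed

lemma norm_conj_op: "T \<in>: l2_ops ==> norm (conj_op beta T) = norm T"
proof (rule antisym)
 assume T: "T \<in>: l2_ops"
 show "norm (conj_op beta T) <= norm T"
  using star_hom_contractive[OF star_hom_conj_op cstar_algebra_l2_ops pre_cstar_l2_ops T] by simp
 show "norm T <= norm (conj_op beta T)"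
 proof (rule norm_blinfun_bound)
  fix x
  have "norm (T x) = norm (conj_op beta T (reindex_l2 (inv_into UNIV beta) x))"
   by (simp add: conj_op_apply[OF T] norm_reindex[OF bij_inv])
  also have "... <= norm (conj_op beta T) * norm (reindex_l2 (inv_into UNIV beta) x)" by (rule norm_blinfun)
  finally show "norm (T x) <= norm (conj_op beta T) * norm x" by (simp add: norm_reindex[OF bij_inv])
 qed simp
qed

end

subsection \<open>Amplifications\<close>

definition slice :: "('i \<times> 'j) l2 => 'i => 'j l2" where
 "slice x i = Abs_l2 (%j. l2_app x (i, j))"

lemma l2_pair_summable: "(%(i, j). (cmod (l2_app x (i, j)))\<^sup>2) summable_on UNIV \<times> UNIV"
 using l2_app_summable[of x] by (simp add: case_prod_unfold)

lemma l2_app_slice [simp]: "l2_app (slice x i) j = l2_app x (i, j)" unfolding slice_def by (subst Abs_l2_inverse)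
  (use summable_on_SigmaD1[OF l2_pair_summable[of x], of i] in "simp_all add: ell2_UNIV_iff")

lemma l2_slice_eqI: "(!!i. slice x i = slice y i) ==> x = y" by (rule l2_eqI) (metis l2_app_slice surj_pair)

lemma slice_linear: "slice (x + y) i = slice x i + slice y i" "slice (scaleC c x) i = scaleC c (slice x i)"
 by (rule l2_eqI; simp)+

lemma slice_norm_summable: "(%i. (norm (slice x i))\<^sup>2) summable_on UNIV"
 using summable_on_Sigma_banach[OF l2_pair_summable[of x]] by (simp add: norm_l2_sq)

lemma norm_l2_slices: "(norm x)\<^sup>2 = (\<Sum>\<^sub>\<infinity>i. (norm (slice x i))\<^sup>2)"
 using infsum_Sigma'_banach[OF l2_pair_summable[of x]] by (simp add: norm_l2_sq case_prod_unfold)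

lemma inner_l2_slices: "inner x y = (\<Sum>\<^sub>\<infinity>i. inner (slice x i) (slice y i))"
proof -
 have "(%(i, j). inner (l2_app x (i, j)) (l2_app y (i, j))) summable_on UNIV \<times> UNIV"
  using inner_l2_summable[of x y] by (simp add: case_prod_unfold)
 from infsum_Sigma'_banach[OF this] show ?thesis by (simp add: inner_l2_def case_prod_unfold)
qed

lemma ell2_of_slices:
 assumes "!!i. xi i \<in> ell2 UNIV" "(%i. \<Sum>\<^sub>\<infinity>j. (cmod (xi i j))\<^sup>2) summable_on UNIV"
 shows "(%(i, j). xi i j) \<in> ell2 UNIV"
proof -
 have "(%(i, j). (cmod (xi i j))\<^sup>2) summable_on UNIV \<times> UNIV"
  by (rule summable_on_SigmaI[where g = "%i. \<Sum>\<^sub>\<infinity>j. (cmod (xi i j))\<^sup>2"])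
   (use assms in "auto simp: ell2_UNIV_iff")
 then show ?thesis by (simp add: ell2_UNIV_iff case_prod_unfold)
qed

text \<open>The operator 1 \<otimes> R: it applies R to every slice.\<close>

definition amp2 :: "'j l2_op => ('i \<times> 'j) l2_op" where
 "amp2 R = Blinfun (%x. Abs_l2 (%(i, j). l2_app (blinfun_apply R (slice x i)) j))"

lemma amp2_summable: "(%i. (norm (blinfun_apply R (slice x i)))\<^sup>2) summable_on UNIV"
proof -
 have "(%i. (norm R)\<^sup>2 * (norm (slice x i))\<^sup>2) summable_on UNIV"
  by (intro summable_on_cmult_right slice_norm_summable)
 then have "(%i. norm ((norm (blinfun_apply R (slice x i)))\<^sup>2)) summable_on UNIV"
  by (rule Infinite_Sum.abs_summable_on_comparison_test')
   (auto intro!: power_mono norm_blinfun simp flip: power_mult_distrib)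
 then show ?thesis by simp
qed

lemma slice_amp2_aux: "slice (Abs_l2 (%(i, j). l2_app (blinfun_apply R (slice x i)) j)) i = blinfun_apply R (slice x i)"
proof -
 have "(%(i, j). l2_app (blinfun_apply R (slice x i)) j) \<in> ell2 UNIV"
  by (rule ell2_of_slices) (use amp2_summable[of R x] in "auto simp: norm_l2_sq l2_app")
 then show ?thesis by (intro l2_eqI) (simp add: Abs_l2_inverse)
qed

lemma slice_amp2:
 assumes "R \<in>: l2_ops"
 shows "slice (blinfun_apply (amp2 R) x) i = blinfun_apply R (slice x i)" and "clinear_op (amp2 R)"
proof -
 let ?F = "%x. Abs_l2 (%(i, j). l2_app (blinfun_apply R (slice x i)) j)"
 have add: "?F (x + y) = ?F x + ?F y" for x y by (rule l2_slice_eqI)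
   (simp only: slice_amp2_aux slice_linear(1)[of "?F x" "?F y"], simp only: slice_linear blinfun.add_right)
 have scl: "?F (scaleC c x) = scaleC c (?F x)" for c x by (rule l2_slice_eqI)
   (simp only: slice_amp2_aux slice_linear(2)[of c "?F x"], simp only: slice_linear clinear_opD[OF l2_opsD(1)[OF assms]])
 have bd: "norm (?F x) <= norm R * norm x" for x
 proof (rule power2_le_imp_le)
  have "(norm (?F x))\<^sup>2 <= (\<Sum>\<^sub>\<infinity>i. (norm R)\<^sup>2 * (norm (slice x i))\<^sup>2)"
   unfolding norm_l2_slices slice_amp2_aux
   by (intro infsum_mono amp2_summable summable_on_cmult_right slice_norm_summable)
    (auto intro!: power_mono norm_blinfun simp flip: power_mult_distrib)
  also have "... = (norm R * norm x)\<^sup>2"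
   by (simp add: infsum_cmult_right slice_norm_summable norm_l2_slices power_mult_distrib)
  finally show "(norm (?F x))\<^sup>2 <= (norm R * norm x)\<^sup>2" .
 qed simp
 show "slice (blinfun_apply (amp2 R) x) i = blinfun_apply R (slice x i)"
  unfolding amp2_def by (subst Blinfun_op(1)[OF add scl bd]) (rule slice_amp2_aux)
 show "clinear_op (amp2 R)" unfolding amp2_def by (rule Blinfun_op(2)[OF add scl bd])
qed

lemma adjoint_amp2: "R \<in>: l2_ops ==> adjoint_ops (amp2 R) (amp2 (adj l2_ops R))"
proof -
 assume R: "R \<in>: l2_ops"
 interpret L: pre_cstar "l2_ops :: 'a l2_op star_algebra" by (rule pre_cstar_l2_ops)
 show ?thesis unfolding adjoint_ops_def by (simp add: inner_l2_slices slice_amp2 R adjoint_opsD[OF l2_opsD(2)[OF R]])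
qed

lemma star_hom_amp2: "star_hom l2_ops l2_ops amp2"
proof (rule star_homI)
 interpret L: pre_cstar "l2_ops :: 'j l2_op star_algebra" by (rule pre_cstar_l2_ops)
 fix R S :: "'j l2_op" and c assume R: "R \<in>: l2_ops"
 show "amp2 R \<in>: l2_ops" by (rule l2_opsI[OF slice_amp2(2)[OF R] adjoint_amp2[OF R]])
 show "amp2 (scl l2_ops c R) = scl l2_ops c (amp2 R)" using slice_amp2(1)[OF L.scl_closed[OF R, of c]]
  by (intro blinfun_eqI l2_slice_eqI) (simp add: slice_amp2(1)[OF R] slice_linear)
 show "amp2 (adj l2_ops R) = adj l2_ops (amp2 R)" by (rule adj_l2_ops_eq[OF adjoint_amp2[OF R], symmetric])
 assume S: "S \<in>: l2_ops"
 show "amp2 (add l2_ops R S) = add l2_ops (amp2 R) (amp2 S)" using slice_amp2(1)[OF L.add_closed[OF R S]]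
  by (intro blinfun_eqI l2_slice_eqI)
   (simp add: slice_amp2(1)[OF R] slice_amp2(1)[OF S] slice_linear blinfun.add_left)
 show "amp2 (mul l2_ops R S) = mul l2_ops (amp2 R) (amp2 S)" using slice_amp2(1)[OF L.mul_closed[OF R S]]
  by (intro blinfun_eqI l2_slice_eqI) (simp add: slice_amp2(1)[OF R] slice_amp2(1)[OF S])
qed

lemma bij_swap: "bij (prod.swap :: 'a \<times> 'b => _)" and inv_swap: "inv_into UNIV (prod.swap :: 'a \<times> 'b => _) = prod.swap"
proof -
 show "bij (prod.swap :: 'a \<times> 'b => _)" by (rule bij_betw_byWitness[of _ prod.swap]) auto
 show "inv_into UNIV (prod.swap :: 'a \<times> 'b => _) = prod.swap" by (rule inv_equality) auto
qed

text \<open>The operator T \<otimes> 1, obtained from 1 \<otimes> T by exchanging the coordinates,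
  so that it inherits the homomorphism property.\<close>

definition amp1 :: "'i l2_op => ('i \<times> 'j) l2_op" where
 "amp1 T = conj_op prod.swap (amp2 T)"

lemma star_hom_amp1: "star_hom l2_ops l2_ops amp1"
 using star_hom_comp[OF star_hom_amp2 star_hom_conj_op[OF bij_swap]] by (simp add: amp1_def[abs_def])

lemma amp1_apply:
 assumes "T \<in>: l2_ops"
 shows "l2_app (blinfun_apply (amp1 T) x) (i, j) = l2_app (blinfun_apply T (slice (reindex_l2 prod.swap x) j)) i"
proof -
 have "l2_app (blinfun_apply (amp1 T) x) (i, j) = l2_app (amp2 T (reindex_l2 prod.swap x)) (j, i)"
  unfolding amp1_def conj_op_apply[OF bij_swap star_homD(1)[OF star_hom_amp2 assms]] inv_swap
  by (simp add: l2_app_reindex[OF bij_swap])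
 also have "... = l2_app (slice (amp2 T (reindex_l2 prod.swap x)) j) i" by simp
 finally show ?thesis by (simp only: slice_amp2(1)[OF assms])
qed

lemma amp2_apply:
 assumes "R \<in>: l2_ops"
 shows "l2_app (blinfun_apply (amp2 R) x) (i, j) = l2_app (blinfun_apply R (slice x i)) j"
 using slice_amp2(1)[OF assms, of x i] l2_app_slice by metis

lemma amp_delta:
 assumes "T \<in>: l2_ops" "R \<in>: l2_ops"
 shows "l2_app (amp1 T (amp2 R (delta (i', j')))) (i, j) = entry T i i' * entry R j j'"
  "l2_app (amp2 R (amp1 T (delta (i', j')))) (i, j) = entry T i i' * entry R j j'"
proof -
 have "slice (delta (i', j')) i = (if i = i' then delta j' else 0)" for i by (rule l2_eqI) (simp add: l2_app_delta)
 then have R: "l2_app (amp2 R (delta (i', j'))) (i, j) = (if i = i' then entry R j j' else 0)" for i j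
  by (simp add: amp2_apply[OF assms(2)] entry_def)
 have "slice (reindex_l2 prod.swap (amp2 R (delta (i', j')))) j = scaleC (entry R j j') (delta i')"
  by (rule l2_eqI) (simp add: l2_app_reindex[OF bij_swap] R l2_app_delta)
 then show "l2_app (amp1 T (amp2 R (delta (i', j')))) (i, j) = entry T i i' * entry R j j'"
  by (simp add: amp1_apply[OF assms(1)] clinear_opD[OF l2_opsD(1)[OF assms(1)]] entry_def[of T])
 have "slice (reindex_l2 prod.swap (delta (i', j'))) j = (if j = j' then delta i' else 0)" for j
  by (rule l2_eqI) (auto simp: l2_app_delta l2_app_reindex[OF bij_swap])
 then have T: "l2_app (amp1 T (delta (i', j'))) (i, j) = (if j = j' then entry T i i' else 0)" for i j
  by (simp add: amp1_apply[OF assms(1)] entry_def)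
 have "slice (amp1 T (delta (i', j'))) i = scaleC (entry T i i') (delta j')" by (rule l2_eqI) (simp add: T l2_app_delta)
 then show "l2_app (amp2 R (amp1 T (delta (i', j')))) (i, j) = entry T i i' * entry R j j'"
  by (simp add: amp2_apply[OF assms(2)] clinear_opD[OF l2_opsD(1)[OF assms(2)]] entry_def[of R])
qed

definition tensor :: "'i l2_op => 'j l2_op => ('i \<times> 'j) l2_op" where
 "tensor T R = amp1 T o\<^sub>L amp2 R"

lemma tensor_closed [simp]:
 "T \<in>: l2_ops ==> R \<in>: l2_ops ==> tensor T R \<in>: l2_ops"
 using pre_cstar.mul_closed[OF pre_cstar_l2_ops star_homD(1)[OF star_hom_amp1] star_homD(1)[OF star_hom_amp2]]
 by (simp add: tensor_def)

lemma entry_tensor: "T \<in>: l2_ops ==> R \<in>: l2_ops ==>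
  entry (tensor T R) (i, j) (i', j') = entry T i i' * entry R j j'"
 unfolding entry_def[of "tensor T R"] unfolding tensor_def by (simp add: amp_delta)

text \<open>The entries of both products are the products of the entries of T and R by
  \<open>amp_delta\<close>, and the entries determine an operator.\<close>

lemma amp_commute:
 assumes "T \<in>: l2_ops" "R \<in>: l2_ops"
 shows "amp2 R o\<^sub>L amp1 T = amp1 T o\<^sub>L amp2 R"
proof (rule l2_op_eqI)
 note closed = star_homD(1)[OF star_hom_amp1 assms(1)] star_homD(1)[OF star_hom_amp2 assms(2)]
 show "amp2 R o\<^sub>L amp1 T \<in>: l2_ops" "amp1 T o\<^sub>L amp2 R \<in>: l2_ops"
  using pre_cstar.mul_closed[OF pre_cstar_l2_ops] closed by auto
 show "entry (amp2 R o\<^sub>L amp1 T) p q = entry (amp1 T o\<^sub>L amp2 R) p q" for p q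
  by (cases p; cases q) (simp add: entry_def amp_delta[OF assms])
qed

lemma tensor_mul:
 assumes "T \<in>: l2_ops" "T' \<in>: l2_ops" "R \<in>: l2_ops" "R' \<in>: l2_ops"
 shows "tensor T R o\<^sub>L tensor T' R' = tensor (T o\<^sub>L T') (R o\<^sub>L R')"
proof -
 have 1: "amp1 (T o\<^sub>L T') = amp1 T o\<^sub>L amp1 T'" "amp2 (R o\<^sub>L R') = amp2 R o\<^sub>L amp2 R'"
  using star_homD(4)[OF star_hom_amp1 assms(1,2)] star_homD(4)[OF star_hom_amp2 assms(3,4)] by simp_all
 have 2: "blinfun_apply (amp2 R) (blinfun_apply (amp1 T') x) = blinfun_apply (amp1 T') (blinfun_apply (amp2 R) x)" for x
  using arg_cong[OF amp_commute[OF assms(2,3)], of "%F. blinfun_apply F x"] by simp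
 show ?thesis by (rule blinfun_eqI) (simp add: tensor_def 1 2)
qed

lemma tensor_adj:
 assumes "T \<in>: l2_ops" "R \<in>: l2_ops"
 shows "adj l2_ops (tensor T R) = tensor (adj l2_ops T) (adj l2_ops R)"
proof -
 interpret L: pre_cstar "l2_ops :: 'a l2_op star_algebra" by (rule pre_cstar_l2_ops)
 interpret L2: pre_cstar "l2_ops :: 'b l2_op star_algebra" by (rule pre_cstar_l2_ops)
 note c = star_homD(1)[OF star_hom_amp1 assms(1)] star_homD(1)[OF star_hom_amp2 assms(2)]
 have "adj l2_ops (tensor T R) = mul l2_ops (adj l2_ops (amp2 R)) (adj l2_ops (amp1 T))"
  using pre_cstar.adj_mul[OF pre_cstar_l2_ops c] by (simp add: tensor_def)
 also have "... = amp2 (adj l2_ops R) o\<^sub>L amp1 (adj l2_ops T)"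
  by (simp add: star_homD(5)[OF star_hom_amp1 assms(1)] star_homD(5)[OF star_hom_amp2 assms(2)])
 finally show ?thesis using amp_commute[OF L.adj_closed[OF assms(1)] L2.adj_closed[OF assms(2)]]
  by (simp add: tensor_def)
qed

lemmas amp1_hom = star_homD[OF star_hom_amp1, simplified l2_ops_simps]
 and amp2_hom = star_homD[OF star_hom_amp2, simplified l2_ops_simps]

lemma tensor_add_left: "T \<in>: l2_ops ==> T' \<in>: l2_ops ==> tensor (T + T') R = tensor T R + tensor T' R"
 by (intro blinfun_eqI) (simp add: tensor_def blinfun.add_left amp1_hom)

lemma tensor_add_right: "R \<in>: l2_ops ==> R' \<in>: l2_ops ==> T \<in>: l2_ops ==>
  tensor T (R + R') = tensor T R + tensor T R'"
 by (intro blinfun_eqI) (simp add: tensor_def blinfun.add_left blinfun.add_right amp2_hom)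

lemma tensor_scl_left: "T \<in>: l2_ops ==> tensor (mult_op c o\<^sub>L T) R = mult_op c o\<^sub>L tensor T R"
 by (intro blinfun_eqI) (simp add: tensor_def amp1_hom)

lemma tensor_scl_right: "R \<in>: l2_ops ==> T \<in>: l2_ops ==> tensor T (mult_op c o\<^sub>L R) = mult_op c o\<^sub>L tensor T R"
 by (intro blinfun_eqI) (simp add: tensor_def amp2_hom clinear_opD[OF l2_opsD(1)[OF amp1_hom(1)]])

lemma norm_tensor_le:
 assumes "T \<in>: l2_ops" "R \<in>: l2_ops"
 shows "norm (tensor T R) <= norm T * norm R"
proof -
 have "norm (tensor T R) <= norm (amp1 T :: ('a \<times> 'b) l2_op) * norm (amp2 R :: ('a \<times> 'b) l2_op)"
  unfolding tensor_def by (rule norm_blinfun_compose)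
 also have "... <= norm T * norm R"
  using star_hom_contractive[OF star_hom_amp1 cstar_algebra_l2_ops pre_cstar_l2_ops assms(1)]
   star_hom_contractive[OF star_hom_amp2 cstar_algebra_l2_ops pre_cstar_l2_ops assms(2)] by (intro mult_mono) simp_all
 finally show ?thesis .
qed

definition assoc :: "('i \<times> 'j) \<times> 'k => 'i \<times> 'j \<times> 'k" where
 "assoc = (%((i, j), k). (i, j, k))"

lemma bij_assoc: "bij assoc" and inv_assoc: "inv_into UNIV assoc (i, j, k) = ((i, j), k)"
proof -
 show bij: "bij (assoc :: ('i \<times> 'j) \<times> 'k => _)"
  by (rule bij_betw_byWitness[of _ "%(i, j, k). ((i, j), k)"]) (auto simp: assoc_def)
 show "inv_into UNIV assoc (i, j, k) = ((i, j), k)" by (rule inv_f_eq) (auto simp: assoc_def inj_on_def)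
qed

lemma tensor_assoc:
 assumes "T \<in>: l2_ops" "R \<in>: l2_ops" "S \<in>: l2_ops"
 shows "conj_op assoc (tensor (tensor T R) S) = tensor T (tensor R S)"
proof (rule l2_op_eqI)
 show "conj_op assoc (tensor (tensor T R) S) \<in>: l2_ops"
  by (rule star_homD(1)[OF star_hom_conj_op[OF bij_assoc]]) (use assms in simp)
 show "tensor T (tensor R S) \<in>: l2_ops" using assms by simp
 show "entry (conj_op assoc (tensor (tensor T R) S)) p q = entry (tensor T (tensor R S)) p q" for p q
  using assms by (cases p; cases q) (simp add: entry_conj_op[OF bij_assoc] entry_tensor inv_assoc)
qed

lemma conj_tensor_left:
 assumes "bij beta" "T \<in>: l2_ops" "R \<in>: l2_ops"
 shows "conj_op (map_prod beta id) (tensor T R) = tensor (conj_op beta T) R"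
proof (rule l2_op_eqI)
 have b: "bij (map_prod beta (id :: 'c => 'c))" by (rule bij_betw_byWitness[of _ "map_prod (inv_into UNIV beta) id"])
   (use assms(1) in "auto simp: bij_is_inj bij_is_surj surj_f_inv_f")
 have i: "inv_into UNIV (map_prod beta (id :: 'c => 'c)) (i, j) = (inv_into UNIV beta i, j)" for i j
  by (rule inv_f_eq) (use assms(1) b in "auto simp: bij_is_inj bij_is_surj surj_f_inv_f")
 note c = star_homD(1)[OF star_hom_conj_op[OF assms(1)]]
 show "conj_op (map_prod beta id) (tensor T R) \<in>: l2_ops" "tensor (conj_op beta T) R \<in>: l2_ops"
  using star_homD(1)[OF star_hom_conj_op[OF b]] assms c by simp_all
 show "entry (conj_op (map_prod beta id) (tensor T R)) p q = entry (tensor (conj_op beta T) R) p q" for p q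
  using assms c by (cases p; cases q) (simp add: entry_conj_op[OF b] entry_conj_op[OF assms(1)] entry_tensor i)
qed

lemma conj_tensor_right:
 assumes "bij beta" "T \<in>: l2_ops" "R \<in>: l2_ops"
 shows "conj_op (map_prod id beta) (tensor T R) = tensor T (conj_op beta R)"
proof (rule l2_op_eqI)
 have b: "bij (map_prod (id :: 'c => 'c) beta)" by (rule bij_betw_byWitness[of _ "map_prod id (inv_into UNIV beta)"])
   (use assms(1) in "auto simp: bij_is_inj bij_is_surj surj_f_inv_f")
 have i: "inv_into UNIV (map_prod (id :: 'c => 'c) beta) (i, j) = (i, inv_into UNIV beta j)" for i j
  by (rule inv_f_eq) (use assms(1) b in "auto simp: bij_is_inj bij_is_surj surj_f_inv_f")
 note c = star_homD(1)[OF star_hom_conj_op[OF assms(1)]]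
 show "conj_op (map_prod id beta) (tensor T R) \<in>: l2_ops" "tensor T (conj_op beta R) \<in>: l2_ops"
  using star_homD(1)[OF star_hom_conj_op[OF b]] assms c by simp_all
 show "entry (conj_op (map_prod id beta) (tensor T R)) p q = entry (tensor T (conj_op beta R)) p q" for p q
  using assms c by (cases p; cases q) (simp add: entry_conj_op[OF b] entry_conj_op[OF assms(1)] entry_tensor i)
qed

section \<open>Translation between operators on plain sequences and elements of
  \<open>l2_ops\<close>\<close>

section \<open>Representations on square-summable sequences\<close>

text \<open>The spatial norm is defined with representations by functions on sequences.
  \<open>rep_op\<close> and \<open>op_rep\<close> exchange these with homomorphisms into
  \<open>l2_ops\<close>, where the C*-algebra results are available.\<close>

definition rep_op :: "('a => ell2_op) => 'a => nat l2_op" where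
 "rep_op \<pi> a = Blinfun (%x. Abs_l2 (\<pi> a (l2_app x)))"

definition op_rep :: "('a => nat l2_op) => 'a => ell2_op" where
 "op_rep rho a xi = l2_app (blinfun_apply (rho a) (Abs_l2 xi))"

lemma rep_op_op_rep [simp]: "rep_op (op_rep rho) = rho"
 by (rule ext) (simp add: rep_op_def op_rep_def l2_app_inverse blinfun_apply_inverse)

lemma ell2_inner_summable: "(%i. cnj (l2_app x i) * l2_app y i) summable_on UNIV"
proof (rule Infinite_Sum.abs_summable_summable, rule Infinite_Sum.abs_summable_on_comparison_test')
 show "(%i. (cmod (l2_app x i))\<^sup>2 + (cmod (l2_app y i))\<^sup>2) summable_on UNIV"
  by (intro summable_on_add l2_app_summable)
 show "norm (cnj (l2_app x i) * l2_app y i) <= (cmod (l2_app x i))\<^sup>2 + (cmod (l2_app y i))\<^sup>2" for i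
 proof -
  have "0 <= cmod (l2_app x i) * cmod (l2_app y i)" by simp
  then show ?thesis using sum_squares_bound[of "cmod (l2_app x i)" "cmod (l2_app y i)"]
   unfolding norm_mult complex_mod_cnj by linarith
 qed
qed

lemma Re_ell2_inner: "Re (ell2_inner (l2_app x) (l2_app y)) = inner x y" unfolding ell2_inner_def inner_l2_def
 by (subst infsum_Re[OF ell2_inner_summable, symmetric]) (simp add: inner_complex_def)

text \<open>The imaginary part of an inner product is the real part after multiplying the second
  argument by -i, so real inner products with all complex multiples determine the complex
  value.\<close>

lemma ell2_inner_eqI:
 assumes "!!c. inner x (scaleC c y) = inner x' (scaleC c y')"
 shows "ell2_inner (l2_app x) (l2_app y) = ell2_inner (l2_app x') (l2_app y')"
proof (rule complex_eqI)
 show "Re (ell2_inner (l2_app x) (l2_app y)) = Re (ell2_inner (l2_app x') (l2_app y'))"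
  using assms[of 1] by (simp add: Re_ell2_inner)
 have im: "Im (ell2_inner (l2_app x) (l2_app y)) = inner x (scaleC (-\<i>) y)" for x y :: "'z l2"
 proof -
  have "ell2_inner (l2_app x) (l2_app (scaleC (-\<i>) y)) = - \<i> * ell2_inner (l2_app x) (l2_app y)"
   unfolding ell2_inner_def by (subst infsum_cmult_right'[symmetric]) (auto simp: algebra_simps)
  then have "Re (- \<i> * ell2_inner (l2_app x) (l2_app y)) = inner x (scaleC (-\<i>) y)"
   using Re_ell2_inner[of x "scaleC (-\<i>) y"] by simp
  then show ?thesis by simp
 qed
 show "Im (ell2_inner (l2_app x) (l2_app y)) = Im (ell2_inner (l2_app x') (l2_app y'))"
  using assms[of "-\<i>"] by (simp add: im)
qed

lemma rep_op_apply_clinear: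
 assumes "bounded_op (\<pi> a)"
 shows "l2_app (blinfun_apply (rep_op \<pi> a) x) = \<pi> a (l2_app x)" and "clinear_op (rep_op \<pi> a)"
proof -
 let ?F = "%x. Abs_l2 (\<pi> a (l2_app x))"
 obtain K where K: "!!xi. xi \<in> ell2 UNIV ==> ell2_norm (\<pi> a xi) <= K * ell2_norm xi"
  using assms unfolding bounded_op_def by blast
 have F: "l2_app (?F x) = \<pi> a (l2_app x)" for x
  using assms l2_app[of x] by (subst Abs_l2_inverse) (auto simp: bounded_op_def)
 have l: "l2_app (x + y) = (%i. l2_app x i + l2_app y i)" "l2_app (scaleC c x) = (%i. c * l2_app x i)" for x y :: "nat l2" and c
  by auto
 have lin: "\<pi> a (%i. l2_app x i + l2_app y i) = (%i. \<pi> a (l2_app x) i + \<pi> a (l2_app y) i)"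
  "\<pi> a (%i. c * l2_app x i) = (%i. c * \<pi> a (l2_app x) i)" for x y c
  using assms l2_app unfolding bounded_op_def by blast+
 have add: "?F (x + y) = ?F x + ?F y" for x y by (rule l2_eqI, simp only: F, simp only: l F lin)
 have scl: "?F (scaleC c x) = scaleC c (?F x)" for c x by (rule l2_eqI, simp only: F, simp only: l F lin)
 have bd: "norm (?F x) <= K * norm x" for x using K[OF l2_app[of x]] by (simp add: norm_l2_eq F)
 show "l2_app (blinfun_apply (rep_op \<pi> a) x) = \<pi> a (l2_app x)"
  unfolding rep_op_def by (subst Blinfun_op(1)[OF add scl bd]) (rule F)
 show "clinear_op (rep_op \<pi> a)" unfolding rep_op_def by (rule Blinfun_op(2)[OF add scl bd])
qed

lemma star_rep_apply: "star_rep A \<pi> ==> a \<in>: A ==> l2_app (blinfun_apply (rep_op \<pi> a) x) = \<pi> a (l2_app x)"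
 by (rule rep_op_apply_clinear) (simp add: star_rep_def)

lemma star_hom_rep_op:
 assumes A: "pre_cstar A" and \<pi>: "star_rep A \<pi>"
 shows "star_hom A l2_ops (rep_op \<pi>)"
proof (rule star_homI)
 interpret A: pre_cstar A by fact
 note app = star_rep_apply[OF \<pi>]
 note rep = \<pi>[unfolded star_rep_def, THEN conjunct2, rule_format, OF l2_app]
 fix a b c assume a: "a \<in>: A"
 have adj: "adjoint_ops (rep_op \<pi> a) (rep_op \<pi> (adj A a))" unfolding adjoint_ops_def
 proof (intro allI)
  fix x y
  have "ell2_inner (l2_app y) (\<pi> a (l2_app x)) = ell2_inner (\<pi> (adj A a) (l2_app y)) (l2_app x)"
   using rep[OF a, of y] l2_app[of x] by blast
  then have "inner y (rep_op \<pi> a x) = inner (rep_op \<pi> (adj A a) y) x"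
   using a by (simp add: app flip: Re_ell2_inner)
  then show "inner (rep_op \<pi> a x) y = inner x (rep_op \<pi> (adj A a) y)" by (simp add: inner_commute)
 qed
 have "clinear_op (rep_op \<pi> a)" using \<pi> a by (intro rep_op_apply_clinear) (simp add: star_rep_def)
 then show "rep_op \<pi> a \<in>: l2_ops" using adj by (rule l2_opsI)
 show "rep_op \<pi> (scl A c a) = scl l2_ops c (rep_op \<pi> a)"
  using rep[OF a] a by (intro blinfun_eqI l2_eqI) (simp add: app)
 show "rep_op \<pi> (adj A a) = adj l2_ops (rep_op \<pi> a)" by (rule adj_l2_ops_eq[OF adj, symmetric])
 assume b: "b \<in>: A"
 show "rep_op \<pi> (add A a b) = add l2_ops (rep_op \<pi> a) (rep_op \<pi> b)"
  using rep[OF a] a b by (intro blinfun_eqI l2_eqI) (simp add: app blinfun.add_left)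
 show "rep_op \<pi> (mul A a b) = mul l2_ops (rep_op \<pi> a) (rep_op \<pi> b)"
  using rep[OF a] a b by (intro blinfun_eqI l2_eqI) (simp add: app)
qed

lemma star_rep_op_rep:
 assumes A: "pre_cstar A" and rho: "star_hom A l2_ops rho"
 shows "star_rep A (op_rep rho)"
proof -
 interpret A: pre_cstar A by fact
 note hom = star_homD[OF rho]
 have add: "Abs_l2 (%i. xi i + \<eta> i) = Abs_l2 xi + Abs_l2 \<eta>" if "xi \<in> ell2 UNIV" "\<eta> \<in> ell2 UNIV" for xi \<eta> :: "nat => complex"
  by (rule l2_eqI) (simp add: Abs_l2_inverse that ell2_add)
 have scl: "Abs_l2 (%i. c * xi i) = scaleC c (Abs_l2 xi)" if "xi \<in> ell2 UNIV" for c and xi :: "nat => complex"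
  by (rule l2_eqI) (simp add: Abs_l2_inverse that ell2_scale)
 have bdd: "bounded_op (op_rep rho a)" if a: "a \<in>: A" for a unfolding bounded_op_def
 proof (intro conjI ballI allI)
  show "op_rep rho a \<in> ell2 UNIV \<rightarrow> ell2 UNIV" by (auto simp: op_rep_def l2_app)
  show "\<exists>K. \<forall>xi\<in>ell2 UNIV. ell2_norm (op_rep rho a xi) <= K * ell2_norm xi"
   by (rule exI[of _ "norm (rho a)"]) (metis Abs_l2_inverse norm_blinfun norm_l2_eq op_rep_def)
 qed (auto simp: op_rep_def add scl blinfun.add_right clinear_opD[OF l2_opsD(1)[OF hom(1)[OF a]]])
 show ?thesis unfolding star_rep_def
 proof (intro conjI ballI allI)
  fix xi \<eta> :: "nat => complex" and a b c assume xi: "xi \<in> ell2 UNIV" and a: "a \<in>: A"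
  show "op_rep rho (scl A c a) xi = (%i. c * op_rep rho a xi i)" by (rule ext) (simp add: op_rep_def hom(3)[OF a])
  show "ell2_inner xi (op_rep rho a \<eta>) = ell2_inner (op_rep rho (adj A a) xi) \<eta>" if \<eta>: "\<eta> \<in> ell2 UNIV"
  proof -
   note T = l2_opsD[OF hom(1)[OF a]]
   have "ell2_inner (l2_app (Abs_l2 xi)) (l2_app (rho a (Abs_l2 \<eta>)))
     = ell2_inner (l2_app (rho (adj A a) (Abs_l2 xi))) (l2_app (Abs_l2 \<eta>))" by (rule ell2_inner_eqI)
     (simp add: hom(5)[OF a] adjoint_opsD[OF adjoint_ops_sym[OF T(2)]] clinear_opD[OF T(1)])
   then show ?thesis by (simp add: op_rep_def Abs_l2_inverse xi \<eta>)
  qed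
  assume b: "b \<in>: A"
  show "op_rep rho (add A a b) xi = (%i. op_rep rho a xi i + op_rep rho b xi i)"
   by (rule ext) (simp add: op_rep_def hom(2)[OF a b] blinfun.add_left)
  show "op_rep rho (mul A a b) xi = op_rep rho a (op_rep rho b xi)"
   by (simp add: op_rep_def hom(4)[OF a b] l2_app_inverse)
 qed (rule bdd)
qed

text \<open>Representations may be degenerate, so 0 is one of them. It keeps the sets behind the
  suprema nonempty.\<close>

lemma star_rep_zero: "pre_cstar A ==> star_rep A (op_rep (%_. 0))"
proof (rule star_rep_op_rep)
 interpret L: pre_cstar "l2_ops :: nat l2_op star_algebra" by (rule pre_cstar_l2_ops)
 show "star_hom A l2_ops (%_. 0 :: nat l2_op)"
  by (rule star_homI) (use L.zer_closed L.adj_zer in "auto intro!: blinfun_eqI l2_eqI")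
qed

section \<open>The spatial norm as a supremum of operator norms, and the resulting tensor
  powers\<close>

section \<open>Spatial tensor powers\<close>

lemma asum_l2_ops: "(!!i. i \<in> I ==> f i \<in>: l2_ops) ==> asum l2_ops f I = sum f I"
proof (induction I rule: infinite_finite_induct)
 interpret L: pre_cstar "l2_ops :: 'b l2_op star_algebra" by (rule pre_cstar_l2_ops)
 case (insert x F)
 then show ?case by (simp add: L.asum_insert)
qed (simp_all add: pre_cstar.asum_infinite[OF pre_cstar_l2_ops] pre_cstar.asum_empty[OF pre_cstar_l2_ops])

lemma l2_app_sum: "l2_app (sum f I) i = (\<Sum>j\<in>I. l2_app (f j) i)"
 by (induction I rule: infinite_finite_induct) auto

lemma l2_app_lin:
 assumes "!!w. w \<in> keys f ==> phi w \<in>: l2_ops"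
 shows "l2_app (blinfun_apply (lin l2_ops phi f) x) i = (\<Sum>w\<in>keys f. lookup f w * l2_app (blinfun_apply (phi w) x) i)"
proof -
 have "lin l2_ops phi f = (\<Sum>w\<in>keys f. mult_op (lookup f w) o\<^sub>L phi w)"
  unfolding lin_def using pre_cstar.scl_closed[OF pre_cstar_l2_ops assms] by (subst asum_l2_ops) auto
 then show ?thesis by (simp add: blinfun.sum_left l2_app_sum)
qed

lemma star_hom_lin_comp:
 assumes h: "star_hom A B h" "pre_cstar A" "pre_cstar B" and phi: "!!w. w \<in> keys f ==> phi w \<in>: A"
 shows "h (lin A phi f) = lin B (%w. h (phi w)) f"
proof -
 interpret A: pre_cstar A by fact
 interpret B: pre_cstar B by fact
 have "h (lin A phi f) = asum B (%w. h (scl A (lookup f w) (phi w))) (keys f)"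
  unfolding lin_def by (rule star_hom_asum[OF h]) (use phi in auto)
 also have "... = lin B (%w. h (phi w)) f"
  unfolding lin_def by (rule B.asum_cong) (use phi in "auto simp: star_homD[OF h(1)]")
 finally show ?thesis .
qed

lemma lin_cong:
 assumes "pre_cstar A" "!!w. w \<in> keys f ==> psi w \<in>: A" "!!w. w \<in> keys f ==> phi w = psi w"
 shows "lin A phi f = lin A psi f"
proof -
 interpret A: pre_cstar A by fact
 show ?thesis unfolding lin_def by (rule A.asum_cong) (use assms in auto)
qed

text \<open>The vectors in the spatial norm live on lists of one length, and factors that send 0 to
  0 keep this support. Other lists therefore contribute nothing to \<open>ell2_norm\<close>.\<close>

lemma tens_op_length:
 "\<forall>T\<in>set Ts. T (%_. 0) = (%_. 0) ==> (!!l. length l ~= length Ts ==> xi l = 0) ==> length l ~= length Ts ==>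
  tens_op Ts xi l = 0"
proof (induction Ts arbitrary: xi l)
 case (Cons T Ts)
 show ?case
 proof (cases l)
  case (Cons m l')
  have "tens_op Ts (%r. xi (m' # r)) l' = 0" for m' by (rule Cons.IH) (use Cons.prems Cons in auto)
  then show ?thesis using Cons Cons.prems by simp
 qed simp
qed simp

definition tuples :: "'a star_algebra => nat => 'a list set" where
 "tuples A k = {w. length w = k & set w <= carrier A}"

definition rep_tuples :: "'a star_algebra => nat => ('a => nat l2_op) list set" where
 "rep_tuples A k = {rhos. length rhos = k & (\<forall>rho\<in>set rhos. star_hom A l2_ops rho)}"

lemma star_semigroup_tuples:
 assumes "pre_cstar A" shows "star_semigroup (tuples A k) (map2 (mul A)) (map (adj A))"
proof -
 interpret A: pre_cstar A by fact
 have nth: "w ! i \<in>: A" if "w \<in> tuples A k" "i < k" for w i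
  using that nth_mem[of i w] by (auto simp: tuples_def)
 have mem: "w \<in> tuples A k" if "length w = k" "!!i. i < k ==> w ! i \<in>: A" for w
  using that by (auto simp: tuples_def in_set_conv_nth)
 show ?thesis
 proof
  fix u v w assume *: "u \<in> tuples A k" "v \<in> tuples A k"
  note len = *[unfolded tuples_def, simplified, THEN conjunct1]
  show "map2 (mul A) u v \<in> tuples A k" by (rule mem) (use * len nth in auto)
  show "map (adj A) u \<in> tuples A k" by (rule mem) (use * len nth in auto)
  show "map (adj A) (map (adj A) u) = u" by (rule nth_equalityI) (use * len nth in auto)
  show "map (adj A) (map2 (mul A) u v) = map2 (mul A) (map (adj A) v) (map (adj A) u)"
   by (rule nth_equalityI) (use * len nth A.adj_mul in auto)
  assume w: "w \<in> tuples A k"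
  then show "map2 (mul A) (map2 (mul A) u v) w = map2 (mul A) u (map2 (mul A) v w)"
   by (intro nth_equalityI) (use * len nth A.mul_assoc in "auto simp: tuples_def")
 qed
qed

lemma formal_tensor_power_eq:
 "formal_tensor_power A k = (sg_alg (tuples A k) (map2 (mul A)) (map (adj A)))\<lparr>nrm := spatial_norm A k\<rparr>"
 by (auto simp: formal_tensor_power_def sg_alg_def formal_mul_def[abs_def] sg_mul_def[abs_def]
   formal_adj_def[abs_def] sg_adj_def[abs_def] tuples_def)

text \<open>
 The spatial norm with \<open>k\<close> factors, in terms of operators \<open>phi rhos w\<close> on a model \<open>'k l2\<close> of the
 \<open>k\<close>-fold tensor power of \<open>nat l2\<close>.
\<close>

locale tensor_model =
 fixes A :: "'a star_algebra" and k :: nat and enc :: "'k => nat list"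
  and phi :: "('a => nat l2_op) list => 'a list => 'k l2_op"
 assumes A: "cstar_algebra A"
  and enc: "bij_betw enc UNIV {l. length l = k}"
  and phi_closed: "rhos \<in> rep_tuples A k ==> w \<in> tuples A k ==> phi rhos w \<in>: l2_ops"
  and phi_mul: "rhos \<in> rep_tuples A k ==> v \<in> tuples A k ==> w \<in> tuples A k ==>
    phi rhos (map2 (mul A) v w) = phi rhos v o\<^sub>L phi rhos w"
  and phi_adj: "rhos \<in> rep_tuples A k ==> w \<in> tuples A k ==> phi rhos (map (adj A) w) = adj l2_ops (phi rhos w)"
  and phi_norm: "rhos \<in> rep_tuples A k ==> w \<in> tuples A k ==> norm (phi rhos w) <= prod_list (map (nrm A) w)"
  and phi_tens: "length \<pi>s = k ==> \<forall>\<pi>\<in>set \<pi>s. star_rep A \<pi> ==> w \<in> tuples A k ==> xi \<in> ell2 {l. length l = k} ==>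
    (%kap. xi (enc kap)) \<in> ell2 UNIV ==>
    tens_op (map2 (%\<pi> a. \<pi> a) \<pi>s w) xi (enc kap) =
     l2_app (blinfun_apply (phi (map rep_op \<pi>s) w) (Abs_l2 (%kap. xi (enc kap)))) kap"
begin

interpretation A: cstar_algebra A by (rule A)

lemma preA: "pre_cstar A" by (rule A.pre.pre_cstar_axioms)

abbreviation "M \<equiv> formal_tensor_power A k"
abbreviation "TP \<equiv> tensor_power A k"
abbreviation "L rhos \<equiv> lin l2_ops (phi rhos)"

lemma carrier_M: "carrier M = {f. keys f <= tuples A k}" by (simp add: formal_tensor_power_eq sg_alg_def)

lemma ell2_norm_enc:
 assumes "!!l. length l ~= k ==> zeta l = 0"
 shows "ell2_norm zeta = ell2_norm (%kap. zeta (enc kap))"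
  "zeta \<in> ell2 {l. length l = k} \<longleftrightarrow> (%kap. zeta (enc kap)) \<in> ell2 UNIV"
proof -
 have "infsum (%l. (cmod (zeta l))\<^sup>2) UNIV = infsum (%l. (cmod (zeta l))\<^sup>2) {l. length l = k}"
  by (rule infsum_cong_neutral) (use assms in auto)
 also have "... = (\<Sum>\<^sub>\<infinity>kap. (cmod (zeta (enc kap)))\<^sup>2)"
  by (rule infsum_reindex_bij_betw[OF enc, symmetric])
 finally show "ell2_norm zeta = ell2_norm (%kap. zeta (enc kap))" by (simp add: ell2_norm_def)
 have "(%l. (cmod (zeta l))\<^sup>2) summable_on UNIV \<longleftrightarrow> (%l. (cmod (zeta l))\<^sup>2) summable_on {l. length l = k}"
  by (rule summable_on_cong_neutral) (use assms in auto)
 also have "... \<longleftrightarrow> (%kap. (cmod (zeta (enc kap)))\<^sup>2) summable_on UNIV"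
  by (rule summable_on_reindex_bij_betw[OF enc, symmetric])
 finally show "zeta \<in> ell2 {l. length l = k} \<longleftrightarrow> (%kap. zeta (enc kap)) \<in> ell2 UNIV"
  using assms by (auto simp: ell2_def)
qed

lemma spatial_element:
 assumes f: "f \<in>: M" and \<pi>s: "length \<pi>s = k" "\<forall>\<pi>\<in>set \<pi>s. star_rep A \<pi>" and xi: "xi \<in> ell2 {l. length l = k}"
 defines "x \<equiv> Abs_l2 (%kap. xi (enc kap))"
 shows "ell2_norm (%l. \<Sum>w\<in>keys f. lookup f w * tens_op (map2 (%\<pi> a. \<pi> a) \<pi>s w) xi l)
   = norm (blinfun_apply (L (map rep_op \<pi>s) f) x)"
  and "norm x = ell2_norm xi" and "map rep_op \<pi>s \<in> rep_tuples A k"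
proof -
 have xi0: "xi l = 0" if "length l ~= k" for l using xi that by (auto simp: ell2_def)
 have x: "(%kap. xi (enc kap)) \<in> ell2 UNIV" using ell2_norm_enc(2)[of xi] xi xi0 by blast
 show "norm x = ell2_norm xi" using ell2_norm_enc(1)[of xi] xi0 by (simp add: norm_l2_eq x_def Abs_l2_inverse x)
 show R: "map rep_op \<pi>s \<in> rep_tuples A k" using \<pi>s star_hom_rep_op[OF preA] by (auto simp: rep_tuples_def)
 have f': "w \<in> tuples A k" if "w \<in> keys f" for w using f that by (auto simp: carrier_M)
 have zero: "tens_op (map2 (%\<pi> a. \<pi> a) \<pi>s w) xi l = 0" if w: "w \<in> tuples A k" and l: "length l ~= k" for w l
 proof (rule tens_op_length)
  have len: "length w = k" using w by (simp add: tuples_def)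
  show "\<forall>T\<in>set (map2 (%\<pi> a. \<pi> a) \<pi>s w). T (%_. 0) = (%_. 0)"
  proof
   fix T assume "T \<in> set (map2 (%\<pi> a. \<pi> a) \<pi>s w)"
   then obtain \<pi> a where T: "T = \<pi> a" "\<pi> \<in> set \<pi>s" "a \<in> set w" by (auto dest: set_zip_leftD set_zip_rightD)
   then have "a \<in>: A" "star_rep A \<pi>" using w \<pi>s by (auto simp: tuples_def)
   then have "\<pi> a (l2_app 0) = l2_app (rep_op \<pi> a 0)" by (intro star_rep_apply[symmetric])
   also have "... = (%_. 0)" by (auto simp: blinfun.zero_right)
   also have "l2_app (0 :: nat l2) = (%_. 0)" by auto
   finally show "T (%_. 0) = (%_. 0)" using T by simp
  qed
 qed (use xi0 l \<pi>s w in "auto simp: tuples_def")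
 let ?zeta = "%l. \<Sum>w\<in>keys f. lookup f w * tens_op (map2 (%\<pi> a. \<pi> a) \<pi>s w) xi l"
 have "ell2_norm ?zeta = ell2_norm (%kap. ?zeta (enc kap))" by (rule ell2_norm_enc) (use zero f' in auto)
 also have "(%kap. ?zeta (enc kap)) = l2_app (blinfun_apply (L (map rep_op \<pi>s) f) x)"
  by (rule ext) (use f' R phi_closed phi_tens[OF \<pi>s _ xi x] in "simp add: l2_app_lin x_def")
 finally show "ell2_norm ?zeta = norm (blinfun_apply (L (map rep_op \<pi>s) f) x)" by (simp add: norm_l2_eq)
qed

text \<open>The bound does not depend on the representations, so the suprema that follow are taken
  over bounded sets.\<close>

lemma norm_L_le:
 assumes f: "f \<in>: M" and rhos: "rhos \<in> rep_tuples A k"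
 shows "norm (L rhos f) <= (\<Sum>w\<in>keys f. cmod (lookup f w) * prod_list (map (nrm A) w))"
proof -
 interpret O: pre_cstar "l2_ops :: 'k l2_op star_algebra" by (rule pre_cstar_l2_ops)
 have f': "w \<in> tuples A k" if "w \<in> keys f" for w using f that by (auto simp: carrier_M)
 have "nrm l2_ops (L rhos f) <= (\<Sum>w\<in>keys f. nrm l2_ops (scl l2_ops (lookup f w) (phi rhos w)))"
  unfolding lin_def by (rule O.nrm_asum_le) (use f' rhos phi_closed O.scl_closed in blast)
 also have "... <= (\<Sum>w\<in>keys f. cmod (lookup f w) * prod_list (map (nrm A) w))"
 proof (rule sum_mono)
  fix w assume "w \<in> keys f"
  then show "nrm l2_ops (scl l2_ops (lookup f w) (phi rhos w)) <= cmod (lookup f w) * prod_list (map (nrm A) w)"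
   using O.nrm_scl[OF phi_closed[OF rhos f'], of w "lookup f w"] phi_norm[OF rhos f', of w]
   by (simp add: mult_left_mono)
 qed
 finally show ?thesis by simp
qed

definition spatial_set :: "('a list \<Rightarrow>\<^sub>0 complex) => real set" where
 "spatial_set f = {ell2_norm (%l. \<Sum>w\<in>keys f. lookup f w * tens_op (map2 (%\<pi> a. \<pi> a) \<pi>s w) xi l) |\<pi>s xi.
  length \<pi>s = k & (\<forall>\<pi>\<in>set \<pi>s. star_rep A \<pi>) & xi \<in> ell2 {l. length l = k} & ell2_norm xi <= 1}"

lemma spatial_set_le:
 assumes f: "f \<in>: M" and "r \<in> spatial_set f"
 shows "\<exists>rhos\<in>rep_tuples A k. r <= norm (L rhos f)"
proof -
 obtain \<pi>s xi where r: "r = ell2_norm (%l. \<Sum>w\<in>keys f. lookup f w * tens_op (map2 (%\<pi> a. \<pi> a) \<pi>s w) xi l)"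
  and \<pi>s: "length \<pi>s = k" "\<forall>\<pi>\<in>set \<pi>s. star_rep A \<pi>" and xi: "xi \<in> ell2 {l. length l = k}" "ell2_norm xi <= 1"
  using assms(2) unfolding spatial_set_def by blast
 note E = spatial_element[OF f \<pi>s xi(1)]
 have "r <= norm (L (map rep_op \<pi>s) f) * ell2_norm xi" unfolding r E(1) E(2)[symmetric] by (rule norm_blinfun)
 also have "... <= norm (L (map rep_op \<pi>s) f)" using xi(2) by (simp add: mult_left_le)
 finally show ?thesis using E(3) by blast
qed

lemma zero_rep_tuple: "replicate k (%_. 0) \<in> rep_tuples A k"
proof -
 have "star_hom A l2_ops (rep_op (op_rep (%_. 0)))" by (rule star_hom_rep_op[OF preA star_rep_zero[OF preA]])
 then show ?thesis by (auto simp: rep_tuples_def)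
qed

text \<open>The definition takes the supremum over representations and vectors at once. Doing the
  vectors first turns it into a supremum of operator norms, that is, of C*-seminorms.\<close>

lemma spatial_norm_eq:
 assumes f: "f \<in>: M"
 shows "spatial_norm A k f = (SUP rhos\<in>rep_tuples A k. norm (L rhos f))"
  and norm_L_le_spatial: "rhos \<in> rep_tuples A k ==> norm (L rhos f) <= spatial_norm A k f"
proof -
 have bdd: "bdd_above ((%rhos. norm (L rhos f)) ` rep_tuples A k)" using norm_L_le[OF f] by (rule bdd_aboveI2)
 have up: "r <= (SUP rhos\<in>rep_tuples A k. norm (L rhos f))" if r: "r \<in> spatial_set f" for r
 proof -
  obtain rhos where "rhos \<in> rep_tuples A k" "r <= norm (L rhos f)" using spatial_set_le[OF f r] by blast
  then show ?thesis using cSUP_upper[OF _ bdd] by (meson order_trans)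
 qed
 have sp: "spatial_norm A k f = Sup (spatial_set f)" by (simp add: spatial_norm_def spatial_set_def)
 have bdd': "bdd_above (spatial_set f)" using up by (rule bdd_aboveI)
 have main: "norm (L rhos f) <= Sup (spatial_set f)" if rhos: "rhos \<in> rep_tuples A k" for rhos
 proof -
  let ?\<pi>s = "map op_rep rhos"
  have \<pi>s: "length ?\<pi>s = k" "\<forall>\<pi>\<in>set ?\<pi>s. star_rep A \<pi>"
   using rhos star_rep_op_rep[OF preA] by (auto simp: rep_tuples_def)
  have rr: "map rep_op ?\<pi>s = rhos" by (simp add: comp_def)
  have unit: "norm (L rhos f x) <= Sup (spatial_set f)" if x: "norm x <= 1" for x
  proof -
   \<comment> \<open>\<open>enc\<close> identifies the model with the lists of length k; on all
     other lists membership in \<open>ell2\<close> forces the value 0.\<close>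
   define xi where "xi = (%l. if length l = k then l2_app x (inv_into UNIV enc l) else 0)"
   have inv: "inv_into UNIV enc (enc kap) = kap" "length (enc kap) = k" for kap using enc by (auto simp: bij_betw_def)
   then have xie: "(%kap. xi (enc kap)) = l2_app x" by (auto simp: xi_def)
   have xi: "xi \<in> ell2 {l. length l = k}" using ell2_norm_enc(2)[of xi] by (simp add: xie l2_app) (simp add: xi_def)
   note E = spatial_element[OF f \<pi>s xi, unfolded rr xie l2_app_inverse]
   have "norm (L rhos f x) \<in> spatial_set f"
    unfolding spatial_set_def E(1)[symmetric] using \<pi>s xi x E(2) by (intro CollectI exI conjI) auto
   then show ?thesis by (rule cSup_upper[OF _ bdd'])
  qed
  have nonneg: "0 <= Sup (spatial_set f)" using unit[of 0] by (simp add: blinfun.zero_right)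
  show ?thesis
  proof (rule norm_blinfun_bound[OF nonneg])
   fix x
   show "norm (L rhos f x) <= Sup (spatial_set f) * norm x"
   proof (cases "x = 0")
    case False
    have "norm (L rhos f ((1 / norm x) *\<^sub>R x)) <= Sup (spatial_set f)" by (rule unit) (use False in simp)
    then show ?thesis using False by (simp add: blinfun.scaleR_right field_simps)
   qed (simp add: blinfun.zero_right)
  qed
 qed
 have ne: "spatial_set f ~= {}"
 proof -
  let ?\<pi>s = "replicate k (op_rep (%_. 0))"
  have "(%_. 0) \<in> ell2 {l :: nat list. length l = k}" "ell2_norm (%_ :: nat list. 0) <= 1"
   by (simp_all add: ell2_def ell2_norm_def)
  moreover have "length ?\<pi>s = k" "\<forall>\<pi>\<in>set ?\<pi>s. star_rep A \<pi>" using star_rep_zero[OF preA] by auto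
  ultimately show ?thesis unfolding spatial_set_def by blast
 qed
 show "spatial_norm A k f = (SUP rhos\<in>rep_tuples A k. norm (L rhos f))" unfolding sp
  by (rule antisym, rule cSup_least[OF ne up], assumption, rule cSUP_least)
   (use zero_rep_tuple main in auto)
 show "norm (L rhos f) <= spatial_norm A k f" if "rhos \<in> rep_tuples A k" unfolding sp by (rule main[OF that])
qed

lemma star_hom_L: "rhos \<in> rep_tuples A k ==> star_hom (sg_alg (tuples A k) (map2 (mul A)) (map (adj A))) l2_ops (L rhos)"
 by (rule pre_cstar.star_hom_lin[OF pre_cstar_l2_ops _ star_semigroup_tuples[OF preA]])
  (auto simp: phi_closed phi_mul phi_adj)

text \<open>On formal combinations the spatial norm is the supremum of norms pulled back along the
  homomorphisms \<open>L rhos\<close>, so \<open>cstar_seminorm_Sup\<close> applies.\<close>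

lemma pre_cstar_M: "pre_cstar M"
proof -
 let ?P = "sg_alg (tuples A k) (map2 (mul A)) (map (adj A))"
 have P: "pre_cstar ?P" by (rule star_semigroup.pre_cstar_sg_alg[OF star_semigroup_tuples[OF preA]])
 interpret P: pre_cstar ?P by (rule P)
 let ?S = "(%rhos f. norm (L rhos f)) ` rep_tuples A k"
 have C: "carrier ?P = carrier M" by (simp add: carrier_M sg_alg_def)
 have "cstar_seminorm ?P (%f. SUP p\<in>?S. p f)"
 proof (rule cstar_seminorm_Sup[OF _ _ P])
  show "?S ~= {}" using zero_rep_tuple by auto
  show "cstar_seminorm ?P p" if "p \<in> ?S" for p
   using that star_hom_seminorm[OF star_hom_L P pre_cstar_l2_ops] by auto
  show "bdd_above ((%p. p f) ` ?S)" if "f \<in>: ?P" for f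
   unfolding image_image using norm_L_le[of f] that C by (intro bdd_aboveI2) auto
 qed
 then have "cstar_seminorm ?P (spatial_norm A k)"
  unfolding cstar_seminorm_def by (simp add: C[symmetric] spatial_norm_eq(1)[folded C] image_image)
 then show ?thesis unfolding formal_tensor_power_eq by (rule pre_cstar_renorm[OF P])
qed

sublocale M: pre_cstar M by (rule pre_cstar_M)

lemma TP_eq: "TP = completion M" by (simp add: tensor_power_def)

lemma cstar_TP: "cstar_algebra TP" unfolding TP_eq by (rule M.cstar_algebra_C)

sublocale TP: cstar_algebra TP by (rule cstar_TP)

lemma star_hom_M: "star_hom (sg_alg (tuples A k) (map2 (mul A)) (map (adj A))) B f \<longleftrightarrow> star_hom M B f"
 by (simp add: star_hom_def formal_tensor_power_eq)

text \<open>The representation rho_1 \<otimes> ... \<otimes> rho_k, extended to the completed tensor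
  power.\<close>

definition Ext :: "('a => nat l2_op) list => (nat => 'a list \<Rightarrow>\<^sub>0 complex) set => 'k l2_op" where
 "Ext rhos = completion_lift l2_ops (L rhos)"

lemma nrm_M [simp]: "nrm M = spatial_norm A k" by (simp add: formal_tensor_power_eq)

lemma tens_eq: "length w = k ==> tens A w = M.emb (single w 1)" by (simp add: tens_def M.emb_def)

lemma single_in_M: "w \<in> tuples A k ==> single w 1 \<in>: M" by (simp add: carrier_M)

lemma lift_TP:
 assumes B: "cstar_algebra B" and F: "!!w. w \<in> tuples A k ==> F w \<in>: B"
  "!!v w. v \<in> tuples A k ==> w \<in> tuples A k ==> F (map2 (mul A) v w) = mul B (F v) (F w)"
  "!!w. w \<in> tuples A k ==> F (map (adj A) w) = adj B (F w)"
  and le: "!!f. f \<in>: M ==> nrm B (lin B F f) <= spatial_norm A k f"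
 shows "star_hom TP B (completion_lift B (lin B F))"
  "w \<in> tuples A k ==> completion_lift B (lin B F) (tens A w) = F w"
  "f \<in>: M ==> completion_lift B (lin B F) (M.emb f) = lin B F f"
proof -
 interpret B: cstar_algebra B by fact
 have h: "star_hom M B (lin B F)" unfolding star_hom_M[symmetric]
  by (rule B.star_hom_lin[OF _ star_semigroup_tuples[OF preA]]) (use F in auto)
 show "star_hom TP B (completion_lift B (lin B F))"
  unfolding TP_eq by (rule M.star_hom_completion_lift[OF B h]) (use le in simp)
 show emb: "completion_lift B (lin B F) (M.emb f) = lin B F f" if "f \<in>: M" for f
  by (rule M.completion_lift_emb[OF B h _ that]) (use le in simp)
 show "completion_lift B (lin B F) (tens A w) = F w" if w: "w \<in> tuples A k"
 proof -
  have "lin B F (single w 1) = scl B 1 (F w)" by (rule B.lin_single[OF F(1) w])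
  then show ?thesis using w emb[OF single_in_M[OF w]] F(1)[OF w] by (simp add: tens_eq tuples_def)
 qed
qed

lemma Ext:
 assumes "rhos \<in> rep_tuples A k"
 shows "star_hom TP l2_ops (Ext rhos)" "w \<in> tuples A k ==> Ext rhos (tens A w) = phi rhos w"
  "f \<in>: M ==> Ext rhos (M.emb f) = L rhos f"
 using lift_TP[OF cstar_algebra_l2_ops, of "phi rhos"] phi_closed[OF assms] phi_mul[OF assms] phi_adj[OF assms]
  norm_L_le_spatial[OF _ assms] by (simp_all add: Ext_def)

text \<open>On the dense image of the formal combinations the norm is the supremum over product
  representations, and contractivity of these extends the bound to limits. Consequently norms and
  identities in the tensor power can be checked after every \<open>Ext rhos\<close>.\<close>

lemma nrm_TP_le:
 assumes x: "x \<in>: TP" and le: "!!rhos. rhos \<in> rep_tuples A k ==> norm (Ext rhos x) <= K"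
 shows "nrm TP x <= K"
proof (rule field_le_epsilon)
 fix e :: real assume "e > 0"
 then have e: "e / 2 > 0" by simp
 obtain f where f: "f \<in>: M" "nrm TP (sub TP x (M.emb f)) < e / 2"
  using M.emb_dense[of x "e / 2"] x e by (auto simp: TP_eq)
 have fc: "M.emb f \<in>: TP" using f by (simp add: TP_eq)
 have "norm (L rhos f) <= K + e / 2" if rhos: "rhos \<in> rep_tuples A k" for rhos
 proof -
  note h = Ext(1)[OF rhos]
  have "norm (Ext rhos x - Ext rhos (M.emb f)) <= nrm TP (sub TP x (M.emb f))"
   using star_hom_contractive[OF h cstar_TP pre_cstar_l2_ops, of "sub TP x (M.emb f)"] x fc
   by (simp add: star_hom_sub[OF h TP.pre.pre_cstar_axioms])
  then show ?thesis using le[OF rhos] f(2) norm_triangle_ineq2[of "Ext rhos (M.emb f)" "Ext rhos x"]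
   by (simp add: Ext(3)[OF rhos f(1)] norm_minus_commute)
 qed
 then have "spatial_norm A k f <= K + e / 2"
  unfolding spatial_norm_eq(1)[OF f(1)] using zero_rep_tuple by (intro cSUP_least) auto
 then have "nrm TP (M.emb f) <= K + e / 2" using f by (simp add: TP_eq)
 moreover have "nrm TP x <= nrm TP (sub TP x (M.emb f)) + nrm TP (M.emb f)"
  using TP.nrm_add[of "sub TP x (M.emb f)" "M.emb f"] x fc by simp
 ultimately show "nrm TP x <= K + e" using f(2) by simp
qed

lemma TP_eqI:
 assumes x: "x \<in>: TP" "y \<in>: TP" and eq: "!!rhos. rhos \<in> rep_tuples A k ==> Ext rhos x = Ext rhos y"
 shows "x = y"
proof -
 have "norm (Ext rhos (sub TP x y)) <= 0" if "rhos \<in> rep_tuples A k" for rhos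
  using star_hom_sub[OF Ext(1)[OF that] TP.pre.pre_cstar_axioms x] eq[OF that] by simp
 then have "nrm TP (sub TP x y) <= 0" using x by (intro nrm_TP_le) auto
 then show ?thesis using TP.nrm_eq_0D[of "sub TP x y"] x TP.sub_eq_zer_iff by simp
qed

lemma tens_closed [simp]: "w \<in> tuples A k ==> tens A w \<in>: TP"
 using single_in_M[of w] by (simp add: tens_eq tuples_def TP_eq)

lemma tens_mul: "v \<in> tuples A k ==> w \<in> tuples A k ==> mul TP (tens A v) (tens A w) = tens A (map2 (mul A) v w)"
 using star_semigroup.m_closed[OF star_semigroup_tuples[OF preA]]
 by (intro TP_eqI) (simp_all add: Ext(2) star_homD(4)[OF Ext(1)] phi_mul)

lemma tens_adj: "w \<in> tuples A k ==> adj TP (tens A w) = tens A (map (adj A) w)"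
 using star_semigroup.st_closed[OF star_semigroup_tuples[OF preA]]
 by (intro TP_eqI) (simp_all add: Ext(2) star_homD(5)[OF Ext(1)] phi_adj)

lemma star_hom_TP_eq:
 assumes f: "star_hom TP B f" and g: "star_hom TP B g" and B: "cstar_algebra B"
  and eq: "!!w. w \<in> tuples A k ==> f (tens A w) = g (tens A w)" and x: "x \<in>: TP"
 shows "f x = g x"
proof (rule M.star_hom_C_eq[OF f[unfolded TP_eq] g[unfolded TP_eq] B])
 fix y assume y: "y \<in>: M"
 have h: "star_hom (sg_alg (tuples A k) (map2 (mul A)) (map (adj A))) B (%y. f' (M.emb y))"
  if "star_hom TP B f'" for f' unfolding star_hom_M using star_hom_comp[OF M.star_hom_emb that[unfolded TP_eq]] .
 show "f (M.emb y) = g (M.emb y)"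
  by (rule star_hom_sg_alg_eq[OF h[OF f] h[OF g] star_semigroup_tuples[OF preA] cstar_algebra_pre[OF B]])
   (use y eq in "auto simp: carrier_M tens_eq tuples_def")
qed (use x in "simp add: TP_eq")

lemma is_unit_TP:
 assumes e: "is_unit_of A e" shows "is_unit_of TP (tens A (replicate k e))"
proof -
 have e': "e \<in>: A" "!!a. a \<in>: A ==> mul A e a = a" "!!a. a \<in>: A ==> mul A a e = a"
  using e by (auto simp: is_unit_of_def)
 have r: "replicate k e \<in> tuples A k" using e' by (auto simp: tuples_def)
 have id: "map2 (mul A) (replicate k e) w = w" "map2 (mul A) w (replicate k e) = w" if "w \<in> tuples A k" for w
  using that nth_mem[of _ w] by (auto simp: tuples_def list_eq_iff_nth_eq intro!: e'(2,3))
 let ?u = "single (replicate k e) (1 :: complex)"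
 have left: "sg_mul (map2 (mul A)) ?u f = f" and right: "sg_mul (map2 (mul A)) f ?u = f" if "keys f <= tuples A k" for f
  using that by (induction f rule: poly_mapping_sg_induct)
   (simp_all add: sg_mul_add_left sg_mul_add_right id)
 have "is_unit_of M ?u" unfolding is_unit_of_def using r
  by (auto simp: carrier_M formal_tensor_power_eq sg_alg_def left right)
 then show ?thesis unfolding TP_eq using M.is_unit_emb by (simp add: tens_eq)
qed

end

subsection \<open>Two and three tensor factors\<close>

definition enc2 :: "nat \<times> nat => nat list" where "enc2 = (%(i, j). [i, j])"
definition enc3 :: "nat \<times> nat \<times> nat => nat list" where "enc3 = (%(i, j, k). [i, j, k])"

definition tens2_op :: "('a => nat l2_op) list => 'a list => (nat \<times> nat) l2_op" where
 "tens2_op rhos w = tensor ((rhos ! 0) (w ! 0)) ((rhos ! 1) (w ! 1))"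

text \<open>Nesting to the right is a choice of model; the other bracketing is brought into this
  form by \<open>conj_op assoc\<close>.\<close>

definition tens3_op :: "('a => nat l2_op) list => 'a list => (nat \<times> nat \<times> nat) l2_op" where
 "tens3_op rhos w = tensor ((rhos ! 0) (w ! 0)) (tensor ((rhos ! 1) (w ! 1)) ((rhos ! 2) (w ! 2)))"

lemma length_2_iff: "length w = 2 \<longleftrightarrow> (\<exists>a b. w = [a, b])"
 and length_3_iff: "length w = 3 \<longleftrightarrow> (\<exists>a b c. w = [a, b, c])"
 by (auto simp: numeral_eq_Suc length_Suc_conv)

lemma tuples_2_iff: "w \<in> tuples A 2 \<longleftrightarrow> (\<exists>a b. w = [a, b] & a \<in>: A & b \<in>: A)"
 and tuples_3_iff: "w \<in> tuples A 3 \<longleftrightarrow> (\<exists>a b c. w = [a, b, c] & a \<in>: A & b \<in>: A & c \<in>: A)"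
 by (auto simp: tuples_def length_2_iff length_3_iff)

lemma rep_tuples_2_iff: "rhos \<in> rep_tuples A 2 \<longleftrightarrow>
  (\<exists>rho1 rho2. rhos = [rho1, rho2] & star_hom A l2_ops rho1 & star_hom A l2_ops rho2)"
 and rep_tuples_3_iff: "rhos \<in> rep_tuples A 3 \<longleftrightarrow>
  (\<exists>rho1 rho2 rho3. rhos = [rho1, rho2, rho3] & star_hom A l2_ops rho1 & star_hom A l2_ops rho2 & star_hom A l2_ops rho3)"
 by (auto simp: rep_tuples_def length_2_iff length_3_iff)

lemma bij_enc2: "bij_betw enc2 UNIV {l. length l = 2}"
 and bij_enc3: "bij_betw enc3 UNIV {l. length l = 3}"
 by (auto simp: bij_betw_def inj_on_def enc2_def enc3_def length_2_iff length_3_iff image_iff)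

lemma tensor_rep_apply:
 assumes \<pi>: "pre_cstar A" "star_rep A \<pi>" "a \<in>: A" and R: "R \<in>: l2_ops"
 shows "l2_app (blinfun_apply (tensor (rep_op \<pi> a) R) x) (i, j) = \<pi> a (%m. l2_app (blinfun_apply R (slice x m)) j) i"
proof -
 let ?y = "slice (reindex_l2 prod.swap (amp2 R x)) j"
 have T: "rep_op \<pi> a \<in>: l2_ops" by (rule star_homD(1)[OF star_hom_rep_op[OF \<pi>(1,2)] \<pi>(3)])
 have "l2_app ?y = (%m. l2_app (blinfun_apply R (slice x m)) j)"
  by (rule ext) (simp add: l2_app_reindex[OF bij_swap] amp2_apply[OF R])
 then show ?thesis by (simp add: tensor_def amp1_apply[OF T] star_rep_apply[OF \<pi>(2,3)])
qed

lemma tens2_norm: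
 assumes "T \<in>: l2_ops" "R \<in>: l2_ops" "norm T <= r" "norm R <= s"
 shows "norm (tensor T R) <= r * s" using norm_tensor_le[OF assms(1,2)] assms(3,4) norm_ge_zero[of T] norm_ge_zero[of R]
 by (meson mult_mono order_trans)

lemma star_hom_l2_norm: "cstar_algebra A ==> star_hom A l2_ops rho ==> a \<in>: A ==> norm (rho a) <= nrm A a"
 using star_hom_contractive[of A l2_ops rho a] pre_cstar_l2_ops by simp

lemma tensor_model_2: "cstar_algebra A ==> tensor_model A 2 enc2 tens2_op"
proof -
 assume A: "cstar_algebra A"
 have pre: "pre_cstar A" by (rule cstar_algebra_pre[OF A])
 show ?thesis
 proof (rule tensor_model.intro)
  fix \<pi>s w xi and kap :: "nat \<times> nat"
  assume \<pi>s: "length \<pi>s = 2" "\<forall>\<pi>\<in>set \<pi>s. star_rep A \<pi>" and w: "w \<in> tuples A 2"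
   and xi: "xi \<in> ell2 {l. length l = 2}" "(%kap. xi (enc2 kap)) \<in> ell2 UNIV"
  let ?x = "Abs_l2 (%kap. xi (enc2 kap))"
  obtain a b where ab: "w = [a, b]" "a \<in>: A" "b \<in>: A" using w by (auto simp: tuples_2_iff)
  obtain \<pi>1 \<pi>2 where \<pi>: "\<pi>s = [\<pi>1, \<pi>2]" "star_rep A \<pi>1" "star_rep A \<pi>2"
   using \<pi>s by (auto simp: length_2_iff)
  obtain i j where ij: "kap = (i, j)" by (cases kap)
  have sl: "l2_app (slice ?x m) = (%r. xi [m, r])" for m
   by (rule ext) (simp add: Abs_l2_inverse xi(2), simp add: enc2_def)
  have R: "rep_op \<pi>2 b \<in>: l2_ops" by (rule star_homD(1)[OF star_hom_rep_op[OF pre \<pi>(3)] ab(3)])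
  show "tens_op (map2 (%\<pi> a. \<pi> a) \<pi>s w) xi (enc2 kap) = l2_app (blinfun_apply (tens2_op (map rep_op \<pi>s) w) ?x) kap"
   by (simp add: tens2_op_def ab \<pi> ij tensor_rep_apply[OF pre \<pi>(2) ab(2) R] star_rep_apply[OF \<pi>(3) ab(3)] sl)
    (simp add: enc2_def)
 qed (use A in "auto simp: bij_enc2 tuples_2_iff rep_tuples_2_iff tens2_op_def star_homD tensor_mul tensor_adj
   intro!: tens2_norm star_hom_l2_norm simp del: mult_cancel_left")
qed

lemma tensor_model_3: "cstar_algebra A ==> tensor_model A 3 enc3 tens3_op"
proof -
 assume A: "cstar_algebra A"
 have pre: "pre_cstar A" by (rule cstar_algebra_pre[OF A])
 show ?thesis
 proof (rule tensor_model.intro)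
  fix \<pi>s w xi and kap :: "nat \<times> nat \<times> nat"
  assume \<pi>s: "length \<pi>s = 3" "\<forall>\<pi>\<in>set \<pi>s. star_rep A \<pi>" and w: "w \<in> tuples A 3"
   and xi: "xi \<in> ell2 {l. length l = 3}" "(%kap. xi (enc3 kap)) \<in> ell2 UNIV"
  let ?x = "Abs_l2 (%kap. xi (enc3 kap))"
  obtain a b c where ab: "w = [a, b, c]" "a \<in>: A" "b \<in>: A" "c \<in>: A" using w by (auto simp: tuples_3_iff)
  obtain \<pi>1 \<pi>2 \<pi>3 where \<pi>: "\<pi>s = [\<pi>1, \<pi>2, \<pi>3]" "star_rep A \<pi>1" "star_rep A \<pi>2" "star_rep A \<pi>3"
   using \<pi>s by (auto simp: length_3_iff)
  obtain i j k where ij: "kap = (i, j, k)" by (cases kap)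
  have sl: "l2_app (slice (slice ?x m) n) = (%r. xi [m, n, r])" for m n
   by (rule ext) (simp add: Abs_l2_inverse xi(2), simp add: enc3_def)
  have R3: "rep_op \<pi>3 c \<in>: l2_ops" by (rule star_homD(1)[OF star_hom_rep_op[OF pre \<pi>(4)] ab(4)])
  have R2: "rep_op \<pi>2 b \<in>: l2_ops" by (rule star_homD(1)[OF star_hom_rep_op[OF pre \<pi>(3)] ab(3)])
  show "tens_op (map2 (%\<pi> a. \<pi> a) \<pi>s w) xi (enc3 kap) = l2_app (blinfun_apply (tens3_op (map rep_op \<pi>s) w) ?x) kap"
   by (simp add: tens3_op_def ab \<pi> ij tensor_rep_apply[OF pre \<pi>(2) ab(2) tensor_closed[OF R2 R3]]
     tensor_rep_apply[OF pre \<pi>(3) ab(3) R3] star_rep_apply[OF \<pi>(4) ab(4)] sl)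
    (simp add: enc3_def)
 qed (use A in "auto simp: bij_enc3 tuples_3_iff rep_tuples_3_iff tens3_op_def star_homD tensor_mul tensor_adj
   intro!: tens2_norm star_hom_l2_norm simp del: mult_cancel_left")
qed

lemma (in tensor_model) closed_subspace_TP:
 assumes L: "closed_subspace TP S" and tens: "!!w. w \<in> tuples A k ==> tens A w \<in> S"
 shows "carrier TP <= S"
proof
 fix x assume "x \<in>: TP"
 then obtain s where s: "cauchy M s" "x = cls M s" by (auto simp: TP_eq elim: M.C_cases)
 note SD = TP.closed_subspaceD[OF L]
 have emb: "M.emb f \<in> S" if "keys f <= tuples A k" for f using that
 proof (induction f rule: poly_mapping_sg_induct)
  case zero
  have "zer M = 0" by (simp add: formal_tensor_power_eq sg_alg_def)
  then have "M.emb 0 = zer TP" by (simp only: M.emb_def M.zer_C TP_eq)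
  then show ?case using SD(3) by simp
 next
  case (single w a)
  have "M.emb (scl M a (single w 1)) = scl TP a (M.emb (single w 1))"
   using star_homD(3)[OF M.star_hom_emb single_in_M[OF single]] by (simp add: TP_eq)
  then have "M.emb (single w a) = scl TP a (tens A w)"
   using single by (simp add: formal_tensor_power_eq sg_alg_def tens_eq tuples_def)
  then show ?case using SD(5) tens[OF single] by simp
 next
  case (add f g)
  then have "M.emb (add M f g) = add TP (M.emb f) (M.emb g)"
   using star_homD(2)[OF M.star_hom_emb] by (simp add: TP_eq carrier_M)
  then show ?case using SD(4) add by (simp add: formal_tensor_power_eq sg_alg_def)
 qed
 have "conv_to TP (%n. M.emb (s n)) x" using M.conv_to_cls[OF s(1)] s by (simp add: TP_eq)
 moreover have "M.emb (s n) \<in> S" for n by (rule emb) (use M.cauchyD[OF s(1), of n] in "simp add: carrier_M")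
 ultimately show "x \<in> S" using SD(7)[of "%n. M.emb (s n)" x] \<open>x \<in>: TP\<close> by simp
qed

section \<open>Coassociativity and the density conditions for a comultiplication given on a magic
  unitary\<close>

section \<open>Criterion for quantum permutation groups\<close>

lemma (in pre_cstar) closed_subspace_vimage:
 assumes S: "closed_subspace A S" and B: "pre_cstar B"
  and F: "!!x. x \<in>: B ==> F x \<in>: A"
  "!!x y. x \<in>: B ==> y \<in>: B ==> F (add B x y) = add A (F x) (F y)"
  "!!c x. x \<in>: B ==> F (scl B c x) = scl A c (F x)"
  "!!s x. (!!n. s n \<in>: B) ==> x \<in>: B ==> conv_to B s x ==> conv_to A (%n. F (s n)) (F x)"
 shows "closed_subspace B {x \<in> carrier B. F x \<in> S}"
proof -
 interpret B: pre_cstar B by fact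
 note SD = closed_subspaceD[OF S]
 have "F (zer B) = zer A" using F(3)[of "zer B" 0] F(1)[of "zer B"] by simp
 then show ?thesis unfolding closed_subspace_def
 proof (intro conjI ballI allI impI)
  fix s x assume s: "\<forall>n. s n \<in> {x \<in> carrier B. F x \<in> S}" "x \<in>: B" "conv_to B s x"
  have "F x \<in> S"
  proof (rule SD(7)[of "%n. F (s n)"])
   show "conv_to A (%n. F (s n)) (F x)" by (rule F(4)) (use s in auto)
  qed (use s F(1) in auto)
  then show "x \<in> {x \<in> carrier B. F x \<in> S}" using s by simp
 qed (use F(1-3) SD(3-5) in auto)
qed

lemma (in pre_cstar) closed_subspace_mul_vimage:
 assumes S: "closed_subspace A S" and a: "a \<in>: A"
 shows "closed_subspace A {x \<in> carrier A. mul A x a \<in> S}" "closed_subspace A {x \<in> carrier A. mul A a x \<in> S}"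
proof -
 have conv: "conv_to A (%n. mul A (s n) a) (mul A x a)" "conv_to A (%n. mul A a (s n)) (mul A a x)"
  if "!!n. s n \<in>: A" "x \<in>: A" "conv_to A s x" for s x
  using conv_to_mul[OF that(3) conv_to_const[OF a]] conv_to_mul[OF conv_to_const[OF a] that(3)] that a by simp_all
 show "closed_subspace A {x \<in> carrier A. mul A x a \<in> S}"
  by (rule closed_subspace_vimage[OF S pre_cstar_axioms]) (use a conv(1) in "simp_all add: mul_add_left mul_scl_left")
 show "closed_subspace A {x \<in> carrier A. mul A a x \<in> S}"
  by (rule closed_subspace_vimage[OF S pre_cstar_axioms]) (use a conv(2) in "simp_all add: mul_add_right mul_scl_right")
qed

lemma (in pre_cstar) closed_span:
 assumes "S <= carrier A"
 shows "closed_subspace A (closed_span A S)" "S <= closed_span A S"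
  "closed_subspace A L ==> S <= L ==> closed_span A S <= L"
proof -
 have mem: "x \<in> closed_span A S \<longleftrightarrow> (\<forall>L. closed_subspace A L --> S <= L --> x \<in> L)" for x
  by (auto simp: closed_span_def)
 have "closed_subspace A (carrier A)" by (auto simp: closed_subspace_def)
 then have sub: "closed_span A S <= carrier A" using assms mem by blast
 show "closed_subspace A (closed_span A S)" unfolding closed_subspace_def
 proof (intro conjI ballI allI impI sub)
  fix s x assume s: "\<forall>n. s n \<in> closed_span A S" "x \<in>: A" "conv_to A s x"
  show "x \<in> closed_span A S" unfolding mem
  proof (intro allI impI)
   fix L assume L: "closed_subspace A L" "S <= L"
   show "x \<in> L" by (rule closed_subspaceD(7)[OF L(1), of s]) (use s L mem in auto)
  qed
 qed (auto simp: mem closed_subspaceD)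
 show "S <= closed_span A S" "closed_subspace A L ==> S <= L ==> closed_span A S <= L" by (auto simp: closed_span_def)
qed

lemma generates_subset:
 assumes "generates A S" "closed_unital_star_subalgebra A L" "S <= L"
 shows "carrier A <= L" using assms unfolding generates_def by blast

lemma star_hom_generates_eq:
 assumes gen: "generates A S" and S: "S <= carrier A" and A: "unital_cstar A" and B: "cstar_algebra B"
  and f: "star_hom A B f" and g: "star_hom A B g"
  and eq: "!!x. x \<in> S ==> f x = g x" "f (unit_of A) = g (unit_of A)" and x: "x \<in>: A"
 shows "f x = g x"
proof -
 interpret A: unital_pre_cstar A by (rule unital_cstar_pre[OF A])
 interpret AC: cstar_algebra A by (rule unital_cstarD[OF A])
 interpret B: cstar_algebra B by fact
 note fD = star_homD[OF f] and gD = star_homD[OF g]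
 have "closed_subspace A {x \<in> carrier A. f x = g x}" unfolding closed_subspace_def
 proof (intro conjI ballI allI impI)
  fix s x assume s: "\<forall>n. s n \<in> {x \<in> carrier A. f x = g x}" "x \<in>: A" "conv_to A s x"
  have "conv_to B (%n. f (s n)) (f x)" "conv_to B (%n. f (s n)) (g x)"
   using star_hom_conv_to[OF f AC.cstar_algebra_axioms B.pre.pre_cstar_axioms s(3)]
    star_hom_conv_to[OF g AC.cstar_algebra_axioms B.pre.pre_cstar_axioms s(3)] s by simp_all
  then show "x \<in> {x \<in> carrier A. f x = g x}"
   using B.conv_to_unique[of "%n. f (s n)" "f x" "g x"] s fD(1) gD(1) by simp
 qed (use star_hom_zer[OF f] star_hom_zer[OF g] A.pre_cstar_axioms B.pre.pre_cstar_axioms in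
   \<open>auto simp: fD gD\<close>)
 then have "closed_unital_star_subalgebra A {x \<in> carrier A. f x = g x}"
  unfolding closed_unital_star_subalgebra_def using eq by (auto simp: fD gD)
 then show ?thesis using generates_subset[OF gen] eq S x by blast
qed

text \<open>
 The cancellation property of a comultiplication: \<open>j\<close> and \<open>j'\<close> are the two inclusions of \<open>A\<close>
 into \<open>A \<otimes> A\<close>, in either order.
\<close>

lemma cancellation_dense:
 assumes A: "unital_cstar A" and P: "unital_cstar P"
  and j: "star_hom A P j" and j': "star_hom A P j'" "j' (unit_of A) = unit_of P" "j (unit_of A) = unit_of P"
  and Delta: "star_hom A P Delta" "Delta (unit_of A) = unit_of P"
  and comm: "!!a b. a \<in>: A ==> b \<in>: A ==> mul P (j a) (j' b) = mul P (j' b) (j a)"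
  and gen: "generates A S" "S <= carrier A" "!!x. x \<in> S ==> adj A x = x"
  and M_def: "M = closed_span P {mul P (Delta a) (j' b) |a b. a \<in>: A & b \<in>: A}"
  and S: "!!x. x \<in> S ==> j x \<in> M" and ab: "a \<in>: A" "b \<in>: A"
 shows "mul P (j a) (j' b) \<in> M"
proof -
 interpret A: unital_pre_cstar A by (rule unital_cstar_pre[OF A])
 interpret AC: cstar_algebra A by (rule unital_cstarD[OF A])
 interpret P: unital_pre_cstar P by (rule unital_cstar_pre[OF P])
 note jD = star_homD[OF j] and j'D = star_homD[OF j'(1)] and DD = star_homD[OF Delta(1)]
 let ?G = "{mul P (Delta a) (j' b) |a b. a \<in>: A & b \<in>: A}"
 have G: "?G <= carrier P" by (auto simp: DD j'D)
 note span = P.closed_span[OF G, folded M_def]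
 note MD = P.closed_subspaceD[OF span(1)]
 have GM: "mul P (Delta a) (j' b) \<in> M" if "a \<in>: A" "b \<in>: A" for a b using span(2) that by blast
 \<comment> \<open>The closed span is stable under right multiplication by the image of j', and
   next, under left multiplication by the image of \<open>Delta\<close>, because this holds for the
   spanning products.\<close>
 have Mj': "mul P x (j' b) \<in> M" if x: "x \<in> M" and b: "b \<in>: A" for x b
 proof -
  have "mul P (mul P (Delta a) (j' c)) (j' b) \<in> M" if "a \<in>: A" "c \<in>: A" for a c
   using GM[of a "mul A c b"] that b by (simp add: j'D DD P.mul_assoc)
  then have "M <= {x \<in> carrier P. mul P x (j' b) \<in> M}"
   using G by (intro span(3) P.closed_subspace_mul_vimage[OF span(1)]) (auto simp: b j'D DD)
  then show ?thesis using x by blast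
 qed
 have DM: "mul P (Delta c) x \<in> M" if x: "x \<in> M" and c: "c \<in>: A" for x c
 proof -
  have "mul P (Delta c) (mul P (Delta a) (j' b)) \<in> M" if "a \<in>: A" "b \<in>: A" for a b
   using GM[of "mul A c a" b] that c by (simp add: j'D DD P.mul_assoc)
  then have "M <= {x \<in> carrier P. mul P (Delta c) x \<in> M}"
   using G by (intro span(3) P.closed_subspace_mul_vimage[OF span(1)]) (auto simp: c DD j'D)
  then show ?thesis using x by blast
 qed
 \<comment> \<open>As j' d commutes with j b, the product Delta c (j' d) (j b) equals Delta c (j b)
   (j' d), which lies in M by the two stability properties. So the elements that j sends into M are
   closed under multiplication.\<close>
 have mulM: "mul P (j a) (j b) \<in> M" if a: "a \<in>: A" "j a \<in> M" and b: "b \<in>: A" "j b \<in> M" for a b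
 proof -
  have "mul P (mul P (Delta c) (j' d)) (j b) \<in> M" if "c \<in>: A" "d \<in>: A" for c d
   using DM[OF Mj'[OF b(2) that(2)] that(1)] that b by (simp add: j'D DD jD P.mul_assoc comm)
  then have "M <= {x \<in> carrier P. mul P x (j b) \<in> M}"
   using G by (intro span(3) P.closed_subspace_mul_vimage[OF span(1)]) (auto simp: b jD DD j'D)
  then show ?thesis using a by blast
 qed
 then have mulM': "j (mul A a b) \<in> M" if "a \<in>: A" "j a \<in> M" "b \<in>: A" "j b \<in> M" for a b
  using that by (simp add: jD(4))
 \<comment> \<open>Including the adjoint in the condition makes the set stable under
   \<open>adj\<close>; for the self-adjoint generators it adds nothing.\<close>
 let ?L = "{a \<in> carrier A. j a \<in> M & j (adj A a) \<in> M}"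
 have jconv: "conv_to P (%n. j (s n)) (j x)" if "!!n. s n \<in>: A" "x \<in>: A" "conv_to A s x" for s x
  using star_hom_conv_to[OF j AC.cstar_algebra_axioms P.pre_cstar_axioms that(3)] that by simp
 have "closed_subspace A {a \<in> carrier A. j a \<in> M}"
  by (rule P.closed_subspace_vimage[OF span(1) A.pre_cstar_axioms]) (use jD jconv in auto)
 note L1 = A.closed_subspaceD[OF this]
 have "closed_unital_star_subalgebra A ?L" unfolding closed_unital_star_subalgebra_def closed_subspace_def
 proof (intro conjI ballI allI impI)
  fix s x assume s: "\<forall>n. s n \<in> ?L" "x \<in>: A" "conv_to A s x"
  have "x \<in> {a \<in> carrier A. j a \<in> M}" by (rule L1(7)[of s]) (use s in auto)
  moreover have "adj A x \<in> {a \<in> carrier A. j a \<in> M}"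
   by (rule L1(7)[of "%n. adj A (s n)"]) (use s A.conv_to_adj[OF s(3)] in auto)
  ultimately show "x \<in> ?L" by simp
 next
  have "j (unit_of A) \<in> M" using GM[of "unit_of A" "unit_of A"] j' Delta by simp
  then show "unit_of A \<in> ?L" by simp
 next
  show "zer A \<in> ?L" using L1(3) by simp
 qed (use mulM' MD(4,5) in "auto simp: jD(2,3) A.adj_add A.adj_scl A.adj_mul")
 then have "carrier A <= ?L" by (rule generates_subset[OF gen(1)]) (use gen S in auto)
 then show ?thesis using Mj' ab by blast
qed

locale unital_tensor =
 fixes A :: "'a star_algebra"
 assumes unital: "unital_cstar A"
begin

sublocale cstar_algebra A by (rule unital_cstarD[OF unital])
sublocale U?: unital_pre_cstar A by (rule unital_cstar_pre[OF unital])
sublocale T2: tensor_model A 2 enc2 tens2_op by (rule tensor_model_2) (rule cstar_algebra_axioms)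
sublocale T3: tensor_model A 3 enc3 tens3_op by (rule tensor_model_3) (rule cstar_algebra_axioms)

abbreviation "e \<equiv> unit_of A"
abbreviation "P2 \<equiv> tensor_power A 2"
abbreviation "P3 \<equiv> tensor_power A 3"

lemma in_tuples [simp]: "a \<in>: A ==> b \<in>: A ==> [a, b] \<in> tuples A 2"
 "a \<in>: A ==> b \<in>: A ==> c \<in>: A ==> [a, b, c] \<in> tuples A 3" by (simp_all add: tuples_def)

lemma unit_P2: "is_unit_of P2 (tens A [e, e])" using T2.is_unit_TP[OF U.unit] by (simp add: numeral_eq_Suc)

lemma unit_P3: "is_unit_of P3 (tens A [e, e, e])" using T3.is_unit_TP[OF U.unit] by (simp add: numeral_eq_Suc)

lemma unit_of_P2: "unit_of P2 = tens A [e, e]" by (rule T2.TP.unit_ofI[OF unit_P2])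
lemma unit_of_P3: "unit_of P3 = tens A [e, e, e]" by (rule T3.TP.unit_ofI[OF unit_P3])

lemma unital_P2: "unital_cstar P2" and unital_P3: "unital_cstar P3"
 using unit_P2 unit_P3 T2.cstar_TP T3.cstar_TP by (auto simp: unital_cstar_def)

text \<open>Formal tensors are not multilinear. The equations hold after completion because every
  product representation satisfies them.\<close>

lemma tens2_add_left: "a \<in>: A ==> a' \<in>: A ==> b \<in>: A ==>
  tens A [add A a a', b] = add P2 (tens A [a, b]) (tens A [a', b])"
 and tens2_add_right: "a \<in>: A ==> b \<in>: A ==> b' \<in>: A ==>
  tens A [a, add A b b'] = add P2 (tens A [a, b]) (tens A [a, b'])"
 and tens2_scl_left: "a \<in>: A ==> b \<in>: A ==> tens A [scl A c a, b] = scl P2 c (tens A [a, b])"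
 and tens2_scl_right: "a \<in>: A ==> b \<in>: A ==> tens A [a, scl A c b] = scl P2 c (tens A [a, b])"
 by (rule T2.TP_eqI; auto simp: rep_tuples_2_iff T2.Ext(2) star_homD[OF T2.Ext(1)] tens2_op_def
   star_homD tensor_add_left tensor_add_right tensor_scl_left tensor_scl_right)+

lemma tens2_mul: "a \<in>: A ==> a' \<in>: A ==> b \<in>: A ==> b' \<in>: A ==>
  mul P2 (tens A [a, b]) (tens A [a', b']) = tens A [mul A a a', mul A b b']" by (simp add: T2.tens_mul)

lemma tens2_zer: "a \<in>: A ==> tens A [a, zer A] = zer P2" "a \<in>: A ==> tens A [zer A, a] = zer P2"
 using tens2_scl_left[of "zer A" a 0] tens2_scl_right[of a "zer A" 0] by simp_all

lemma tens2_asum_left: "(!!i. i \<in> I ==> f i \<in>: A) ==> b \<in>: A ==>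
  tens A [asum A f I, b] = asum P2 (%i. tens A [f i, b]) I"
 by (induction I rule: infinite_finite_induct) (simp_all add: tens2_zer asum_insert T2.TP.asum_insert tens2_add_left)

lemma tens2_asum_right: "(!!i. i \<in> I ==> f i \<in>: A) ==> b \<in>: A ==>
  tens A [b, asum A f I] = asum P2 (%i. tens A [b, f i]) I"
 by (induction I rule: infinite_finite_induct) (simp_all add: tens2_zer asum_insert T2.TP.asum_insert tens2_add_right)

lemma star_hom_incl1: "star_hom A P2 (%a. tens A [a, e])"
 by (rule star_homI) (simp_all add: tens2_add_left tens2_scl_left tens2_mul T2.tens_adj)

lemma star_hom_incl2: "star_hom A P2 (%a. tens A [e, a])"
 by (rule star_homI) (simp_all add: tens2_add_right tens2_scl_right tens2_mul T2.tens_adj)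

lemma bij_map_prod_encode: "bij (map_prod id prod_encode :: 'x \<times> _ => _)" "bij (map_prod prod_encode id :: _ \<times> 'x => _)"
proof -
 have "inj prod_encode" "surj prod_encode" using bij_prod_encode by (auto simp: bij_def)
 then show "bij (map_prod id prod_encode :: 'x \<times> _ => _)" "bij (map_prod prod_encode id :: _ \<times> 'x => _)"
  by (auto simp: bij_def intro!: prod.inj_map map_prod_surj)
qed

text \<open>
 The spatial norm also dominates representations in which one factor acts on the square-summable
 families indexed by \<open>nat \<times> nat\<close>, because this space is isomorphic to \<open>nat l2\<close>.
\<close>

lemma spatial_norm_dominates:
 fixes sig :: "'a => (nat \<times> nat) l2_op" and rho :: "'a => nat l2_op"
 assumes rho: "star_hom A l2_ops rho" and sig: "star_hom A l2_ops sig" and f: "f \<in>: T2.M"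
 shows "norm (lin l2_ops (%w. tensor (rho (w ! 0)) (sig (w ! 1))) f) <= spatial_norm A 2 f"
  "norm (lin l2_ops (%w. tensor (sig (w ! 0)) (rho (w ! 1))) f) <= spatial_norm A 2 f"
proof -
 define sig' where "sig' = (%a. conj_op prod_encode (sig a))"
 have sig': "star_hom A l2_ops sig'"
  unfolding sig'_def by (rule star_hom_comp[OF sig star_hom_conj_op[OF bij_prod_encode]])
 have w: "w ! 0 \<in>: A" "w ! 1 \<in>: A" if "w \<in> keys f" for w
 proof -
  have "w \<in> tuples A 2" using that f by (auto simp: T2.carrier_M)
  then show "w ! 0 \<in>: A" "w ! 1 \<in>: A" by (auto simp: tuples_2_iff)
 qed
 note cl = star_homD(1)[OF rho] star_homD(1)[OF sig] star_homD(1)[OF sig']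
 let ?F = "%w. tensor (rho (w ! 0)) (sig (w ! 1))" and ?G = "%w. tensor (sig (w ! 0)) (rho (w ! 1))"
 have F: "lin l2_ops ?F f \<in>: l2_ops" "lin l2_ops ?G f \<in>: l2_ops"
  by (rule pre_cstar.lin_closed[OF pre_cstar_l2_ops, of "keys f"]; use w cl in simp)+
 have "conj_op (map_prod id prod_encode) (lin l2_ops ?F f) = lin l2_ops (%w. conj_op (map_prod id prod_encode) (?F w)) f"
  by (rule star_hom_lin_comp[OF star_hom_conj_op[OF bij_map_prod_encode(1)] pre_cstar_l2_ops pre_cstar_l2_ops])
   (use w cl in simp)
 also have "... = lin l2_ops (tens2_op [rho, sig']) f" by (rule lin_cong[OF pre_cstar_l2_ops])
   (use w cl in "simp_all add: tens2_op_def conj_tensor_right[OF bij_prod_encode] sig'_def[symmetric]", simp add: sig'_def)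
 finally have "norm (lin l2_ops ?F f) = norm (lin l2_ops (tens2_op [rho, sig']) f)"
  using norm_conj_op[OF bij_map_prod_encode(1) F(1)] by simp
 then show "norm (lin l2_ops ?F f) <= spatial_norm A 2 f"
  using T2.norm_L_le_spatial[OF f, of "[rho, sig']"] rho sig' by (simp add: rep_tuples_2_iff)
 have "conj_op (map_prod prod_encode id) (lin l2_ops ?G f) = lin l2_ops (%w. conj_op (map_prod prod_encode id) (?G w)) f"
  by (rule star_hom_lin_comp[OF star_hom_conj_op[OF bij_map_prod_encode(2)] pre_cstar_l2_ops pre_cstar_l2_ops])
   (use w cl in simp)
 also have "... = lin l2_ops (tens2_op [sig', rho]) f" by (rule lin_cong[OF pre_cstar_l2_ops])
   (use w cl in "simp_all add: tens2_op_def conj_tensor_left[OF bij_prod_encode] sig'_def[symmetric]", simp add: sig'_def)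
 finally have "norm (lin l2_ops ?G f) = norm (lin l2_ops (tens2_op [sig', rho]) f)"
  using norm_conj_op[OF bij_map_prod_encode(2) F(2)] by simp
 then show "norm (lin l2_ops ?G f) <= spatial_norm A 2 f"
  using T2.norm_L_le_spatial[OF f, of "[sig', rho]"] rho sig' by (simp add: rep_tuples_2_iff)
qed

end

lemma magic_unitaryD:
 assumes "magic_unitary I A u" "i \<in> I" "j \<in> I"
 shows "u i j \<in>: A" "mul A (u i j) (u i j) = u i j" "adj A (u i j) = u i j"
  "asum A (%j. u i j) I = unit_of A" "asum A (%i. u i j) I = unit_of A" using assms by (auto simp: magic_unitary_def)

text \<open>In a degenerate representation the unit acts as a projection Q, and this takes the place
  of the identity in an additional tensor factor. Since Q is a projection, tensoring with it is
  still multiplicative and compatible with adjoints.\<close>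

lemma star_hom_tensor_const:
 assumes Q: "Q \<in>: l2_ops" "adj l2_ops Q = Q" "Q o\<^sub>L Q = Q"
 shows "star_hom l2_ops l2_ops (%T. tensor T Q)" "star_hom l2_ops l2_ops (%R. tensor Q R)"
proof -
 show "star_hom l2_ops l2_ops (%T. tensor T Q)"
  by (rule star_homI) (use Q in "simp_all add: tensor_add_left tensor_scl_left tensor_mul tensor_adj")
 show "star_hom l2_ops l2_ops (%R. tensor Q R)"
  by (rule star_homI) (use Q in "simp_all add: tensor_add_right tensor_scl_right tensor_mul tensor_adj")
qed

context unital_tensor
begin

lemma rep_unit:
 assumes rho: "star_hom A l2_ops rho"
 shows "rho e \<in>: l2_ops" "adj l2_ops (rho e) = rho e" "rho e o\<^sub>L rho e = rho e"
 using star_homD(1)[OF rho, of e] star_homD(5)[OF rho, of e] star_homD(4)[OF rho, of e e] by simp_all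

text \<open>Under a triple product representation, \<open>F\<close> becomes a product of two
  representations of \<open>A\<close>, one of which acts on two of the three coordinates. The two
  alternatives say which two coordinates these are.\<close>

definition splits_as_pair where
 "splits_as_pair F rhos \<longleftrightarrow> (\<exists>(rho :: 'a => nat l2_op) (sig :: 'a => (nat \<times> nat) l2_op).
   star_hom A l2_ops rho & star_hom A l2_ops sig &
   ((\<forall>w\<in>tuples A 2. T3.Ext rhos (F w) = tensor (rho (w ! 0)) (sig (w ! 1))) \<or>
   (\<forall>w\<in>tuples A 2. T3.Ext rhos (F w) = conj_op assoc (tensor (sig (w ! 0)) (rho (w ! 1))))))"

text \<open>Product representations determine the norm of the tensor cube. Under each of them
  \<open>F\<close> is a product representation of the tensor square with one factor on l2(N x N),
  and \<open>spatial_norm_dominates\<close> bounds it by the spatial norm. Hence the linear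
  extension of \<open>F\<close> is contractive and passes to the completion.\<close>

lemma lift_to_P3:
 assumes F: "!!w. w \<in> tuples A 2 ==> F w \<in>: P3"
  and E: "!!rhos. rhos \<in> rep_tuples A 3 ==> splits_as_pair F rhos"
 shows "star_hom P2 P3 (completion_lift P3 (lin P3 F))"
  "w \<in> tuples A 2 ==> completion_lift P3 (lin P3 F) (tens A w) = F w"
proof -
 note SG = star_semigroup_tuples[OF T2.preA, of 2]
 note cj = star_homD[OF star_hom_conj_op[OF bij_assoc]]
 have Fc: "T3.Ext rhos (F w) \<in>: l2_ops" if "rhos \<in> rep_tuples A 3" "w \<in> tuples A 2" for rhos w
  by (rule star_homD(1)[OF T3.Ext(1)[OF that(1)] F[OF that(2)]])
 have mul: "T3.Ext rhos (F (map2 (mul A) v w)) = T3.Ext rhos (F v) o\<^sub>L T3.Ext rhos (F w)"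
  if rhos: "rhos \<in> rep_tuples A 3" and v: "v \<in> tuples A 2" and w: "w \<in> tuples A 2" for rhos v w
 proof -
  obtain a b c d where ab: "v = [a, b]" "w = [c, d]" "a \<in>: A" "b \<in>: A" "c \<in>: A" "d \<in>: A"
   using v w by (auto simp: tuples_2_iff)
  obtain rho :: "'a => nat l2_op" and sig :: "'a => (nat \<times> nat) l2_op"
   where h: "star_hom A l2_ops rho" "star_hom A l2_ops sig" and
   cases: "(\<forall>w\<in>tuples A 2. T3.Ext rhos (F w) = tensor (rho (w ! 0)) (sig (w ! 1))) \<or>
   (\<forall>w\<in>tuples A 2. T3.Ext rhos (F w) = conj_op assoc (tensor (sig (w ! 0)) (rho (w ! 1))))"
   using E[OF rhos] unfolding splits_as_pair_def by blast
  note hD = star_homD[OF h(1), simplified l2_ops_simps] star_homD[OF h(2), simplified l2_ops_simps]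
  from cases show ?thesis
  proof
   assume "\<forall>w\<in>tuples A 2. T3.Ext rhos (F w) = tensor (rho (w ! 0)) (sig (w ! 1))"
   then show ?thesis by (simp add: ab hD tensor_mul)
  next
   assume "\<forall>w\<in>tuples A 2. T3.Ext rhos (F w) = conj_op assoc (tensor (sig (w ! 0)) (rho (w ! 1)))"
   then show ?thesis using cj(4)[of "tensor (sig a) (rho b)" "tensor (sig c) (rho d)"] by (simp add: ab hD tensor_mul)
  qed
 qed
 have adj: "T3.Ext rhos (F (map (adj A) w)) = adj l2_ops (T3.Ext rhos (F w))"
  if rhos: "rhos \<in> rep_tuples A 3" and w: "w \<in> tuples A 2" for rhos w
 proof -
  obtain c d where ab: "w = [c, d]" "c \<in>: A" "d \<in>: A" using w by (auto simp: tuples_2_iff)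
  obtain rho :: "'a => nat l2_op" and sig :: "'a => (nat \<times> nat) l2_op"
   where h: "star_hom A l2_ops rho" "star_hom A l2_ops sig" and
   cases: "(\<forall>w\<in>tuples A 2. T3.Ext rhos (F w) = tensor (rho (w ! 0)) (sig (w ! 1))) \<or>
   (\<forall>w\<in>tuples A 2. T3.Ext rhos (F w) = conj_op assoc (tensor (sig (w ! 0)) (rho (w ! 1))))"
   using E[OF rhos] unfolding splits_as_pair_def by blast
  note hD = star_homD[OF h(1), simplified l2_ops_simps] star_homD[OF h(2), simplified l2_ops_simps]
  from cases show ?thesis
  proof
   assume "\<forall>w\<in>tuples A 2. T3.Ext rhos (F w) = tensor (rho (w ! 0)) (sig (w ! 1))"
   then show ?thesis by (simp add: ab hD tensor_adj)
  next
   assume "\<forall>w\<in>tuples A 2. T3.Ext rhos (F w) = conj_op assoc (tensor (sig (w ! 0)) (rho (w ! 1)))"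
   then show ?thesis using cj(5)[of "tensor (sig c) (rho d)"] by (simp add: ab hD tensor_adj)
  qed
 qed
 have norm: "nrm P3 (lin P3 F f) <= spatial_norm A 2 f" if f: "f \<in>: T2.M" for f
 proof (rule T3.nrm_TP_le)
  have f': "w \<in> tuples A 2" if "w \<in> keys f" for w using f that by (auto simp: T2.carrier_M)
  show "lin P3 F f \<in>: P3" by (rule T3.TP.lin_closed[of "keys f"]) (use f' F in auto)
  fix rhos assume rhos: "rhos \<in> rep_tuples A 3"
  have 1: "T3.Ext rhos (lin P3 F f) = lin l2_ops (%w. T3.Ext rhos (F w)) f"
   by (rule star_hom_lin_comp[OF T3.Ext(1)[OF rhos] T3.TP.pre.pre_cstar_axioms pre_cstar_l2_ops]) (use f' F in auto)
  obtain rho :: "'a => nat l2_op" and sig :: "'a => (nat \<times> nat) l2_op"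
   where h: "star_hom A l2_ops rho" "star_hom A l2_ops sig" and
   cases: "(\<forall>w\<in>tuples A 2. T3.Ext rhos (F w) = tensor (rho (w ! 0)) (sig (w ! 1))) \<or>
   (\<forall>w\<in>tuples A 2. T3.Ext rhos (F w) = conj_op assoc (tensor (sig (w ! 0)) (rho (w ! 1))))"
   using E[OF rhos] unfolding splits_as_pair_def by blast
  have w: "w ! 0 \<in>: A" "w ! Suc 0 \<in>: A" if "w \<in> keys f" for w using f'[OF that] by (auto simp: tuples_2_iff)
  note hc = star_homD(1)[OF h(1)] star_homD(1)[OF h(2)]
  from cases show "norm (T3.Ext rhos (lin P3 F f)) <= spatial_norm A 2 f"
  proof
   assume *: "\<forall>w\<in>tuples A 2. T3.Ext rhos (F w) = tensor (rho (w ! 0)) (sig (w ! 1))"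
   have "T3.Ext rhos (lin P3 F f) = lin l2_ops (%w. tensor (rho (w ! 0)) (sig (w ! 1))) f"
    unfolding 1 by (rule lin_cong[OF pre_cstar_l2_ops]) (use * f' w hc in auto)
   then show ?thesis using spatial_norm_dominates(1)[OF h f] by simp
  next
   assume *: "\<forall>w\<in>tuples A 2. T3.Ext rhos (F w) = conj_op assoc (tensor (sig (w ! 0)) (rho (w ! 1)))"
   let ?G = "%w. tensor (sig (w ! 0)) (rho (w ! 1))"
   have "T3.Ext rhos (lin P3 F f) = lin l2_ops (%w. conj_op assoc (?G w)) f"
    unfolding 1 by (rule lin_cong[OF pre_cstar_l2_ops]) (use * f' w hc in "auto intro!: star_homD(1)[OF star_hom_conj_op[OF bij_assoc]]")
   also have "... = conj_op assoc (lin l2_ops ?G f)"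
    by (rule star_hom_lin_comp[OF star_hom_conj_op[OF bij_assoc] pre_cstar_l2_ops pre_cstar_l2_ops, symmetric])
     (use w hc in auto)
   finally have "norm (T3.Ext rhos (lin P3 F f)) = norm (conj_op assoc (lin l2_ops ?G f))" by simp
   also have "... = norm (lin l2_ops ?G f)"
    by (rule norm_conj_op[OF bij_assoc]) (rule pre_cstar.lin_closed[OF pre_cstar_l2_ops, of "keys f"]; use w hc in auto)
   finally show ?thesis using spatial_norm_dominates(2)[OF h f] by simp
  qed
 qed
 have F_mul: "F (map2 (mul A) v w) = mul P3 (F v) (F w)" if "v \<in> tuples A 2" "w \<in> tuples A 2" for v w
  by (rule T3.TP_eqI)
   (use that F star_semigroup.m_closed[OF SG] mul in "simp_all add: star_homD(4)[OF T3.Ext(1)]")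
 have F_adj: "F (map (adj A) w) = adj P3 (F w)" if "w \<in> tuples A 2" for w by (rule T3.TP_eqI)
   (use that F star_semigroup.st_closed[OF SG] adj in "simp_all add: star_homD(5)[OF T3.Ext(1)]")
 show "star_hom P2 P3 (completion_lift P3 (lin P3 F))"
  "w \<in> tuples A 2 ==> completion_lift P3 (lin P3 F) (tens A w) = F w"
  using T2.lift_TP[OF T3.cstar_TP F F_mul F_adj norm] by blast+
qed

definition incl12 where "incl12 = completion_lift P3 (lin P3 (%w. tens A [w ! 0, w ! 1, e]))"
definition incl23 where "incl23 = completion_lift P3 (lin P3 (%w. tens A [e, w ! 0, w ! 1]))"

lemma nth_tuples: "w \<in> tuples A 2 ==> w ! 0 \<in>: A" "w \<in> tuples A 2 ==> w ! Suc 0 \<in>: A"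
 by (auto simp: tuples_2_iff)

lemma star_hom_tensor_rep:
 assumes "star_hom A l2_ops rho" "star_hom A l2_ops rho'"
 shows "star_hom A l2_ops (%a. tensor (rho a) (rho' e))" "star_hom A l2_ops (%a. tensor (rho e) (rho' a))"
 by (rule star_hom_comp[OF assms(1) star_hom_tensor_const(1)[OF rep_unit[OF assms(2)]]],
   rule star_hom_comp[OF assms(2) star_hom_tensor_const(2)[OF rep_unit[OF assms(1)]]])

lemma incl12: "star_hom P2 P3 incl12" "a \<in>: A ==> b \<in>: A ==> incl12 (tens A [a, b]) = tens A [a, b, e]"
proof -
 let ?F = "%w. tens A [w ! 0, w ! 1, e]"
 have Fc: "?F w \<in>: P3" if "w \<in> tuples A 2" for w using nth_tuples[OF that] by simp
 have E: "splits_as_pair ?F rhos"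
  if rhos: "rhos \<in> rep_tuples A 3" for rhos
 proof -
  obtain rho1 rho2 rho3 where rho: "rhos = [rho1, rho2, rho3]" "star_hom A l2_ops rho1" "star_hom A l2_ops rho2" "star_hom A l2_ops rho3"
   using rhos by (auto simp: rep_tuples_3_iff)
  have "\<forall>w\<in>tuples A 2. T3.Ext rhos (?F w) = tensor (rho1 (w ! 0)) (tensor (rho2 (w ! 1)) (rho3 e))"
   unfolding rho(1) using nth_tuples by (simp add: T3.Ext(2)[OF rhos[unfolded rho(1)]] tens3_op_def)
  then show ?thesis unfolding splits_as_pair_def using rho(2) star_hom_tensor_rep(1)[OF rho(3,4)] by blast
 qed
 show "star_hom P2 P3 incl12" unfolding incl12_def by (rule lift_to_P3(1)[OF Fc E])
 show "a \<in>: A ==> b \<in>: A ==> incl12 (tens A [a, b]) = tens A [a, b, e]"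
  unfolding incl12_def using lift_to_P3(2)[OF Fc E, of "[a, b]"] by simp
qed

lemma incl23: "star_hom P2 P3 incl23" "a \<in>: A ==> b \<in>: A ==> incl23 (tens A [a, b]) = tens A [e, a, b]"
proof -
 let ?F = "%w. tens A [e, w ! 0, w ! 1]"
 have Fc: "?F w \<in>: P3" if "w \<in> tuples A 2" for w using nth_tuples[OF that] by simp
 have E: "splits_as_pair ?F rhos"
  if rhos: "rhos \<in> rep_tuples A 3" for rhos
 proof -
  obtain rho1 rho2 rho3 where rho: "rhos = [rho1, rho2, rho3]" "star_hom A l2_ops rho1" "star_hom A l2_ops rho2" "star_hom A l2_ops rho3"
   using rhos by (auto simp: rep_tuples_3_iff)
  have "\<forall>w\<in>tuples A 2. T3.Ext rhos (?F w) = conj_op assoc (tensor (tensor (rho1 e) (rho2 (w ! 0))) (rho3 (w ! 1)))"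
   unfolding rho(1) using nth_tuples by (simp add: T3.Ext(2)[OF rhos[unfolded rho(1)]] tens3_op_def tensor_assoc rho(2-)[THEN star_homD(1)])
  then show ?thesis unfolding splits_as_pair_def using rho(4) star_hom_tensor_rep(2)[OF rho(2,3)] by blast
 qed
 show "star_hom P2 P3 incl23" unfolding incl23_def by (rule lift_to_P3(1)[OF Fc E])
 show "a \<in>: A ==> b \<in>: A ==> incl23 (tens A [a, b]) = tens A [e, a, b]"
  unfolding incl23_def using lift_to_P3(2)[OF Fc E, of "[a, b]"] by simp
qed

lemma Ext_incl12:
 assumes rho: "star_hom A l2_ops rho1" "star_hom A l2_ops rho2" "star_hom A l2_ops rho3" and y: "y \<in>: P2"
 shows "T3.Ext [rho1, rho2, rho3] (incl12 y) = conj_op assoc (tensor (T2.Ext [rho1, rho2] y) (rho3 e))"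
proof (rule T2.star_hom_TP_eq[OF _ _ cstar_algebra_l2_ops _ y])
 have rhos: "[rho1, rho2, rho3] \<in> rep_tuples A 3" "[rho1, rho2] \<in> rep_tuples A 2"
  using rho by (simp_all add: rep_tuples_def)
 show "star_hom P2 l2_ops (%y. T3.Ext [rho1, rho2, rho3] (incl12 y))"
  by (rule star_hom_comp[OF incl12(1) T3.Ext(1)[OF rhos(1)]])
 show "star_hom P2 l2_ops (%y. conj_op assoc (tensor (T2.Ext [rho1, rho2] y) (rho3 e)))"
  by (rule star_hom_comp[OF star_hom_comp[OF T2.Ext(1)[OF rhos(2)] star_hom_tensor_const(1)[OF rep_unit[OF rho(3)]]]
     star_hom_conj_op[OF bij_assoc]])
 show "T3.Ext [rho1, rho2, rho3] (incl12 (tens A w)) = conj_op assoc (tensor (T2.Ext [rho1, rho2] (tens A w)) (rho3 e))"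
  if w: "w \<in> tuples A 2" for w
  using w by (auto simp: tuples_2_iff incl12 T3.Ext(2)[OF rhos(1)] T2.Ext(2)[OF rhos(2)] tens3_op_def tens2_op_def
    tensor_assoc rho[THEN star_homD(1)])
qed

lemma Ext_incl23:
 assumes rho: "star_hom A l2_ops rho1" "star_hom A l2_ops rho2" "star_hom A l2_ops rho3" and y: "y \<in>: P2"
 shows "T3.Ext [rho1, rho2, rho3] (incl23 y) = tensor (rho1 e) (T2.Ext [rho2, rho3] y)"
proof (rule T2.star_hom_TP_eq[OF _ _ cstar_algebra_l2_ops _ y])
 have rhos: "[rho1, rho2, rho3] \<in> rep_tuples A 3" "[rho2, rho3] \<in> rep_tuples A 2"
  using rho by (simp_all add: rep_tuples_def)
 show "star_hom P2 l2_ops (%y. T3.Ext [rho1, rho2, rho3] (incl23 y))"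
  by (rule star_hom_comp[OF incl23(1) T3.Ext(1)[OF rhos(1)]])
 show "star_hom P2 l2_ops (%y. tensor (rho1 e) (T2.Ext [rho2, rho3] y))"
  by (rule star_hom_comp[OF T2.Ext(1)[OF rhos(2)] star_hom_tensor_const(2)[OF rep_unit[OF rho(1)]]])
 show "T3.Ext [rho1, rho2, rho3] (incl23 (tens A w)) = tensor (rho1 e) (T2.Ext [rho2, rho3] (tens A w))"
  if w: "w \<in> tuples A 2" for w
  using w by (auto simp: tuples_2_iff incl23 T3.Ext(2)[OF rhos(1)] T2.Ext(2)[OF rhos(2)] tens3_op_def tens2_op_def)
qed

context
 fixes Delta :: "'a => (nat => 'a list \<Rightarrow>\<^sub>0 complex) set"
 assumes Delta: "unital_star_hom A P2 Delta"
begin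

lemma Delta_hom: "star_hom A P2 Delta" and Delta_unit: "Delta e = tens A [e, e]"
 using Delta by (simp_all add: unital_star_hom_def unit_of_P2)

lemma Delta_closed [simp]: "a \<in>: A ==> Delta a \<in>: P2" by (rule star_homD(1)[OF Delta_hom])

text \<open>The map Delta \<otimes> id, given on elementary tensors by the formula that
  \<open>coassociative\<close> prescribes.\<close>

definition comult_left where
 "comult_left = completion_lift P3 (lin P3 (%w. mul P3 (incl12 (Delta (w ! 0))) (tens A [e, e, w ! 1])))"

text \<open>The map id \<otimes> Delta, likewise.\<close>

definition comult_right where
 "comult_right = completion_lift P3 (lin P3 (%w. mul P3 (tens A [w ! 0, e, e]) (incl23 (Delta (w ! 1)))))"

lemma comult_left: "star_hom P2 P3 comult_left"
 "a \<in>: A ==> b \<in>: A ==> comult_left (tens A [a, b]) = mul P3 (incl12 (Delta a)) (tens A [e, e, b])"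
proof -
 let ?F = "%w. mul P3 (incl12 (Delta (w ! 0))) (tens A [e, e, w ! 1])"
 have Fc: "?F w \<in>: P3" if "w \<in> tuples A 2" for w
  using nth_tuples[OF that] by (simp add: star_homD(1)[OF incl12(1)])
 have E: "splits_as_pair ?F rhos"
  if rhos: "rhos \<in> rep_tuples A 3" for rhos
 proof -
  obtain rho1 rho2 rho3 where rho: "rhos = [rho1, rho2, rho3]" "star_hom A l2_ops rho1" "star_hom A l2_ops rho2" "star_hom A l2_ops rho3"
   using rhos by (auto simp: rep_tuples_3_iff)
  note rhoc = rho(2-)[THEN star_homD(1)]
  have rhos2: "[rho1, rho2] \<in> rep_tuples A 2" using rho by (simp add: rep_tuples_def)
  define sig where "sig = (%a. T2.Ext [rho1, rho2] (Delta a))"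
  have sig: "star_hom A l2_ops sig" unfolding sig_def by (rule star_hom_comp[OF Delta_hom T2.Ext(1)[OF rhos2]])
  note sigc = star_homD(1)[OF sig]
  \<comment> \<open>rho1 e \<otimes> rho2 e is only a projection. It is absorbed because it is the
    value of \<open>sig\<close> at the unit, \<open>Delta\<close> being unital.\<close>
  have sige: "sig a o\<^sub>L tensor (rho1 e) (rho2 e) = sig a" if a: "a \<in>: A" for a
   using star_homD(4)[OF sig a U.unit_closed] a by (simp add: sig_def Delta_unit T2.Ext(2)[OF rhos2] tens2_op_def)
  have "T3.Ext rhos (?F w) = conj_op assoc (tensor (sig (w ! 0)) (rho3 (w ! 1)))" if w: "w \<in> tuples A 2" for w
  proof -
   obtain a b where ab: "w = [a, b]" "a \<in>: A" "b \<in>: A" using w by (auto simp: tuples_2_iff)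
   have "T3.Ext rhos (?F w) = T3.Ext rhos (incl12 (Delta a)) o\<^sub>L T3.Ext rhos (tens A [e, e, b])"
    using star_homD(4)[OF T3.Ext(1)[OF rhos], of "incl12 (Delta a)" "tens A [e, e, b]"] ab
    by (simp add: star_homD(1)[OF incl12(1)])
   also have "... = conj_op assoc (tensor (sig a) (rho3 e)) o\<^sub>L conj_op assoc (tensor (tensor (rho1 e) (rho2 e)) (rho3 b))"
    unfolding rho(1) using ab rhos
    by (simp add: Ext_incl12[OF rho(2-)] sig_def T3.Ext(2)[OF rhos[unfolded rho(1)]] tens3_op_def tensor_assoc rhoc)
   also have "... = conj_op assoc (tensor (sig a) (rho3 e) o\<^sub>L tensor (tensor (rho1 e) (rho2 e)) (rho3 b))"
    using star_homD(4)[OF star_hom_conj_op[OF bij_assoc], of "tensor (sig a) (rho3 e)" "tensor (tensor (rho1 e) (rho2 e)) (rho3 b)"] ab sigc rhoc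
    by simp
   also have "... = conj_op assoc (tensor (sig a) (rho3 b))"
    using ab sigc rhoc sige star_homD(4)[OF rho(4), of e b] by (simp add: tensor_mul)
   finally show ?thesis by (simp add: ab)
  qed
  then show ?thesis unfolding splits_as_pair_def using rho(4) sig by blast
 qed
 show "star_hom P2 P3 comult_left" unfolding comult_left_def by (rule lift_to_P3(1)[OF Fc E])
 show "a \<in>: A ==> b \<in>: A ==> comult_left (tens A [a, b]) = mul P3 (incl12 (Delta a)) (tens A [e, e, b])"
  unfolding comult_left_def using lift_to_P3(2)[OF Fc E, of "[a, b]"] by simp
qed

lemma comult_right: "star_hom P2 P3 comult_right"
 "a \<in>: A ==> b \<in>: A ==> comult_right (tens A [a, b]) = mul P3 (tens A [a, e, e]) (incl23 (Delta b))"
proof -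
 let ?F = "%w. mul P3 (tens A [w ! 0, e, e]) (incl23 (Delta (w ! 1)))"
 have Fc: "?F w \<in>: P3" if "w \<in> tuples A 2" for w
  using nth_tuples[OF that] by (simp add: star_homD(1)[OF incl23(1)])
 have E: "splits_as_pair ?F rhos"
  if rhos: "rhos \<in> rep_tuples A 3" for rhos
 proof -
  obtain rho1 rho2 rho3 where rho: "rhos = [rho1, rho2, rho3]" "star_hom A l2_ops rho1" "star_hom A l2_ops rho2" "star_hom A l2_ops rho3"
   using rhos by (auto simp: rep_tuples_3_iff)
  note rhoc = rho(2-)[THEN star_homD(1)]
  have rhos2: "[rho2, rho3] \<in> rep_tuples A 2" using rho by (simp add: rep_tuples_def)
  define sig where "sig = (%a. T2.Ext [rho2, rho3] (Delta a))"
  have sig: "star_hom A l2_ops sig" unfolding sig_def by (rule star_hom_comp[OF Delta_hom T2.Ext(1)[OF rhos2]])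
  note sigc = star_homD(1)[OF sig]
  have sige: "tensor (rho2 e) (rho3 e) o\<^sub>L sig a = sig a" if a: "a \<in>: A" for a
   using star_homD(4)[OF sig U.unit_closed a] a by (simp add: sig_def Delta_unit T2.Ext(2)[OF rhos2] tens2_op_def)
  have "T3.Ext rhos (?F w) = tensor (rho1 (w ! 0)) (sig (w ! 1))" if w: "w \<in> tuples A 2" for w
  proof -
   obtain a b where ab: "w = [a, b]" "a \<in>: A" "b \<in>: A" using w by (auto simp: tuples_2_iff)
   have "T3.Ext rhos (?F w) = T3.Ext rhos (tens A [a, e, e]) o\<^sub>L T3.Ext rhos (incl23 (Delta b))"
    using star_homD(4)[OF T3.Ext(1)[OF rhos], of "tens A [a, e, e]" "incl23 (Delta b)"] ab
    by (simp add: star_homD(1)[OF incl23(1)])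
   also have "... = tensor (rho1 a) (tensor (rho2 e) (rho3 e)) o\<^sub>L tensor (rho1 e) (sig b)"
    unfolding rho(1) using ab
    by (simp add: Ext_incl23[OF rho(2-)] sig_def T3.Ext(2)[OF rhos[unfolded rho(1)]] tens3_op_def rhoc)
   also have "... = tensor (rho1 a) (sig b)"
    using ab sigc rhoc sige star_homD(4)[OF rho(2), of a e] by (simp add: tensor_mul)
   finally show ?thesis by (simp add: ab)
  qed
  then show ?thesis unfolding splits_as_pair_def using rho(2) sig by blast
 qed
 show "star_hom P2 P3 comult_right" unfolding comult_right_def by (rule lift_to_P3(1)[OF Fc E])
 show "a \<in>: A ==> b \<in>: A ==> comult_right (tens A [a, b]) = mul P3 (tens A [a, e, e]) (incl23 (Delta b))"
  unfolding comult_right_def using lift_to_P3(2)[OF Fc E, of "[a, b]"] by simp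
qed

lemma coassociativeI:
 assumes gen: "generates A S" "S <= carrier A"
  and S: "!!a. a \<in> S ==> comult_left (Delta a) = comult_right (Delta a)"
 shows "coassociative A Delta"
proof -
 have units: "incl12 (unit_of P2) = unit_of P3" "incl23 (unit_of P2) = unit_of P3"
  "comult_left (unit_of P2) = unit_of P3" "comult_right (unit_of P2) = unit_of P3"
  by (simp_all add: unit_of_P2 unit_of_P3 incl12 incl23 comult_left comult_right Delta_unit T3.tens_mul)
 have eq: "comult_left (Delta a) = comult_right (Delta a)" if "a \<in>: A" for a
  by (rule star_hom_generates_eq[OF gen unital T3.cstar_TP star_hom_comp[OF Delta_hom comult_left(1)]
     star_hom_comp[OF Delta_hom comult_right(1)] S _ that])
   (simp_all add: Delta_unit units flip: unit_of_P2)
 show ?thesis unfolding coassociative_def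
  by (rule exI[of _ incl12], rule exI[of _ incl23], rule exI[of _ comult_left], rule exI[of _ comult_right])
   (auto simp: unital_star_hom_def units incl12 incl23 comult_left comult_right eq)
qed

end

subsection \<open>Magic unitaries\<close>

lemma magic_unitary_orthogonal:
 assumes u: "magic_unitary I A u" and I: "finite I" "i \<in> I" "j \<in> I" "k \<in> I" "j ~= k"
 shows "mul A (u i j) (u i k) = zer A" "mul A (u j i) (u k i) = zer A"
 by (rule projections_orthogonal[OF U.unit I(1), of "%j. u i j"],
   use magic_unitaryD[OF u] I in auto,
   rule projections_orthogonal[OF U.unit I(1), of "%j. u j i"],
   use magic_unitaryD[OF u] I in auto)

definition comult_matrix where
 "comult_matrix I u i j = asum P2 (%k. tens A [u i k, u k j]) I"

text \<open>In the square of sum_k u_ik \<otimes> u_kj the terms with different k vanish because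
  entries of one row are orthogonal. Row and column sums are evaluated one tensor factor at a
  time.\<close>

lemma magic_unitary_comult_matrix:
 assumes u: "magic_unitary I A u" and I: "finite I"
 shows "magic_unitary I P2 (comult_matrix I u)"
proof -
 note uD = magic_unitaryD[OF u] and orth = magic_unitary_orthogonal[OF u I]
 have c: "comult_matrix I u i j \<in>: P2" if "i \<in> I" "j \<in> I" for i j
  using that by (simp add: comult_matrix_def uD)
 have sq: "mul P2 (comult_matrix I u i j) (comult_matrix I u i j) = comult_matrix I u i j" if ij: "i \<in> I" "j \<in> I" for i j
 proof -
  have "mul P2 (comult_matrix I u i j) (comult_matrix I u i j) =
    asum P2 (%k. mul P2 (tens A [u i k, u k j]) (comult_matrix I u i j)) I"
   unfolding comult_matrix_def by (rule T2.TP.asum_mul_right) (use ij uD in auto)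
  also have "... = comult_matrix I u i j" unfolding comult_matrix_def[of I u i j]
  proof (rule T2.TP.asum_cong[OF refl])
   fix k assume k: "k \<in> I"
   have "mul P2 (tens A [u i k, u k j]) (asum P2 (%k. tens A [u i k, u k j]) I) =
     asum P2 (%l. mul P2 (tens A [u i k, u k j]) (tens A [u i l, u l j])) I"
    by (rule T2.TP.asum_mul_left) (use ij k uD in auto)
   also have "... = mul P2 (tens A [u i k, u k j]) (tens A [u i k, u k j])"
    by (rule T2.TP.asum_single) (use ij k uD I orth in "auto simp: tens2_mul tens2_zer")
   also have "... = tens A [u i k, u k j]" using ij k uD by (simp add: tens2_mul)
   finally show "mul P2 (tens A [u i k, u k j]) (asum P2 (%k. tens A [u i k, u k j]) I) = tens A [u i k, u k j]" .
  qed (use ij uD in auto)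
  finally show ?thesis .
 qed
 have adj: "adj P2 (comult_matrix I u i j) = comult_matrix I u i j" if ij: "i \<in> I" "j \<in> I" for i j
 proof -
  have "adj P2 (comult_matrix I u i j) = asum P2 (%k. adj P2 (tens A [u i k, u k j])) I"
   unfolding comult_matrix_def by (rule T2.TP.asum_adj) (use ij uD in auto)
  also have "... = comult_matrix I u i j"
   unfolding comult_matrix_def by (rule T2.TP.asum_cong) (use ij uD in "auto simp: T2.tens_adj")
  finally show ?thesis .
 qed
 have row: "asum P2 (%j. comult_matrix I u i j) I = unit_of P2" if i: "i \<in> I" for i
 proof -
  have "asum P2 (%j. comult_matrix I u i j) I = asum P2 (%k. asum P2 (%j. tens A [u i k, u k j]) I) I"
   unfolding comult_matrix_def by (rule T2.TP.asum_swap) (use i uD I in auto)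
  also have "... = asum P2 (%k. tens A [u i k, e]) I"
   by (rule T2.TP.asum_cong) (use i uD in "auto simp: tens2_asum_right[symmetric]")
  also have "... = tens A [e, e]" using i uD by (simp add: tens2_asum_left[symmetric])
  finally show ?thesis by (simp add: unit_of_P2)
 qed
 have col: "asum P2 (%i. comult_matrix I u i j) I = unit_of P2" if j: "j \<in> I" for j
 proof -
  have "asum P2 (%i. comult_matrix I u i j) I = asum P2 (%k. asum P2 (%i. tens A [u i k, u k j]) I) I"
   unfolding comult_matrix_def by (rule T2.TP.asum_swap) (use j uD I in auto)
  also have "... = asum P2 (%k. tens A [e, u k j]) I"
   by (rule T2.TP.asum_cong) (use j uD in "auto simp: tens2_asum_left[symmetric]")
  also have "... = tens A [e, e]" using j uD by (simp add: tens2_asum_right[symmetric])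
  finally show ?thesis by (simp add: unit_of_P2)
 qed
 show ?thesis unfolding magic_unitary_def using c sq adj row col by blast
qed

text \<open>The scalar matrix passes through u in the first factor, crosses to the second factor by
  bilinearity, and passes through u there.\<close>

lemma comult_matrix_intertwines:
 assumes u: "magic_unitary I A u" and I: "finite I"
  and comm: "!!x y. x \<in> I ==> y \<in> I ==>
   asum A (%z. scl A (a x z) (u z y)) I = asum A (%z. scl A (a z y) (u x z)) I"
  and xy: "x \<in> I" "y \<in> I"
 shows "asum P2 (%z. scl P2 (a x z) (comult_matrix I u z y)) I = asum P2 (%z. scl P2 (a z y) (comult_matrix I u x z)) I"
proof -
 note uD = magic_unitaryD[OF u]
 have "asum P2 (%z. scl P2 (a x z) (comult_matrix I u z y)) I =
   asum P2 (%z. asum P2 (%k. tens A [scl A (a x z) (u z k), u k y]) I) I" unfolding comult_matrix_def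
  by (intro T2.TP.asum_cong refl)
   (use xy uD in "(simp; fail) | (simp add: T2.TP.asum_scl[symmetric], intro T2.TP.asum_cong refl; simp add: tens2_scl_left)")+
 also have "... = asum P2 (%k. asum P2 (%z. tens A [scl A (a x z) (u z k), u k y]) I) I"
  by (rule T2.TP.asum_swap) (use xy uD I in auto)
 also have "... = asum P2 (%k. asum P2 (%z. tens A [u x z, scl A (a z k) (u k y)]) I) I"
 proof (rule T2.TP.asum_cong[OF refl])
  fix k assume k: "k \<in> I"
  have "asum P2 (%z. tens A [scl A (a x z) (u z k), u k y]) I = tens A [asum A (%z. scl A (a x z) (u z k)) I, u k y]"
   by (rule tens2_asum_left[symmetric]) (use xy k uD in auto)
  also have "... = tens A [asum A (%z. scl A (a z k) (u x z)) I, u k y]" using comm[OF xy(1) k] by simp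
  also have "... = asum P2 (%z. tens A [scl A (a z k) (u x z), u k y]) I"
   by (rule tens2_asum_left) (use xy k uD in auto)
  also have "... = asum P2 (%z. tens A [u x z, scl A (a z k) (u k y)]) I"
   by (rule T2.TP.asum_cong) (use xy k uD in "auto simp: tens2_scl_left tens2_scl_right")
  finally show "asum P2 (%z. tens A [scl A (a x z) (u z k), u k y]) I = asum P2 (%z. tens A [u x z, scl A (a z k) (u k y)]) I" .
 qed (use xy uD in auto)
 also have "... = asum P2 (%z. asum P2 (%k. tens A [u x z, scl A (a z k) (u k y)]) I) I"
  by (rule T2.TP.asum_swap) (use xy uD I in auto)
 also have "... = asum P2 (%z. asum P2 (%k. tens A [u x z, scl A (a k y) (u z k)]) I) I"
 proof (rule T2.TP.asum_cong[OF refl])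
  fix z assume z: "z \<in> I"
  have "asum P2 (%k. tens A [u x z, scl A (a z k) (u k y)]) I = tens A [u x z, asum A (%k. scl A (a z k) (u k y)) I]"
   by (rule tens2_asum_right[symmetric]) (use xy z uD in auto)
  also have "... = tens A [u x z, asum A (%k. scl A (a k y) (u z k)) I]" using comm[OF z xy(2)] by simp
  also have "... = asum P2 (%k. tens A [u x z, scl A (a k y) (u z k)]) I"
   by (rule tens2_asum_right) (use xy z uD in auto)
  finally show "asum P2 (%k. tens A [u x z, scl A (a z k) (u k y)]) I = asum P2 (%k. tens A [u x z, scl A (a k y) (u z k)]) I" .
 qed (use xy uD in auto)
 also have "... = asum P2 (%k. asum P2 (%z. tens A [u x z, scl A (a k y) (u z k)]) I) I"
  by (rule T2.TP.asum_swap) (use xy uD I in auto)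
 also have "... = asum P2 (%z. scl P2 (a z y) (comult_matrix I u x z)) I" unfolding comult_matrix_def
  by (intro T2.TP.asum_cong refl)
   (use xy uD in "(simp; fail) | (simp add: T2.TP.asum_scl[symmetric], intro T2.TP.asum_cong refl; simp add: tens2_scl_right)")+
 finally show ?thesis .
qed

text \<open>On an entry u_ij both sides of coassociativity are the double sum of u_ik \<otimes> u_kl
  \<otimes> u_lj over k and l. For density it suffices, by \<open>cancellation_dense\<close>, to
  reach u_il \<otimes> 1 and 1 \<otimes> u_lj, and both are sums of spanning products.\<close>

theorem quantum_permutation_groupI:
 assumes u: "magic_unitary I A u" and I: "finite I" and gen: "generates A {u i j |i j. i \<in> I & j \<in> I}"
  and Delta: "unital_star_hom A P2 Delta" and Delta_u: "!!i j. i \<in> I ==> j \<in> I ==> Delta (u i j) = comult_matrix I u i j"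
 shows "quantum_permutation_group I A u"
proof -
 note uD = magic_unitaryD[OF u] and orth = magic_unitary_orthogonal[OF u I]
 note Delta_hom = Delta_hom[OF Delta] and Delta_unit = Delta_unit[OF Delta]
 let ?S = "{u i j |i j. i \<in> I & j \<in> I}"
 have S: "?S <= carrier A" using uD by auto
 interpret P2: unital_pre_cstar P2 by (rule unital_cstar_pre[OF unital_P2])
 have t3: "mul P3 (tens A [a, b, c]) (tens A [a', b', c']) = tens A [mul A a a', mul A b b', mul A c c']"
  if "a \<in>: A" "b \<in>: A" "c \<in>: A" "a' \<in>: A" "b' \<in>: A" "c' \<in>: A" for a b c a' b' c'
  using that by (simp add: T3.tens_mul)
 have coassoc: "coassociative A Delta"
 proof (rule coassociativeI[OF Delta gen S])
  fix a assume "a \<in> ?S"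
  then obtain i j where a: "a = u i j" "i \<in> I" "j \<in> I" by blast
  have l12: "incl12 (Delta (u i k)) = asum P3 (%l. tens A [u i l, u l k, e]) I" if "k \<in> I" for k
   unfolding Delta_u[OF a(2) that] comult_matrix_def using a that uD
   by (subst star_hom_asum[OF incl12(1) T2.TP.pre.pre_cstar_axioms T3.TP.pre.pre_cstar_axioms])
    ((simp; fail) | (intro T3.TP.asum_cong refl; simp add: incl12))+
  have l23: "incl23 (Delta (u k j)) = asum P3 (%l. tens A [e, u k l, u l j]) I" if "k \<in> I" for k
   unfolding Delta_u[OF that a(3)] comult_matrix_def using a that uD
   by (subst star_hom_asum[OF incl23(1) T2.TP.pre.pre_cstar_axioms T3.TP.pre.pre_cstar_axioms])
    ((simp; fail) | (intro T3.TP.asum_cong refl; simp add: incl23))+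
  have "comult_left Delta (Delta a) = asum P3 (%k. mul P3 (incl12 (Delta (u i k))) (tens A [e, e, u k j])) I"
   unfolding a(1) Delta_u[OF a(2,3)] comult_matrix_def using a uD
   by (subst star_hom_asum[OF comult_left(1)[OF Delta] T2.TP.pre.pre_cstar_axioms T3.TP.pre.pre_cstar_axioms])
    ((simp; fail) | (intro T3.TP.asum_cong refl; simp add: comult_left(2)[OF Delta] star_homD(1)[OF incl12(1)] star_homD(1)[OF Delta_hom]))+
  also have "... = asum P3 (%k. asum P3 (%l. tens A [u i l, u l k, u k j]) I) I"
  proof (rule T3.TP.asum_cong[OF refl])
   fix k assume k: "k \<in> I"
   have "mul P3 (incl12 (Delta (u i k))) (tens A [e, e, u k j]) =
     asum P3 (%l. mul P3 (tens A [u i l, u l k, e]) (tens A [e, e, u k j])) I"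
    unfolding l12[OF k] by (rule T3.TP.asum_mul_right) (use a k uD in auto)
   also have "... = asum P3 (%l. tens A [u i l, u l k, u k j]) I"
    by (intro T3.TP.asum_cong refl) (use a k uD in "simp_all add: t3")
   finally show "mul P3 (incl12 (Delta (u i k))) (tens A [e, e, u k j]) = asum P3 (%l. tens A [u i l, u l k, u k j]) I" .
  qed (use a uD in auto)
  also have "... = asum P3 (%l. asum P3 (%k. tens A [u i l, u l k, u k j]) I) I"
   by (rule T3.TP.asum_swap) (use a uD I in auto)
  also have "... = asum P3 (%k. mul P3 (tens A [u i k, e, e]) (incl23 (Delta (u k j)))) I"
  proof (rule T3.TP.asum_cong[OF refl])
   fix k assume k: "k \<in> I"
   have "mul P3 (tens A [u i k, e, e]) (incl23 (Delta (u k j))) =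
     asum P3 (%l. mul P3 (tens A [u i k, e, e]) (tens A [e, u k l, u l j])) I"
    unfolding l23[OF k] by (rule T3.TP.asum_mul_left) (use a k uD in auto)
   also have "... = asum P3 (%l. tens A [u i k, u k l, u l j]) I"
    by (intro T3.TP.asum_cong refl) (use a k uD in "simp_all add: t3")
   finally show "asum P3 (%l. tens A [u i k, u k l, u l j]) I = mul P3 (tens A [u i k, e, e]) (incl23 (Delta (u k j)))"
    by (rule sym)
  qed (use a uD in "auto simp: star_homD(1)[OF incl23(1)] star_homD(1)[OF Delta_hom]")
  also have "... = comult_right Delta (Delta a)" unfolding a(1) Delta_u[OF a(2,3)] comult_matrix_def using a uD
   by (subst star_hom_asum[OF comult_right(1)[OF Delta] T2.TP.pre.pre_cstar_axioms T3.TP.pre.pre_cstar_axioms])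
    ((simp; fail) | (rule sym, intro T3.TP.asum_cong refl; simp add: comult_right(2)[OF Delta] star_homD(1)[OF incl23(1)] star_homD(1)[OF Delta_hom]) | (intro T3.TP.asum_cong refl; simp add: comult_right(2)[OF Delta] star_homD(1)[OF incl23(1)] star_homD(1)[OF Delta_hom]))+
  finally show "comult_left Delta (Delta a) = comult_right Delta (Delta a)" .
 qed
 have comm: "mul P2 (tens A [a, e]) (tens A [e, b]) = tens A [a, b]" "mul P2 (tens A [e, b]) (tens A [a, e]) = tens A [a, b]"
  if "a \<in>: A" "b \<in>: A" for a b using that by (simp_all add: tens2_mul)
 have Su: "adj A x = x" if "x \<in> ?S" for x using that uD by auto
 let ?G1 = "{mul P2 (Delta a) (tens A [e, b]) |a b. a \<in>: A & b \<in>: A}"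
 let ?G2 = "{mul P2 (Delta a) (tens A [b, e]) |a b. a \<in>: A & b \<in>: A}"
 have G1: "?G1 <= carrier P2" and G2: "?G2 <= carrier P2" by (auto simp: star_homD(1)[OF Delta_hom])
 note span1 = T2.TP.closed_span[OF G1] and span2 = T2.TP.closed_span[OF G2]
 have dense1: "closed_span P2 ?G1 = carrier P2"
 proof (rule antisym)
  show "closed_span P2 ?G1 <= carrier P2" by (rule T2.TP.closed_subspaceD(1)[OF span1(1)])
  have gen1: "tens A [x, e] \<in> closed_span P2 ?G1" if x_in: "x \<in> ?S" for x
  proof -
   obtain i l where x: "x = u i l" "i \<in> I" "l \<in> I" using x_in by blast
   \<comment> \<open>Orthogonality within the column j leaves only the term k = l. Summing the
     result over j then gives u_il \<otimes> 1.\<close>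
   have eq: "mul P2 (Delta (u i j)) (tens A [e, u l j]) = tens A [u i l, u l j]" if j: "j \<in> I" for j
   proof -
    have "mul P2 (Delta (u i j)) (tens A [e, u l j]) = asum P2 (%k. mul P2 (tens A [u i k, u k j]) (tens A [e, u l j])) I"
     unfolding Delta_u[OF x(2) j] comult_matrix_def by (rule T2.TP.asum_mul_right) (use x j uD in auto)
    also have "... = mul P2 (tens A [u i l, u l j]) (tens A [e, u l j])"
     by (rule T2.TP.asum_single) (use x j uD I orth in "auto simp: tens2_mul tens2_zer")
    finally show ?thesis using x j uD by (simp add: tens2_mul)
   qed
   have "tens A [u i l, u l j] \<in> closed_span P2 ?G1" if j: "j \<in> I" for j
   proof (rule subsetD[OF span1(2)])
    show "tens A [u i l, u l j] \<in> ?G1"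
     unfolding eq[OF j, symmetric] using uD(1)[OF x(2) j] uD(1)[OF x(3) j] by blast
   qed
   then have "asum P2 (%j. tens A [u i l, u l j]) I \<in> closed_span P2 ?G1"
    by (rule T2.TP.closed_subspace_asum[OF span1(1)])
   then show ?thesis using x uD by (simp add: tens2_asum_right[symmetric])
  qed
  show "carrier P2 <= closed_span P2 ?G1"
  proof (rule T2.closed_subspace_TP[OF span1(1)])
   fix w assume "w \<in> tuples A 2"
   then obtain a b where ab: "w = [a, b]" "a \<in>: A" "b \<in>: A" by (auto simp: tuples_2_iff)
   have "mul P2 (tens A [a, e]) (tens A [e, b]) \<in> closed_span P2 ?G1"
    by (rule cancellation_dense[OF unital unital_P2 star_hom_incl1 star_hom_incl2 _ _ Delta_hom _ _ gen S Su refl gen1 ab(2,3)])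
     (use comm in "auto simp: unit_of_P2 Delta_unit")
   then show "tens A w \<in> closed_span P2 ?G1" using ab comm by simp
  qed
 qed
 have dense2: "closed_span P2 ?G2 = carrier P2"
 proof (rule antisym)
  show "closed_span P2 ?G2 <= carrier P2" by (rule T2.TP.closed_subspaceD(1)[OF span2(1)])
  have gen2: "tens A [e, x] \<in> closed_span P2 ?G2" if x_in: "x \<in> ?S" for x
  proof -
   obtain l j where x: "x = u l j" "l \<in> I" "j \<in> I" using x_in by blast
   \<comment> \<open>Now orthogonality within the row i leaves only k = l, and summing over i gives
     1 \<otimes> u_lj.\<close>
   have eq: "mul P2 (Delta (u i j)) (tens A [u i l, e]) = tens A [u i l, u l j]" if i: "i \<in> I" for i
   proof -
    have "mul P2 (Delta (u i j)) (tens A [u i l, e]) = asum P2 (%k. mul P2 (tens A [u i k, u k j]) (tens A [u i l, e])) I"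
     unfolding Delta_u[OF i x(3)] comult_matrix_def by (rule T2.TP.asum_mul_right) (use x i uD in auto)
    also have "... = mul P2 (tens A [u i l, u l j]) (tens A [u i l, e])"
     by (rule T2.TP.asum_single) (use x i uD I orth in "auto simp: tens2_mul tens2_zer")
    finally show ?thesis using x i uD by (simp add: tens2_mul)
   qed
   have "tens A [u i l, u l j] \<in> closed_span P2 ?G2" if i: "i \<in> I" for i
   proof (rule subsetD[OF span2(2)])
    show "tens A [u i l, u l j] \<in> ?G2"
     unfolding eq[OF i, symmetric] using uD(1)[OF i x(3)] uD(1)[OF i x(2)] by blast
   qed
   then have "asum P2 (%i. tens A [u i l, u l j]) I \<in> closed_span P2 ?G2"
    by (rule T2.TP.closed_subspace_asum[OF span2(1)])
   then show ?thesis using x uD by (simp add: tens2_asum_left[symmetric])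
  qed
  show "carrier P2 <= closed_span P2 ?G2"
  proof (rule T2.closed_subspace_TP[OF span2(1)])
   fix w assume "w \<in> tuples A 2"
   then obtain a b where ab: "w = [a, b]" "a \<in>: A" "b \<in>: A" by (auto simp: tuples_2_iff)
   have "mul P2 (tens A [e, b]) (tens A [a, e]) \<in> closed_span P2 ?G2"
    by (rule cancellation_dense[OF unital unital_P2 star_hom_incl2 star_hom_incl1 _ _ Delta_hom _ _ gen S Su refl gen2 ab(3,2)])
     (use comm in "auto simp: unit_of_P2 Delta_unit")
   then show "tens A w \<in> closed_span P2 ?G2" using ab comm by simp
  qed
 qed
 have "compact_quantum_group A Delta"
  unfolding compact_quantum_group_def using unital Delta coassoc dense1 dense2 by blast
 then show ?thesis
  unfolding quantum_permutation_group_def using I unital u gen Delta_u by (auto simp: comult_matrix_def)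
qed

end

section \<open>Universal C*-algebras, magic relations, free products and unitizations\<close>

section \<open>Universal C*-algebras\<close>

lemma max_seminormed_simps [simp]:
 "carrier (max_seminormed P R) = carrier P" "zer (max_seminormed P R) = zer P" "add (max_seminormed P R) = add P"
 "scl (max_seminormed P R) = scl P" "mul (max_seminormed P R) = mul P" "adj (max_seminormed P R) = adj P"
 by (simp_all add: max_seminormed_def)

lemma single_Cons_word:
 "single (Star_Word (l # ls)) 1 = (single (Star_Word [l]) 1 * single (Star_Word ls) 1 :: 'g free_alg)"
 by (simp add: Poly_Mapping.mult_single plus_star_word_def)

lemma free_star_gen: "free_star (gen g) = single (Star_Word [(g, True)]) 1"
 by (simp add: free_star_eq_sg_adj gen_def star_word_adj_def)

definition univ_lift :: "'b star_algebra => ('g => 'b) => 'g univ => 'b" where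
 "univ_lift B f = completion_lift B (ev B f)"

text \<open>The bound on the generators makes the maximal seminorm finite. Unital and nonunital free
  algebras are treated together; membership of 1 in \<open>P\<close> tells them apart where it
  matters.\<close>

locale universal_cstar =
 fixes P :: "'g free_alg star_algebra" and R :: "'g free_alg set" and G :: "'g set"
 assumes P: "P = free_unital G \<or> P = free_nonunital G" and R: "R <= carrier P"
  and bound: "g \<in> G ==> \<exists>K. \<forall>p. cstar_seminorm P p --> (\<forall>r\<in>R. p r = 0) --> p (gen g) <= K"
begin

lemma P_simps [simp]: "zer P = 0" "add P = (+)" "scl P = cscale" "mul P = (*)" "adj P = free_star" "sub P x y = x - y"
 using P by auto

lemma gen_in_P [simp]: "g \<in> G ==> gen g \<in>: P" using P by auto

lemma pre_P: "pre_cstar P" using P pre_cstar_free_unital pre_cstar_free_nonunital by auto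

sublocale P: pre_cstar P by (rule pre_P)

lemma carrier_P_subset: "carrier P <= carrier (free_unital G)" using P carrier_free_nonunital by auto

text \<open>Words are built from their letters and not from the empty word, so the induction serves
  the nonunital algebra too; the case of 1 arises only where 1 belongs to \<open>P\<close>.\<close>

lemma free_induct [consumes 1, case_names zero one gen star add scl mul]:
 assumes x: "x \<in>: P" and zero: "Q 0" and one: "1 \<in>: P ==> Q 1" and gen: "!!g. g \<in> G ==> Q (gen g)"
  and star: "!!g. g \<in> G ==> Q (free_star (gen g))"
  and add: "!!x y. x \<in>: P ==> y \<in>: P ==> Q x ==> Q y ==> Q (x + y)"
  and scl: "!!c x. x \<in>: P ==> Q x ==> Q (cscale c x)"
  and mul: "!!x y. x \<in>: P ==> y \<in>: P ==> Q x ==> Q y ==> Q (x * y)"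
 shows "Q x"
proof -
 define W where "W = {w. single w 1 \<in>: P}"
 have carrier: "y \<in>: P \<longleftrightarrow> keys y <= W" for y
  using P by (auto simp: W_def free_unital_eq free_nonunital_eq sg_alg_def)
 have letter: "single (Star_Word [l]) 1 \<in>: P & Q (single (Star_Word [l]) 1)" if l: "fst l \<in> G" for l
  using gen[OF l] star[OF l] gen_in_P[OF l] P.adj_closed[OF gen_in_P[OF l]]
  by (cases l; cases "snd l") (auto simp: gen_def free_star_gen[unfolded gen_def])
 have nonempty: "ls ~= [] ==> fst ` set ls <= G ==> single (Star_Word ls) 1 \<in>: P & Q (single (Star_Word ls) 1)" for ls
 proof (induction ls)
  case (Cons l ls)
  show ?case
  proof (cases "ls = []")
   case True
   then show ?thesis using letter[of l] Cons.prems by simp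
  next
   case False
   then have ls: "single (Star_Word ls) 1 \<in>: P" "Q (single (Star_Word ls) 1)" using Cons by auto
   have l: "single (Star_Word [l]) 1 \<in>: P" "Q (single (Star_Word [l]) 1)" using letter[of l] Cons.prems by auto
   show ?thesis unfolding single_Cons_word[of l ls]
    using mul[OF l(1) ls(1) l(2) ls(2)] P.mul_closed[OF l(1) ls(1)] by simp
  qed
 qed simp
 have "Q (single w 1)" if w: "w \<in> W" for w
 proof (cases "letters w = []")
  case True
  then have w0: "w = 0" by (simp add: star_word_eqI)
  then show ?thesis using one w unfolding W_def w0 by (simp add: single_one)
 next
  case False
  have "fst ` set (letters w) <= G"
   using subsetD[OF carrier_P_subset, of "single w 1"] w unfolding W_def by (simp add: free_unital_def)
  then show ?thesis using nonempty[OF False] by (cases w) auto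
 qed
 then have basis: "Q (single w a)" if "w \<in> W" for w a using scl[of "single w 1" a] that by (auto simp: W_def)
 have "keys x <= W" using x carrier by blast
 then show ?thesis by (induction x rule: poly_mapping_sg_induct) (use zero basis add carrier in auto)
qed

abbreviation "M \<equiv> max_seminormed P R"
abbreviation "U \<equiv> univ_cstar P R"
abbreviation "\<gamma> \<equiv> univ_gen P R"

definition admissible :: "('g free_alg => real) set" where
 "admissible = {p. cstar_seminorm P p & (\<forall>r\<in>R. p r = 0)}"

text \<open>Generators are bounded by assumption, adjoints have the same seminorm, and p 1 = (p 1)^2
  gives p 1 <= 1. Sums, multiples and products preserve a bound that is uniform in p.\<close>

lemma bdd_admissible:
 assumes "x \<in>: P"
 shows "bdd_above ((%p. p x) ` admissible)"
proof -
 have sem: "cstar_seminorm P p" if "p \<in> admissible" for p using that by (simp add: admissible_def)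
 note f = cstar_seminorm_facts[OF pre_P sem, unfolded P_simps]
 have "\<exists>K. \<forall>p\<in>admissible. p x <= K" using assms
 proof (induction x rule: free_induct)
  case zero
  have "p 0 <= 0" if "p \<in> admissible" for p using f(1)[OF that] by simp
  then show ?case by blast
 next
  case one
  have "p 1 <= 1" if "p \<in> admissible" for p
   using f(7)[OF that one] by (simp add: free_star_eq_sg_adj power2_eq_square flip: single_one) auto
  then show ?case by blast
 next
  case (gen g)
  then show ?case using bound[OF gen] unfolding admissible_def by blast
 next
  case (star g)
  obtain K where K: "!!p. p \<in> admissible ==> p (gen g) <= K" using bound[OF star] unfolding admissible_def by blast
  have "p (free_star (gen g)) <= K" if "p \<in> admissible" for p using f(6)[OF that gen_in_P[OF star]] K[OF that] by simp
  then show ?case by blast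
 next
  case (add x y)
  then obtain K L where K: "\<forall>p\<in>admissible. p x <= K" "\<forall>p\<in>admissible. p y <= L" by blast
  have "p (x + y) <= K + L" if "p \<in> admissible" for p using f(3)[OF that add(1,2)] K that by fastforce
  then show ?case by blast
 next
  case (scl c x)
  then obtain K where K: "\<forall>p\<in>admissible. p x <= K" by blast
  have "p (cscale c x) <= cmod c * K" if "p \<in> admissible" for p
   using f(5)[OF that scl(1), of c] K that by (simp add: mult_left_mono)
  then show ?case by blast
 next
  case (mul x y)
  then obtain K L where K: "\<forall>p\<in>admissible. p x <= K" "\<forall>p\<in>admissible. p y <= L" by blast
  have "p (x * y) <= K * L" if p: "p \<in> admissible" for p
  proof -
   have "p (x * y) <= p x * p y" by (rule f(4)[OF p mul(1,2)])
   also have "... <= K * L" using K p f(2)[OF p mul(1)] f(2)[OF p mul(2)] by (intro mult_mono) auto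
   finally show ?thesis .
  qed
  then show ?case by blast
 qed
 then show ?thesis by (auto simp: bdd_above_def)
qed

lemma nrm_M: "nrm M x = (SUP p\<in>admissible. p x)" by (simp add: max_seminormed_def admissible_def)

lemma zero_admissible: "(%_. 0) \<in> admissible" using P.nrm_cstar unfolding admissible_def cstar_seminorm_def by simp

lemma le_nrm_M:
 assumes "cstar_seminorm P p" "!!r. r \<in> R ==> p r = 0" "x \<in>: P"
 shows "p x <= nrm M x"
 unfolding nrm_M by (rule cSUP_upper[OF _ bdd_admissible]) (use assms in "auto simp: admissible_def")

lemma nrm_M_R: "r \<in> R ==> nrm M r = 0"
proof -
 assume r: "r \<in> R"
 have "(SUP p\<in>admissible. p r) = (SUP p\<in>admissible. 0)" by (rule SUP_cong) (use r in "auto simp: admissible_def")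
 then show ?thesis using zero_admissible unfolding nrm_M by (subst (asm) cSUP_const) auto
qed

lemma pre_M: "pre_cstar M" unfolding max_seminormed_def admissible_def[symmetric]
 by (rule pre_cstar_renorm[OF pre_P], rule cstar_seminorm_Sup[OF _ _ pre_P bdd_admissible])
  (use zero_admissible in "auto simp: admissible_def")

sublocale M: pre_cstar M by (rule pre_M)

lemma cstar_U: "cstar_algebra U" unfolding univ_cstar_def by (rule M.cstar_algebra_C)

sublocale U: cstar_algebra U by (rule cstar_U)

abbreviation "\<eta> \<equiv> M.emb"

lemma gen_eq: "\<gamma> g = \<eta> (gen g)" by (simp add: univ_gen_def M.emb_def)

lemma star_hom_M [simp]: "star_hom M B f \<longleftrightarrow> star_hom P B f" by (simp add: star_hom_def)

lemma star_hom_eta: "star_hom P U \<eta>" using M.star_hom_emb by (simp add: univ_cstar_def)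

lemma eta_closed [simp]: "x \<in>: P ==> \<eta> x \<in>: U" by (rule star_homD(1)[OF star_hom_eta])

lemma eta_simps:
 "x \<in>: P ==> y \<in>: P ==> \<eta> (x + y) = add U (\<eta> x) (\<eta> y)"
 "x \<in>: P ==> \<eta> (cscale c x) = scl U c (\<eta> x)"
 "x \<in>: P ==> y \<in>: P ==> \<eta> (x * y) = mul U (\<eta> x) (\<eta> y)"
 "x \<in>: P ==> \<eta> (free_star x) = adj U (\<eta> x)"
 "x \<in>: P ==> y \<in>: P ==> \<eta> (x - y) = sub U (\<eta> x) (\<eta> y)"
 using star_homD(2-5)[OF star_hom_eta] star_hom_sub[OF star_hom_eta pre_P] by simp_all

lemma eta_sum: "(!!i. i \<in> I ==> f i \<in>: P) ==> \<eta> (\<Sum>i\<in>I. f i) = asum U (%i. \<eta> (f i)) I"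
 and sum_in_P: "(!!i. i \<in> I ==> f i \<in>: P) ==> (\<Sum>i\<in>I. f i) \<in>: P"
proof -
 assume f: "!!i. i \<in> I ==> f i \<in>: P"
 have "asum P f I = (\<Sum>i\<in>I. f i)" using f
  by (induction I rule: infinite_finite_induct) (auto simp: P.asum_insert)
 then show "\<eta> (\<Sum>i\<in>I. f i) = asum U (%i. \<eta> (f i)) I" "(\<Sum>i\<in>I. f i) \<in>: P"
  using star_hom_asum[OF star_hom_eta pre_P U.pre.pre_cstar_axioms, of I f] P.asum_closed[of I f] f by simp_all
qed

lemma eta_R: "r \<in> R ==> \<eta> r = zer U"
 using R M.nrm_emb[of r] nrm_M_R[of r] by (intro U.nrm_eq_0D) (auto simp: univ_cstar_def)

lemma eta_eq_if_R: "x - y \<in> R ==> x \<in>: P ==> y \<in>: P ==> \<eta> x = \<eta> y"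
 using eta_R[of "x - y"] eta_simps(5)[of x y] U.sub_eq_zer_iff[of "\<eta> x" "\<eta> y"] by simp

lemma gen_closed [simp]: "g \<in> G ==> \<gamma> g \<in>: U" by (simp add: gen_eq)

lemma is_unit_U: "1 \<in>: P ==> is_unit_of U (\<eta> 1)"
 unfolding univ_cstar_def by (rule M.is_unit_emb) (simp add: is_unit_of_def)

lemma unital_U: "1 \<in>: P ==> unital_cstar U" using is_unit_U cstar_U by (auto simp: unital_cstar_def)

lemma unit_U: "1 \<in>: P ==> unit_of U = \<eta> 1" using U.unit_ofI[OF is_unit_U] by simp

text \<open>The norm pulled back along evaluation is a C*-seminorm that vanishes on the relations,
  hence one of those under the supremum. Evaluation is therefore contractive and extends to the
  completion.\<close>

lemma lift:
 assumes B: "unital_cstar B" and f: "!!g. g \<in> G ==> f g \<in>: B" and rel: "!!r. r \<in> R ==> ev B f r = zer B"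
 shows "star_hom U B (univ_lift B f)" "g \<in> G ==> univ_lift B f (\<gamma> g) = f g"
  "1 \<in>: P ==> univ_lift B f (unit_of U) = unit_of B"
proof -
 interpret B: unital_pre_cstar B by (rule unital_cstar_pre[OF B])
 have C: "cstar_algebra B" by (rule unital_cstarD[OF B])
 have "star_hom (free_unital G) B (ev B f)" by (rule B.star_hom_ev[OF f])
 then have ev: "star_hom P B (ev B f)" using P subsetD[OF carrier_free_nonunital] by (auto simp: star_hom_def Pi_iff)
 have le: "nrm B (ev B f x) <= nrm M x" if "x \<in>: M" for x
  by (rule le_nrm_M[OF star_hom_seminorm[OF ev pre_P B.pre_cstar_axioms]]) (use rel that in auto)
 have evM: "star_hom M B (ev B f)" using ev by simp
 show "star_hom U B (univ_lift B f)"
  unfolding univ_cstar_def univ_lift_def by (rule M.star_hom_completion_lift[OF C evM le])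
 have emb: "univ_lift B f (\<eta> x) = ev B f x" if "x \<in>: P" for x
  unfolding univ_lift_def by (rule M.completion_lift_emb[OF C evM le]) (use that in auto)
 show "g \<in> G ==> univ_lift B f (\<gamma> g) = f g" using emb[of "gen g"] B.ev_gen[of G f g] f by (simp add: gen_eq)
 show "univ_lift B f (unit_of U) = unit_of B" if "1 \<in>: P"
  using emb[of 1] B.ev_one[of G f] f that by (simp add: unit_U)
qed

lemma hom_eq:
 assumes f: "star_hom U B f" and g: "star_hom U B g" and B: "cstar_algebra B"
  and gens: "!!z. z \<in> G ==> f (\<gamma> z) = g (\<gamma> z)" and one: "1 \<in>: P ==> f (unit_of U) = g (unit_of U)"
  and x: "x \<in>: U"
 shows "f x = g x"
proof (rule M.star_hom_C_eq[OF f[unfolded univ_cstar_def] g[unfolded univ_cstar_def] B _ x[unfolded univ_cstar_def]])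
 fix y assume "y \<in>: M"
 then have "y \<in>: P" by simp
 note z = star_hom_zer[OF f U.pre.pre_cstar_axioms cstar_algebra_pre[OF B]]
  star_hom_zer[OF g U.pre.pre_cstar_axioms cstar_algebra_pre[OF B]]
 have z0: "\<eta> 0 = zer U" using star_hom_zer[OF star_hom_eta pre_P U.pre.pre_cstar_axioms] by simp
 show "f (\<eta> y) = g (\<eta> y)" using \<open>y \<in>: P\<close>
 proof (induction y rule: free_induct)
  case one': one
  then show ?case using one by (simp add: unit_U)
 qed (simp_all add: z0 z gens[unfolded gen_eq] eta_simps star_homD[OF f] star_homD[OF g])
qed

lemma subalgebra_U:
 assumes cl: "closed_subspace U L" and mul: "!!a b. a \<in> L ==> b \<in> L ==> mul U a b \<in> L"
  and adj: "!!a. a \<in> L ==> adj U a \<in> L" and gens: "!!g. g \<in> G ==> \<gamma> g \<in> L"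
  and one: "1 \<in>: P ==> unit_of U \<in> L" and x: "x \<in>: U"
 shows "x \<in> L"
proof -
 have z0: "\<eta> 0 = zer U" using star_hom_zer[OF star_hom_eta pre_P U.pre.pre_cstar_axioms] by simp
 have emb: "\<eta> y \<in> L" if "y \<in>: P" for y using that
 proof (induction y rule: free_induct)
  case one': one
  then show ?case using one by (simp add: unit_U)
 next
  case (gen g)
  then show ?case using gens by (simp add: gen_eq)
 next
  case (star g)
  then show ?case using adj[OF gens[OF star]] by (simp add: eta_simps gen_eq)
 qed (simp_all add: z0 eta_simps U.closed_subspaceD(3-5)[OF cl] mul)
 obtain s where s: "cauchy M s" "x = cls M s" using x M.C_cases unfolding univ_cstar_def by blast
 have "conv_to U (%n. \<eta> (s n)) x" using M.conv_to_cls[OF s(1)] s by (simp add: univ_cstar_def)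
 then show ?thesis by (rule U.closed_subspaceD(7)[OF cl _ x, rotated]) (rule emb, use M.cauchyD[OF s(1)] in simp)
qed

lemma generates_U:
 assumes unital: "1 \<in>: P"
 shows "generates U (\<gamma> ` G)"
proof -
 have "x \<in> L" if L: "closed_unital_star_subalgebra U L" "\<gamma> ` G <= L" and x: "x \<in>: U" for L x
  by (rule subalgebra_U[OF _ _ _ _ _ x]) (use L in "auto simp: closed_unital_star_subalgebra_def")
 moreover have "closed_unital_star_subalgebra U (carrier U)"
  using unital by (simp add: closed_unital_star_subalgebra_def closed_subspace_def U.mul_closed U.adj_closed U.scl_closed unit_U)
 moreover have "\<gamma> ` G <= carrier U" by auto
 ultimately show ?thesis unfolding generates_def by (intro antisym Inter_lower Inter_greatest subsetI) (simp, simp)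
qed

lemma hom_of_rels:
 assumes "hom_rels A \<iota> <= R" "!!a. a \<in>: A ==> \<iota> a \<in> G" "pre_cstar A"
 shows "star_hom A U (%a. \<gamma> (\<iota> a))"
proof -
 interpret A: pre_cstar A by fact
 note rel = subsetD[OF assms(1)]
 have p: "gen (\<iota> a) \<in>: P" if "a \<in>: A" for a using assms(2)[OF that] by simp
 show ?thesis
 proof (rule star_homI, goal_cases)
  case (1 x) then show ?case using assms(2) by simp
 next
  case (2 x y)
  have "\<eta> (gen (\<iota> (add A x y))) = \<eta> (gen (\<iota> x) + gen (\<iota> y))"
   by (rule eta_eq_if_R[OF rel]) (use 2 p P.add_closed in "auto simp: hom_rels_def")
  then show ?case using 2 p by (simp add: gen_eq eta_simps)
 next
  case (3 x c)
  have "\<eta> (gen (\<iota> (scl A c x))) = \<eta> (cscale c (gen (\<iota> x)))"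
   by (rule eta_eq_if_R[OF rel]) (use 3 p P.scl_closed A.scl_closed in "auto simp: hom_rels_def")
  then show ?case using 3 p by (simp add: gen_eq eta_simps)
 next
  case (4 x y)
  have "\<eta> (gen (\<iota> (mul A x y))) = \<eta> (gen (\<iota> x) * gen (\<iota> y))"
   by (rule eta_eq_if_R[OF rel]) (use 4 p P.mul_closed A.mul_closed in "auto simp: hom_rels_def")
  then show ?case using 4 p by (simp add: gen_eq eta_simps)
 next
  case (5 x)
  have "\<eta> (gen (\<iota> (adj A x))) = \<eta> (free_star (gen (\<iota> x)))"
   by (rule eta_eq_if_R[OF rel]) (use 5 p P.adj_closed A.adj_closed in "auto simp: hom_rels_def")
  then show ?case using 5 p by (simp add: gen_eq eta_simps)
 qed
qed

end

lemma cstar_seminorm_eq_if_diff: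
 assumes P: "P = free_unital G \<or> P = free_nonunital G" and p: "cstar_seminorm P p"
  and xy: "x \<in>: P" "y \<in>: P" "p (x - y) = 0"
 shows "p x = p y"
proof -
 have P': "pre_cstar P" using P pre_cstar_free_unital pre_cstar_free_nonunital by auto
 interpret pre_cstar "P\<lparr>nrm := p\<rparr>" by (rule pre_cstar_renorm[OF P' p])
 have "sub (P\<lparr>nrm := p\<rparr>) x y = x - y" using P by (auto simp: sub_def cscale_minus_one)
 then show ?thesis using nrm_diff_le[of x y] xy by simp
qed

text \<open>Modulo the relations, a maps to p (gen (\<iota> a)) as a C*-seminorm on the C*-algebra
  \<open>A\<close>, and such a seminorm is at most the norm. This gives the finiteness of the
  maximal seminorm for all coproducts.\<close>

lemma hom_rels_bound:
 assumes A: "cstar_algebra A" and P: "P = free_unital G \<or> P = free_nonunital G" and p: "cstar_seminorm P p"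
  and rel: "!!r. r \<in> hom_rels A \<iota> ==> p r = 0" and \<iota>: "!!a. a \<in>: A ==> \<iota> a \<in> G" and a: "a \<in>: A"
 shows "p (gen (\<iota> a)) <= nrm A a"
proof -
 interpret A: cstar_algebra A by fact
 have P': "pre_cstar P" using P pre_cstar_free_unital pre_cstar_free_nonunital by auto
 interpret P: pre_cstar P by fact
 have Ps: "add P = (+)" "scl P = cscale" "mul P = (*)" "adj P = free_star" using P by auto
 have g: "gen (\<iota> x) \<in>: P" if "x \<in>: A" for x using \<iota>[OF that] P by auto
 note pf = cstar_seminorm_facts[OF P' p, unfolded Ps]
 note Pc = P.add_closed P.mul_closed P.scl_closed P.adj_closed
 note Pc = Pc[unfolded Ps]
 have add: "p (gen (\<iota> (add A x y))) = p (gen (\<iota> x) + gen (\<iota> y))" if "x \<in>: A" "y \<in>: A" for x y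
  by (rule cstar_seminorm_eq_if_diff[OF P p _ _ rel]) (use that g Pc in "auto simp: hom_rels_def")
 have scl: "p (gen (\<iota> (scl A c x))) = p (cscale c (gen (\<iota> x)))" if "x \<in>: A" for x and c :: complex
  by (rule cstar_seminorm_eq_if_diff[OF P p _ _ rel]) (use that g Pc A.scl_closed in "auto simp: hom_rels_def")
 have mul: "p (gen (\<iota> (mul A x y))) = p (gen (\<iota> x) * gen (\<iota> y))" if "x \<in>: A" "y \<in>: A" for x y
  by (rule cstar_seminorm_eq_if_diff[OF P p _ _ rel]) (use that g Pc A.mul_closed in "auto simp: hom_rels_def")
 have adj0: "p (gen (\<iota> (adj A x)) - free_star (gen (\<iota> x))) = 0" if "x \<in>: A" for x
  by (rule rel) (use that in "auto simp: hom_rels_def")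
 \<comment> \<open>The generator of the adjoint and the adjoint of the generator differ by a
   relation, and multiplying the difference by a fixed element leaves its seminorm 0.\<close>
 have cs: "p (gen (\<iota> (adj A x)) * gen (\<iota> x)) = (p (gen (\<iota> x)))\<^sup>2" if x: "x \<in>: A" for x
 proof -
  let ?a = "gen (\<iota> (adj A x))" and ?g = "gen (\<iota> x)"
  have c: "?a \<in>: P" "?g \<in>: P" "free_star ?g \<in>: P" using x g Pc(4) A.adj_closed by auto
  have d: "?a - free_star ?g \<in>: P" using P.sub_closed[OF c(1,3)] P by auto
  have "p ((?a - free_star ?g) * ?g) <= 0" using pf(4)[OF d c(2)] adj0[OF x] by simp
  then have "p (?a * ?g - free_star ?g * ?g) = 0" using pf(2)[OF Pc(2)[OF d c(2)]] by (simp add: left_diff_distrib)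
  then have "p (?a * ?g) = p (free_star ?g * ?g)"
   by (rule cstar_seminorm_eq_if_diff[OF P p Pc(2)[OF c(1,2)] Pc(2)[OF c(3,2)]])
  then show ?thesis using pf(7)[OF c(2)] by simp
 qed
 have "cstar_seminorm A (%a. p (gen (\<iota> a)))"
  unfolding cstar_seminorm_def using pf(2-5) g by (simp add: add scl mul A.adj_closed cs)
 then show ?thesis by (rule A.seminorm_le_nrm) (rule a)
qed

lemma free_unital_ops:
 "x \<in>: free_unital G ==> y \<in>: free_unital G ==> x + y \<in>: free_unital G"
 "x \<in>: free_unital G ==> y \<in>: free_unital G ==> x - y \<in>: free_unital G"
 "x \<in>: free_unital G ==> y \<in>: free_unital G ==> x * y \<in>: free_unital G"
 "x \<in>: free_unital G ==> cscale c x \<in>: free_unital G"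
 "x \<in>: free_unital G ==> free_star x \<in>: free_unital G"
 using pre_cstar.add_closed[OF pre_cstar_free_unital, of x G y] pre_cstar.sub_closed[OF pre_cstar_free_unital, of x G y]
  pre_cstar.mul_closed[OF pre_cstar_free_unital, of x G y] pre_cstar.scl_closed[OF pre_cstar_free_unital, of x G c]
  pre_cstar.adj_closed[OF pre_cstar_free_unital, of x G] by simp_all

lemma free_unital_sum:
 "(!!i. i \<in> I ==> h i \<in>: free_unital G) ==> (\<Sum>i\<in>I. h i) \<in>: free_unital G"
 using pre_cstar.zer_closed[OF pre_cstar_free_unital, of G]
 by (induction I rule: infinite_finite_induct) (auto intro: free_unital_ops)

lemmas free_unital_closed = free_unital_ops free_unital_sum

context unital_pre_cstar
begin

context
 fixes G :: "'g set" and f :: "'g => 'a"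
 assumes f: "!!g. g \<in> G ==> f g \<in>: A"
begin

lemma ev_closed: "x \<in>: free_unital G ==> ev A f x \<in>: A" by (rule star_homD(1)[OF star_hom_ev[OF f]])

lemma star_hom_ev': "star_hom (free_unital G) A (ev A f)" by (rule star_hom_ev[OF f])

lemma ev_simps:
 assumes "x \<in>: free_unital G"
 shows "ev A f (cscale c x) = scl A c (ev A f x)" "ev A f (free_star x) = adj A (ev A f x)"
  "y \<in>: free_unital G ==> ev A f (x + y) = add A (ev A f x) (ev A f y)"
  "y \<in>: free_unital G ==> ev A f (x * y) = mul A (ev A f x) (ev A f y)"
  "y \<in>: free_unital G ==> ev A f (x - y) = sub A (ev A f x) (ev A f y)"
 using star_homD(2,4)[OF star_hom_ev', of x y] star_homD(3)[OF star_hom_ev', of x c] star_homD(5)[OF star_hom_ev', of x]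
  star_hom_sub[OF star_hom_ev' pre_cstar_free_unital, of x y] assms by simp_all

lemma ev_gen' [simp]: "g \<in> G ==> ev A f (gen g) = f g" by (rule ev_gen[OF f])

lemma ev_one' [simp]: "ev A f 1 = unit_of A" by (rule ev_one[OF f])

lemma ev_sum: "(!!i. i \<in> I ==> h i \<in>: free_unital G) ==> ev A f (\<Sum>i\<in>I. h i) = asum A (%i. ev A f (h i)) I"
proof (induction I rule: infinite_finite_induct)
 case (insert i I)
 then show ?case using free_unital_closed(6)[of I h G] by (simp add: ev_simps asum_insert ev_closed)
qed (simp_all add: ev_def lin_def)

lemma ev_hom_rels:
 assumes D: "pre_cstar D" and hom: "star_hom D A (%d. f (\<iota> d))" and \<iota>: "!!d. d \<in>: D ==> \<iota> d \<in> G"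
  and r: "r \<in> hom_rels D \<iota>"
 shows "ev A f r = zer A"
proof -
 interpret D: pre_cstar D by fact
 note h = star_homD[OF hom]
 note [simp] = D.add_closed D.mul_closed D.scl_closed D.adj_closed
 show ?thesis using r unfolding hom_rels_def
  by (elim UnE CollectE exE conjE) (simp_all add: \<iota> ev_simps free_unital_closed h(2-5) f)
qed

end

end

subsection \<open>Magic relations\<close>

text \<open>The rectangular form is needed for a block, whose rows and columns are indexed by the
  vertices of two different graphs.\<close>

definition magic_matrix :: "'i set => 'j set => 'a star_algebra => ('i => 'j => 'a) => bool" where
 "magic_matrix I J A u \<longleftrightarrow>
  (\<forall>i\<in>I. \<forall>j\<in>J. u i j \<in>: A & mul A (u i j) (u i j) = u i j & adj A (u i j) = u i j) &
  (\<forall>i\<in>I. asum A (%j. u i j) J = unit_of A) & (\<forall>j\<in>J. asum A (%i. u i j) I = unit_of A)"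

lemma magic_unitary_iff: "magic_unitary I A u \<longleftrightarrow> magic_matrix I I A u"
 by (simp add: magic_unitary_def magic_matrix_def)

lemma magic_matrixD:
 assumes "magic_matrix I J A u"
 shows "i \<in> I ==> j \<in> J ==> u i j \<in>: A" "i \<in> I ==> j \<in> J ==> mul A (u i j) (u i j) = u i j"
  "i \<in> I ==> j \<in> J ==> adj A (u i j) = u i j"
  "i \<in> I ==> asum A (%j. u i j) J = unit_of A" "j \<in> J ==> asum A (%i. u i j) I = unit_of A"
 using assms by (simp_all add: magic_matrix_def)

lemma magic_matrix_orthogonal:
 assumes A: "unital_cstar A" and u: "magic_matrix I J A u"
 shows "finite J ==> i \<in> I ==> j \<in> J ==> k \<in> J ==> j ~= k ==> mul A (u i j) (u i k) = zer A"
  "finite I ==> i \<in> I ==> k \<in> I ==> j \<in> J ==> i ~= k ==> mul A (u i j) (u k j) = zer A"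
proof -
 interpret cstar_algebra A by (rule unital_cstarD[OF A])
 note e = unital_pre_cstar.unit[OF unital_cstar_pre[OF A]] and uD = magic_matrixD[OF u]
 show "mul A (u i j) (u i k) = zer A" if "finite J" "i \<in> I" "j \<in> J" "k \<in> J" "j ~= k"
  by (rule projections_orthogonal[OF e that(1) uD(4)]) (use that uD in auto)
 show "mul A (u i j) (u k j) = zer A" if "finite I" "i \<in> I" "k \<in> I" "j \<in> J" "i ~= k"
  by (rule projections_orthogonal[OF e that(1) uD(5)]) (use that uD in auto)
qed

lemma magic_rels_in_free: "magic_rels I J <= carrier (free_unital (I \<times> J))"
 unfolding magic_rels_def by (auto simp: free_unital_closed)

lemma (in unital_pre_cstar) ev_magic_rels:
 assumes f: "magic_matrix I J A (%i j. f (i, j))" and r: "r \<in> magic_rels I J"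
 shows "ev A f r = zer A"
proof -
 note fD = magic_matrixD[OF f]
 have fc: "!!g. g \<in> I \<times> J ==> f g \<in>: A" using fD by auto
 have "asum A (%j. ev A f (gen (i, j))) J = unit_of A" if "i \<in> I" for i
  using asum_cong[OF refl, of J "%j. f (i, j)" "%j. ev A f (gen (i, j))"] fD that by (simp add: ev_gen'[OF fc])
 moreover have "asum A (%i. ev A f (gen (i, j))) I = unit_of A" if "j \<in> J" for j
  using asum_cong[OF refl, of I "%i. f (i, j)" "%i. ev A f (gen (i, j))"] fD that by (simp add: ev_gen'[OF fc])
 ultimately show ?thesis using r unfolding magic_rels_def by (elim UnE CollectE exE conjE)
   (simp_all add: ev_simps[OF fc] ev_sum[OF fc] free_unital_closed ev_gen'[OF fc] ev_one'[OF fc] fD)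
qed

text \<open>A seminorm that satisfies the relations treats the generator g as a projection, so
  p(g)^2 = p(g^* g) = p(g).\<close>

lemma magic_rels_bound:
 assumes p: "cstar_seminorm (free_unital G) p" and rel: "!!r. r \<in> magic_rels I J ==> p r = 0"
  and G: "I \<times> J <= G" and g: "g \<in> I \<times> J"
 shows "p (gen g) <= 1"
proof -
 let ?g = "gen g" and ?P = "free_unital G"
 have c: "?g \<in>: ?P" using g G by auto
 note pf = cstar_seminorm_facts[OF pre_cstar_free_unital p, simplified]
 have 1: "p (?g * ?g) = p ?g"
  by (rule cstar_seminorm_eq_if_diff[OF disjI1[OF refl] p _ _ rel]) (use g c in "auto simp: magic_rels_def free_unital_closed")
 have d: "p (free_star ?g - ?g) = 0" by (rule rel) (use g in "auto simp: magic_rels_def")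
 have dc: "free_star ?g - ?g \<in>: ?P" "free_star ?g \<in>: ?P" using c by (auto simp: free_unital_closed)
 have "p ((free_star ?g - ?g) * ?g) = 0" using pf(4)[OF dc(1) c] pf(2)[OF free_unital_closed(3)[OF dc(1) c]] d by simp
 then have "p (free_star ?g * ?g) = p (?g * ?g)"
  by (intro cstar_seminorm_eq_if_diff[OF disjI1[OF refl] p]) (use c dc in "auto simp: left_diff_distrib free_unital_closed")
 then have "(p ?g)\<^sup>2 = p ?g" using pf(7)[OF c] 1 by simp
 then have "p ?g = 0 \<or> p ?g = 1" by (simp add: power2_eq_square)
 then show ?thesis by auto
qed

lemma universal_magic:
 assumes "magic_rels I J <= R" "R <= carrier (free_unital (I \<times> J))"
 shows "universal_cstar (free_unital (I \<times> J)) R (I \<times> J)"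
proof
 fix g assume "g \<in> I \<times> J"
 then show "\<exists>K. \<forall>p. cstar_seminorm (free_unital (I \<times> J)) p --> (\<forall>r\<in>R. p r = 0) --> p (gen g) <= K"
  using magic_rels_bound[of "I \<times> J" _ I J g] assms by (intro exI[of _ 1]) blast
qed (use assms in auto)

lemma universal_magic_matrix:
 assumes "magic_rels I J <= R" "R <= carrier (free_unital (I \<times> J))"
 shows "magic_matrix I J (univ_cstar (free_unital (I \<times> J)) R) (%i j. univ_gen (free_unital (I \<times> J)) R (i, j))"
proof -
 interpret universal_cstar "free_unital (I \<times> J)" R "I \<times> J" by (rule universal_magic) fact+
 note rel = subsetD[OF assms(1)]
 have sq: "mul U (\<gamma> (i, j)) (\<gamma> (i, j)) = \<gamma> (i, j)" "adj U (\<gamma> (i, j)) = \<gamma> (i, j)" if ij: "i \<in> I" "j \<in> J" for i j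
 proof -
  have "\<eta> (gen (i, j) * gen (i, j)) = \<eta> (gen (i, j))"
   by (rule eta_eq_if_R[OF rel]) (use ij in "auto simp: magic_rels_def free_unital_closed")
  moreover have "\<eta> (free_star (gen (i, j))) = \<eta> (gen (i, j))"
   by (rule eta_eq_if_R[OF rel]) (use ij in "auto simp: magic_rels_def free_unital_closed")
  ultimately show "mul U (\<gamma> (i, j)) (\<gamma> (i, j)) = \<gamma> (i, j)" "adj U (\<gamma> (i, j)) = \<gamma> (i, j)"
   using ij by (simp_all add: eta_simps gen_eq)
 qed
 have row: "asum U (%j. \<gamma> (i, j)) J = unit_of U" if i: "i \<in> I" for i
 proof -
  have "\<eta> (\<Sum>j\<in>J. gen (i, j)) = \<eta> 1"
   by (rule eta_eq_if_R[OF rel]) (use i in "auto simp: magic_rels_def intro!: sum_in_P")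
  then show ?thesis using i by (simp add: eta_sum gen_eq unit_U)
 qed
 have col: "asum U (%i. \<gamma> (i, j)) I = unit_of U" if j: "j \<in> J" for j
 proof -
  have "\<eta> (\<Sum>i\<in>I. gen (i, j)) = \<eta> 1"
   by (rule eta_eq_if_R[OF rel]) (use j in "auto simp: magic_rels_def intro!: sum_in_P")
  then show ?thesis using j by (simp add: eta_sum gen_eq unit_U)
 qed
 show ?thesis unfolding magic_matrix_def using sq row col by simp
qed

text \<open>One form for S_n^+, QIso and Qut: in a target with a magic matrix only the remaining
  relations have to be verified.\<close>

lemma universal_magic_facts:
 assumes R: "magic_rels I J <= R" "R <= carrier (free_unital (I \<times> J))"
 defines "U \<equiv> univ_cstar (free_unital (I \<times> J)) R" and "v \<equiv> %i j. univ_gen (free_unital (I \<times> J)) R (i, j)"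
 shows "unital_cstar U" "generates U {v i j |i j. i \<in> I & j \<in> J}"
  "unital_cstar B ==> magic_matrix I J B w ==> (!!r. r \<in> R - magic_rels I J ==> ev B (%(i, j). w i j) r = zer B) ==>
   \<exists>phi. star_hom U B phi & phi (unit_of U) = unit_of B & (\<forall>i\<in>I. \<forall>j\<in>J. phi (v i j) = w i j)"
proof -
 interpret universal_cstar "free_unital (I \<times> J)" R "I \<times> J" by (rule universal_magic) fact+
 show "unital_cstar U" unfolding U_def by (rule unital_U) simp
 have "\<gamma> ` (I \<times> J) = {v i j |i j. i \<in> I & j \<in> J}" unfolding v_def by blast
 then show "generates U {v i j |i j. i \<in> I & j \<in> J}" unfolding U_def using generates_U by simp
 assume B: "unital_cstar B" and w: "magic_matrix I J B w"
  and R': "!!r. r \<in> R - magic_rels I J ==> ev B (%(i, j). w i j) r = zer B"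
 interpret B: unital_pre_cstar B by (rule unital_cstar_pre[OF B])
 let ?f = "%(i, j). w i j"
 have f: "?f g \<in>: B" if "g \<in> I \<times> J" for g using magic_matrixD(1)[OF w] that by auto
 have rel: "ev B ?f r = zer B" if "r \<in> R" for r
  using B.ev_magic_rels[of I J ?f r] w R' that by (cases "r \<in> magic_rels I J") simp_all
 show "\<exists>phi. star_hom U B phi & phi (unit_of U) = unit_of B & (\<forall>i\<in>I. \<forall>j\<in>J. phi (v i j) = w i j)"
  unfolding U_def v_def using lift[OF B f rel] by (intro exI[of _ "univ_lift B ?f"]) auto
qed

subsection \<open>The universal algebras of the statement\<close>

lemma unital_Sn_plus: "unital_cstar (Sn_plus n)"
 and generates_Sn_plus: "generates (Sn_plus n) {Sn_plus_gen n i j |i j. i \<in> {1..n} & j \<in> {1..n}}"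
 and magic_Sn_plus: "magic_unitary {1..n} (Sn_plus n) (Sn_plus_gen n)"
 unfolding Sn_plus_def Sn_plus_gen_def magic_unitary_iff
 by (rule universal_magic_facts(1,2)[OF subset_refl magic_rels_in_free] universal_magic_matrix[OF subset_refl magic_rels_in_free])+

lemma Sn_plus_lift:
 assumes "unital_cstar B" "magic_unitary {1..n} B w"
 shows "\<exists>phi. star_hom (Sn_plus n) B phi & phi (unit_of (Sn_plus n)) = unit_of B &
   (\<forall>i\<in>{1..n}. \<forall>j\<in>{1..n}. phi (Sn_plus_gen n i j) = w i j)"
 unfolding Sn_plus_def Sn_plus_gen_def
 by (rule universal_magic_facts(3)[OF subset_refl magic_rels_in_free assms(1) assms(2)[unfolded magic_unitary_iff]]) simp

lemma QIso_rels_in_free: "QIso_rels X Y <= carrier (free_unital (pverts X \<times> pverts Y))"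
 unfolding QIso_rels_def using magic_rels_in_free[of "pverts X" "pverts Y"] by (auto simp: free_unital_closed)

lemma QIso_magic_rels: "magic_rels (pverts X) (pverts Y) <= QIso_rels X Y" by (simp add: QIso_rels_def)

definition arc_mismatch :: "'v pair_pre_digraph => 'w pair_pre_digraph => 'v => 'v => 'w => 'w => bool" where
 "arc_mismatch X Y x x' y y' \<longleftrightarrow> x \<in> pverts X & x' \<in> pverts X & y \<in> pverts Y & y' \<in> pverts Y &
  ((x, x') \<in> parcs X & (y, y') \<notin> parcs Y \<or> (x, x') \<notin> parcs X & (y, y') \<in> parcs Y)"

lemma unital_QIso: "unital_cstar (QIso X Y)"
 and generates_QIso: "generates (QIso X Y) {QIso_gen X Y x y |x y. x \<in> pverts X & y \<in> pverts Y}"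
 and magic_QIso: "magic_matrix (pverts X) (pverts Y) (QIso X Y) (QIso_gen X Y)" unfolding QIso_def QIso_gen_def
 by (rule universal_magic_facts(1,2)[OF QIso_magic_rels QIso_rels_in_free] universal_magic_matrix[OF QIso_magic_rels QIso_rels_in_free])+

lemma QIso_mismatch:
 assumes m: "arc_mismatch X Y x x' y y'"
 shows "mul (QIso X Y) (QIso_gen X Y x y) (QIso_gen X Y x' y') = zer (QIso X Y)"
proof -
 interpret universal_cstar "free_unital (pverts X \<times> pverts Y)" "QIso_rels X Y" "pverts X \<times> pverts Y"
  by (rule universal_magic[OF QIso_magic_rels QIso_rels_in_free])
 have "gen (x, y) * gen (x', y') \<in> QIso_rels X Y" using m unfolding QIso_rels_def arc_mismatch_def by blast
 then show ?thesis using eta_R m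
  unfolding QIso_def QIso_gen_def by (simp add: gen_eq arc_mismatch_def eta_simps(3)[symmetric])
qed

lemma QIso_lift:
 assumes B: "unital_cstar B" and w: "magic_matrix (pverts X) (pverts Y) B w"
  and orth: "!!x x' y y'. arc_mismatch X Y x x' y y' ==> mul B (w x y) (w x' y') = zer B"
 shows "\<exists>phi. star_hom (QIso X Y) B phi & phi (unit_of (QIso X Y)) = unit_of B &
   (\<forall>x\<in>pverts X. \<forall>y\<in>pverts Y. phi (QIso_gen X Y x y) = w x y)" unfolding QIso_def QIso_gen_def
proof (rule universal_magic_facts(3)[OF QIso_magic_rels QIso_rels_in_free B w])
 interpret B: unital_pre_cstar B by (rule unital_cstar_pre[OF B])
 have f: "!!g. g \<in> pverts X \<times> pverts Y ==> (%(x, y). w x y) g \<in>: B" using magic_matrixD(1)[OF w] by auto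
 fix r assume "r \<in> QIso_rels X Y - magic_rels (pverts X) (pverts Y)"
 then obtain x x' y y' where "r = gen (x, y) * gen (x', y')" and m: "arc_mismatch X Y x x' y y'"
  unfolding QIso_rels_def arc_mismatch_def by blast
 then show "ev B (%(x, y). w x y) r = zer B"
  using orth[OF m] by (simp add: B.ev_simps[OF f] B.ev_gen'[OF f] arc_mismatch_def)
qed

definition intertwines :: "'v pair_pre_digraph => 'a star_algebra => ('v => 'v => 'a) => bool" where
 "intertwines X B w \<longleftrightarrow> (\<forall>x\<in>pverts X. \<forall>y\<in>pverts X.
  asum B (%z. scl B (adjacency X x z) (w z y)) (pverts X) = asum B (%z. scl B (adjacency X z y) (w x z)) (pverts X))"

lemma Qut_rels_in_free: "Qut_rels X <= carrier (free_unital (pverts X \<times> pverts X))"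
 unfolding Qut_rels_def using magic_rels_in_free[of "pverts X" "pverts X"] by (auto intro!: free_unital_closed)

lemma Qut_magic_rels: "magic_rels (pverts X) (pverts X) <= Qut_rels X" by (simp add: Qut_rels_def)

lemma unital_Qut: "unital_cstar (Qut X)"
 and generates_Qut: "generates (Qut X) {Qut_gen X x y |x y. x \<in> pverts X & y \<in> pverts X}"
 and magic_Qut: "magic_unitary (pverts X) (Qut X) (Qut_gen X)" unfolding Qut_def Qut_gen_def magic_unitary_iff
 by (rule universal_magic_facts(1,2)[OF Qut_magic_rels Qut_rels_in_free] universal_magic_matrix[OF Qut_magic_rels Qut_rels_in_free])+

lemma intertwines_Qut: "intertwines X (Qut X) (Qut_gen X)" unfolding intertwines_def
proof (intro ballI)
 let ?I = "pverts X"
 interpret universal_cstar "free_unital (?I \<times> ?I)" "Qut_rels X" "?I \<times> ?I"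
  by (rule universal_magic[OF Qut_magic_rels Qut_rels_in_free])
 fix x y assume xy: "x \<in> ?I" "y \<in> ?I"
 have c: "cscale a (gen (z, z')) \<in>: (free_unital (?I \<times> ?I))" if "z \<in> ?I" "z' \<in> ?I" for a z z'
  using that by (simp add: free_unital_closed)
 have "\<eta> (\<Sum>z\<in>?I. cscale (adjacency X x z) (gen (z, y))) = \<eta> (\<Sum>z\<in>?I. cscale (adjacency X z y) (gen (x, z)))"
 proof (rule eta_eq_if_R)
  show "(\<Sum>z\<in>?I. cscale (adjacency X x z) (gen (z, y))) - (\<Sum>z\<in>?I. cscale (adjacency X z y) (gen (x, z))) \<in> Qut_rels X"
   unfolding Qut_rels_def using xy by blast
 qed (rule sum_in_P; use xy c in simp)+
 moreover have "asum U (%z. \<eta> (cscale (adjacency X x z) (gen (z, y)))) ?I = asum U (%z. scl U (adjacency X x z) (\<gamma> (z, y))) ?I"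
  "asum U (%z. \<eta> (cscale (adjacency X z y) (gen (x, z)))) ?I = asum U (%z. scl U (adjacency X z y) (\<gamma> (x, z))) ?I"
  by (rule U.asum_cong; use xy in "simp add: eta_simps gen_eq U.scl_closed")+
 ultimately show "asum (Qut X) (%z. scl (Qut X) (adjacency X x z) (Qut_gen X z y)) ?I =
   asum (Qut X) (%z. scl (Qut X) (adjacency X z y) (Qut_gen X x z)) ?I"
  using xy c unfolding Qut_def Qut_gen_def by (simp add: eta_sum)
qed

lemma Qut_lift:
 assumes B: "unital_cstar B" and w: "magic_unitary (pverts X) B w" and int: "intertwines X B w"
 shows "\<exists>phi. star_hom (Qut X) B phi & phi (unit_of (Qut X)) = unit_of B &
   (\<forall>x\<in>pverts X. \<forall>y\<in>pverts X. phi (Qut_gen X x y) = w x y)" unfolding Qut_def Qut_gen_def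
proof (rule universal_magic_facts(3)[OF Qut_magic_rels Qut_rels_in_free B w[unfolded magic_unitary_iff]])
 interpret B: unital_pre_cstar B by (rule unital_cstar_pre[OF B])
 let ?I = "pverts X" and ?f = "%(x, y). w x y"
 note wc = magic_matrixD(1)[OF w[unfolded magic_unitary_iff]]
 have f: "!!g. g \<in> ?I \<times> ?I ==> ?f g \<in>: B" using wc by auto
 have s: "ev B ?f (\<Sum>z\<in>?I. cscale (a z) (gen (b z))) = asum B (%z. scl B (a z) (?f (b z))) ?I"
  "(\<Sum>z\<in>?I. cscale (a z) (gen (b z))) \<in>: (free_unital (?I \<times> ?I))"
  if b: "!!z. z \<in> ?I ==> b z \<in> ?I \<times> ?I" for a b
 proof -
  have c: "cscale (a z) (gen (b z)) \<in>: (free_unital (?I \<times> ?I))" if "z \<in> ?I" for z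
   by (rule free_unital_ops(4)[OF gen_in_free_unital[OF b[OF that]]])
  show "(\<Sum>z\<in>?I. cscale (a z) (gen (b z))) \<in>: (free_unital (?I \<times> ?I))" by (rule free_unital_sum[OF c])
  have "ev B ?f (\<Sum>z\<in>?I. cscale (a z) (gen (b z))) = asum B (%z. ev B ?f (cscale (a z) (gen (b z)))) ?I"
   by (rule B.ev_sum[OF f]) (use c in simp_all)
  also have "... = asum B (%z. scl B (a z) (?f (b z))) ?I"
   by (rule B.asum_cong[OF refl]) (use b f in "simp_all add: B.ev_simps[OF f] B.ev_gen'[OF f] B.scl_closed")
  finally show "ev B ?f (\<Sum>z\<in>?I. cscale (a z) (gen (b z))) = asum B (%z. scl B (a z) (?f (b z))) ?I" .
 qed
 fix r assume "r \<in> Qut_rels X - magic_rels ?I ?I"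
 then obtain x y where xy: "x \<in> ?I" "y \<in> ?I" and r: "r = (\<Sum>z\<in>?I. cscale (adjacency X x z) (gen (z, y))) -
  (\<Sum>z\<in>?I. cscale (adjacency X z y) (gen (x, z)))" unfolding Qut_rels_def by blast
 then show "ev B ?f r = zer B" using int wc unfolding intertwines_def by (simp add: B.ev_simps(5)[OF f] s B.scl_closed)
qed

subsection \<open>Free products and unitizations\<close>

lemma one_notin_free_nonunital [simp]: "1 \<notin> carrier (free_nonunital G)"
 by (simp add: free_nonunital_def flip: single_one)

lemma hom_rels_in_free:
 assumes A: "pre_cstar A" and \<iota>: "!!a. a \<in>: A ==> \<iota> a \<in> G" and P: "P = free_unital G \<or> P = free_nonunital G"
 shows "hom_rels A \<iota> <= carrier P"
proof -
 interpret A: pre_cstar A by fact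
 have P': "pre_cstar P" using P pre_cstar_free_unital pre_cstar_free_nonunital by auto
 interpret P: pre_cstar P by fact
 have Ps: "add P = (+)" "scl P = cscale" "mul P = (*)" "adj P = free_star" "!!x y. sub P x y = x - y" using P by auto
 have g: "gen (\<iota> x) \<in>: P" if "x \<in>: A" for x using \<iota>[OF that] P by auto
 note Pc = P.add_closed P.mul_closed P.scl_closed P.adj_closed P.sub_closed
 show ?thesis unfolding hom_rels_def by (intro Un_least subsetI; elim CollectE exE conjE)
   (simp_all add: g Pc[unfolded Ps] A.scl_closed A.mul_closed A.adj_closed)
qed

context
 fixes K :: "'k set" and A :: "'k => 'a star_algebra"
 assumes A: "!!k. k \<in> K ==> cstar_algebra (A k)"
begin

lemma universal_free_prod: "universal_cstar (free_prod_gens K A) (free_prod_rels K A) (SIGMA k:K. carrier (A k))"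
proof
 show "free_prod_gens K A = free_unital (SIGMA k:K. carrier (A k)) \<or> free_prod_gens K A = free_nonunital (SIGMA k:K. carrier (A k))"
  by (simp add: free_prod_gens_def)
 show "free_prod_rels K A <= carrier (free_prod_gens K A)" unfolding free_prod_rels_def free_prod_gens_def
  by (intro UN_least hom_rels_in_free[OF cstar_algebra_pre[OF A], where G = "SIGMA k:K. carrier (A k)"]) auto
 fix g assume "g \<in> (SIGMA k:K. carrier (A k))"
 then obtain k a where g: "g = (k, a)" "k \<in> K" "a \<in>: A k" by auto
 have "p (gen g) <= nrm (A k) a" if p: "cstar_seminorm (free_prod_gens K A) p" "\<forall>r\<in>free_prod_rels K A. p r = 0" for p
  unfolding g(1) by (rule hom_rels_bound[OF A[OF g(2)] _ p(1), where G = "SIGMA k:K. carrier (A k)"])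
   (use p g in "auto simp: free_prod_gens_def free_prod_rels_def")
 then show "\<exists>C. \<forall>p. cstar_seminorm (free_prod_gens K A) p --> (\<forall>r\<in>free_prod_rels K A. p r = 0) --> p (gen g) <= C"
  by blast
qed

interpretation universal_cstar "free_prod_gens K A" "free_prod_rels K A" "SIGMA k:K. carrier (A k)"
 by (rule universal_free_prod)

lemma cstar_free_prod: "cstar_algebra (free_prod K A)" unfolding free_prod_def by (rule cstar_U)

lemma star_hom_free_prod_incl: "k \<in> K ==> star_hom (A k) (free_prod K A) (free_prod_incl K A k)"
 unfolding free_prod_def free_prod_incl_def [abs_def]
 by (rule hom_of_rels) (auto simp: free_prod_rels_def cstar_algebra_pre[OF A])

lemma free_prod_lift:
 assumes B: "unital_cstar B" and h: "!!k. k \<in> K ==> star_hom (A k) B (h k)"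
 shows "\<exists>phi. star_hom (free_prod K A) B phi & (\<forall>k\<in>K. \<forall>a\<in>carrier (A k). phi (free_prod_incl K A k a) = h k a)"
proof -
 interpret B: unital_pre_cstar B by (rule unital_cstar_pre[OF B])
 let ?f = "%(k, a). h k a"
 have f: "!!g. g \<in> (SIGMA k:K. carrier (A k)) ==> ?f g \<in>: B" using star_homD(1)[OF h] by auto
 have rel: "ev B ?f r = zer B" if r: "r \<in> free_prod_rels K A" for r
 proof -
  obtain k where k: "k \<in> K" "r \<in> hom_rels (A k) (Pair k)" using r by (auto simp: free_prod_rels_def)
  show ?thesis by (rule B.ev_hom_rels[OF f cstar_algebra_pre[OF A[OF k(1)]] _ _ k(2)]) (use h k in auto)
 qed
 show ?thesis unfolding free_prod_def free_prod_incl_def using lift(1,2)[OF B f rel]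
  by (intro exI[of _ "univ_lift B ?f"]) auto
qed

lemma free_prod_eq:
 assumes "star_hom (free_prod K A) B f" "star_hom (free_prod K A) B g" "cstar_algebra B"
  "!!k a. k \<in> K ==> a \<in>: A k ==> f (free_prod_incl K A k a) = g (free_prod_incl K A k a)"
  "x \<in>: free_prod K A"
 shows "f x = g x" by (rule hom_eq[OF assms(1,2)[unfolded free_prod_def] assms(3) _ _ assms(5)[unfolded free_prod_def]])
  (use assms(4) in "auto simp: free_prod_incl_def free_prod_gens_def")

end

text \<open>The relations \<open>T\<close> are empty for the nonunital coproduct; for the unital one
  they identify both units with 1.\<close>

locale coproduct =
 fixes A :: "'a star_algebra" and B :: "'b star_algebra" and P R T
 assumes A: "cstar_algebra A" and B: "cstar_algebra B"
  and P: "P = free_unital (carrier A <+> carrier B) \<or> P = free_nonunital (carrier A <+> carrier B)"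
  and R_eq: "R = hom_rels A Inl \<union> hom_rels B Inr \<union> T" and T: "T <= carrier P"
begin

lemma universal_coproduct: "universal_cstar P R (carrier A <+> carrier B)"
proof
 show "R <= carrier P"
  unfolding R_eq using hom_rels_in_free[OF cstar_algebra_pre[OF A] _ P, of Inl] hom_rels_in_free[OF cstar_algebra_pre[OF B] _ P, of Inr] T
  by auto
 fix g assume "g \<in> carrier A <+> carrier B"
 then show "\<exists>K. \<forall>p. cstar_seminorm P p --> (\<forall>r\<in>R. p r = 0) --> p (gen g) <= K"
  using hom_rels_bound[OF A P, of _ Inl] hom_rels_bound[OF B P, of _ Inr] unfolding R_eq by (elim PlusE) (auto, blast+)
qed (rule P)

sublocale universal_cstar P R "carrier A <+> carrier B" by (rule universal_coproduct)

lemma star_hom_coproduct_incl: "star_hom A U (%a. \<gamma> (Inl a))" "star_hom B U (%b. \<gamma> (Inr b))"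
 by (rule hom_of_rels; auto simp: R_eq cstar_algebra_pre[OF A] cstar_algebra_pre[OF B])+

lemma coproduct_lift:
 assumes C: "unital_cstar C" and h: "star_hom A C h" and h': "star_hom B C h'"
  and T: "!!r. r \<in> T ==> ev C (case_sum h h') r = zer C"
 shows "\<exists>phi. star_hom U C phi & (1 \<in>: P --> phi (unit_of U) = unit_of C) &
  (\<forall>a\<in>carrier A. phi (\<gamma> (Inl a)) = h a) & (\<forall>b\<in>carrier B. phi (\<gamma> (Inr b)) = h' b)"
proof -
 interpret C: unital_pre_cstar C by (rule unital_cstar_pre[OF C])
 have f: "!!g. g \<in> carrier A <+> carrier B ==> case_sum h h' g \<in>: C"
  using star_homD(1)[OF h] star_homD(1)[OF h'] by auto
 have rel: "ev C (case_sum h h') r = zer C" if r: "r \<in> R" for r using r unfolding R_eq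
 proof (elim UnE)
  show "r \<in> hom_rels A Inl ==> ?thesis" by (rule C.ev_hom_rels[OF f cstar_algebra_pre[OF A]]) (auto simp: h)
  show "r \<in> hom_rels B Inr ==> ?thesis" by (rule C.ev_hom_rels[OF f cstar_algebra_pre[OF B]]) (auto simp: h')
 qed (rule T)
 show ?thesis using lift[OF C f rel] by (intro exI[of _ "univ_lift C (case_sum h h')"]) (auto simp: InlI InrI)
qed

end

lemma coproduct_free_prod2:
 assumes "cstar_algebra A" "cstar_algebra B"
 shows "coproduct A B (free_prod2_gens A B) (free_prod2_rels A B) {}"
 by (rule coproduct.intro) (simp_all add: assms free_prod2_gens_def free_prod2_rels_def)

context
 fixes A :: "'a star_algebra" and B :: "'b star_algebra"
 assumes A: "cstar_algebra A" and B: "cstar_algebra B"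
begin

interpretation coproduct A B "free_prod2_gens A B" "free_prod2_rels A B" "{}" by (rule coproduct_free_prod2[OF A B])

lemma cstar_free_prod2: "cstar_algebra (free_prod2 A B)" unfolding free_prod2_def by (rule cstar_U)

lemma star_hom_free_prod2_incl: "star_hom A (free_prod2 A B) (%a. free_prod2_incl A B (Inl a))"
 "star_hom B (free_prod2 A B) (%b. free_prod2_incl A B (Inr b))"
 unfolding free_prod2_def free_prod2_incl_def by (fact star_hom_coproduct_incl)+

lemma free_prod2_lift:
 assumes "unital_cstar C" "star_hom A C h" "star_hom B C h'"
 shows "\<exists>phi. star_hom (free_prod2 A B) C phi & (\<forall>a\<in>carrier A. phi (free_prod2_incl A B (Inl a)) = h a) &
  (\<forall>b\<in>carrier B. phi (free_prod2_incl A B (Inr b)) = h' b)"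
 unfolding free_prod2_def free_prod2_incl_def using coproduct_lift[OF assms] by auto

lemma free_prod2_eq:
 assumes "star_hom (free_prod2 A B) C f" "star_hom (free_prod2 A B) C g" "cstar_algebra C"
  "!!a. a \<in>: A ==> f (free_prod2_incl A B (Inl a)) = g (free_prod2_incl A B (Inl a))"
  "!!b. b \<in>: B ==> f (free_prod2_incl A B (Inr b)) = g (free_prod2_incl A B (Inr b))"
  "x \<in>: free_prod2 A B"
 shows "f x = g x"
 by (rule hom_eq[OF assms(1,2)[unfolded free_prod2_def] assms(3) _ _ assms(6)[unfolded free_prod2_def]])
  (use assms(4,5) in "auto simp: free_prod2_incl_def free_prod2_gens_def")

lemma free_prod2_subalgebra:
 assumes "closed_subspace (free_prod2 A B) L"
  "!!a b. a \<in> L ==> b \<in> L ==> mul (free_prod2 A B) a b \<in> L" "!!a. a \<in> L ==> adj (free_prod2 A B) a \<in> L"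
  "!!a. a \<in>: A ==> free_prod2_incl A B (Inl a) \<in> L" "!!b. b \<in>: B ==> free_prod2_incl A B (Inr b) \<in> L"
  "x \<in>: free_prod2 A B"
 shows "x \<in> L" by (rule subalgebra_U[OF assms(1-3)[unfolded free_prod2_def] _ _ assms(6)[unfolded free_prod2_def]])
  (use assms(4,5) in "auto simp: free_prod2_incl_def free_prod2_gens_def")

end

lemma coproduct_unital_free_prod:
 assumes "unital_cstar A" "unital_cstar B"
 shows "coproduct A B (unital_free_prod_gens A B) (unital_free_prod_rels A B) {gen (Inl (unit_of A)) - 1, gen (Inr (unit_of B)) - 1}"
proof (rule coproduct.intro)
 interpret A: unital_pre_cstar A by (rule unital_cstar_pre) fact
 interpret B: unital_pre_cstar B by (rule unital_cstar_pre) fact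
 show "{gen (Inl (unit_of A)) - 1, gen (Inr (unit_of B)) - 1} <= carrier (unital_free_prod_gens A B)"
  by (auto simp: unital_free_prod_gens_def intro!: free_unital_closed gen_in_free_unital)
qed (use assms unital_cstarD in "simp_all add: unital_free_prod_gens_def unital_free_prod_rels_def")

context
 fixes A :: "'a star_algebra" and B :: "'b star_algebra"
 assumes A: "unital_cstar A" and B: "unital_cstar B"
begin

interpretation A: unital_pre_cstar A by (rule unital_cstar_pre[OF A])
interpretation B: unital_pre_cstar B by (rule unital_cstar_pre[OF B])
interpretation coproduct A B "unital_free_prod_gens A B" "unital_free_prod_rels A B" "{gen (Inl (unit_of A)) - 1, gen (Inr (unit_of B)) - 1}"
 by (rule coproduct_unital_free_prod[OF A B])

lemma unital_free_prod_one: "1 \<in>: unital_free_prod_gens A B" by (simp add: unital_free_prod_gens_def)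

lemma unital_unital_free_prod: "unital_cstar (unital_free_prod A B)"
 unfolding unital_free_prod_def by (rule unital_U[OF unital_free_prod_one])

lemma star_hom_unital_free_prod_incl: "star_hom A (unital_free_prod A B) (%a. unital_free_prod_incl A B (Inl a))"
 "star_hom B (unital_free_prod A B) (%b. unital_free_prod_incl A B (Inr b))"
 unfolding unital_free_prod_def unital_free_prod_incl_def by (fact star_hom_coproduct_incl)+

lemma unital_free_prod_incl_unit: "unital_free_prod_incl A B (Inl (unit_of A)) = unit_of (unital_free_prod A B)"
 "unital_free_prod_incl A B (Inr (unit_of B)) = unit_of (unital_free_prod A B)"
 unfolding unital_free_prod_def unital_free_prod_incl_def gen_eq unit_U[OF unital_free_prod_one]
 by (rule eta_eq_if_R; auto simp: unital_free_prod_rels_def unital_free_prod_gens_def intro!: gen_in_free_unital)+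

lemma unital_free_prod_lift:
 assumes C: "unital_cstar C" and h: "star_hom A C h" "h (unit_of A) = unit_of C"
  and h': "star_hom B C h'" "h' (unit_of B) = unit_of C"
 shows "\<exists>phi. star_hom (unital_free_prod A B) C phi & phi (unit_of (unital_free_prod A B)) = unit_of C &
  (\<forall>a\<in>carrier A. phi (unital_free_prod_incl A B (Inl a)) = h a) &
  (\<forall>b\<in>carrier B. phi (unital_free_prod_incl A B (Inr b)) = h' b)"
proof -
 interpret C: unital_pre_cstar C by (rule unital_cstar_pre[OF C])
 have f: "!!g. g \<in> carrier A <+> carrier B ==> case_sum h h' g \<in>: C"
  using star_homD(1)[OF h(1)] star_homD(1)[OF h'(1)] by auto
 have "ev C (case_sum h h') (gen g - 1) = zer C" if "g \<in> carrier A <+> carrier B" "case_sum h h' g = unit_of C" for g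
  using that by (simp add: C.ev_simps[OF f] C.ev_gen'[OF f] C.ev_one'[OF f])
 then have T: "ev C (case_sum h h') r = zer C" if "r \<in> {gen (Inl (unit_of A)) - 1, gen (Inr (unit_of B)) - 1}" for r
  using that h(2) h'(2) by (auto simp: InlI InrI)
 show ?thesis
  unfolding unital_free_prod_def unital_free_prod_incl_def using coproduct_lift[OF C h(1) h'(1) T] unital_free_prod_one by blast
qed

lemma unital_free_prod_eq:
 assumes f: "star_hom (unital_free_prod A B) C f" and g: "star_hom (unital_free_prod A B) C g" and "cstar_algebra C"
  and l: "!!a. a \<in>: A ==> f (unital_free_prod_incl A B (Inl a)) = g (unital_free_prod_incl A B (Inl a))"
  and r: "!!b. b \<in>: B ==> f (unital_free_prod_incl A B (Inr b)) = g (unital_free_prod_incl A B (Inr b))"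
  and x: "x \<in>: unital_free_prod A B"
 shows "f x = g x"
proof (rule hom_eq[OF f[unfolded unital_free_prod_def] g[unfolded unital_free_prod_def] assms(3) _ _ x[unfolded unital_free_prod_def]])
 show "f (unit_of U) = g (unit_of U)"
  using l[OF A.unit_closed] by (simp add: unital_free_prod_incl_unit) (simp add: unital_free_prod_def)
 show "f (\<gamma> z) = g (\<gamma> z)" if "z \<in> carrier A <+> carrier B" for z
  using that l r by (auto simp: unital_free_prod_incl_def)
qed

end

lemma closed_subspace_Int: "closed_subspace A S ==> closed_subspace A T ==> closed_subspace A (S \<inter> T)"
 unfolding closed_subspace_def by (simp add: subset_iff) blast

lemma cstar_algebra_complex: "cstar_algebra complex_cstar"
proof (rule cstar_algebra.intro)
 show "comm_group (additive_group complex_cstar)"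
 proof (rule comm_groupI)
  fix x assume "x \<in>: additive_group complex_cstar"
  show "\<exists>y\<in>carrier (additive_group complex_cstar). y \<otimes>\<^bsub>additive_group complex_cstar\<^esub> x = \<one>\<^bsub>additive_group complex_cstar\<^esub>"
   by (rule bexI[of _ "- x"]) (simp_all add: complex_cstar_def)
 qed (simp_all add: complex_cstar_def)
 fix s assume s: "cauchy complex_cstar s"
 have "Cauchy s" using s unfolding Cauchy_def cauchy_def by (simp add: complex_cstar_def sub_def dist_norm)
 then obtain x where "s \<longlonglongrightarrow> x" using Cauchy_convergent_iff convergent_def by blast
 then have "conv_to complex_cstar s x"
  using tendsto_norm_zero_iff[of "%n. s n - x"] LIM_zero_iff[of s x] by (simp add: conv_to_def complex_cstar_def sub_def)
 then show "\<exists>x\<in>carrier complex_cstar. conv_to complex_cstar s x" by (auto simp: complex_cstar_def)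
qed (simp_all add: complex_cstar_def algebra_simps norm_mult norm_triangle_ineq power2_eq_square)

context
 fixes A :: "'a star_algebra"
 assumes A: "cstar_algebra A"
begin

abbreviation (input) "AC \<equiv> free_prod2 A complex_cstar"
abbreviation (input) "kA a \<equiv> free_prod2_incl A complex_cstar (Inl a)"
abbreviation (input) "kC c \<equiv> free_prod2_incl A complex_cstar (Inr c)"

definition unitization_rels where
 "unitization_rels = {sub AC (mul AC (kC 1) (kA a)) (kA a) |a. a \<in>: A} \<union> {sub AC (mul AC (kA a) (kC 1)) (kA a) |a. a \<in>: A}"

lemma unitization_ideal_eq: "unitization_ideal A = ideal_gen AC unitization_rels"
 by (simp add: unitization_ideal_def unitization_rels_def Let_def)

interpretation AC: cstar_algebra AC by (rule cstar_free_prod2[OF A cstar_algebra_complex])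

lemma free_prod2_complex_closed: "a \<in>: A ==> kA a \<in>: AC" "kC c \<in>: AC"
 using star_homD(1)[OF star_hom_free_prod2_incl(1)[OF A cstar_algebra_complex]]
  star_homD(1)[OF star_hom_free_prod2_incl(2)[OF A cstar_algebra_complex]] by (auto simp: complex_cstar_def)

lemma unitization_rels_closed: "unitization_rels <= carrier AC"
 by (auto simp: unitization_rels_def free_prod2_complex_closed AC.mul_closed)

interpretation I: cstar_ideal AC "unitization_ideal A"
 by unfold_locales (simp add: unitization_ideal_eq AC.closed_ideal_ideal_gen[OF unitization_rels_closed])

lemma cstar_unitization: "cstar_algebra (unitization A)" unfolding unitization_def by (rule I.cstar_algebra_Q)

lemma star_hom_unitization_incl: "star_hom A (unitization A) (unitization_incl A)"
 unfolding unitization_def unitization_incl_def [abs_def]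
 by (rule star_hom_comp[OF star_hom_free_prod2_incl(1)[OF A cstar_algebra_complex] I.star_hom_coset])

lemma kC_simps: "mul AC (kC c) (kC d) = kC (c * d)" "adj AC (kC c) = kC (cnj c)" "scl AC c (kC d) = kC (c * d)"
 using star_homD(3-5)[OF star_hom_free_prod2_incl(2)[OF A cstar_algebra_complex]] by (simp_all add: complex_cstar_def)

text \<open>The elements y for which 1 y - y and y 1 - y lie in the ideal, 1 being the unit of the
  second factor, form a closed subalgebra stable under adjoints: products are handled by writing 1
  (a b) - a b = (1 a - a) b. It contains \<open>A\<close> by the relations and the complex numbers
  trivially.\<close>

lemma is_unit_unitization: "is_unit_of (unitization A) (coset AC (unitization_ideal A) (kC 1))"
proof -
 let ?I = "unitization_ideal A" and ?u = "kC 1"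
 note [simp] = free_prod2_complex_closed AC.mul_closed AC.adj_closed AC.scl_closed
 have sub_I: "unitization_rels <= ?I" unfolding unitization_ideal_eq by (rule AC.ideal_gen_subset)
 have cl: "closed_subspace AC ?I" by (rule AC.closed_idealD(1)[OF I.I])
 define L where "L = {y \<in> carrier AC. sub AC (mul AC ?u y) y \<in> ?I} \<inter> {y \<in> carrier AC. sub AC (mul AC y ?u) y \<in> ?I}"
 have L: "y \<in> L" if y: "y \<in>: AC" for y
 proof (rule free_prod2_subalgebra[OF A cstar_algebra_complex _ _ _ _ _ y])
  show "closed_subspace AC L" unfolding L_def
  proof (rule closed_subspace_Int)
   show "closed_subspace AC {y \<in> carrier AC. sub AC (mul AC ?u y) y \<in> ?I}"
   proof (rule AC.closed_subspace_vimage[OF cl AC.pre.pre_cstar_axioms])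
    fix s x assume s: "!!n. s n \<in>: AC" "x \<in>: AC" "conv_to AC s x"
    show "conv_to AC (%n. sub AC (mul AC ?u (s n)) (s n)) (sub AC (mul AC ?u x) x)"
     by (rule AC.conv_to_sub[OF AC.conv_to_mul[OF AC.conv_to_const s(3)] s(3)]) (simp_all add: s(1,2))
   qed (simp_all add: AC.mul_add_right AC.sub_add_add AC.mul_scl_right AC.scl_sub)
   show "closed_subspace AC {y \<in> carrier AC. sub AC (mul AC y ?u) y \<in> ?I}"
   proof (rule AC.closed_subspace_vimage[OF cl AC.pre.pre_cstar_axioms])
    fix s x assume s: "!!n. s n \<in>: AC" "x \<in>: AC" "conv_to AC s x"
    show "conv_to AC (%n. sub AC (mul AC (s n) ?u) (s n)) (sub AC (mul AC x ?u) x)"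
     by (rule AC.conv_to_sub[OF AC.conv_to_mul[OF s(3) AC.conv_to_const] s(3)]) (simp_all add: s(1,2))
   qed (simp_all add: AC.mul_add_left AC.sub_add_add AC.mul_scl_left AC.scl_sub)
  qed
  show "mul AC a b \<in> L" if "a \<in> L" "b \<in> L" for a b
  proof -
   have ab: "a \<in>: AC" "b \<in>: AC" "sub AC (mul AC ?u a) a \<in> ?I" "sub AC (mul AC b ?u) b \<in> ?I"
    using that by (auto simp: L_def)
   have "sub AC (mul AC ?u (mul AC a b)) (mul AC a b) = mul AC (sub AC (mul AC ?u a) a) b"
    "sub AC (mul AC (mul AC a b) ?u) (mul AC a b) = mul AC a (sub AC (mul AC b ?u) b)"
    using ab by (simp_all add: AC.mul_sub_left AC.mul_sub_right AC.mul_assoc)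
   then show ?thesis using ab I.I unfolding L_def closed_ideal_def by simp
  qed
  show "adj AC a \<in> L" if "a \<in> L" for a
  proof -
   have a: "a \<in>: AC" "sub AC (mul AC ?u a) a \<in> ?I" "sub AC (mul AC a ?u) a \<in> ?I"
    using that by (auto simp: L_def)
   have "sub AC (mul AC ?u (adj AC a)) (adj AC a) = adj AC (sub AC (mul AC a ?u) a)"
    "sub AC (mul AC (adj AC a) ?u) (adj AC a) = adj AC (sub AC (mul AC ?u a) a)"
    using a by (simp_all add: AC.adj_sub AC.adj_mul kC_simps)
   then show ?thesis using a AC.closed_ideal_adj[OF I.I a(2)] AC.closed_ideal_adj[OF I.I a(3)] unfolding L_def by simp
  qed
  show "kA a \<in> L" if "a \<in>: A" for a using that sub_I unfolding L_def unitization_rels_def by auto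
  show "kC c \<in> L" if "c \<in>: complex_cstar" for c
   using AC.closed_subspaceD(3)[OF cl] unfolding L_def by (simp add: kC_simps)
 qed
 have "mul I.Q (I.cs ?u) (I.cs y) = I.cs y & mul I.Q (I.cs y) (I.cs ?u) = I.cs y" if y: "y \<in>: AC" for y
  using L[OF y] y by (simp add: I.mul_Q I.coset_eq_iff L_def)
 then show ?thesis unfolding unitization_def is_unit_of_def by (auto simp: I.carrier_Q)
qed

lemma unital_unitization: "unital_cstar (unitization A)"
 using cstar_unitization is_unit_unitization by (auto simp: unital_cstar_def)

lemma unit_unitization: "unit_of (unitization A) = coset AC (unitization_ideal A) (kC 1)"
 by (rule pre_cstar.unit_ofI[OF cstar_algebra_pre[OF cstar_unitization] is_unit_unitization])

lemma unitization_lift: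
 assumes B: "unital_cstar B" and h: "star_hom A B h"
 shows "\<exists>phi. star_hom (unitization A) B phi & phi (unit_of (unitization A)) = unit_of B &
  (\<forall>a\<in>carrier A. phi (unitization_incl A a) = h a)"
proof -
 interpret B: unital_pre_cstar B by (rule unital_cstar_pre[OF B])
 have hc: "star_hom complex_cstar B (%c. scl B c (unit_of B))" by (rule star_homI)
   (simp_all add: complex_cstar_def B.scl_closed B.scl_add_left B.scl_scl B.mul_scl_left B.mul_scl_right B.adj_scl mult.commute)
 obtain phi where phi: "star_hom AC B phi" "!!a. a \<in>: A ==> phi (kA a) = h a" "!!c. phi (kC c) = scl B c (unit_of B)"
  using free_prod2_lift[OF A cstar_algebra_complex B h hc] by (auto simp: complex_cstar_def)
 note phiD = star_homD[OF phi(1)]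
 have ker: "phi x = zer B" if "x \<in> unitization_rels" for x
  using that star_homD(1)[OF h] unfolding unitization_rels_def
  by (auto simp: star_hom_sub[OF phi(1)] AC.pre.pre_cstar_axioms free_prod2_complex_closed AC.mul_closed phiD phi(2,3) B.scl_one)
 note lift = star_hom_ideal_gen_lift[OF phi(1) AC.cstar_algebra_axioms unital_cstarD[OF B] unitization_rels_closed ker,
   folded unitization_ideal_eq]
 show ?thesis using lift free_prod2_complex_closed by (intro exI[of _ "quotient_lift phi"])
   (simp add: unit_unitization unitization_incl_def phi(2,3) B.scl_one, simp add: unitization_def)
qed

lemma unitization_eq:
 assumes f: "star_hom (unitization A) B f" and g: "star_hom (unitization A) B g" and B: "cstar_algebra B"
  and eq: "!!a. a \<in>: A ==> f (unitization_incl A a) = g (unitization_incl A a)"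
  and unit: "f (unit_of (unitization A)) = g (unit_of (unitization A))" and x: "x \<in>: unitization A"
 shows "f x = g x"
proof -
 obtain y where y: "y \<in>: AC" "x = I.cs y" using x by (auto simp: unitization_def elim: I.Q_cases)
 note hom = f[unfolded unitization_def] g[unfolded unitization_def]
 have "f (I.cs y) = g (I.cs y)"
 proof (rule free_prod2_eq[OF A cstar_algebra_complex star_hom_comp[OF I.star_hom_coset hom(1)]
    star_hom_comp[OF I.star_hom_coset hom(2)] B _ _ y(1)])
  show "f (I.cs (kA a)) = g (I.cs (kA a))" if "a \<in>: A" for a using eq[OF that] by (simp add: unitization_incl_def)
  have c: "I.cs (kC c) = scl I.Q c (I.cs (kC 1))" for c by (simp add: I.scl_Q free_prod2_complex_closed kC_simps)
  show "f (I.cs (kC c)) = g (I.cs (kC c))" for c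
  proof -
   have "f (scl I.Q c (I.cs (kC 1))) = g (scl I.Q c (I.cs (kC 1)))" using unit unfolding unit_unitization
    by (simp add: star_homD(3)[OF hom(1)] star_homD(3)[OF hom(2)] free_prod2_complex_closed)
   then show ?thesis by (simp only: c[symmetric])
  qed
 qed
 then show ?thesis by (simp add: y)
qed

end

section \<open>Universal property of the component algebra\<close>

section \<open>The algebra of the components\<close>

lemma magic_matrix_hom:
 assumes u: "magic_matrix I J A u" and f: "star_hom A B f" "f (unit_of A) = unit_of B" and A: "pre_cstar A" and B: "pre_cstar B"
 shows "magic_matrix I J B (%i j. f (u i j))"
proof -
 note uD = magic_matrixD[OF u] and fD = star_homD[OF f(1)]
 have "mul B (f (u i j)) (f (u i j)) = f (u i j)" "adj B (f (u i j)) = f (u i j)" if "i \<in> I" "j \<in> J" for i j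
  using fD(4)[of "u i j" "u i j"] fD(5)[of "u i j"] uD that by simp_all
 moreover have "asum B (%j. f (u i j)) J = unit_of B" if "i \<in> I" for i
  using star_hom_asum[OF f(1) A B, of J "%j. u i j"] uD(1,4) that f(2) by simp
 moreover have "asum B (%i. f (u i j)) I = unit_of B" if "j \<in> J" for j
  using star_hom_asum[OF f(1) A B, of I "%i. u i j"] uD(1,5) that f(2) by simp
 ultimately show ?thesis unfolding magic_matrix_def using fD(1) uD(1) by simp
qed

context
 fixes n :: nat and X :: "nat => 'v pair_pre_digraph"
begin

definition component_hom where
 "component_hom i j a = coset (amalgam n X) (component_ideal n X) (amalgam_QIso n X i j a)"

abbreviation (input) "FP \<equiv> QIso_free_prod n X"
abbreviation (input) "MA \<equiv> amalgam n X"
abbreviation (input) "CA \<equiv> component_algebra n X"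

lemma cstar_QIso_family: "k \<in> {1..n} \<times> {1..n} ==> cstar_algebra (QIso_family X k)"
 by (auto simp: QIso_family_def unital_cstarD[OF unital_QIso])

lemma cstar_QIso_free_prod: "cstar_algebra FP"
 unfolding QIso_free_prod_def by (rule cstar_free_prod[OF cstar_QIso_family])

lemma star_hom_QIso_free_prod_incl:
 "i \<in> {1..n} ==> j \<in> {1..n} ==> star_hom (QIso (X i) (X j)) FP (QIso_free_prod_incl n X i j)"
 using star_hom_free_prod_incl[of "{1..n} \<times> {1..n}" "QIso_family X" "(i, j)"] cstar_QIso_family
 by (simp add: QIso_free_prod_def QIso_free_prod_incl_def QIso_family_def)

lemma unital_unitization_FP: "unital_cstar (unitization FP)" by (rule unital_unitization[OF cstar_QIso_free_prod])

lemma unital_amalgam: "unital_cstar MA"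
 unfolding amalgam_def by (rule unital_unital_free_prod[OF unital_unitization_FP unital_Sn_plus])

interpretation MA: cstar_algebra MA by (rule unital_cstarD[OF unital_amalgam])

lemma star_hom_amalgam_QIso:
 assumes "i \<in> {1..n}" "j \<in> {1..n}"
 shows "star_hom (QIso (X i) (X j)) MA (amalgam_QIso n X i j)" unfolding amalgam_def amalgam_QIso_def [abs_def]
 by (rule star_hom_comp[OF star_hom_QIso_free_prod_incl[OF assms] star_hom_comp[OF star_hom_unitization_incl[OF cstar_QIso_free_prod]
    star_hom_unital_free_prod_incl(1)[OF unital_unitization_FP unital_Sn_plus]]])

lemma magic_amalgam_Sn: "magic_unitary {1..n} MA (amalgam_Sn n X)"
 unfolding amalgam_def amalgam_Sn_def [abs_def] magic_unitary_iff
 by (rule magic_matrix_hom[OF magic_Sn_plus[unfolded magic_unitary_iff] star_hom_unital_free_prod_incl(2)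
    unital_free_prod_incl_unit(2)])
  (use unital_unitization_FP unital_Sn_plus unital_amalgam in "auto intro!: cstar_algebra_pre unital_cstarD simp: amalgam_def")

definition component_rels where
 "component_rels = {sub MA (amalgam_Sn n X i j) (amalgam_QIso n X i j (unit_of (QIso (X i) (X j)))) |i j. i \<in> {1..n} & j \<in> {1..n}}"

lemma component_ideal_eq: "component_ideal n X = ideal_gen MA component_rels"
 by (simp add: component_ideal_def component_rels_def)

lemma unit_QIso: "unit_of (QIso Y Z) \<in>: QIso Y Z"
 using unital_pre_cstar.unit_closed[OF unital_cstar_pre[OF unital_QIso]] .

lemma component_rels_closed: "component_rels <= carrier MA" unfolding component_rels_def
 using magic_unitaryD(1)[OF magic_amalgam_Sn] star_homD(1)[OF star_hom_amalgam_QIso unit_QIso] by auto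

interpretation I: cstar_ideal MA "component_ideal n X"
 by unfold_locales (simp add: component_ideal_eq MA.closed_ideal_ideal_gen[OF component_rels_closed])

lemma unital_component_algebra: "unital_cstar CA"
proof -
 interpret MU: unital_pre_cstar MA by (rule unital_cstar_pre[OF unital_amalgam])
 show ?thesis
  unfolding component_algebra_def unital_cstar_def using I.cstar_algebra_Q I.is_unit_coset[OF MU.unit] by blast
qed

lemma unit_component_algebra: "unit_of CA = coset MA (component_ideal n X) (unit_of MA)"
proof -
 interpret MU: unital_pre_cstar MA by (rule unital_cstar_pre[OF unital_amalgam])
 interpret CA: cstar_algebra CA by (rule unital_cstarD[OF unital_component_algebra])
 show ?thesis by (rule CA.unit_ofI) (use I.is_unit_coset[OF MU.unit] in "simp add: component_algebra_def")
qed

lemma star_hom_component_hom: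
 "i \<in> {1..n} ==> j \<in> {1..n} ==> star_hom (QIso (X i) (X j)) CA (component_hom i j)"
 unfolding component_algebra_def component_hom_def [abs_def]
 by (rule star_hom_comp[OF star_hom_amalgam_QIso I.star_hom_coset])

lemma component_hom_unit:
 assumes ij: "i \<in> {1..n}" "j \<in> {1..n}"
 shows "component_hom i j (unit_of (QIso (X i) (X j))) = coset MA (component_ideal n X) (amalgam_Sn n X i j)"
proof -
 have "sub MA (amalgam_Sn n X i j) (amalgam_QIso n X i j (unit_of (QIso (X i) (X j)))) \<in> component_ideal n X"
  unfolding component_ideal_eq by (rule subsetD[OF MA.ideal_gen_subset]) (use ij in "auto simp: component_rels_def")
 then show ?thesis unfolding component_hom_def
  using I.coset_eq_iff[OF magic_unitaryD(1)[OF magic_amalgam_Sn ij] star_homD(1)[OF star_hom_amalgam_QIso[OF ij] unit_QIso]]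
  by simp
qed

lemma magic_component_hom_unit:
 "magic_unitary {1..n} CA (%i j. component_hom i j (unit_of (QIso (X i) (X j))))"
proof -
 have "magic_matrix {1..n} {1..n} CA (%i j. coset MA (component_ideal n X) (amalgam_Sn n X i j))"
  by (rule magic_matrix_hom[OF magic_amalgam_Sn[unfolded magic_unitary_iff]])
   (use I.star_hom_coset unit_component_algebra MA.pre.pre_cstar_axioms I.pre_cstar_Q in "simp_all add: component_algebra_def")
 then have m: "magic_matrix {1..n} {1..n} CA (%i j. coset MA (component_ideal n X) (amalgam_Sn n X i j))" .
 interpret CA: cstar_algebra CA by (rule unital_cstarD[OF unital_component_algebra])
 have "asum CA (%j. component_hom i j (unit_of (QIso (X i) (X j)))) {1..n} = unit_of CA" if i: "i \<in> {1..n}" for i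
  unfolding magic_matrixD(4)[OF m i, symmetric]
  by (rule CA.asum_cong[OF refl]) (use i magic_matrixD(1)[OF m] in "simp_all add: component_hom_unit")
 moreover have "asum CA (%i. component_hom i j (unit_of (QIso (X i) (X j)))) {1..n} = unit_of CA" if j: "j \<in> {1..n}" for j
  unfolding magic_matrixD(5)[OF m j, symmetric]
  by (rule CA.asum_cong[OF refl]) (use j magic_matrixD(1)[OF m] in "simp_all add: component_hom_unit")
 ultimately show ?thesis unfolding magic_unitary_def using magic_matrixD(1-3)[OF m] by (simp add: component_hom_unit)
qed

text \<open>The maps \<open>h i j\<close> are combined through the free product, the unitization and
  the unital free product. Their values at the units form a magic unitary, which supplies the map on
  S_n^+; the elements u_ij - 1_{ij} are then sent to 0, so the map descends to the quotient.\<close>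

lemma component_algebra_lift:
 assumes C: "unital_cstar C" and h: "!!i j. i \<in> {1..n} ==> j \<in> {1..n} ==> star_hom (QIso (X i) (X j)) C (h i j)"
  and m: "magic_unitary {1..n} C (%i j. h i j (unit_of (QIso (X i) (X j))))"
 shows "\<exists>psi. star_hom CA C psi & psi (unit_of CA) = unit_of C &
  (\<forall>i\<in>{1..n}. \<forall>j\<in>{1..n}. \<forall>a\<in>carrier (QIso (X i) (X j)). psi (component_hom i j a) = h i j a)"
proof -
 have Cc: "cstar_algebra C" by (rule unital_cstarD[OF C])
 interpret C: cstar_algebra C by (rule Cc)
 have "\<exists>phi. star_hom FP C phi & (\<forall>k\<in>{1..n} \<times> {1..n}. \<forall>a\<in>carrier (QIso_family X k).
   phi (free_prod_incl ({1..n} \<times> {1..n}) (QIso_family X) k a) = (case k of (i, j) => h i j) a)"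
  unfolding QIso_free_prod_def by (rule free_prod_lift[OF cstar_QIso_family C]) (auto simp: QIso_family_def h)
 then obtain phi where phi: "star_hom FP C phi"
  "!!i j a. i \<in> {1..n} ==> j \<in> {1..n} ==> a \<in>: (QIso (X i) (X j)) ==> phi (QIso_free_prod_incl n X i j a) = h i j a"
  by (force simp: QIso_free_prod_incl_def QIso_family_def)
 obtain phi' where phi': "star_hom (unitization FP) C phi'" "phi' (unit_of (unitization FP)) = unit_of C"
  "!!a. a \<in>: FP ==> phi' (unitization_incl FP a) = phi a"
  using unitization_lift[OF cstar_QIso_free_prod C phi(1)] by blast
 obtain rho where rho: "star_hom (Sn_plus n) C rho" "rho (unit_of (Sn_plus n)) = unit_of C"
  "!!i j. i \<in> {1..n} ==> j \<in> {1..n} ==> rho (Sn_plus_gen n i j) = h i j (unit_of (QIso (X i) (X j)))"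
  using Sn_plus_lift[OF C m] by blast
 obtain theta where theta: "star_hom MA C theta" "theta (unit_of MA) = unit_of C"
  "!!a. a \<in>: unitization FP ==> theta (unital_free_prod_incl (unitization FP) (Sn_plus n) (Inl a)) = phi' a"
  "!!b. b \<in>: Sn_plus n ==> theta (unital_free_prod_incl (unitization FP) (Sn_plus n) (Inr b)) = rho b"
  using unital_free_prod_lift[OF unital_unitization_FP unital_Sn_plus C phi'(1,2) rho(1,2)] unfolding amalgam_def by blast
 have thetaQ: "theta (amalgam_QIso n X i j a) = h i j a" if "i \<in> {1..n}" "j \<in> {1..n}" "a \<in>: (QIso (X i) (X j))" for i j a
  unfolding amalgam_QIso_def using that star_homD(1)[OF star_hom_QIso_free_prod_incl]
   star_homD(1)[OF star_hom_unitization_incl[OF cstar_QIso_free_prod]] by (simp add: theta(3) phi'(3) phi(2))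
 have thetaS: "theta (amalgam_Sn n X i j) = h i j (unit_of (QIso (X i) (X j)))" if "i \<in> {1..n}" "j \<in> {1..n}" for i j
  unfolding amalgam_Sn_def using that magic_unitaryD(1)[OF magic_Sn_plus] by (simp add: theta(4) rho(3))
 have ker: "theta x = zer C" if "x \<in> component_rels" for x
 proof -
  obtain i j where ij: "i \<in> {1..n}" "j \<in> {1..n}"
   and x: "x = sub MA (amalgam_Sn n X i j) (amalgam_QIso n X i j (unit_of (QIso (X i) (X j))))"
   using \<open>x \<in> component_rels\<close> unfolding component_rels_def by blast
  show ?thesis unfolding x star_hom_sub[OF theta(1) MA.pre.pre_cstar_axioms magic_unitaryD(1)[OF magic_amalgam_Sn ij]
     star_homD(1)[OF star_hom_amalgam_QIso[OF ij] unit_QIso]] thetaS[OF ij] thetaQ[OF ij unit_QIso]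
   by (rule C.sub_self[OF star_homD(1)[OF h[OF ij] unit_QIso]])
 qed
 note lift = star_hom_ideal_gen_lift[OF theta(1) MA.cstar_algebra_axioms Cc component_rels_closed ker,
   folded component_ideal_eq]
 interpret MU: unital_pre_cstar MA by (rule unital_cstar_pre[OF unital_amalgam])
 have 1: "star_hom CA C (quotient_lift theta)" unfolding component_algebra_def by (rule lift(1))
 have 2: "quotient_lift theta (unit_of CA) = unit_of C"
  unfolding unit_component_algebra using lift(2)[OF _ MU.unit_closed] theta(2) by simp
 have 3: "quotient_lift theta (component_hom i j a) = h i j a"
  if "i \<in> {1..n}" "j \<in> {1..n}" "a \<in>: (QIso (X i) (X j))" for i j a
  unfolding component_hom_def using lift(2)[OF _ star_homD(1)[OF star_hom_amalgam_QIso[OF that(1,2)] that(3)]] thetaQ[OF that] by simp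
 show ?thesis using 1 2 3 by blast
qed

text \<open>Agreement at the entries of the blocks is enough because a block has a row: its sum is
  the unit of QIso(X_i, X_j), so the maps agree at these units, and by the defining relations at the
  generators of S_n^+.\<close>

lemma component_algebra_eq:
 assumes f: "star_hom CA C f" and g: "star_hom CA C g" and C: "cstar_algebra C"
  and unit: "f (unit_of CA) = g (unit_of CA)"
  and gens: "!!i j p q. i \<in> {1..n} ==> j \<in> {1..n} ==> p \<in> pverts (X i) ==> q \<in> pverts (X j) ==>
   f (component_hom i j (QIso_gen (X i) (X j) p q)) = g (component_hom i j (QIso_gen (X i) (X j) p q))"
  and nonempty: "!!i. i \<in> {1..n} ==> pverts (X i) ~= {}"
  and x: "x \<in>: CA"
 shows "f x = g x"
proof -
 interpret C: cstar_algebra C by fact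
 have Q: "f (component_hom i j a) = g (component_hom i j a)"
  if ij: "i \<in> {1..n}" "j \<in> {1..n}" and a: "a \<in>: (QIso (X i) (X j))" for i j a
 proof (rule star_hom_generates_eq[OF generates_QIso _ unital_QIso C star_hom_comp[OF star_hom_component_hom[OF ij] f]
    star_hom_comp[OF star_hom_component_hom[OF ij] g] _ _ a])
  let ?Q = "QIso (X i) (X j)" and ?v = "QIso_gen (X i) (X j)"
  note vD = magic_matrixD[OF magic_QIso[of "X i" "X j"]]
  show "{?v p q |p q. p \<in> pverts (X i) & q \<in> pverts (X j)} <= carrier ?Q" using vD(1) by blast
  show "f (component_hom i j y) = g (component_hom i j y)" if "y \<in> {?v p q |p q. p \<in> pverts (X i) & q \<in> pverts (X j)}" for y
   using that gens[OF ij] by blast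
  obtain p where p: "p \<in> pverts (X i)" using nonempty[OF ij(1)] by blast
  have pre: "pre_cstar ?Q" by (rule cstar_algebra_pre[OF unital_cstarD[OF unital_QIso]])
  have "f (component_hom i j (unit_of ?Q)) = asum C (%q. f (component_hom i j (?v p q))) (pverts (X j))"
   unfolding vD(4)[OF p, symmetric]
   by (rule star_hom_asum[OF star_hom_comp[OF star_hom_component_hom[OF ij] f] pre C.pre.pre_cstar_axioms vD(1)[OF p]])
  also have "... = asum C (%q. g (component_hom i j (?v p q))) (pverts (X j))" by (rule C.asum_cong[OF refl])
    (use p gens[OF ij] vD(1) star_homD(1)[OF star_hom_comp[OF star_hom_component_hom[OF ij] g]] in simp_all)
  also have "... = g (component_hom i j (unit_of ?Q))" unfolding vD(4)[OF p, symmetric]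
   by (rule star_hom_asum[OF star_hom_comp[OF star_hom_component_hom[OF ij] g] pre C.pre.pre_cstar_axioms vD(1)[OF p], symmetric])
  finally show "f (component_hom i j (unit_of ?Q)) = g (component_hom i j (unit_of ?Q))" .
 qed
 let ?cs = "coset MA (component_ideal n X)"
 have fM: "star_hom MA C (%y. f (?cs y))" and gM: "star_hom MA C (%y. g (?cs y))"
  by (rule star_hom_comp[OF I.star_hom_coset]; use f g in "simp add: component_algebra_def")+
 have unitM: "f (?cs (unit_of MA)) = g (?cs (unit_of MA))" using unit unfolding unit_component_algebra .
 let ?T = "unitization FP"
 let ?l = "%a. unital_free_prod_incl ?T (Sn_plus n) (Inl a)" and ?r = "%a. unital_free_prod_incl ?T (Sn_plus n) (Inr a)"
 have l: "star_hom ?T MA ?l" and r: "star_hom (Sn_plus n) MA ?r" and lu: "?l (unit_of ?T) = unit_of MA"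
  and ru: "?r (unit_of (Sn_plus n)) = unit_of MA" unfolding amalgam_def
  by (rule star_hom_unital_free_prod_incl[OF unital_unitization_FP unital_Sn_plus]
    unital_free_prod_incl_unit[OF unital_unitization_FP unital_Sn_plus])+
 note k = star_hom_unitization_incl[OF cstar_QIso_free_prod]
 have F: "f (?cs (?l (unitization_incl FP a))) = g (?cs (?l (unitization_incl FP a)))" if a: "a \<in>: FP" for a
 proof (rule free_prod_eq[OF cstar_QIso_family _ _ C _ a[unfolded QIso_free_prod_def]])
  show "star_hom (free_prod ({1..n} \<times> {1..n}) (QIso_family X)) C (%a. f (?cs (?l (unitization_incl FP a))))"
   "star_hom (free_prod ({1..n} \<times> {1..n}) (QIso_family X)) C (%a. g (?cs (?l (unitization_incl FP a))))"
   unfolding QIso_free_prod_def[symmetric]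
   by (rule star_hom_comp[OF star_hom_comp[OF k l] fM], rule star_hom_comp[OF star_hom_comp[OF k l] gM])
  fix ij and a :: "('v \<times> 'v) univ"
  assume "ij \<in> {1..n} \<times> {1..n}" "a \<in>: QIso_family X ij"
  then obtain i j where "ij = (i, j)" "i \<in> {1..n}" "j \<in> {1..n}" "a \<in>: (QIso (X i) (X j))"
   by (auto simp: QIso_family_def)
  then show "f (?cs (?l (unitization_incl FP (free_prod_incl ({1..n} \<times> {1..n}) (QIso_family X) ij a)))) =
    g (?cs (?l (unitization_incl FP (free_prod_incl ({1..n} \<times> {1..n}) (QIso_family X) ij a))))"
   using Q unfolding component_hom_def amalgam_QIso_def QIso_free_prod_incl_def by simp
 qed
 have L: "f (?cs (?l a)) = g (?cs (?l a))" if a: "a \<in>: ?T" for a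
  by (rule unitization_eq[OF cstar_QIso_free_prod star_hom_comp[OF l fM] star_hom_comp[OF l gM] C F _ a])
   (simp_all add: lu unitM)
 have R: "f (?cs (?r b)) = g (?cs (?r b))" if b: "b \<in>: Sn_plus n" for b
 proof (rule star_hom_generates_eq[OF generates_Sn_plus _ unital_Sn_plus C star_hom_comp[OF r fM] star_hom_comp[OF r gM] _ _ b])
  show "{Sn_plus_gen n i j |i j. i \<in> {1..n} & j \<in> {1..n}} <= carrier (Sn_plus n)"
   using magic_unitaryD(1)[OF magic_Sn_plus] by blast
  fix y assume "y \<in> {Sn_plus_gen n i j |i j. i \<in> {1..n} & j \<in> {1..n}}"
  then obtain i j where y: "y = Sn_plus_gen n i j" and ij: "i \<in> {1..n}" "j \<in> {1..n}" by blast
  show "f (?cs (?r y)) = g (?cs (?r y))" using Q[OF ij unit_QIso] unfolding component_hom_unit[OF ij] y amalgam_Sn_def .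
 qed (simp_all add: ru unitM)
 obtain y where y: "y \<in>: MA" "x = ?cs y" using x by (auto simp: component_algebra_def elim: I.Q_cases)
 have M: "star_hom (unital_free_prod ?T (Sn_plus n)) C (%y. f (?cs y))"
  "star_hom (unital_free_prod ?T (Sn_plus n)) C (%y. g (?cs y))" "y \<in>: (unital_free_prod ?T (Sn_plus n))"
  unfolding amalgam_def[symmetric] by (rule fM, rule gM, rule y(1))
 have "f (?cs y) = g (?cs y)" by (rule unital_free_prod_eq[OF unital_unitization_FP unital_Sn_plus M(1,2) C L R M(3)])
 then show ?thesis by (simp add: y)
qed

end

subsection \<open>Corners\<close>

text \<open>The algebra p A p. Only the carrier changes, so operations and norm are inherited
  literally.\<close>

definition corner :: "'a star_algebra => 'a => 'a star_algebra" where
 "corner A p = A\<lparr>carrier := {x \<in> carrier A. mul A p x = x & mul A x p = x}\<rparr>"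

lemma corner_simps [simp]:
 "zer (corner A p) = zer A" "add (corner A p) = add A" "scl (corner A p) = scl A" "mul (corner A p) = mul A"
 "adj (corner A p) = adj A" "nrm (corner A p) = nrm A" "sub (corner A p) x y = sub A x y"
 by (simp_all add: corner_def sub_def)

lemma carrier_corner: "carrier (corner A p) = {x \<in> carrier A. mul A p x = x & mul A x p = x}"
 by (simp add: corner_def)

context cstar_algebra
begin

text \<open>A unital homomorphism into the corner is a homomorphism into \<open>A\<close> that sends
  the unit to p. This is how the unital universal property of QIso produces maps whose unit is a
  proper projection.\<close>

lemma corner:
 assumes p: "p \<in>: A" "mul A p p = p" "adj A p = p"
 shows "unital_cstar (corner A p)" "unit_of (corner A p) = p" "star_hom (corner A p) A (%x. x)"
proof -
 let ?B = "corner A p"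
 have c: "x \<in>: ?B \<longleftrightarrow> x \<in>: A & mul A p x = x & mul A x p = x" for x by (simp add: carrier_corner)
 have mc: "mul A x y \<in>: ?B" if "x \<in>: ?B" "y \<in>: ?B" for x y
  using that p unfolding c by (metis mul_assoc mul_closed)
 have ac: "adj A x \<in>: ?B" if "x \<in>: ?B" for x using that p unfolding c by (metis adj_mul adj_closed)
 have sc: "scl A d x \<in>: ?B" if "x \<in>: ?B" for d x
  using that p unfolding c by (simp add: scl_closed mul_scl_left mul_scl_right)
 have addc: "add A x y \<in>: ?B" if "x \<in>: ?B" "y \<in>: ?B" for x y
  using that p unfolding c by (simp add: mul_add_left mul_add_right)
 have zc: "zer A \<in>: ?B" using p unfolding c by simp
 have sub: "x \<in>: A" if "x \<in>: ?B" for x using that unfolding c by simp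
 have grp: "comm_group (additive_group ?B)"
 proof (rule comm_groupI)
  fix x assume "x \<in>: (additive_group ?B)"
  then have x: "x \<in>: ?B" by simp
  show "\<exists>y\<in>carrier (additive_group ?B). y \<otimes>\<^bsub>additive_group ?B\<^esub> x = \<one>\<^bsub>additive_group ?B\<^esub>"
   by (rule bexI[of _ "scl A (-1) x"]) (use x sub sc in "simp_all add: add_commute scl_closed")
 qed (simp_all add: addc zc sub add_ac)
 have cs: "cstar_algebra ?B"
 proof (rule cstar_algebra.intro[OF grp])
  fix s assume s: "cauchy ?B s"
  then have sB: "s n \<in>: ?B" for n by (simp add: cauchy_def)
  have "cauchy A s" using s sub unfolding cauchy_def by simp
  then obtain x where x: "x \<in>: A" "conv_to A s x" by (rule cauchy_limit)
  have sA: "s n \<in>: A" "mul A p (s n) = s n" "mul A (s n) p = s n" for n using sB[of n] unfolding c by auto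
  have "conv_to A (%n. mul A p (s n)) (mul A p x)"
   by (rule conv_to_mul[OF conv_to_const[OF p(1)] x(2)]) (simp_all add: p sA x)
  then have 1: "mul A p x = x" using conv_to_unique[OF _ x(2) sA(1) _ x(1), of "mul A p x"] by (simp add: sA p x)
  have "conv_to A (%n. mul A (s n) p) (mul A x p)"
   by (rule conv_to_mul[OF x(2) conv_to_const[OF p(1)]]) (simp_all add: p sA x)
  then have 2: "mul A x p = x" using conv_to_unique[OF _ x(2) sA(1) _ x(1), of "mul A x p"] by (simp add: sA p x)
  show "\<exists>x\<in>carrier ?B. conv_to ?B s x" using x 1 2 by (intro bexI[of _ x]) (simp_all add: conv_to_def c)
 qed (simp_all add: sub mc ac sc addc scl_add_right scl_add_left scl_scl scl_one mul_assoc mul_add_left mul_add_right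
   mul_scl_left mul_scl_right adj_adj adj_add adj_scl adj_mul nrm_nonneg nrm_eq_0 nrm_add nrm_scl nrm_mul nrm_cstar)
 have u: "is_unit_of ?B p" unfolding is_unit_of_def using p by (simp add: c)
 show "unital_cstar ?B" unfolding unital_cstar_def using cs u by blast
 show "unit_of ?B = p" by (rule pre_cstar.unit_ofI[OF cstar_algebra_pre[OF cs] u])
 show "star_hom ?B A (%x. x)" by (rule star_homI) (simp_all add: sub)
qed

end

section \<open>From an intertwining magic unitary on a disjoint union to its blocks, and
  back\<close>

subsection \<open>Magic unitaries on disjoint unions\<close>

lemma constant_on_connected:
 assumes "Digraph_Component.connected (with_proj X)" "p \<in> pverts X" "p' \<in> pverts X"
  and edge: "!!x y. (x, y) \<in> parcs X ==> f x = f y"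
 shows "f p = f p'"
proof -
 have "(p, p') \<in> rtrancl_on (pverts X) (parcs (mk_symmetric (with_proj X)))"
  using assms(1-3) unfolding connected_def strongly_connected_def reachable_def by simp
 then show ?thesis
 proof (induction rule: rtrancl_on_induct)
  case (step y z)
  have "(y, z) \<in> parcs X \<or> (z, y) \<in> parcs X" using step(2) by (auto simp: parcs_mk_symmetric)
  then show ?case using edge step by metis
 qed simp
qed

text \<open>Write F_k and G_k for the block sums, both adding up to the unit, with F_i G_k = 0 for
  different blocks. Then F_j = F_j (sum of all G_k) = F_j G_j = (sum of all F_k) G_j = G_j.\<close>

lemma (in cstar_algebra) block_sums_eq:
 assumes unit: "is_unit_of A e" and N: "finite N" and V: "!!j. j \<in> N ==> finite (V j)"
  and f: "!!j q. j \<in> N ==> q \<in> V j ==> f (j, q) \<in>: A" "asum A f (SIGMA j:N. V j) = e"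
  and g: "!!j q. j \<in> N ==> q \<in> V j ==> g (j, q) \<in>: A" "asum A g (SIGMA j:N. V j) = e"
  and orth: "!!j k q r. j \<in> N ==> k \<in> N ==> j ~= k ==> q \<in> V j ==> r \<in> V k ==> mul A (f (j, q)) (g (k, r)) = zer A"
  and j: "j \<in> N"
 shows "asum A (%q. f (j, q)) (V j) = asum A (%q. g (j, q)) (V j)"
proof -
 let ?F = "%j. asum A (%q. f (j, q)) (V j)" and ?G = "%j. asum A (%q. g (j, q)) (V j)"
 have c: "?F k \<in>: A" "?G k \<in>: A" if "k \<in> N" for k using that f g by auto
 have e: "mul A e x = x" "mul A x e = x" if "x \<in>: A" for x using unit that by (auto simp: is_unit_of_def)
 have FG: "mul A (?F i) (?G k) = zer A" if ik: "i \<in> N" "k \<in> N" "i ~= k" for i k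
 proof -
  have "mul A (?F i) (?G k) = asum A (%q. mul A (f (i, q)) (?G k)) (V i)" by (rule asum_mul_right) (use ik f c in auto)
  also have "... = zer A"
  proof (rule asum_neutral)
   fix q assume q: "q \<in> V i"
   have "mul A (f (i, q)) (?G k) = asum A (%r. mul A (f (i, q)) (g (k, r))) (V k)"
    by (rule asum_mul_left) (use ik f g q in auto)
   also have "... = zer A" by (rule asum_neutral) (rule orth[OF ik q])
   finally show "mul A (f (i, q)) (?G k) = zer A" .
  qed
  finally show ?thesis .
 qed
 have "?F j = mul A (?F j) (asum A ?G N)" using asum_Sigma[where f = g, OF N V] g e(2)[OF c(1)[OF j]] by simp
 also have "... = asum A (%k. mul A (?F j) (?G k)) N" by (rule asum_mul_left) (use c j in auto)
 also have "... = mul A (?F j) (?G j)" by (rule asum_single) (use N j c FG mul_closed in auto)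
 also have "... = asum A (%k. mul A (?F k) (?G j)) N" by (rule asum_single[symmetric]) (use N j c FG mul_closed in auto)
 also have "... = mul A (asum A ?F N) (?G j)" by (rule asum_mul_right[symmetric]) (use c j in auto)
 also have "... = ?G j" using asum_Sigma[where f = f, OF N V] f e(1)[OF c(2)[OF j]] by simp
 finally show ?thesis .
qed

text \<open>Let s be the entry at (x, y') of the two equal products of w with the adjacency matrix.
  In the expression w_xy s w_x'y', row orthogonality turns s into the coefficient for y, y', and
  column orthogonality turns it into the coefficient for x, x'. If these differ, the product of the
  two entries is 0.\<close>

lemma intertwines_mismatch:
 assumes A: "unital_cstar A" and w: "magic_unitary (pverts X) A w" and fin: "finite (pverts X)"
  and int: "intertwines X A w" and m: "arc_mismatch X X x x' y y'"
 shows "mul A (w x y) (w x' y') = zer A"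
proof -
 interpret cstar_algebra A by (rule unital_cstarD[OF A])
 let ?V = "pverts X"
 have wm: "magic_matrix ?V ?V A w" using w by (simp add: magic_unitary_iff)
 note wD = magic_matrixD[OF wm] and orth = magic_matrix_orthogonal[OF A wm]
 have v: "x \<in> ?V" "x' \<in> ?V" "y \<in> ?V" "y' \<in> ?V" using m by (auto simp: arc_mismatch_def)
 let ?s = "asum A (%z. scl A (adjacency X x z) (w z y')) ?V"
 have s: "?s = asum A (%z. scl A (adjacency X z y') (w x z)) ?V" using int v unfolding intertwines_def by blast
 have "mul A (w x y) ?s = asum A (%z. mul A (w x y) (scl A (adjacency X z y') (w x z))) ?V"
  unfolding s by (rule asum_mul_left) (use wD v in "auto simp: scl_closed")
 also have "... = mul A (w x y) (scl A (adjacency X y y') (w x y))"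
  by (rule asum_single) (use fin v wD orth in "auto simp: scl_closed mul_closed mul_scl_right")
 finally have 1: "mul A (w x y) ?s = scl A (adjacency X y y') (w x y)" using wD v by (simp add: mul_scl_right)
 have "mul A ?s (w x' y') = asum A (%z. mul A (scl A (adjacency X x z) (w z y')) (w x' y')) ?V"
  by (rule asum_mul_right) (use wD v in "auto simp: scl_closed")
 also have "... = mul A (scl A (adjacency X x x') (w x' y')) (w x' y')"
  by (rule asum_single) (use fin v wD orth in "auto simp: scl_closed mul_closed mul_scl_left")
 finally have 2: "mul A ?s (w x' y') = scl A (adjacency X x x') (w x' y')" using wD v by (simp add: mul_scl_left)
 let ?p = "mul A (w x y) (w x' y')"
 have sc: "?s \<in>: A" using wD v by (auto simp: scl_closed)
 have "scl A (adjacency X x x') ?p = mul A (w x y) (mul A ?s (w x' y'))" using 2 wD v by (simp add: mul_scl_right)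
 also have "... = mul A (mul A (w x y) ?s) (w x' y')" using sc wD v by (simp add: mul_assoc)
 also have "... = scl A (adjacency X y y') ?p" using 1 wD v by (simp add: mul_scl_left)
 finally have eq: "scl A (adjacency X x x') ?p = scl A (adjacency X y y') ?p" .
 have pc: "?p \<in>: A" using wD v by (simp add: mul_closed)
 show ?thesis using m eq pc unfolding arc_mismatch_def adjacency_def by (auto simp: scl_one)
qed

text \<open>Insert 1 as the sum of row p on the right. In each term v_zq v_pt the adjacency of p, z
  may be replaced by that of q, t, because otherwise the product is 0. Then the sum of column q is 1
  and disappears. Symmetry of the arcs exchanges (p, z) with (z, p).\<close>

lemma mismatch_intertwines:
 assumes A: "unital_cstar A" and v: "magic_matrix (pverts X) (pverts Y) A v"
  and fin: "finite (pverts X)" "finite (pverts Y)" and sym: "!!x x'. (x, x') \<in> parcs X ==> (x', x) \<in> parcs X"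
  and m: "!!x x' y y'. arc_mismatch X Y x x' y y' ==> mul A (v x y) (v x' y') = zer A"
  and pq: "p \<in> pverts X" "q \<in> pverts Y"
 shows "asum A (%z. scl A (adjacency X p z) (v z q)) (pverts X) = asum A (%z. scl A (adjacency Y q z) (v p z)) (pverts Y)"
proof -
 interpret cstar_algebra A by (rule unital_cstarD[OF A])
 interpret U: unital_pre_cstar A by (rule unital_cstar_pre[OF A])
 let ?X = "pverts X" and ?Y = "pverts Y"
 note vD = magic_matrixD[OF v]
 have eq: "scl A (adjacency X p z) (mul A (v z q) (v p t)) = scl A (adjacency Y q t) (mul A (v z q) (v p t))"
  if "z \<in> ?X" "t \<in> ?Y" for z t
 proof (cases "arc_mismatch X Y z p q t")
  case True
  then show ?thesis by (simp add: m)
 next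
  case False
  then have "adjacency X p z = adjacency Y q t" using that pq sym unfolding arc_mismatch_def adjacency_def by auto
  then show ?thesis by simp
 qed
 have "asum A (%z. scl A (adjacency X p z) (v z q)) ?X =
   asum A (%z. asum A (%t. scl A (adjacency X p z) (mul A (v z q) (v p t))) ?Y) ?X"
 proof (rule asum_cong[OF refl])
  fix z assume z: "z \<in> ?X"
  have "scl A (adjacency X p z) (v z q) = scl A (adjacency X p z) (mul A (v z q) (asum A (v p) ?Y))"
   using vD(1,4) pq z by simp
  also have "... = scl A (adjacency X p z) (asum A (%t. mul A (v z q) (v p t)) ?Y)"
   by (subst asum_mul_left) (use vD pq z in simp_all)
  also have "... = asum A (%t. scl A (adjacency X p z) (mul A (v z q) (v p t))) ?Y"
   by (rule asum_scl[symmetric]) (use vD pq z in "simp add: mul_closed")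
  finally show "scl A (adjacency X p z) (v z q) = asum A (%t. scl A (adjacency X p z) (mul A (v z q) (v p t))) ?Y" .
 qed (use vD pq in "simp add: scl_closed mul_closed")
 also have "... = asum A (%z. asum A (%t. scl A (adjacency Y q t) (mul A (v z q) (v p t))) ?Y) ?X"
  by (intro asum_cong refl) (use vD pq eq in "simp_all add: scl_closed mul_closed")
 also have "... = asum A (%t. asum A (%z. scl A (adjacency Y q t) (mul A (v z q) (v p t))) ?X) ?Y"
  by (rule asum_swap) (use fin vD pq in "simp_all add: scl_closed mul_closed")
 also have "... = asum A (%t. scl A (adjacency Y q t) (v p t)) ?Y"
 proof (rule asum_cong[OF refl])
  fix t assume t: "t \<in> ?Y"
  have "asum A (%z. scl A (adjacency Y q t) (mul A (v z q) (v p t))) ?X = scl A (adjacency Y q t) (asum A (%z. mul A (v z q) (v p t)) ?X)"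
   by (rule asum_scl) (use vD pq t in "simp add: mul_closed")
  also have "... = scl A (adjacency Y q t) (mul A (asum A (%z. v z q) ?X) (v p t))"
   by (subst asum_mul_right) (use vD pq t in simp_all)
  also have "... = scl A (adjacency Y q t) (v p t)" using vD(1,5) pq t by simp
  finally show "asum A (%z. scl A (adjacency Y q t) (mul A (v z q) (v p t))) ?X = scl A (adjacency Y q t) (v p t)" .
 qed (use vD pq in "simp add: scl_closed")
 finally show ?thesis .
qed

lemma (in pre_cstar) asum_orthogonal_mul:
 assumes "finite J" "!!k. k \<in> J ==> p k \<in>: A" "j \<in> J" "mul A (p j) (p j) = p j"
  "!!k. k \<in> J ==> k ~= j ==> mul A (p k) (p j) = zer A" "!!k. k \<in> J ==> k ~= j ==> mul A (p j) (p k) = zer A"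
 shows "mul A (asum A p J) (p j) = p j" "mul A (p j) (asum A p J) = p j"
 using asum_single[of J j "%k. mul A (p k) (p j)"] asum_single[of J j "%k. mul A (p j) (p k)"] assms
 by (simp_all add: asum_mul_left asum_mul_right)

locale connected_components =
 fixes n :: nat and X :: "nat => 'v pair_pre_digraph"
 assumes graph: "i \<in> {1..n} ==> pair_graph (X i)"
  and conn: "i \<in> {1..n} ==> Digraph_Component.connected (with_proj (X i))"
begin

abbreviation "D \<equiv> disjoint_union n X"

lemma finite_X [simp]: "i \<in> {1..n} ==> finite (pverts (X i))"
 using pair_fin_digraph.pair_finite_verts[OF pair_digraph.axioms(1)[OF pair_graph.axioms(1)[OF graph]]] .

lemma sym_X: "i \<in> {1..n} ==> (x, y) \<in> parcs (X i) ==> (y, x) \<in> parcs (X i)"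
 using pair_sym_digraph.pair_sym_arcs[OF pair_pseudo_graph.axioms(2)[OF pair_graph.axioms(2)[OF graph]]]
 by (auto simp: symmetric_def elim: symE)

lemma arcs_X: "i \<in> {1..n} ==> (x, y) \<in> parcs (X i) ==> x \<in> pverts (X i) & y \<in> pverts (X i)"
 using pair_wf_digraph.in_arcsD1[OF pair_fin_digraph.axioms(1)[OF pair_digraph.axioms(1)[OF pair_graph.axioms(1)[OF graph]]]]
  pair_wf_digraph.in_arcsD2[OF pair_fin_digraph.axioms(1)[OF pair_digraph.axioms(1)[OF pair_graph.axioms(1)[OF graph]]]] by blast

lemma nonempty_X: "i \<in> {1..n} ==> pverts (X i) ~= {}"
 using conn[of i] by (simp add: connected_def strongly_connected_def)

lemma pverts_D: "pverts D = (SIGMA i:{1..n}. pverts (X i))" by (simp add: disjoint_union_def)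

lemma in_pverts_D [simp]: "(i, p) \<in> pverts D \<longleftrightarrow> i \<in> {1..n} & p \<in> pverts (X i)"
 by (simp add: pverts_D)

lemma finite_D: "finite (pverts D)" unfolding pverts_D by (rule finite_SigmaI) auto

lemma arcs_D [simp]: "((i, p), (j, q)) \<in> parcs D \<longleftrightarrow> i = j & i \<in> {1..n} & (p, q) \<in> parcs (X i)"
 by (auto simp: disjoint_union_def)

lemma mismatch_D:
 "i \<in> {1..n} ==> j \<in> {1..n} ==> arc_mismatch (X i) (X j) p p' q q' ==> arc_mismatch D D (i, p) (i, p') (j, q) (j, q')"
 by (auto simp: arc_mismatch_def)

theorem component_blocks:
 assumes A: "unital_cstar A" and w: "magic_unitary (pverts D) A w"
  and m: "!!x x' y y'. arc_mismatch D D x x' y y' ==> mul A (w x y) (w x' y') = zer A"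
 obtains h where "!!i j. i \<in> {1..n} ==> j \<in> {1..n} ==> star_hom (QIso (X i) (X j)) A (h i j)"
  "!!i j p q. i \<in> {1..n} ==> j \<in> {1..n} ==> p \<in> pverts (X i) ==> q \<in> pverts (X j) ==>
   h i j (QIso_gen (X i) (X j) p q) = w (i, p) (j, q)"
  "magic_unitary {1..n} A (%i j. h i j (unit_of (QIso (X i) (X j))))"
proof -
 interpret cstar_algebra A by (rule unital_cstarD[OF A])
 interpret U: unital_pre_cstar A by (rule unital_cstar_pre[OF A])
 have wm: "magic_matrix (pverts D) (pverts D) A w" using w by (simp add: magic_unitary_iff)
 note orth = magic_matrix_orthogonal[OF A wm]
 have wD: "w (i, p) (j, q) \<in>: A" "mul A (w (i, p) (j, q)) (w (i, p) (j, q)) = w (i, p) (j, q)"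
  "adj A (w (i, p) (j, q)) = w (i, p) (j, q)"
  if "i \<in> {1..n}" "j \<in> {1..n}" "p \<in> pverts (X i)" "q \<in> pverts (X j)" for i j p q
  using magic_matrixD(1-3)[OF wm, of "(i, p)" "(j, q)"] that by auto
 have rows: "asum A (%y. w (i, p) y) (SIGMA j:{1..n}. pverts (X j)) = unit_of A" if "i \<in> {1..n}" "p \<in> pverts (X i)" for i p
  using magic_matrixD(4)[OF wm, of "(i, p)"] that by (simp add: pverts_D)
 have cols: "asum A (%x. w x (j, q)) (SIGMA i:{1..n}. pverts (X i)) = unit_of A" if "j \<in> {1..n}" "q \<in> pverts (X j)" for j q
  using magic_matrixD(5)[OF wm, of "(j, q)"] that by (simp add: pverts_D)
 \<comment> \<open>An arbitrary reference vertex in each component; \<open>row\<close> and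
   \<open>col\<close> show that the sums do not depend on it.\<close>
 define p0 where "p0 i = (SOME p. p \<in> pverts (X i))" for i
 have p0: "p0 i \<in> pverts (X i)" if "i \<in> {1..n}" for i
  unfolding p0_def using nonempty_X[OF that] by (simp add: some_in_eq)
 define u where "u i j = asum A (%q. w (i, p0 i) (j, q)) (pverts (X j))" for i j
 define c where "c i j = asum A (%p. w (i, p) (j, p0 j)) (pverts (X i))" for i j
 have row: "asum A (%q. w (i, p) (j, q)) (pverts (X j)) = u i j"
  if ij: "i \<in> {1..n}" "j \<in> {1..n}" and p: "p \<in> pverts (X i)" for i j p unfolding u_def
 proof (rule constant_on_connected[OF conn[OF ij(1)] p p0[OF ij(1)]])
  fix x y assume xy: "(x, y) \<in> parcs (X i)"
  note xyV = arcs_X[OF ij(1) xy]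
  show "asum A (%q. w (i, x) (j, q)) (pverts (X j)) = asum A (%q. w (i, y) (j, q)) (pverts (X j))"
  proof (rule block_sums_eq[OF U.unit, of "{1..n}" "%j. pverts (X j)" "w (i, x)" "w (i, y)"])
   \<comment> \<open>x and y are adjacent, while vertices in different components are not, so the
     mismatch condition makes the product vanish.\<close>
   fix j k q r assume "j \<in> {1..n}" "k \<in> {1..n}" "j ~= k" "q \<in> pverts (X j)" "r \<in> pverts (X k)"
   then show "mul A (w (i, x) (j, q)) (w (i, y) (k, r)) = zer A"
    using xy xyV ij by (intro m) (simp add: arc_mismatch_def)
  qed (use ij xyV wD rows in auto)
 qed
 have col: "asum A (%p. w (i, p) (j, q)) (pverts (X i)) = c i j"
  if ij: "i \<in> {1..n}" "j \<in> {1..n}" and q: "q \<in> pverts (X j)" for i j q unfolding c_def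
 proof (rule constant_on_connected[OF conn[OF ij(2)] q p0[OF ij(2)]])
  fix x y assume xy: "(x, y) \<in> parcs (X j)"
  note xyV = arcs_X[OF ij(2) xy]
  show "asum A (%p. w (i, p) (j, x)) (pverts (X i)) = asum A (%p. w (i, p) (j, y)) (pverts (X i))"
  proof (rule block_sums_eq[OF U.unit, of "{1..n}" "%i. pverts (X i)" "%z. w z (j, x)" "%z. w z (j, y)"])
   fix i k q r assume "i \<in> {1..n}" "k \<in> {1..n}" "i ~= k" "q \<in> pverts (X i)" "r \<in> pverts (X k)"
   then show "mul A (w (i, q) (j, x)) (w (k, r) (j, y)) = zer A"
    using xy xyV ij by (intro m) (simp add: arc_mismatch_def)
  qed (use ij xyV wD cols in auto)
 qed
 have uc: "u i j \<in>: A" "c i j \<in>: A" if "i \<in> {1..n}" "j \<in> {1..n}" for i j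
  unfolding u_def c_def using that wD p0 by auto
 have uw: "mul A (u i j) (w (i, p) (j, q)) = w (i, p) (j, q)" "mul A (w (i, p) (j, q)) (u i j) = w (i, p) (j, q)"
  if ij: "i \<in> {1..n}" "j \<in> {1..n}" and pq: "p \<in> pverts (X i)" "q \<in> pverts (X j)" for i j p q
  unfolding row[OF ij pq(1), symmetric] by (rule asum_orthogonal_mul; use ij pq wD orth(1)[OF finite_D] in simp)+
 have wc: "mul A (w (i, p) (j, q)) (c i j) = w (i, p) (j, q)"
  if ij: "i \<in> {1..n}" "j \<in> {1..n}" and pq: "p \<in> pverts (X i)" "q \<in> pverts (X j)" for i j p q
  unfolding col[OF ij pq(2), symmetric]
  by (rule asum_orthogonal_mul(2)[where p = "%r. w (i, r) (j, q)"]; use ij pq wD orth(2)[OF finite_D] in simp)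
 \<comment> \<open>Every entry of the block is absorbed by u on its left and by c on its right.
   Expanding u in the product u c gives u, and expanding c gives c.\<close>
 have u_eq_c: "u i j = c i j" if ij: "i \<in> {1..n}" "j \<in> {1..n}" for i j
 proof -
  have "mul A (u i j) (c i j) = asum A (%q. mul A (w (i, p0 i) (j, q)) (c i j)) (pverts (X j))"
   unfolding u_def by (rule asum_mul_right) (use ij p0 wD uc in auto)
  also have "... = u i j" unfolding u_def by (rule asum_cong[OF refl]) (use ij p0 wD wc in auto)
  finally have 1: "mul A (u i j) (c i j) = u i j" .
  have "mul A (u i j) (c i j) = asum A (%p. mul A (u i j) (w (i, p) (j, p0 j))) (pverts (X i))"
   unfolding c_def by (rule asum_mul_left) (use ij p0 wD uc in auto)
  also have "... = c i j" unfolding c_def by (rule asum_cong[OF refl]) (use ij p0 wD uw in auto)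
  finally show ?thesis using 1 by simp
 qed
 have usq: "mul A (u i j) (u i j) = u i j" if ij: "i \<in> {1..n}" "j \<in> {1..n}" for i j
 proof -
  have "mul A (u i j) (asum A (%q. w (i, p0 i) (j, q)) (pverts (X j))) =
    asum A (%q. mul A (u i j) (w (i, p0 i) (j, q))) (pverts (X j))" by (rule asum_mul_left) (use ij p0 wD uc in auto)
  also have "... = asum A (%q. w (i, p0 i) (j, q)) (pverts (X j))"
   by (rule asum_cong[OF refl]) (use ij p0 wD uw in auto)
  finally show ?thesis unfolding u_def[symmetric] .
 qed
 have usa: "adj A (u i j) = u i j" if ij: "i \<in> {1..n}" "j \<in> {1..n}" for i j
 proof -
  have "adj A (u i j) = asum A (%q. adj A (w (i, p0 i) (j, q))) (pverts (X j))"
   unfolding u_def by (rule asum_adj) (use ij p0 wD in auto)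
  also have "... = u i j" unfolding u_def by (rule asum_cong[OF refl]) (use ij p0 wD in auto)
  finally show ?thesis .
 qed
 have "asum A (%j. u i j) {1..n} = unit_of A" if i: "i \<in> {1..n}" for i
  unfolding u_def rows[OF i p0[OF i], symmetric] by (rule asum_Sigma[symmetric]) (use i p0 wD in auto)
 moreover have "asum A (%i. u i j) {1..n} = unit_of A" if j: "j \<in> {1..n}" for j
 proof -
  have "asum A (%i. u i j) {1..n} = asum A (%i. c i j) {1..n}" by (rule asum_cong[OF refl]) (use j uc u_eq_c in auto)
  also have "... = unit_of A" unfolding c_def cols[OF j p0[OF j], symmetric]
   by (rule asum_Sigma[symmetric]) (use j p0 wD in auto)
  finally show ?thesis .
 qed
 ultimately have magic_u: "magic_unitary {1..n} A u" unfolding magic_unitary_def using uc usq usa by simp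
 have ex: "\<exists>phi. star_hom (QIso (X i) (X j)) A phi & phi (unit_of (QIso (X i) (X j))) = u i j &
   (\<forall>p\<in>pverts (X i). \<forall>q\<in>pverts (X j). phi (QIso_gen (X i) (X j) p q) = w (i, p) (j, q))"
  if ij: "i \<in> {1..n}" "j \<in> {1..n}" for i j
 proof -
  \<comment> \<open>The rows and columns of this block sum to u i j and not to 1, so the universal
    property is applied in the corner of u i j, whose unit it is.\<close>
  note corner = corner[OF uc(1)[OF ij] usq[OF ij] usa[OF ij]]
  let ?B = "corner A (u i j)"
  have pre: "pre_cstar ?B" by (rule cstar_algebra_pre[OF unital_cstarD[OF corner(1)]])
  have wB: "w (i, p) (j, q) \<in>: ?B" if "p \<in> pverts (X i)" "q \<in> pverts (X j)" for p q
   using uw[OF ij that] wD(1)[OF ij that] by (simp add: carrier_corner)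
  have asum_B: "asum ?B f I = asum A f I" if "!!i. i \<in> I ==> f i \<in>: ?B" for I and f :: "'v => _"
   using star_hom_asum[OF corner(3) pre pre.pre_cstar_axioms, of I f] that by simp
  have mag: "magic_matrix (pverts (X i)) (pverts (X j)) ?B (%p q. w (i, p) (j, q))"
   unfolding magic_matrix_def corner(2) using wB wD[OF ij] row[OF ij] col[OF ij, folded u_eq_c[OF ij]]
   by (simp add: asum_B)
  have mis: "mul ?B (w (i, p) (j, q)) (w (i, p') (j, q')) = zer ?B" if "arc_mismatch (X i) (X j) p p' q q'" for p p' q q'
   using m[OF mismatch_D[OF ij that]] by simp
  show ?thesis using QIso_lift[OF corner(1) mag mis] star_hom_comp[OF _ corner(3)] corner(2) by fastforce
 qed
 define h where "h i j = (SOME phi. star_hom (QIso (X i) (X j)) A phi & phi (unit_of (QIso (X i) (X j))) = u i j &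
   (\<forall>p\<in>pverts (X i). \<forall>q\<in>pverts (X j). phi (QIso_gen (X i) (X j) p q) = w (i, p) (j, q)))" for i j
 have h: "star_hom (QIso (X i) (X j)) A (h i j)" "h i j (unit_of (QIso (X i) (X j))) = u i j"
  "!!p q. p \<in> pverts (X i) ==> q \<in> pverts (X j) ==> h i j (QIso_gen (X i) (X j) p q) = w (i, p) (j, q)"
  if ij: "i \<in> {1..n}" "j \<in> {1..n}" for i j using someI_ex[OF ex[OF ij]] unfolding h_def[symmetric] by auto
 have "magic_unitary {1..n} A (%i j. h i j (unit_of (QIso (X i) (X j))))"
 proof -
  have "asum A (%j. h i j (unit_of (QIso (X i) (X j)))) {1..n} = asum A (%j. u i j) {1..n}" if "i \<in> {1..n}" for i
   by (rule asum_cong[OF refl]) (use that h(2) uc in simp_all)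
  moreover have "asum A (%i. h i j (unit_of (QIso (X i) (X j)))) {1..n} = asum A (%i. u i j) {1..n}" if "j \<in> {1..n}" for j
   by (rule asum_cong[OF refl]) (use that h(2) uc in simp_all)
  ultimately show ?thesis using magic_u unfolding magic_unitary_def by (simp add: h(2))
 qed
 then show ?thesis using that h by blast
qed

abbreviation "CX \<equiv> component_algebra n X"

lemma component_matrix_eq: "component_matrix n X (i, p) (j, q) = component_hom n X i j (QIso_gen (X i) (X j) p q)"
 by (simp add: component_matrix_def component_hom_def)

lemma component_matrix_closed:
 assumes "i \<in> {1..n}" "j \<in> {1..n}" "p \<in> pverts (X i)" "q \<in> pverts (X j)"
 shows "component_matrix n X (i, p) (j, q) \<in>: CX" unfolding component_matrix_eq
 by (rule star_homD(1)[OF star_hom_component_hom[OF assms(1,2)] magic_matrixD(1)[OF magic_QIso assms(3,4)]])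

lemma component_hom_asum:
 assumes "i \<in> {1..n}" "j \<in> {1..n}" "!!k. k \<in> K ==> a k \<in>: (QIso (X i) (X j))"
 shows "component_hom n X i j (asum (QIso (X i) (X j)) a K) = asum CX (%k. component_hom n X i j (a k)) K"
 by (rule star_hom_asum[OF star_hom_component_hom[OF assms(1,2)] cstar_algebra_pre[OF unital_cstarD[OF unital_QIso]]
    cstar_algebra_pre[OF unital_cstarD[OF unital_component_algebra]] assms(3)])

text \<open>A row sums over each block to the image of the unit of QIso(X_i, X_j), and by the
  relations of the quotient these images form a magic unitary in i and j. The same holds for
  columns.\<close>

lemma magic_component_matrix: "magic_unitary (pverts D) CX (component_matrix n X)"
proof -
 interpret CA: cstar_algebra CX by (rule unital_cstarD[OF unital_component_algebra])
 let ?w = "component_matrix n X" and ?o = "%i j. component_hom n X i j (unit_of (QIso (X i) (X j)))"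
 note um = magic_matrixD[OF magic_component_hom_unit[of n X, unfolded magic_unitary_iff]]
 note wc = component_matrix_closed
 have "mul CX (?w (i, p) (j, q)) (?w (i, p) (j, q)) = ?w (i, p) (j, q) & adj CX (?w (i, p) (j, q)) = ?w (i, p) (j, q)"
  if "i \<in> {1..n}" "j \<in> {1..n}" "p \<in> pverts (X i)" "q \<in> pverts (X j)" for i j p q
 proof -
  note vD = magic_matrixD(1-3)[OF magic_QIso[of "X i" "X j"] that(3,4)]
  show ?thesis unfolding component_matrix_eq using star_homD(4)[OF star_hom_component_hom[OF that(1,2)] vD(1) vD(1)]
    star_homD(5)[OF star_hom_component_hom[OF that(1,2)] vD(1)] vD(2,3) by simp
 qed
 moreover have "asum CX (%y. ?w (i, p) y) (pverts D) = unit_of CX" if ip: "i \<in> {1..n}" "p \<in> pverts (X i)" for i p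
 proof -
  have "asum CX (%y. ?w (i, p) y) (pverts D) = asum CX (%j. asum CX (%q. ?w (i, p) (j, q)) (pverts (X j))) {1..n}"
   unfolding pverts_D by (rule CA.asum_Sigma) (use ip wc in auto)
  also have "... = asum CX (%j. ?o i j) {1..n}"
  proof (rule CA.asum_cong[OF refl])
   fix j assume j: "j \<in> {1..n}"
   show "asum CX (%q. ?w (i, p) (j, q)) (pverts (X j)) = ?o i j"
    unfolding component_matrix_eq magic_matrixD(4)[OF magic_QIso ip(2), symmetric]
    by (rule component_hom_asum[OF ip(1) j magic_matrixD(1)[OF magic_QIso ip(2)], symmetric])
  qed (rule um(1)[OF ip(1)])
  also have "... = unit_of CX" by (rule um(4)[OF ip(1)])
  finally show ?thesis .
 qed
 moreover have "asum CX (%x. ?w x (j, q)) (pverts D) = unit_of CX" if jq: "j \<in> {1..n}" "q \<in> pverts (X j)" for j q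
 proof -
  have "asum CX (%x. ?w x (j, q)) (pverts D) = asum CX (%i. asum CX (%p. ?w (i, p) (j, q)) (pverts (X i))) {1..n}"
   unfolding pverts_D by (rule CA.asum_Sigma) (use jq wc in auto)
  also have "... = asum CX (%i. ?o i j) {1..n}"
  proof (rule CA.asum_cong[OF refl])
   fix i assume i: "i \<in> {1..n}"
   show "asum CX (%p. ?w (i, p) (j, q)) (pverts (X i)) = ?o i j"
    unfolding component_matrix_eq magic_matrixD(5)[OF magic_QIso jq(2), symmetric]
    by (rule component_hom_asum[OF i jq(1) magic_matrixD(1)[OF magic_QIso _ jq(2)], symmetric])
  qed (rule um(1)[OF _ jq(1)])
  also have "... = unit_of CX" by (rule um(5)[OF jq(1)])
  finally show ?thesis .
 qed
 ultimately show ?thesis unfolding magic_unitary_def using wc by (simp add: pverts_D)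
qed

lemma (in pre_cstar) asum_Sigma_single:
 assumes "finite N" "!!k. k \<in> N ==> finite (V k)" "!!k z. k \<in> N ==> z \<in> V k ==> f (k, z) \<in>: A"
  and i: "i \<in> N" and zero: "!!k z. k \<in> N ==> z \<in> V k ==> k ~= i ==> f (k, z) = zer A"
 shows "asum A f (SIGMA k:N. V k) = asum A (%z. f (i, z)) (V i)"
proof -
 have "asum A f (SIGMA k:N. V k) = asum A (%k. asum A (%z. f (k, z)) (V k)) N" by (rule asum_Sigma) fact+
 also have "... = asum A (%z. f (i, z)) (V i)" by (rule asum_single) (use assms in "auto intro!: asum_neutral")
 finally show ?thesis .
qed

lemma adjacency_D: "i \<in> {1..n} ==> adjacency D (i, p) (k, z) = (if k = i then adjacency (X i) p z else 0)"
 by (auto simp: adjacency_def)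

text \<open>Adjacency in the disjoint union is block diagonal, so each side reduces to a sum inside
  one block. There \<open>mismatch_intertwines\<close> holds in QIso(X_i, X_j) and is carried over
  by \<open>component_hom\<close>.\<close>

lemma intertwines_component_matrix: "intertwines D CX (component_matrix n X)" unfolding intertwines_def
proof (intro ballI)
 interpret CA: cstar_algebra CX by (rule unital_cstarD[OF unital_component_algebra])
 let ?w = "component_matrix n X"
 fix x y assume "x \<in> pverts D" "y \<in> pverts D"
 then obtain i p j q where x: "x = (i, p)" and y: "y = (j, q)" and ij: "i \<in> {1..n}" "j \<in> {1..n}"
  and pq: "p \<in> pverts (X i)" "q \<in> pverts (X j)" by (auto simp: pverts_D)
 let ?Q = "QIso (X i) (X j)" and ?v = "QIso_gen (X i) (X j)"
 interpret Q: cstar_algebra ?Q by (rule unital_cstarD[OF unital_QIso])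
 note hom = star_hom_component_hom[OF ij] and vc = magic_matrixD(1)[OF magic_QIso[of "X i" "X j"]]
 have sc: "scl CX a (?w (i', p') (j', q')) \<in>: CX"
  if "i' \<in> {1..n}" "j' \<in> {1..n}" "p' \<in> pverts (X i')" "q' \<in> pverts (X j')" for a i' j' p' q'
  by (rule CA.scl_closed[OF component_matrix_closed[OF that]])
 have "asum CX (%z. scl CX (adjacency D x z) (?w z y)) (pverts D) =
   asum CX (%z. scl CX (adjacency D (i, p) (i, z)) (?w (i, z) (j, q))) (pverts (X i))" unfolding pverts_D x y
  by (rule CA.asum_Sigma_single) (use ij pq sc component_matrix_closed in "auto simp: adjacency_D")
 also have "... = asum CX (%z. component_hom n X i j (scl ?Q (adjacency (X i) p z) (?v z q))) (pverts (X i))"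
  by (rule CA.asum_cong[OF refl])
   (use ij pq vc in "simp_all add: adjacency_D component_matrix_eq star_homD(3)[OF hom] star_homD(1)[OF hom] CA.scl_closed")
 also have "... = component_hom n X i j (asum ?Q (%z. scl ?Q (adjacency (X i) p z) (?v z q)) (pverts (X i)))"
  by (rule component_hom_asum[OF ij, symmetric]) (use vc pq in "simp add: Q.scl_closed")
 also have "asum ?Q (%z. scl ?Q (adjacency (X i) p z) (?v z q)) (pverts (X i)) =
   asum ?Q (%z. scl ?Q (adjacency (X j) q z) (?v p z)) (pverts (X j))"
  by (rule mismatch_intertwines[OF unital_QIso magic_QIso finite_X[OF ij(1)] finite_X[OF ij(2)] sym_X[OF ij(1)] QIso_mismatch pq])
 also have "component_hom n X i j ... = asum CX (%z. component_hom n X i j (scl ?Q (adjacency (X j) q z) (?v p z))) (pverts (X j))"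
  by (rule component_hom_asum[OF ij]) (use vc pq in "simp add: Q.scl_closed")
 also have "... = asum CX (%z. scl CX (adjacency D (j, z) (j, q)) (?w (i, p) (j, z))) (pverts (X j))"
 proof (rule CA.asum_cong[OF refl])
  fix z assume z: "z \<in> pverts (X j)"
  have "adjacency (X j) q z = adjacency (X j) z q" using sym_X[OF ij(2)] by (auto simp: adjacency_def)
  then show "component_hom n X i j (scl ?Q (adjacency (X j) q z) (?v p z)) = scl CX (adjacency D (j, z) (j, q)) (?w (i, p) (j, z))"
   using ij pq vc z by (simp add: adjacency_D component_matrix_eq star_homD(3)[OF hom])
 qed (use ij pq sc in auto)
 also have "... = asum CX (%z. scl CX (adjacency D z y) (?w x z)) (pverts D)" unfolding pverts_D x y
  by (rule CA.asum_Sigma_single[symmetric]) (use ij pq sc component_matrix_closed in "auto simp: adjacency_D")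
 finally show "asum CX (%z. scl CX (adjacency D x z) (?w z y)) (pverts D) = asum CX (%z. scl CX (adjacency D z y) (?w x z)) (pverts D)" .
qed

end

section \<open>The two inverse homomorphisms and the comultiplication\<close>

lemma star_hom_id: "star_hom A A (%x. x)" by (rule star_homI) simp_all

text \<open>Homomorphisms of C*-algebras are continuous, so the preimage of a closed unital
  *-subalgebra is again one; if it contains the generators it is everything, and surjectivity
  concludes.\<close>

lemma generates_iso:
 assumes gen: "generates A S" and S: "S <= carrier A" and A: "unital_cstar A" and B: "unital_cstar B"
  and phi: "star_hom A B phi" "phi (unit_of A) = unit_of B" and surj: "carrier B <= phi ` carrier A"
 shows "generates B (phi ` S)"
proof -
 interpret A: cstar_algebra A by (rule unital_cstarD[OF A])
 interpret B: cstar_algebra B by (rule unital_cstarD[OF B])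
 interpret UB: unital_pre_cstar B by (rule unital_cstar_pre[OF B])
 interpret UA: unital_pre_cstar A by (rule unital_cstar_pre[OF A])
 note phiD = star_homD[OF phi(1)]
 have "carrier B <= L" if L: "closed_unital_star_subalgebra B L" "phi ` S <= L" for L
 proof -
  have cl: "closed_subspace B L" using L by (simp add: closed_unital_star_subalgebra_def)
  have "closed_subspace A {x \<in> carrier A. phi x \<in> L}"
   by (rule B.closed_subspace_vimage[OF cl A.pre.pre_cstar_axioms phiD(1-3)])
    (use star_hom_conv_to[OF phi(1) A.cstar_algebra_axioms B.pre.pre_cstar_axioms] in blast)+
  then have "closed_unital_star_subalgebra A {x \<in> carrier A. phi x \<in> L}"
   using L phi(2) unfolding closed_unital_star_subalgebra_def by (simp add: phiD(4,5) A.mul_closed A.adj_closed)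
  then have "carrier A <= {x \<in> carrier A. phi x \<in> L}" by (rule generates_subset[OF gen]) (use L S in auto)
  then show ?thesis using surj by blast
 qed
 moreover have "closed_unital_star_subalgebra B (carrier B)"
  by (simp add: closed_unital_star_subalgebra_def closed_subspace_def B.mul_closed B.adj_closed B.scl_closed)
 moreover have "phi ` S <= carrier B" using S phiD(1) by auto
 ultimately show ?thesis unfolding generates_def by (intro antisym Inter_lower Inter_greatest) auto
qed

theorem theorem5p3:
  fixes X :: "nat \<Rightarrow> 'v pair_pre_digraph" and n :: nat
  assumes "\<And>i. i \<in> {1..n} \<Longrightarrow> pair_graph (X i)"
    and "\<And>i. i \<in> {1..n} \<Longrightarrow> Digraph_Component.connected (with_proj (X i))"
  shows "quantum_permutation_group (pverts (disjoint_union n X))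
           (component_algebra n X) (component_matrix n X) \<and>
         same_quantum_permutation_group (pverts (disjoint_union n X))
           (Qut (disjoint_union n X)) (Qut_gen (disjoint_union n X))
           (component_algebra n X) (component_matrix n X)"
proof -
 interpret connected_components n X by (rule connected_components.intro) (fact assms)+
 interpret C: unital_tensor CX by (rule unital_tensor.intro) (rule unital_component_algebra)
 let ?V = "pverts D" and ?Q = "Qut D" and ?w = "Qut_gen D" and ?v = "component_matrix n X"
 have Q: "cstar_algebra ?Q" by (rule unital_cstarD[OF unital_Qut])
 note wD = magic_unitaryD[OF magic_Qut[of D]]
 note magic_v = magic_component_matrix and int_v = intertwines_component_matrix
 obtain phi where phi: "star_hom ?Q CX phi" "phi (unit_of ?Q) = unit_of CX" "!!x y. x \<in> ?V ==> y \<in> ?V ==> phi (?w x y) = ?v x y"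
  using Qut_lift[OF unital_component_algebra magic_v int_v] by blast
 obtain h where h: "!!i j. i \<in> {1..n} ==> j \<in> {1..n} ==> star_hom (QIso (X i) (X j)) ?Q (h i j)"
  "!!i j p q. i \<in> {1..n} ==> j \<in> {1..n} ==> p \<in> pverts (X i) ==> q \<in> pverts (X j) ==>
   h i j (QIso_gen (X i) (X j) p q) = ?w (i, p) (j, q)"
  "magic_unitary {1..n} ?Q (%i j. h i j (unit_of (QIso (X i) (X j))))"
  using component_blocks[OF unital_Qut magic_Qut intertwines_mismatch[OF unital_Qut magic_Qut finite_D intertwines_Qut]] by blast
 obtain psi where psi: "star_hom CX ?Q psi" "psi (unit_of CX) = unit_of ?Q"
  "!!i j a. i \<in> {1..n} ==> j \<in> {1..n} ==> a \<in>: (QIso (X i) (X j)) ==> psi (component_hom n X i j a) = h i j a"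
  using component_algebra_lift[OF unital_Qut h(1) h(3)] by blast
 have psi_v: "psi (?v x y) = ?w x y" if xy: "x \<in> ?V" "y \<in> ?V" for x y
 proof -
  obtain i p j q where x: "x = (i, p)" "i \<in> {1..n}" "p \<in> pverts (X i)" and y: "y = (j, q)" "j \<in> {1..n}" "q \<in> pverts (X j)"
   using xy by (cases x; cases y) auto
  show ?thesis unfolding x(1) y(1) component_matrix_eq psi(3)[OF x(2) y(2) magic_matrixD(1)[OF magic_QIso x(3) y(3)]]
   by (rule h(2)[OF x(2) y(2) x(3) y(3)])
 qed
 have psi_phi: "psi (phi a) = a" if "a \<in>: ?Q" for a
  by (rule star_hom_generates_eq[OF generates_Qut _ unital_Qut Q star_hom_comp[OF phi(1) psi(1)] star_hom_id _ _ that])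
   (use wD(1) in "auto simp: phi psi(2) psi_v")
 have phipsi: "phi (psi b) = b" if "b \<in>: CX" for b
 proof (rule component_algebra_eq[OF star_hom_comp[OF psi(1) phi(1)] star_hom_id C.cstar_algebra_axioms _ _ nonempty_X that])
  fix i j p q assume "i \<in> {1..n}" "j \<in> {1..n}" "p \<in> pverts (X i)" "q \<in> pverts (X j)"
  then show "phi (psi (component_hom n X i j (QIso_gen (X i) (X j) p q))) = component_hom n X i j (QIso_gen (X i) (X j) p q)"
   by (simp add: component_matrix_eq[symmetric] psi_v phi(3))
 qed (simp_all add: phi(2) psi(2))
 have "bij_betw phi (carrier ?Q) (carrier CX)"
  by (rule bij_betwI[where g = psi]) (use star_homD(1)[OF phi(1)] star_homD(1)[OF psi(1)] psi_phi phipsi in auto)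
 then have same: "same_quantum_permutation_group ?V ?Q ?w CX ?v"
  unfolding same_quantum_permutation_group_def star_iso_def using phi by blast
 have gen: "generates CX {?v x y |x y. x \<in> ?V & y \<in> ?V}"
 proof -
  have "generates CX (phi ` {?w x y |x y. x \<in> ?V & y \<in> ?V})"
  proof (rule generates_iso[OF generates_Qut _ unital_Qut unital_component_algebra phi(1,2)])
   show "carrier CX <= phi ` carrier ?Q" using star_homD(1)[OF psi(1)] phipsi by (metis image_eqI subsetI)
  qed (use wD(1) in blast)
  moreover have "phi ` {?w x y |x y. x \<in> ?V & y \<in> ?V} = {?v x y |x y. x \<in> ?V & y \<in> ?V}"
  proof (intro equalityI subsetI)
   fix b assume "b \<in> phi ` {?w x y |x y. x \<in> ?V & y \<in> ?V}"
   then obtain x y where b: "b = phi (?w x y)" and xy: "x \<in> ?V" "y \<in> ?V" by blast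
   show "b \<in> {?v x y |x y. x \<in> ?V & y \<in> ?V}" unfolding b phi(3)[OF xy] using xy by blast
  next
   fix b assume "b \<in> {?v x y |x y. x \<in> ?V & y \<in> ?V}"
   then obtain x y where b: "b = ?v x y" and xy: "x \<in> ?V" "y \<in> ?V" by blast
   show "b \<in> phi ` {?w x y |x y. x \<in> ?V & y \<in> ?V}" unfolding b phi(3)[OF xy, symmetric] using xy by blast
  qed
  ultimately show ?thesis by simp
 qed
 \<comment> \<open>The sums of v_xk \<otimes> v_ky satisfy the relations of Qut over the tensor
   square of the component algebra. The homomorphism obtained in this way starts at Qut; composition
   with \<open>psi\<close> makes it the comultiplication of the component algebra.\<close>
 have "intertwines D C.P2 (C.comult_matrix ?V ?v)" unfolding intertwines_def
  by (intro ballI C.comult_matrix_intertwines[OF magic_v finite_D])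
   (use int_v in "simp_all add: intertwines_def")
 then obtain Delta where Delta: "star_hom ?Q C.P2 Delta" "Delta (unit_of ?Q) = unit_of C.P2"
  "!!x y. x \<in> ?V ==> y \<in> ?V ==> Delta (?w x y) = C.comult_matrix ?V ?v x y"
  using Qut_lift[OF C.unital_P2 C.magic_unitary_comult_matrix[OF magic_v finite_D]] by blast
 have "quantum_permutation_group ?V CX ?v"
 proof (rule C.quantum_permutation_groupI[OF magic_v finite_D gen])
  show "unital_star_hom CX C.P2 (%b. Delta (psi b))"
   unfolding unital_star_hom_def using star_hom_comp[OF psi(1) Delta(1)] psi(2) Delta(2) by simp
 qed (simp add: psi_v Delta(3))
 then show ?thesis using same by blast
qed

end
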